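(* Let $A$ be a unital $AH$ algebra with the ideal property and with finitely many extremal tracial states, and such that the Cuntz semigroup $W(A)$ is almost unperforated. Then $A$ has weak strict comparison.
   Context: Unital $C^*$-algebras are taken to be nonzero. "Ideal" means closed two-sided ideal. A $C^*$-algebra $A$ has the ideal property if each of its ideals is generated (as an ideal) by the projections it contains. An $AH$ algebra is a $C^*$-algebra that is the inductive limit of a sequence $A_1\to A_2\to A_3\to\cdots$ of $C^*$-algebras and $*$-homomorphisms with $A_n=\bigoplus_{i=1}^{t_n}P_{n,i}M_{[n,i]}(C(X_{n,i}))P_{n,i}$, where the local spectra $X_{n,i}$ are finite connected CW complexes, $t_n$ and $[n,i]$ are strictly positive integers, and each $P_{n,i}$ is a projection of $M_{[n,i]}(C(X_{n,i}))$. Extremal tracial states are the extreme points of the convex set $T(A)$ of tracial states of $A$. $M_\infty(A)$ is the algebraic inductive limit of the $M_n(A)$ under $x\mapsto x\oplus 0$, and $M_\infty(A)^+$ is its set of positive elements. For $a,b\in M_\infty(A)^+$ write $a\precsim b$ if for some $n$ with $a,b\in M_n(A)$ there is a sequence $\{x_k\}$ in $M_n(A)$ with $a=\lim_k x_k b x_k^*$; write $a\sim b$ if $a\precsim b$ and $b\precsim a$. The Cuntz semigroup is $W(A)=M_\infty(A)^+/\!\sim$, with classes $\langle a\rangle$, addition $\langle a\rangle+\langle b\rangle=\langle a\oplus b\rangle$, and order $\langle a\rangle\le\langle b\rangle\iff a\precsim b$. $W(A)$ is almost unperforated if for all $x,y\in W(A)$ and all $m,n\in\mathbb N$ (positive integers)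 with $nx\le my$ and $n>m$, one has $x\le y$. A dimension function on $A$ is an additive order preserving function $d:W(A)\to[0,\infty]$; equivalently, a function $d:M_\infty(A)^+\to[0,\infty]$ with $d(a\oplus b)=d(a)+d(b)$ and $a\precsim b\Rightarrow d(a)\le d(b)$. $DF(A)$ is the set of all dimension functions on $A$. For $A$ unital, a (normalized) quasitrace on $A$ is a function $\tau:A\to\mathbb C$ such that: (i) $\tau(1)=1$; (ii) $0\le\tau(xx^* )=\tau(x^*x)$ for all $x\in A$; (iii) $\tau(a+ib)=\tau(a)+i\tau(b)$ for all self-adjoint $a,b\in A$; (iv) $\tau$ is linear on abelian sub-$C^*$-algebras of $A$; (v) for every $n$, $\tau$ extends (along $x\mapsto x\oplus 0$) to a function $M_n(A)\to\mathbb C$ satisfying (ii)-(iv). $QT(A)$ is the set of all normalized quasitraces on $A$. For $\tau\in QT(A)$, $d_\tau(a)=\lim_{n\to\infty}\tau(a^{1/n})$ for $a\in M_\infty(A)^+$; this is a dimension function. A unital $C^*$-algebra $A$ with $QT(A)\ne\emptyset$ has weak strict comparison if $a\precsim b$ whenever $a,b\in M_\infty(A)^+$ satisfy $d(a)<d(b)$ for every $d\in E\cup\{f\in DF(A)\setminus E: f(b)=1\}$, where $E=\{d_\tau:\tau\in QT(A)\}$. *)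

theory Defs
  imports "HOL-Analysis.Analysis" "HOL-Algebra.Ideal"
begin

section \<open>Unital \<open>C\<^sup>*\<close>-algebras\<close>

text \<open>The algebras below have types depending on a dimension or on a space, so they are
  represented by records with an explicit carrier. All of them have a unit (a corner
  \<open>pBp\<close> has unit \<open>p\<close>), but the zero algebra is allowed and
  \<open>*\<close>-homomorphisms need not preserve units.\<close>

record 'a cstar = "'a ring" +
  cscale :: "complex \<Rightarrow> 'a \<Rightarrow> 'a"
  adj :: "'a \<Rightarrow> 'a"
  cnorm :: "'a \<Rightarrow> real"

text \<open>The value 0 off the carrier is there because \<^locale>\<open>Metric_space\<close> asks for a
  nonnegative symmetric function on the whole type.\<close>

definition cdist :: "'a cstar \<Rightarrow> 'a \<Rightarrow> 'a \<Rightarrow> real" where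
  "cdist A x y = (if x \<in> carrier A \<and> y \<in> carrier A then cnorm A (x \<ominus>\<^bsub>A\<^esub> y) else 0)"

abbreviation norm_topology :: "'a cstar \<Rightarrow> 'a topology" where
  "norm_topology A \<equiv> Metric_space.mtopology (carrier A) (cdist A)"

locale cstar_algebra = ring A for A :: "'a cstar" (structure) +
  assumes cscale_closed: "x \<in> carrier A \<Longrightarrow> cscale A c x \<in> carrier A"
    and cscale_add_right: "\<lbrakk>x \<in> carrier A; y \<in> carrier A\<rbrakk> \<Longrightarrow>
          cscale A c (x \<oplus> y) = cscale A c x \<oplus> cscale A c y"
    and cscale_add_left: "x \<in> carrier A \<Longrightarrow> cscale A (c + d) x = cscale A c x \<oplus> cscale A d x"
    and cscale_cscale: "x \<in> carrier A \<Longrightarrow> cscale A c (cscale A d x) = cscale A (c * d) x"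
    and cscale_one: "x \<in> carrier A \<Longrightarrow> cscale A 1 x = x"
    and cscale_mult_left: "\<lbrakk>x \<in> carrier A; y \<in> carrier A\<rbrakk> \<Longrightarrow>
          cscale A c x \<otimes> y = cscale A c (x \<otimes> y)"
    and cscale_mult_right: "\<lbrakk>x \<in> carrier A; y \<in> carrier A\<rbrakk> \<Longrightarrow>
          x \<otimes> cscale A c y = cscale A c (x \<otimes> y)"
    and adj_closed: "x \<in> carrier A \<Longrightarrow> adj A x \<in> carrier A"
    and adj_adj: "x \<in> carrier A \<Longrightarrow> adj A (adj A x) = x"
    and adj_add: "\<lbrakk>x \<in> carrier A; y \<in> carrier A\<rbrakk> \<Longrightarrow> adj A (x \<oplus> y) = adj A x \<oplus> adj A y"
    and adj_cscale: "x \<in> carrier A \<Longrightarrow> adj A (cscale A c x) = cscale A (cnj c) (adj A x)"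
    and adj_mult: "\<lbrakk>x \<in> carrier A; y \<in> carrier A\<rbrakk> \<Longrightarrow> adj A (x \<otimes> y) = adj A y \<otimes> adj A x"
    and cnorm_nonneg: "x \<in> carrier A \<Longrightarrow> 0 \<le> cnorm A x"
    and cnorm_eq_zero: "x \<in> carrier A \<Longrightarrow> cnorm A x = 0 \<longleftrightarrow> x = \<zero>"
    and cnorm_triangle: "\<lbrakk>x \<in> carrier A; y \<in> carrier A\<rbrakk> \<Longrightarrow>
          cnorm A (x \<oplus> y) \<le> cnorm A x + cnorm A y"
    and cnorm_cscale: "x \<in> carrier A \<Longrightarrow> cnorm A (cscale A c x) = cmod c * cnorm A x"
    and cnorm_mult: "\<lbrakk>x \<in> carrier A; y \<in> carrier A\<rbrakk> \<Longrightarrow>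
          cnorm A (x \<otimes> y) \<le> cnorm A x * cnorm A y"
    and cstar_identity: "x \<in> carrier A \<Longrightarrow> cnorm A (adj A x \<otimes> x) = (cnorm A x)\<^sup>2"
    and complete: "Metric_space.mcomplete (carrier A) (cdist A)"

lemma (in cstar_algebra) Metric_space_cdist: "Metric_space (carrier A) (cdist A)"
proof
  fix x y z
  have neg: "\<ominus> u = cscale A (-1) u" if "u \<in> carrier A" for u
  proof -
    have *: "cscale A 0 u = \<zero>"
      using cscale_add_left[of u 0 0] that cscale_closed[of u 0] by (metis add.r_cancel_one' add.right_neutral)
    have "cscale A (-1) u \<oplus> u = cscale A (-1 + 1) u"
      using that by (subst cscale_add_left) (auto simp: cscale_one)
    then have "cscale A (-1) u \<oplus> u = \<zero>" using * by simp
    then show ?thesis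
      using that cscale_closed[of u "-1"] minus_equality by blast
  qed
  show "0 \<le> cdist A x y"
    by (simp add: cdist_def cnorm_nonneg)
  have "y \<ominus> x = cscale A (-1) (x \<ominus> y)" if "x \<in> carrier A" "y \<in> carrier A"
    using that by (simp add: neg[symmetric] minus_add minus_minus a_minus_def a_comm)
  then show "cdist A x y = cdist A y x"
    by (auto simp: cdist_def cnorm_cscale)
  show "cdist A x y = 0 \<longleftrightarrow> x = y" if "x \<in> carrier A" "y \<in> carrier A"
  proof
    assume "cdist A x y = 0"
    then have "x \<oplus> \<ominus> y = \<zero>"
      using that by (simp add: cdist_def cnorm_eq_zero a_minus_def)
    then show "x = y"
      using that by (metis minus_equality minus_minus a_inv_closed)
  qed (use that in \<open>simp add: cdist_def cnorm_eq_zero a_minus_def r_neg\<close>)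
  have "x \<ominus> z = (x \<ominus> y) \<oplus> (y \<ominus> z)"
    if "x \<in> carrier A" "y \<in> carrier A" "z \<in> carrier A"
    using that by (simp add: a_minus_def a_assoc) (simp add: a_assoc[symmetric] l_neg)
  then show "cdist A x z \<le> cdist A x y + cdist A y z"
    if "x \<in> carrier A" "y \<in> carrier A" "z \<in> carrier A"
    using that cnorm_triangle[of "x \<ominus> y" "y \<ominus> z"] by (simp add: cdist_def)
qed

definition star_hom :: "'a cstar \<Rightarrow> 'b cstar \<Rightarrow> ('a \<Rightarrow> 'b) \<Rightarrow> bool" where
  "star_hom A B f \<longleftrightarrow>
     (\<forall>x\<in>carrier A. f x \<in> carrier B \<and> f (adj A x) = adj B (f x) \<and>
        (\<forall>c. f (cscale A c x) = cscale B c (f x))) \<and>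
     (\<forall>x\<in>carrier A. \<forall>y\<in>carrier A.
        f (x \<oplus>\<^bsub>A\<^esub> y) = f x \<oplus>\<^bsub>B\<^esub> f y \<and> f (x \<otimes>\<^bsub>A\<^esub> y) = f x \<otimes>\<^bsub>B\<^esub> f y)"

definition positives :: "'a cstar \<Rightarrow> 'a set" where
  "positives A = {adj A x \<otimes>\<^bsub>A\<^esub> x | x. x \<in> carrier A}"

definition projections :: "'a cstar \<Rightarrow> 'a set" where
  "projections A = {p \<in> carrier A. adj A p = p \<and> p \<otimes>\<^bsub>A\<^esub> p = p}"

text \<open>The algebra has a unit, so an algebraic ideal is automatically closed under
  complex scalars.\<close>

definition closed_ideal :: "'a cstar \<Rightarrow> 'a set \<Rightarrow> bool" where
  "closed_ideal A I \<longleftrightarrow> ideal I A \<and> closedin (norm_topology A) I"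

definition ideal_property :: "'a cstar \<Rightarrow> bool" where
  "ideal_property A \<longleftrightarrow>
     (\<forall>I. closed_ideal A I \<longrightarrow> I = \<Inter>{J. closed_ideal A J \<and> I \<inter> projections A \<subseteq> J})"

section \<open>Constructions\<close>

text \<open>\<open>C(X)\<close>, for a nonempty compact Hausdorff space \<open>X\<close>; functions are
  extended by 0 off the space.\<close>

definition cont_alg :: "'x topology \<Rightarrow> ('x \<Rightarrow> complex) cstar" where
  "cont_alg X =
     \<lparr>carrier = {f. continuous_map X euclidean f \<and> (\<forall>x. x \<notin> topspace X \<longrightarrow> f x = 0)},
      mult = (\<lambda>f g x. f x * g x),
      one = (\<lambda>x. if x \<in> topspace X then 1 else 0),
      zero = (\<lambda>x. 0),
      add = (\<lambda>f g x. f x + g x),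
      cscale = (\<lambda>c f x. c * f x),
      adj = (\<lambda>f x. cnj (f x)),
      cnorm = (\<lambda>f. SUP x\<in>topspace X. cmod (f x))\<rparr>"

text \<open>\<open>M\<^sub>n(A)\<close>. Matrices are extended by zero entries, so that
  \<open>x \<mapsto> x \<oplus> 0\<close> from \<open>M\<^sub>n(A)\<close> to
  \<open>M\<^sub>m(A)\<close> is an inclusion of carriers and the algebraic limit
  \<open>M\<^sub>\<infinity>(A)\<close> is their union. The norm is the
  \<open>C\<^sup>*\<close>-norm, written as the operator norm of the (faithful) action on the Hilbert
  \<open>A\<close>-module \<open>A\<^sup>n\<close>, whose norm is
  \<open>\<parallel>v\<parallel>\<^sup>2 = \<parallel>\<Sum>\<^sub>j v\<^sub>j\<^sup>* v\<^sub>j\<parallel>\<close>.\<close>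

definition module_norm :: "'a cstar \<Rightarrow> nat \<Rightarrow> (nat \<Rightarrow> 'a) \<Rightarrow> real" where
  "module_norm A n v = sqrt (cnorm A (\<Oplus>\<^bsub>A\<^esub>j\<in>{..<n}. adj A (v j) \<otimes>\<^bsub>A\<^esub> v j))"

definition mat_alg :: "'a cstar \<Rightarrow> nat \<Rightarrow> (nat \<Rightarrow> nat \<Rightarrow> 'a) cstar" where
  "mat_alg A n =
     \<lparr>carrier = {x. (\<forall>i j. x i j \<in> carrier A) \<and> (\<forall>i j. i \<ge> n \<or> j \<ge> n \<longrightarrow> x i j = \<zero>\<^bsub>A\<^esub>)},
      mult = (\<lambda>x y i j. if i < n \<and> j < n then \<Oplus>\<^bsub>A\<^esub>k\<in>{..<n}. x i k \<otimes>\<^bsub>A\<^esub> y k j else \<zero>\<^bsub>A\<^esub>),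
      one = (\<lambda>i j. if i < n \<and> i = j then \<one>\<^bsub>A\<^esub> else \<zero>\<^bsub>A\<^esub>),
      zero = (\<lambda>i j. \<zero>\<^bsub>A\<^esub>),
      add = (\<lambda>x y i j. x i j \<oplus>\<^bsub>A\<^esub> y i j),
      cscale = (\<lambda>c x i j. cscale A c (x i j)),
      adj = (\<lambda>x i j. adj A (x j i)),
      cnorm = (\<lambda>x. SUP v\<in>{v. (\<forall>j. v j \<in> carrier A) \<and> module_norm A n v \<le> 1}.
                 module_norm A n (\<lambda>i. \<Oplus>\<^bsub>A\<^esub>j\<in>{..<n}. x i j \<otimes>\<^bsub>A\<^esub> v j))\<rparr>"

definition corner_alg :: "'a cstar \<Rightarrow> 'a \<Rightarrow> 'a cstar" where
  "corner_alg B p =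
     B\<lparr>carrier := {p \<otimes>\<^bsub>B\<^esub> x \<otimes>\<^bsub>B\<^esub> p | x. x \<in> carrier B}, one := p\<rparr>"

definition direct_sum_alg :: "nat \<Rightarrow> (nat \<Rightarrow> 'a cstar) \<Rightarrow> (nat \<Rightarrow> 'a) cstar" where
  "direct_sum_alg t B =
     \<lparr>carrier = (\<Pi>\<^sub>E i\<in>{..<t}. carrier (B i)),
      mult = (\<lambda>x y. \<lambda>i\<in>{..<t}. x i \<otimes>\<^bsub>B i\<^esub> y i),
      one = (\<lambda>i\<in>{..<t}. \<one>\<^bsub>B i\<^esub>),
      zero = (\<lambda>i\<in>{..<t}. \<zero>\<^bsub>B i\<^esub>),
      add = (\<lambda>x y. \<lambda>i\<in>{..<t}. x i \<oplus>\<^bsub>B i\<^esub> y i),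
      cscale = (\<lambda>c x. \<lambda>i\<in>{..<t}. cscale (B i) c (x i)),
      adj = (\<lambda>x. \<lambda>i\<in>{..<t}. adj (B i) (x i)),
      cnorm = (\<lambda>x. Max ((\<lambda>i. cnorm (B i) (x i)) ` {..<t}))\<rparr>"

section \<open>AH algebras\<close>

definition euclidean_disc :: "nat \<Rightarrow> (nat \<Rightarrow> real) set" where
  "euclidean_disc n = {x \<in> topspace (Euclidean_space n). (\<Sum>i<n. (x i)\<^sup>2) \<le> 1}"

definition euclidean_open_disc :: "nat \<Rightarrow> (nat \<Rightarrow> real) set" where
  "euclidean_open_disc n = {x \<in> topspace (Euclidean_space n). (\<Sum>i<n. (x i)\<^sup>2) < 1}"

text \<open>Whitehead's definition, for finitely many cells (closure-finiteness and the weak topology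
  are then automatic). The cells are numbered by \<open>e < N\<close>, with dimension
  \<open>dim e\<close> and characteristic map \<open>\<Phi> e\<close>.\<close>

definition finite_CW_complex :: "'x topology \<Rightarrow> bool" where
  "finite_CW_complex X \<longleftrightarrow> Hausdorff_space X \<and>
     (\<exists>(N::nat) (dim :: nat \<Rightarrow> nat) (\<Phi> :: nat \<Rightarrow> (nat \<Rightarrow> real) \<Rightarrow> 'x).
        (\<forall>e<N. continuous_map (subtopology (Euclidean_space (dim e)) (euclidean_disc (dim e))) X (\<Phi> e) \<and>
               homeomorphic_map
                 (subtopology (Euclidean_space (dim e)) (euclidean_open_disc (dim e)))
                 (subtopology X (\<Phi> e ` euclidean_open_disc (dim e))) (\<Phi> e) \<and>
               \<Phi> e ` (euclidean_disc (dim e) - euclidean_open_disc (dim e)) \<subseteq>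
                 (\<Union>e'\<in>{e'. e' < N \<and> dim e' < dim e}. \<Phi> e' ` euclidean_open_disc (dim e'))) \<and>
        disjoint_family_on (\<lambda>e. \<Phi> e ` euclidean_open_disc (dim e)) {..<N} \<and>
        (\<Union>e<N. \<Phi> e ` euclidean_open_disc (dim e)) = topspace X)"

primrec iterated_map :: "(nat \<Rightarrow> 'b \<Rightarrow> 'b) \<Rightarrow> nat \<Rightarrow> nat \<Rightarrow> 'b \<Rightarrow> 'b" where
  "iterated_map \<phi> n 0 x = x"
| "iterated_map \<phi> n (Suc m) x = \<phi> (n + m) (iterated_map \<phi> n m x)"

text \<open>The inductive limit is the completion of the algebraic limit with respect to the seminorm
  \<open>lim\<^sub>m \<parallel>\<phi>\<^sub>n\<^sub>,\<^sub>m(x)\<parallel>\<close>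
  (modulo its kernel). The following says that the canonical maps \<open>\<mu> n\<close> identify
  \<open>A\<close> with it.\<close>

definition is_inductive_limit ::
    "(nat \<Rightarrow> 'b cstar) \<Rightarrow> (nat \<Rightarrow> 'b \<Rightarrow> 'b) \<Rightarrow> 'a cstar \<Rightarrow> (nat \<Rightarrow> 'b \<Rightarrow> 'a) \<Rightarrow> bool" where
  "is_inductive_limit B \<phi> A \<mu> \<longleftrightarrow>
     (\<forall>n. star_hom (B n) (B (Suc n)) (\<phi> n)) \<and>
     (\<forall>n. star_hom (B n) A (\<mu> n)) \<and>
     (\<forall>n. \<forall>x\<in>carrier (B n). \<mu> (Suc n) (\<phi> n x) = \<mu> n x) \<and>
     (\<forall>n. \<forall>x\<in>carrier (B n).
        (\<lambda>m. cnorm (B (n + m)) (iterated_map \<phi> n m x)) \<longlonglongrightarrow> cnorm A (\<mu> n x)) \<and>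
     norm_topology A closure_of (\<Union>n. \<mu> n ` carrier (B n)) = carrier A"

definition AH_building_block ::
    "nat \<Rightarrow> (nat \<Rightarrow> 'x topology) \<Rightarrow> (nat \<Rightarrow> nat) \<Rightarrow> (nat \<Rightarrow> nat \<Rightarrow> nat \<Rightarrow> 'x \<Rightarrow> complex) \<Rightarrow>
     (nat \<Rightarrow> nat \<Rightarrow> nat \<Rightarrow> 'x \<Rightarrow> complex) cstar" where
  "AH_building_block t X k P =
     direct_sum_alg t (\<lambda>i. corner_alg (mat_alg (cont_alg (X i)) (k i)) (P i))"

text \<open>The points of the local spectra are taken from an arbitrary type \<open>'x\<close>. It is
  passed as an argument because it does not occur in the type of \<open>A\<close>.\<close>

definition AH_algebra :: "'x itself \<Rightarrow> 'a cstar \<Rightarrow> bool" where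
  "AH_algebra (_ :: 'x itself) A \<longleftrightarrow> cstar_algebra A \<and>
     (\<exists>(t :: nat \<Rightarrow> nat) (X :: nat \<Rightarrow> nat \<Rightarrow> 'x topology) (k :: nat \<Rightarrow> nat \<Rightarrow> nat) P \<phi> \<mu>.
        (\<forall>n. 0 < t n \<and>
           (\<forall>i<t n. finite_CW_complex (X n i) \<and> connected_space (X n i) \<and> topspace (X n i) \<noteq> {} \<and>
              0 < k n i \<and> P n i \<in> projections (mat_alg (cont_alg (X n i)) (k n i)))) \<and>
        is_inductive_limit (\<lambda>n. AH_building_block (t n) (X n) (k n) (P n)) \<phi> A \<mu>)"

section \<open>Tracial states\<close>

definition tracial_states :: "'a cstar \<Rightarrow> ('a \<Rightarrow> complex) set" where
  "tracial_states A = {\<tau> \<in> extensional (carrier A).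
     (\<forall>x\<in>carrier A. \<forall>y\<in>carrier A. \<tau> (x \<oplus>\<^bsub>A\<^esub> y) = \<tau> x + \<tau> y) \<and>
     (\<forall>x\<in>carrier A. \<forall>c. \<tau> (cscale A c x) = c * \<tau> x) \<and>
     (\<forall>x\<in>positives A. \<tau> x \<in> \<real>\<^sub>\<ge>\<^sub>0) \<and>
     \<tau> \<one>\<^bsub>A\<^esub> = 1 \<and>
     (\<forall>x\<in>carrier A. \<forall>y\<in>carrier A. \<tau> (x \<otimes>\<^bsub>A\<^esub> y) = \<tau> (y \<otimes>\<^bsub>A\<^esub> x))}"

definition extremal_tracial_states :: "'a cstar \<Rightarrow> ('a \<Rightarrow> complex) set" where
  "extremal_tracial_states A = {\<tau> \<in> tracial_states A.
     \<forall>\<sigma>\<in>tracial_states A. \<forall>\<rho>\<in>tracial_states A. \<forall>s::real. 0 < s \<and> s < 1 \<and>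
       (\<forall>x\<in>carrier A. \<tau> x = of_real s * \<sigma> x + of_real (1 - s) * \<rho> x) \<longrightarrow> \<sigma> = \<tau> \<and> \<rho> = \<tau>}"

section \<open>The Cuntz semigroup\<close>

definition Minf_pos :: "'a cstar \<Rightarrow> (nat \<Rightarrow> nat \<Rightarrow> 'a) set" where
  "Minf_pos A = (\<Union>n\<in>{1..}. positives (mat_alg A n))"

definition cuntz_le :: "'a cstar \<Rightarrow> (nat \<Rightarrow> nat \<Rightarrow> 'a) \<Rightarrow> (nat \<Rightarrow> nat \<Rightarrow> 'a) \<Rightarrow> bool" where
  "cuntz_le A a b \<longleftrightarrow> (\<exists>n\<ge>1. let M = mat_alg A n in
     a \<in> carrier M \<and> b \<in> carrier M \<and>
     (\<exists>x :: nat \<Rightarrow> nat \<Rightarrow> nat \<Rightarrow> 'a. (\<forall>k. x k \<in> carrier M) \<and>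
        limitin (norm_topology M) (\<lambda>k. x k \<otimes>\<^bsub>M\<^esub> b \<otimes>\<^bsub>M\<^esub> adj M (x k)) a sequentially))"

definition cuntz_rel :: "'a cstar \<Rightarrow> ((nat \<Rightarrow> nat \<Rightarrow> 'a) \<times> (nat \<Rightarrow> nat \<Rightarrow> 'a)) set" where
  "cuntz_rel A = {(a, b). a \<in> Minf_pos A \<and> b \<in> Minf_pos A \<and> cuntz_le A a b \<and> cuntz_le A b a}"

definition cuntz_semigroup :: "'a cstar \<Rightarrow> (nat \<Rightarrow> nat \<Rightarrow> 'a) set set" where
  "cuntz_semigroup A = Minf_pos A // cuntz_rel A"

text \<open>\<open>a \<oplus> b\<close> for \<open>a\<close> regarded as an \<open>n \<times> n\<close>
  matrix. The Cuntz class of the result does not depend on the choice of \<open>n\<close>.\<close>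

definition block_sum :: "'a cstar \<Rightarrow> nat \<Rightarrow> (nat \<Rightarrow> nat \<Rightarrow> 'a) \<Rightarrow> (nat \<Rightarrow> nat \<Rightarrow> 'a) \<Rightarrow> nat \<Rightarrow> nat \<Rightarrow> 'a" where
  "block_sum A n a b = (\<lambda>i j. if i < n \<and> j < n then a i j
     else if n \<le> i \<and> n \<le> j then b (i - n) (j - n) else \<zero>\<^bsub>A\<^esub>)"

text \<open>The sum \<open>\<langle>a\<rangle> + \<langle>b\<rangle>\<close> is the set of all elements equivalent to a block
  sum of representatives, which is the class of \<open>a \<oplus> b\<close>.\<close>

definition cuntz_add :: "'a cstar \<Rightarrow> (nat \<Rightarrow> nat \<Rightarrow> 'a) set \<Rightarrow> (nat \<Rightarrow> nat \<Rightarrow> 'a) set \<Rightarrow> (nat \<Rightarrow> nat \<Rightarrow> 'a) set" where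
  "cuntz_add A x y = {c. \<exists>n\<ge>1. \<exists>a b. a \<in> x \<and> a \<in> carrier (mat_alg A n) \<and> b \<in> y \<and>
     (block_sum A n a b, c) \<in> cuntz_rel A}"

definition cuntz_zero :: "'a cstar \<Rightarrow> (nat \<Rightarrow> nat \<Rightarrow> 'a) set" where
  "cuntz_zero A = cuntz_rel A `` {\<lambda>i j. \<zero>\<^bsub>A\<^esub>}"

definition cuntz_multiple :: "'a cstar \<Rightarrow> nat \<Rightarrow> (nat \<Rightarrow> nat \<Rightarrow> 'a) set \<Rightarrow> (nat \<Rightarrow> nat \<Rightarrow> 'a) set" where
  "cuntz_multiple A n x = (cuntz_add A x ^^ n) (cuntz_zero A)"

definition cuntz_class_le :: "'a cstar \<Rightarrow> (nat \<Rightarrow> nat \<Rightarrow> 'a) set \<Rightarrow> (nat \<Rightarrow> nat \<Rightarrow> 'a) set \<Rightarrow> bool" where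
  "cuntz_class_le A x y \<longleftrightarrow> (\<exists>a\<in>x. \<exists>b\<in>y. cuntz_le A a b)"

definition almost_unperforated :: "'a cstar \<Rightarrow> bool" where
  "almost_unperforated A \<longleftrightarrow>
     (\<forall>x\<in>cuntz_semigroup A. \<forall>y\<in>cuntz_semigroup A. \<forall>m n. 0 < m \<and> m < n \<and>
        cuntz_class_le A (cuntz_multiple A n x) (cuntz_multiple A m y) \<longrightarrow> cuntz_class_le A x y)"

section \<open>Dimension functions and quasitraces\<close>

definition dimension_functions :: "'a cstar \<Rightarrow> ((nat \<Rightarrow> nat \<Rightarrow> 'a) \<Rightarrow> ennreal) set" where
  "dimension_functions A = {d \<in> extensional (Minf_pos A).
     (\<forall>n\<ge>1. \<forall>a\<in>positives (mat_alg A n). \<forall>b\<in>Minf_pos A. d (block_sum A n a b) = d a + d b) \<and>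
     (\<forall>a\<in>Minf_pos A. \<forall>b\<in>Minf_pos A. cuntz_le A a b \<longrightarrow> d a \<le> d b)}"

definition abelian_sub_cstar :: "'a cstar \<Rightarrow> 'a set \<Rightarrow> bool" where
  "abelian_sub_cstar A S \<longleftrightarrow> closedin (norm_topology A) S \<and> \<zero>\<^bsub>A\<^esub> \<in> S \<and>
     (\<forall>x\<in>S. adj A x \<in> S \<and> (\<forall>c. cscale A c x \<in> S)) \<and>
     (\<forall>x\<in>S. \<forall>y\<in>S. x \<oplus>\<^bsub>A\<^esub> y \<in> S \<and> x \<otimes>\<^bsub>A\<^esub> y \<in> S \<and> x \<otimes>\<^bsub>A\<^esub> y = y \<otimes>\<^bsub>A\<^esub> x)"

text \<open>The conditions on a quasitrace other than normalization and extendability to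
  matrices.\<close>

definition quasitracial :: "'a cstar \<Rightarrow> ('a \<Rightarrow> complex) \<Rightarrow> bool" where
  "quasitracial A \<tau> \<longleftrightarrow>
     (\<forall>x\<in>carrier A. \<tau> (x \<otimes>\<^bsub>A\<^esub> adj A x) \<in> \<real>\<^sub>\<ge>\<^sub>0 \<and> \<tau> (x \<otimes>\<^bsub>A\<^esub> adj A x) = \<tau> (adj A x \<otimes>\<^bsub>A\<^esub> x)) \<and>
     (\<forall>a\<in>carrier A. \<forall>b\<in>carrier A. adj A a = a \<and> adj A b = b \<longrightarrow>
        \<tau> (a \<oplus>\<^bsub>A\<^esub> cscale A \<i> b) = \<tau> a + \<i> * \<tau> b) \<and>
     (\<forall>S. abelian_sub_cstar A S \<longrightarrow>
        (\<forall>x\<in>S. \<forall>y\<in>S. \<tau> (x \<oplus>\<^bsub>A\<^esub> y) = \<tau> x + \<tau> y) \<and>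
        (\<forall>x\<in>S. \<forall>c. \<tau> (cscale A c x) = c * \<tau> x))"

definition corner_embed :: "'a cstar \<Rightarrow> 'a \<Rightarrow> nat \<Rightarrow> nat \<Rightarrow> 'a" where
  "corner_embed A a = (\<lambda>i j. if i = 0 \<and> j = 0 then a else \<zero>\<^bsub>A\<^esub>)"

definition extends_to_mat :: "'a cstar \<Rightarrow> ('a \<Rightarrow> complex) \<Rightarrow> nat \<Rightarrow> ((nat \<Rightarrow> nat \<Rightarrow> 'a) \<Rightarrow> complex) \<Rightarrow> bool" where
  "extends_to_mat A \<tau> n T \<longleftrightarrow>
     (\<forall>a\<in>carrier A. T (corner_embed A a) = \<tau> a) \<and> quasitracial (mat_alg A n) T"

definition quasitraces :: "'a cstar \<Rightarrow> ('a \<Rightarrow> complex) set" where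
  "quasitraces A = {\<tau> \<in> extensional (carrier A).
     \<tau> \<one>\<^bsub>A\<^esub> = 1 \<and> quasitracial A \<tau> \<and> (\<forall>n\<ge>1. \<exists>T. extends_to_mat A \<tau> n T)}"

text \<open>The extension of \<open>\<tau>\<close> to \<open>M\<^sub>\<infinity>(A)\<close>, obtained from the
  extensions to the \<open>M\<^sub>n(A)\<close>. These are unique (Blackadar and Handelman), hence
  compatible with each other.\<close>

definition quasitrace_ext :: "'a cstar \<Rightarrow> ('a \<Rightarrow> complex) \<Rightarrow> (nat \<Rightarrow> nat \<Rightarrow> 'a) \<Rightarrow> complex" where
  "quasitrace_ext A \<tau> = (SOME T. \<forall>n\<ge>1. extends_to_mat A \<tau> n T)"

text \<open>\<open>a\<^bsup>1/k\<^esup>\<close>, as the unique positive \<open>k\<close>-th root (for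
  \<open>k \<ge> 1\<close>). It does not depend on the size of the matrix algebra.\<close>

definition Minf_root :: "'a cstar \<Rightarrow> nat \<Rightarrow> (nat \<Rightarrow> nat \<Rightarrow> 'a) \<Rightarrow> nat \<Rightarrow> nat \<Rightarrow> 'a" where
  "Minf_root A k a = (THE b. \<exists>n\<ge>1. a \<in> positives (mat_alg A n) \<and> b \<in> positives (mat_alg A n) \<and>
     b [^]\<^bsub>mat_alg A n\<^esub> k = a)"

definition dim_of_quasitrace :: "'a cstar \<Rightarrow> ('a \<Rightarrow> complex) \<Rightarrow> (nat \<Rightarrow> nat \<Rightarrow> 'a) \<Rightarrow> ennreal" where
  "dim_of_quasitrace A \<tau> = (\<lambda>a\<in>Minf_pos A.
     ennreal (lim (\<lambda>k. Re (quasitrace_ext A \<tau> (Minf_root A k a)))))"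

definition weak_strict_comparison :: "'a cstar \<Rightarrow> bool" where
  "weak_strict_comparison A \<longleftrightarrow> quasitraces A \<noteq> {} \<and>
     (let E = dim_of_quasitrace A ` quasitraces A in
      \<forall>a\<in>Minf_pos A. \<forall>b\<in>Minf_pos A.
        (\<forall>d \<in> E \<union> {f \<in> dimension_functions A - E. f b = 1}. d a < d b) \<longrightarrow> cuntz_le A a b)"

end

theory Submission
  imports Defs
begin

text \<open>Neither the ideal property nor the finiteness of the set of extremal tracial states is essential.
  Let \<open>a\<close>, \<open>b\<close> be positive matrices as in the definition of weak strict comparison, and let \<open>y\<close> be the
  sum of the diagonal entries of \<open>b\<close>. There is a dichotomy for \<open>y\<close>.

  Consider the convex cone generated by the positive elements, by \<open>- y\<close> and by the commutators
  \<open>zz\<^sup>* - z\<^sup>*z\<close>. If it contains no negative multiple of 1, a Hahn--Banach argument yields a tracial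
  state that vanishes at \<open>y\<close>. Otherwise, an approximation of the relation
  \<open>- \<delta> + Cy + \<Sum> (zz\<^sup>* - z\<^sup>*z) = \<sigma>\<^sup>*\<sigma>\<close> holds at some stage of the inductive limit, and taking pointwise
  traces there bounds the trace of \<open>y\<close> below by a multiple of the trace of the unit. Then a sum of elements
  \<open>v y v\<^sup>*\<close>, in which the \<open>v\<close> are multiples of compressed matrix units, is the unit of that stage;
  so \<open>y\<close> is full.

  If a tracial state \<open>\<tau>\<close> vanishes at \<open>y\<close>, then its extension vanishes at \<open>b\<close> and at all roots of \<open>b\<close>, so
  that \<open>d\<^sub>\<tau>(b) = 0\<close>, which contradicts \<open>d\<^sub>\<tau>(a) < d\<^sub>\<tau>(b)\<close>. If \<open>y\<close> is full, then \<open>\<langle>b\<rangle>\<close> is an order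
  unit of the Cuntz semigroup. As this is almost unperforated, \<open>a \<precsim> b\<close> unless some dimension function \<open>d\<close>
  has \<open>d(b) = 1 \<le> d(a)\<close>. For \<open>y = 0\<close> the dichotomy provides a tracial state, hence a quasitrace.\<close>

section \<open>Positivity in unital \<open>C\<^sup>*\<close>-algebras\<close>

text \<open>The extension \<open>quasitrace_ext\<close> of a trace to matrices is an arbitrary
  choice, about which only the axioms of quasitraces are known. That
  \<open>d\<^sub>\<tau>(b) = 0\<close> therefore has to be derived for functionals that are additive
  on commuting elements only, where even monotonicity is not evident. Spectral theory is done for a
  type class, since the algebras are records whose types vary with the size of the matrices and with
  the space: all algebras over one carrier type become direct factors of one universal algebra.
  There the unit of a factor is merely a central projection \<open>e\<close>, whence the terms
  \<open>1 - e\<close> and the multiplications by \<open>e\<close>; complex scalars are supplied by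
  a central element \<open>ii\<close> with square -1.

  The order unit is what allows a dimension function to be normalized at \<open>b\<close> by a
  Hahn-Banach argument. In passing from a finite stage to the limit, the number of the elements
  \<open>v\<close> is not under control, but the norm of the sum of all \<open>v v\<^sup>*\<close>
  is, and this suffices.\<close>

class unital_cstar = real_normed_algebra_1 + banach +
  fixes star :: "'a \<Rightarrow> 'a" and ii :: 'a
  assumes star_star [simp]: "star (star x) = x"
    and star_add: "star (x + y) = star x + star y"
    and star_scaleR: "star (r *\<^sub>R x) = r *\<^sub>R star x"
    and star_mult: "star (x * y) = star y * star x"
    and star_ii: "star ii = - ii"
    and ii_commute: "ii * x = x * ii"
    and ii_square: "ii * ii = - 1"
    and norm_star_mult: "norm (star x * x) = (norm x)\<^sup>2"

section \<open>Involution and norm\<close>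

lemma star_0 [simp]: "star 0 = (0 :: 'a :: unital_cstar)"
  using star_add[of "0::'a" 0] by simp

lemma star_1 [simp]: "star 1 = (1 :: 'a :: unital_cstar)"
  by (metis mult_1 mult_1_right star_mult star_star)

lemma star_minus: "star (- x) = - star (x :: 'a :: unital_cstar)"
  using star_scaleR[of "-1" x] by simp

lemma star_diff: "star (x - y) = star x - star (y :: 'a :: unital_cstar)"
  by (simp add: diff_conv_add_uminus star_add star_minus del: add_uminus_conv_diff)

lemma star_of_real [simp]: "star (of_real r) = (of_real r :: 'a :: unital_cstar)"
  by (simp add: of_real_def star_scaleR)

lemma star_sum: "star (sum f S) = (\<Sum>i\<in>S. star (f i :: 'a :: unital_cstar))"
  by (induction S rule: infinite_finite_induct) (auto simp: star_add)

lemma star_power: "star (x ^ n) = star (x :: 'a :: unital_cstar) ^ n"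
  by (induction n) (auto simp: star_mult power_commutes)

lemmas star_simps = star_add star_minus star_diff star_scaleR star_mult star_power star_sum

lemma norm_star [simp]: "norm (star x) = norm (x :: 'a :: unital_cstar)"
proof -
  have "norm y \<le> norm (star y)" for y :: 'a
  proof (cases "y = 0")
    case False
    have "norm y * norm y \<le> norm (star y) * norm y"
      using norm_mult_ineq[of "star y" y] norm_star_mult[of y] by (simp add: power2_eq_square)
    then show ?thesis using False by simp
  qed simp
  from this[of x] this[of "star x"] show ?thesis by simp
qed

lemma norm_mult_star: "norm (x * star x) = (norm (x :: 'a :: unital_cstar))\<^sup>2"
  using norm_star_mult[of "star x"] by simp

lemma star_mult_eq_0D: "star x * x = 0 \<Longrightarrow> x = (0 :: 'a :: unital_cstar)"
  using norm_star_mult[of x] by simp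

lemma bounded_linear_star: "bounded_linear (star :: 'a :: unital_cstar \<Rightarrow> 'a)"
  by (rule bounded_linear_intro[of _ 1]) (auto simp: star_simps)

lemmas tendsto_star [tendsto_intros] = bounded_linear.tendsto[OF bounded_linear_star]

text \<open>By the C*-identity the norm is multiplicative along the powers
  \<open>b ^ (2 ^ m)\<close>, and \<open>b ^ n\<close> is a factor of
  \<open>b ^ (2 ^ n)\<close>.\<close>

lemma selfadjoint_power_eq_0:
  fixes b :: "'a :: unital_cstar"
  assumes b: "star b = b" and "b ^ n = 0"
  shows "b = 0"
proof -
  have eq: "norm (b ^ (2 ^ m)) = norm b ^ (2 ^ m)" for m
  proof (induction m)
    case (Suc m)
    have "b ^ (2 ^ Suc m) = star (b ^ (2 ^ m)) * b ^ (2 ^ m)"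
      using b by (simp add: star_power mult_2 flip: power_add)
    then show ?case using Suc by (simp add: norm_star_mult power_mult[symmetric] mult.commute)
  qed simp
  have "n \<le> 2 ^ n" by (rule less_imp_le) (rule less_exp)
  then have "b ^ (2 ^ n) = b ^ n * b ^ (2 ^ n - n)" by (simp flip: power_add)
  then show ?thesis using eq[of n] assms(2) by simp
qed

text \<open>From the first power on the coefficients alternate in sign, so that at
  \<open>- x\<close> their terms all add up in one direction, to
  \<open>1 - (1 - x) powr a \<le> 1\<close>. Letting \<open>x\<close> tend to 1 in the partial sums
  bounds the sum of the absolute values. Summability at radius 1 is what admits
  \<open>norm u = 1\<close> in \<open>root_of_one_plus\<close>.\<close>

lemma binomial_coeffs_abs_summable:
  fixes a :: real
  assumes a: "0 < a" "a \<le> 1"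
  shows "summable (\<lambda>n. \<bar>a gchoose n\<bar>)"
proof -
  define g where "g n = (-1) ^ n * (a gchoose Suc n)" for n
  have g_Suc: "g (Suc n) = g n * (real (Suc n) - a) / real (Suc (Suc n))" for n
    by (simp add: g_def gbinomial_Suc_rec[of a "Suc n"] gbinomial_absorb_comp field_simps
        gbinomial_rec gbinomial_Suc)
  have g_nonneg: "g n \<ge> 0" for n
  proof (induction n)
    case 0 show ?case using a by (simp add: g_def)
  next
    case (Suc n) then show ?case unfolding g_Suc using a by (intro divide_nonneg_nonneg mult_nonneg_nonneg) auto
  qed
  have bound: "(\<Sum>n<N. g n * x ^ Suc n) \<le> 1" if x: "0 \<le> x" "x < 1" for x N
  proof -
    have "(\<lambda>n. (a gchoose n) * (- x) ^ n) sums (1 + - x) powr a"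
      using x by (intro gen_binomial_real) auto
    then have "(\<lambda>n. (a gchoose Suc n) * (- x) ^ Suc n) sums ((1 - x) powr a - 1)"
      by (subst sums_Suc_iff) (use a in simp)
    then have "(\<lambda>n. - ((a gchoose Suc n) * (- x) ^ Suc n)) sums - ((1 - x) powr a - 1)"
      by (rule sums_minus)
    moreover have "- ((a gchoose Suc n) * (- x) ^ Suc n) = g n * x ^ Suc n" for n
      by (simp add: g_def power_minus[of x])
    ultimately have s: "(\<lambda>n. g n * x ^ Suc n) sums (1 - (1 - x) powr a)"
      by (metis (no_types, lifting) minus_diff_eq sums_cong)
    have "(\<Sum>n<N. g n * x ^ Suc n) \<le> (\<Sum>n. g n * x ^ Suc n)"
      using s x g_nonneg by (intro sum_le_suminf) (auto simp: sums_iff)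
    also have "\<dots> \<le> 1" using s by (simp add: sums_iff)
    finally show ?thesis .
  qed
  have "(\<Sum>n<N. g n) \<le> 1" for N
  proof -
    have "((\<lambda>x. \<Sum>n<N. g n * x ^ Suc n) \<longlongrightarrow> (\<Sum>n<N. g n * 1 ^ Suc n)) (at_left 1)"
      by (intro tendsto_intros)
    moreover have "\<forall>\<^sub>F x in at_left 1. (\<Sum>n<N. g n * x ^ Suc n) \<le> 1"
      unfolding eventually_at_left_field using bound by (intro exI[of _ 0]) auto
    ultimately show ?thesis
      by (intro tendsto_upperbound[of "\<lambda>x. \<Sum>n<N. g n * x ^ Suc n" _ "at_left 1"]) auto
  qed
  then have "summable g" using g_nonneg by (intro summableI_nonneg_bounded)
  then have "summable (\<lambda>n. \<bar>g n\<bar>)" using g_nonneg by simp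
  then have "summable (\<lambda>n. \<bar>a gchoose Suc n\<bar>)" by (simp add: g_def abs_mult power_abs)
  then show ?thesis using summable_Suc_iff[of "\<lambda>n. \<bar>a gchoose n\<bar>"] by simp
qed

text \<open>Evaluation at a contraction is a homomorphism on the power series with absolutely
  summable coefficients, by the Cauchy product. It takes the place of the continuous functional
  calculus.\<close>

lemma fps_eval_mult:
  fixes f g :: "real fps" and u :: "'a :: {real_normed_algebra_1, banach}"
  assumes f: "summable (\<lambda>n. \<bar>fps_nth f n\<bar>)" and g: "summable (\<lambda>n. \<bar>fps_nth g n\<bar>)" and u: "norm u \<le> 1"
  shows "summable (\<lambda>n. \<bar>fps_nth (f * g) n\<bar>)"
    and "(\<Sum>n. fps_nth (f * g) n *\<^sub>R u ^ n) = (\<Sum>n. fps_nth f n *\<^sub>R u ^ n) * (\<Sum>n. fps_nth g n *\<^sub>R u ^ n)"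
proof -
  have norm_u: "norm (u ^ n) \<le> 1" for n
    by (rule order_trans[OF norm_power_ineq power_le_one]) (use u in auto)
  have 1: "summable (\<lambda>n. norm (fps_nth h n *\<^sub>R u ^ n))" if "summable (\<lambda>n. \<bar>fps_nth h n\<bar>)" for h :: "real fps"
    by (rule summable_comparison_test'[OF that, of 0]) (use norm_u in \<open>simp add: mult_left_le\<close>)
  have "summable (\<lambda>k. \<Sum>i\<le>k. \<bar>fps_nth f i\<bar> * \<bar>fps_nth g (k - i)\<bar>)"
    using f g by (intro summable_Cauchy_product) auto
  then show "summable (\<lambda>n. \<bar>fps_nth (f * g) n\<bar>)"
    by (rule summable_comparison_test'[of _ 0])
      (auto simp: fps_mult_nth atLeast0AtMost abs_mult intro!: order_trans[OF sum_abs])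
  have "(\<Sum>n. fps_nth f n *\<^sub>R u ^ n) * (\<Sum>n. fps_nth g n *\<^sub>R u ^ n)
      = (\<Sum>k. \<Sum>i\<le>k. (fps_nth f i *\<^sub>R u ^ i) * (fps_nth g (k - i) *\<^sub>R u ^ (k - i)))"
    by (rule Cauchy_product) (use 1 f g in auto)
  also have "\<dots> = (\<Sum>n. fps_nth (f * g) n *\<^sub>R u ^ n)"
    by (rule suminf_cong)
      (auto simp: fps_mult_nth atLeast0AtMost scaleR_sum_left mult.commute simp flip: power_add intro!: sum.cong)
  finally show "(\<Sum>n. fps_nth (f * g) n *\<^sub>R u ^ n) = (\<Sum>n. fps_nth f n *\<^sub>R u ^ n) * (\<Sum>n. fps_nth g n *\<^sub>R u ^ n)" ..
qed

text \<open>The \<open>k\<close>-th power of the binomial series with exponent \<open>1 / k\<close>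
  is \<open>1 + fps_X\<close>. As a limit of polynomials in \<open>u\<close>, the root commutes with
  everything that commutes with \<open>u\<close>; this clause is passed on to all later
  roots.\<close>

lemma root_of_one_plus:
  fixes u :: "'a :: unital_cstar"
  assumes u: "star u = u" "norm u \<le> 1" and k: "k \<ge> 1"
  shows "\<exists>r. star r = r \<and> r ^ k = 1 + u \<and> (\<forall>y. y * u = u * y \<longrightarrow> y * r = r * y)"
proof -
  define f where "f = fps_binomial (1 / real k)"
  define F where "F = (\<lambda>g::real fps. \<Sum>n. fps_nth g n *\<^sub>R u ^ n)"
  have sf: "summable (\<lambda>n. \<bar>fps_nth f n\<bar>)"
    unfolding f_def fps_binomial_nth by (rule binomial_coeffs_abs_summable) (use k in auto)
  have norm_u: "norm (u ^ n) \<le> 1" for n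
    by (rule order_trans[OF norm_power_ineq power_le_one]) (use u in auto)
  have summ: "summable (\<lambda>n. fps_nth f n *\<^sub>R u ^ n)"
    by (rule summable_norm_cancel, rule summable_comparison_test'[OF sf, of 0])
      (use norm_u in \<open>simp add: mult_left_le\<close>)
  have pow: "summable (\<lambda>n. \<bar>fps_nth (f ^ m) n\<bar>) \<and> F (f ^ m) = F f ^ m" for m
  proof (induction m)
    case 0
    have "(\<lambda>n. fps_nth (1 :: real fps) n *\<^sub>R u ^ n) sums (\<Sum>n\<in>{0}. fps_nth (1 :: real fps) n *\<^sub>R u ^ n)"
      by (rule sums_finite) auto
    moreover have "(\<lambda>n. \<bar>fps_nth (1 :: real fps) n\<bar>) sums (\<Sum>n\<in>{0}. \<bar>fps_nth (1 :: real fps) n\<bar>)"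
      by (rule sums_finite) auto
    ultimately show ?case by (auto simp: F_def sums_iff)
  next
    case (Suc m)
    then show ?case
      using fps_eval_mult[OF sf _ u(2), of "f ^ m"] by (auto simp: F_def)
  qed
  have "f ^ k = 1 + fps_X" using k by (simp add: f_def fps_binomial_power fps_binomial_1)
  moreover have "F (1 + fps_X) = 1 + u"
  proof -
    have "(\<lambda>n. fps_nth (1 + fps_X :: real fps) n *\<^sub>R u ^ n) sums (\<Sum>n\<in>{0,1}. fps_nth (1 + fps_X :: real fps) n *\<^sub>R u ^ n)"
      by (rule sums_finite) (auto simp: fps_X_def)
    then show ?thesis by (auto simp: F_def sums_iff)
  qed
  ultimately have "F f ^ k = 1 + u" using pow[of k] by simp
  moreover have "star (F f) = F f"
    unfolding F_def using bounded_linear.suminf[OF bounded_linear_star summ] u(1) by (simp add: star_simps)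
  moreover have "y * F f = F f * y" if y: "y * u = u * y" for y
  proof -
    have "y * u ^ n = u ^ n * y" for n using power_commuting_commutes[of u y n] y by simp
    then show ?thesis unfolding F_def using suminf_mult[OF summ, of y] suminf_mult2[OF summ, of y] by simp
  qed
  ultimately show ?thesis by blast
qed

text \<open>Squares of self-adjoint elements are what the series produce. That
  \<open>star x * x\<close> has this form too is the content of \<open>pos_star_mult\<close>, which
  comes only after an order theory based on norms.\<close>

definition pos :: "'a :: unital_cstar \<Rightarrow> bool" where
  "pos a \<longleftrightarrow> (\<exists>h. star h = h \<and> a = h * h)"

lemma pos_selfadjoint: "pos a \<Longrightarrow> star a = (a :: 'a :: unital_cstar)"
  by (auto simp: pos_def star_mult)

lemma pos_square: "star h = h \<Longrightarrow> pos (h * h :: 'a :: unital_cstar)"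
  by (auto simp: pos_def)

lemma pos_0 [simp]: "pos (0 :: 'a :: unital_cstar)"
  using pos_square[of "0::'a"] by simp

lemma of_real_mult_commute: "of_real r * x = x * (of_real r :: 'a :: real_normed_algebra_1)"
  by (simp add: of_real_def)

lemma norm_imaginary: "norm (ii * x) = norm (x :: 'a :: unital_cstar)"
proof -
  have "star (ii * x) * (ii * x) = star x * x"
  proof -
    have "star (ii * x) * (ii * x) = - (star x * (ii * ii) * x)" by (simp add: star_mult star_ii mult.assoc)
    then show ?thesis by (simp add: ii_square)
  qed
  then have "(norm (ii * x))\<^sup>2 = (norm x)\<^sup>2" by (metis norm_star_mult)
  then show ?thesis by simp
qed

text \<open>If \<open>h\<^sup>2 + r\<^sup>2 = s\<^sup>2\<close> for commuting self-adjoint \<open>h\<close> and \<open>r\<close>, then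
  \<open>h + ir\<close> is \<open>s\<close> times a unitary with real part \<open>h\<close> and imaginary part \<open>r\<close>.\<close>

lemma norm_le_of_sum_squares:
  fixes h r :: "'a :: unital_cstar"
  assumes h: "star h = h" and r: "star r = r" and c: "h * r = r * h"
    and eq: "h * h + r * r = of_real (s\<^sup>2)" and s: "s \<ge> 0"
  shows "norm h \<le> s" and "norm r \<le> s"
proof -
  define z where "z = h + ii * r"
  have sz: "star z = h - ii * r"
    by (simp add: z_def star_simps h r star_ii) (simp add: ii_commute[of r])
  have "star z * z = h * h + (h * (ii * r) - ii * r * h) - ii * r * (ii * r)"
    unfolding sz by (simp add: z_def algebra_simps)
  also have "h * (ii * r) = ii * r * h" by (metis c ii_commute mult.assoc)
  also have "ii * r * (ii * r) = - (r * r)"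
    by (metis ii_commute ii_square mult.assoc mult_minus_left mult_1)
  finally have "star z * z = of_real (s\<^sup>2)" using eq by simp
  then have nz: "norm z = s"
    using norm_star_mult[of z] s by (simp add: norm_of_real del: of_real_power)
  have "2 *\<^sub>R h = z + star z" "2 *\<^sub>R (ii * r) = z - star z"
    unfolding sz by (simp_all add: z_def scaleR_2)
  then have "2 * norm h \<le> 2 * s" "2 * norm (ii * r) \<le> 2 * s"
    using norm_triangle_ineq[of z "star z"] norm_triangle_ineq4[of z "star z"] nz
      norm_scaleR[of 2 h] norm_scaleR[of 2 "ii * r"] by auto
  then show "norm h \<le> s" "norm r \<le> s" by (auto simp: norm_imaginary)
qed

text \<open>The root of \<open>1 - h * h\<close> from the binomial series commutes with
  \<open>h\<close>, so that \<open>norm_le_of_sum_squares\<close> applies with \<open>s = 1\<close>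
  and makes this root a contraction as well.\<close>

lemma norm_one_minus_square:
  fixes h :: "'a :: unital_cstar"
  assumes h: "star h = h" and n: "norm h \<le> 1"
  shows "norm (1 - h * h) \<le> 1"
proof -
  have n2: "norm (- (h * h)) \<le> 1"
    using norm_star_mult[of h] h n by (simp add: power_le_one)
  have sa: "star (- (h * h)) = - (h * h)" using h by (simp add: star_simps)
  obtain r where r: "star r = r" "r ^ 2 = 1 + - (h * h)"
      "\<And>y. y * (- (h * h)) = (- (h * h)) * y \<Longrightarrow> y * r = r * y"
    using root_of_one_plus[OF sa n2 one_le_numeral] by blast
  have "h * r = r * h" by (rule r) (simp add: mult.assoc)
  then have "norm r \<le> 1"
    using norm_le_of_sum_squares(2)[of h r 1] h r(1,2) by (simp add: power2_eq_square)
  then have "norm (star r * r) \<le> 1" by (simp add: norm_star_mult power_le_one)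
  then show ?thesis using r(1,2) by (simp add: power2_eq_square)
qed

text \<open>With the converse \<open>norm_le_pos\<close>, positivity becomes an inequality between
  norms, and closure under addition reduces to the triangle inequality.\<close>

lemma pos_norm_le:
  fixes a :: "'a :: unital_cstar"
  assumes a: "pos a" and t: "norm a \<le> t"
  shows "norm (of_real t - a) \<le> t"
proof (cases "t = 0")
  case False
  then have t0: "t > 0" using t norm_ge_zero[of a] by linarith
  obtain h where h: "star h = h" "a = h * h" using a by (auto simp: pos_def)
  define g where "g = (1 / sqrt t) *\<^sub>R h"
  have g: "star g = g" "g * g = (1 / t) *\<^sub>R a"
    using t0 by (auto simp: g_def star_simps h)
  have "norm (star g * g) \<le> 1" using g t t0 by simp
  then have "norm g \<le> 1" unfolding norm_star_mult using power2_le_imp_le[of "norm g" 1] by simp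
  then have "norm (1 - (1 / t) *\<^sub>R a) \<le> 1"
    using norm_one_minus_square[of g] g by simp
  moreover have "of_real t - a = t *\<^sub>R (1 - (1 / t) *\<^sub>R a)"
    using t0 by (simp add: algebra_simps of_real_def)
  ultimately show ?thesis using t0 by simp
qed (use t in simp)

lemma norm_le_root:
  fixes a :: "'a :: unital_cstar"
  assumes a: "star a = a" and t: "norm (of_real t - a) \<le> t" and k: "k \<ge> 1"
  shows "\<exists>r. pos r \<and> r ^ k = a \<and> (\<forall>y. y * a = a * y \<longrightarrow> y * r = r * y)"
proof (cases "t = 0")
  case True
  then have "a = 0" using t by simp
  then show ?thesis using k by (intro exI[of _ 0]) (auto simp: power_0_left)
next
  case False
  then have t0: "t > 0" using t norm_ge_zero[of "of_real t - a"] by linarith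
  define u where "u = (1 / t) *\<^sub>R a - 1"
  have "u = (- 1 / t) *\<^sub>R (of_real t - a)" using t0 by (simp add: u_def algebra_simps of_real_def)
  then have "norm u \<le> 1" using t t0 by (simp del: of_real_diff)
  moreover have "star u = u" by (simp add: u_def star_simps a)
  \<comment> \<open>A root of order \<open>2 * k\<close> is taken because its square is a positive
    root of order \<open>k\<close>.\<close>
  ultimately obtain r where r: "star r = r" "r ^ (2 * k) = 1 + u" "\<And>y. y * u = u * y \<Longrightarrow> y * r = r * y"
    using root_of_one_plus[of u "2 * k"] k by auto
  define c where "c = root k t"
  have c: "c > 0" "c ^ k = t" using k t0 by (auto simp: c_def)
  let ?s = "c *\<^sub>R (r * r)"
  have "?s = (sqrt c *\<^sub>R r) * (sqrt c *\<^sub>R r)" using c by simp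
  then have "pos ?s" by (metis pos_square r(1) star_scaleR)
  moreover have "?s ^ k = a"
  proof -
    have "?s ^ k = t *\<^sub>R (1 + u)" by (simp add: c(2) r(2)[symmetric] power_mult power2_eq_square)
    then show ?thesis using t0 by (simp add: u_def)
  qed
  moreover have "y * ?s = ?s * y" if "y * a = a * y" for y
  proof -
    have "y * r = r * y" by (rule r) (use that in \<open>simp add: u_def algebra_simps\<close>)
    then show ?thesis by (metis mult.assoc mult_scaleR_left mult_scaleR_right)
  qed
  ultimately show ?thesis by blast
qed

lemma norm_le_pos:
  fixes a :: "'a :: unital_cstar"
  assumes "star a = a" and "norm (of_real t - a) \<le> t"
  shows "pos a"
proof -
  obtain r where "pos r" "r ^ 2 = a" using norm_le_root[of a t 2] assms by auto
  then show ?thesis by (metis pos_selfadjoint pos_square power2_eq_square)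
qed

lemma pos_root:
  fixes a :: "'a :: unital_cstar"
  assumes "pos a" and "k \<ge> 1"
  obtains r where "pos r" "r ^ k = a" "\<And>y. y * a = a * y \<Longrightarrow> y * r = r * y"
  using norm_le_root[OF pos_selfadjoint[OF assms(1)] pos_norm_le[OF assms(1) order_refl] assms(2)] by blast

lemma pos_sqrt:
  fixes a :: "'a :: unital_cstar"
  assumes "pos a"
  obtains r where "pos r" "star r = r" "r * r = a" "\<And>y. y * a = a * y \<Longrightarrow> y * r = r * y"
proof -
  obtain r where r: "pos r" "r ^ 2 = a" "\<And>y. y * a = a * y \<Longrightarrow> y * r = r * y"
    using pos_root[OF assms one_le_numeral] by blast
  show ?thesis
    by (rule that[OF r(1) pos_selfadjoint[OF r(1)] _ r(3)]) (use r(2) in \<open>simp add: power2_eq_square\<close>)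
qed

section \<open>The positive cone and the order it defines\<close>

lemma pos_add:
  fixes a b :: "'a :: unital_cstar"
  assumes "pos a" "pos b"
  shows "pos (a + b)"
proof (rule norm_le_pos)
  have "of_real (norm a + norm b) - (a + b) = (of_real (norm a) - a) + (of_real (norm b) - b)" by simp
  then show "norm (of_real (norm a + norm b) - (a + b)) \<le> norm a + norm b"
    using norm_triangle_le pos_norm_le assms by (metis add_mono order_refl)
qed (use assms in \<open>simp add: star_add pos_selfadjoint\<close>)

lemma pos_scaleR:
  fixes a :: "'a :: unital_cstar"
  assumes "pos a" "r \<ge> 0"
  shows "pos (r *\<^sub>R a)"
proof -
  obtain h where h: "star h = h" "a = h * h" using assms by (auto simp: pos_def)
  have "r *\<^sub>R a = (sqrt r *\<^sub>R h) * (sqrt r *\<^sub>R h)" using assms h by simp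
  then show ?thesis by (metis pos_square h(1) star_scaleR)
qed

lemma pos_of_real: "r \<ge> 0 \<Longrightarrow> pos (of_real r :: 'a :: unital_cstar)"
  using pos_scaleR[OF pos_square[of "1 :: 'a"], of r] by (simp add: of_real_def)

lemma pos_1 [simp]: "pos (1 :: 'a :: unital_cstar)"
  using pos_of_real[of 1] by simp

lemma pos_sum: "(\<And>i. i \<in> S \<Longrightarrow> pos (f i)) \<Longrightarrow> pos (\<Sum>i\<in>S. f i :: 'a :: unital_cstar)"
  by (induction S rule: infinite_finite_induct) (auto intro: pos_add)

lemma pos_mult_commuting:
  fixes a b :: "'a :: unital_cstar"
  assumes "pos a" "pos b" "a * b = b * a"
  shows "pos (a * b)"
proof -
  obtain h where h: "pos h" "star h = h" "h * h = a" "\<And>y. y * a = a * y \<Longrightarrow> y * h = h * y"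
    using pos_sqrt[OF assms(1)] by blast
  obtain g where g: "pos g" "star g = g" "g * g = b" "\<And>y. y * b = b * y \<Longrightarrow> y * g = g * y"
    using pos_sqrt[OF assms(2)] by blast
  have "b * h = h * b" using h assms(3) by metis
  then have hg: "h * g = g * h" using g by metis
  have "a * b = (h * g) * (h * g)" using h g hg by (metis mult.assoc)
  then show ?thesis using hg h g by (metis pos_square star_mult)
qed

lemma pos_power: "pos a \<Longrightarrow> pos (a ^ n :: 'a :: unital_cstar)"
  by (induction n) (auto intro!: pos_mult_commuting simp: power_commutes)

lemma pos_bounds:
  fixes a :: "'a :: unital_cstar"
  assumes "star a = a" "norm a \<le> t"
  shows "pos (of_real t - a)" "pos (of_real t + a)"
  by (rule norm_le_pos[of _ t]; use assms in \<open>simp add: star_simps\<close>)+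

text \<open>The product of the commuting positive elements \<open>s - c\<close> and
  \<open>s + c\<close> is \<open>s\<^sup>2 - c\<^sup>2\<close>; a root \<open>m\<close> of it gives
  \<open>c\<^sup>2 + m\<^sup>2 = s\<^sup>2\<close>, the situation of
  \<open>norm_le_of_sum_squares\<close>.\<close>

lemma norm_le_of_bounds:
  fixes c :: "'a :: unital_cstar"
  assumes "pos (of_real s - c)" "pos (of_real s + c)" and s: "s \<ge> 0"
  shows "norm c \<le> s"
proof -
  have c: "star c = c"
    using pos_selfadjoint[OF assms(2)] by (simp add: star_add)
  have "pos ((of_real s - c) * (of_real s + c))"
    using assms by (intro pos_mult_commuting) (auto simp: algebra_simps of_real_mult_commute[of s c])
  moreover have "(of_real s - c) * (of_real s + c) = of_real (s\<^sup>2) - c * c"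
    by (simp add: algebra_simps power2_eq_square of_real_mult_commute[of s c])
  ultimately obtain m where m: "star m = m" "m * m = of_real (s\<^sup>2) - c * c"
      "\<And>y. y * (of_real (s\<^sup>2) - c * c) = (of_real (s\<^sup>2) - c * c) * y \<Longrightarrow> y * m = m * y"
    using pos_sqrt[of "of_real (s\<^sup>2) - c * c"] by metis
  have "c * m = m * c"
    by (rule m) (simp add: right_diff_distrib left_diff_distrib mult.assoc of_real_mult_commute[of _ c] del: of_real_power)
  then show ?thesis
    using norm_le_of_sum_squares(1)[of c m s] c m(1,2) s by simp
qed

lemma norm_mono:
  fixes a b :: "'a :: unital_cstar"
  assumes a: "pos a" and ab: "pos (b - a)"
  shows "norm a \<le> norm b"
proof (rule norm_le_of_bounds)
  have b: "star b = b" using pos_selfadjoint[OF a] pos_selfadjoint[OF ab] by (simp add: star_diff)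
  show "pos (of_real (norm b) - a)"
    using pos_add[OF pos_bounds(1)[OF b order_refl] ab] by simp
  show "pos (of_real (norm b) + a)" using a pos_of_real[of "norm b"] by (intro pos_add) auto
qed simp

lemma pos_antisym:
  fixes a :: "'a :: unital_cstar"
  assumes "pos a" "pos (- a)"
  shows "a = 0"
  using norm_le_of_bounds[of 0 a] assms by simp

lemma pos_le_bound:
  fixes q :: "'a :: unital_cstar"
  assumes q: "pos q" and s: "pos (of_real s - q)"
  shows "norm q \<le> s"
proof -
  have p: "pos (of_real s :: 'a)" using pos_add[OF q s] by simp
  have "s \<ge> 0"
  proof (rule ccontr)
    assume "\<not> s \<ge> 0"
    then have "pos (- of_real s :: 'a)" using pos_of_real[of "- s", where 'a='a] by simp
    then have "(of_real s :: 'a) = 0" using pos_antisym p by blast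
    then show False using \<open>\<not> s \<ge> 0\<close> by simp
  qed
  then show ?thesis using q s p by (intro norm_le_of_bounds) (auto intro: pos_add)
qed

text \<open>Let \<open>n\<close> be the absolute value of \<open>p\<close> and
  \<open>b = n - p\<close>, morally twice the negative part of \<open>p\<close>. From
  \<open>n\<^sup>2 = p\<^sup>2\<close> follow \<open>b n = b\<^sup>2 / 2\<close> and
  \<open>b p = - b\<^sup>2 / 2\<close>, so that \<open>b ^ 5\<close> equals both
  \<open>2 b\<^sup>2 n b\<^sup>2\<close>, which is positive, and \<open>- 8 b p (p + q) p b\<close>,
  which is negative. Hence \<open>b = 0\<close> and \<open>p = n\<close>.\<close>

lemma pos_part_aux:
  fixes p q :: "'a :: unital_cstar"
  assumes p: "star p = p" and q: "star q = q" and pq: "p * q = 0" "q * p = 0" and m: "pos (p + q)"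
  shows "pos p"
proof -
  obtain h where h: "star h = h" "h * h = p + q" "\<And>y. y * (p + q) = (p + q) * y \<Longrightarrow> y * h = h * y"
    using pos_sqrt[OF m] by blast
  have hp: "p * h = h * p" by (rule h) (simp add: algebra_simps pq)
  obtain n where n: "pos n" "star n = n" "n * n = p * p" "\<And>y. y * (p * p) = p * p * y \<Longrightarrow> y * n = n * y"
    using pos_sqrt[OF pos_square[OF p]] by metis
  have np: "p * n = n * p" by (rule n) (simp add: mult.assoc)
  have nh: "h * n = n * h" by (rule n) (metis hp mult.assoc)
  define b where "b = n - p"
  have b: "star b = b" by (simp add: b_def star_diff n p)
  have bp: "p * b = b * p" and bn: "n * b = b * n" and bh: "h * b = b * h"
    using np nh hp by (auto simp: b_def algebra_simps)
  have n_eq: "n = b + p" by (simp add: b_def)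
  have "b * b + 2 *\<^sub>R (b * p) = (b + p) * (b + p) - p * p"
    by (simp add: algebra_simps bp scaleR_2)
  then have "b * b + 2 *\<^sub>R (b * p) = 0" using n(3) n_eq by simp
  then have "2 *\<^sub>R (b * p) = - (b * b)" by (simp add: eq_neg_iff_add_eq_0 add.commute)
  then have "(1/2) *\<^sub>R (2 *\<^sub>R (b * p)) = (1/2) *\<^sub>R (- (b * b))" by simp
  then have bpb: "b * p = - (1/2) *\<^sub>R (b * b)" by simp
  have bn': "b * n = (1/2) *\<^sub>R (b * b)"
    by (simp add: n_eq ring_distribs bpb flip: scaleR_left_distrib)
       (metis scaleR_half_double scaleR_right_diff_distrib add_diff_cancel scaleR_2)
  obtain g where g: "star g = g" "g * g = n" "\<And>y. y * n = n * y \<Longrightarrow> y * g = g * y"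
    using pos_sqrt[OF n(1)] by metis
  have bg: "b * g = g * b" by (rule g) (simp add: bn)
  have "b ^ 5 = 2 *\<^sub>R (b * b * n * (b * b))"
  proof -
    have "b * b * n * (b * b) = (b * (b * n)) * (b * b)" by (simp add: mult.assoc)
    also have "\<dots> = (1/2) *\<^sub>R (b ^ 5)" unfolding bn' by (simp add: mult.assoc eval_nat_numeral)
    finally show ?thesis by simp
  qed
  also have "b * b * n * (b * b) = (b * b * g) * (g * (b * b))" by (simp add: g(2)[symmetric] mult.assoc)
  also have "\<dots> = (b * b * g) * (b * b * g)" by (metis bg mult.assoc)
  finally have "b ^ 5 = 2 *\<^sub>R ((b * b * g) * (b * b * g))" .
  moreover have "star (b * b * g) = b * b * g" by (simp add: star_mult b g) (metis bg mult.assoc)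
  ultimately have 1: "pos (b ^ 5)" by (metis pos_scaleR pos_square zero_le_numeral)
  have "b ^ 5 = - 8 *\<^sub>R (b * (p * (p * (p * b))))"
  proof -
    have "p * b = - (1/2) *\<^sub>R (b * b)" using bp bpb by simp
    then have "p * (p * (p * b)) = (-(1/2)) ^ 3 *\<^sub>R (b * b * b * b)"
      by (simp add: mult.assoc[symmetric] eval_nat_numeral)
    then show ?thesis by (simp add: mult.assoc eval_nat_numeral)
  qed
  also have "b * (p * (p * (p * b))) = b * p * (p + q) * p * b" by (simp add: algebra_simps pq)
  also have "\<dots> = (b * p * h) * (h * p * b)" by (simp add: h(2)[symmetric] mult.assoc)
  also have "h * p * b = b * p * h" by (metis hp bh bp mult.assoc)
  finally have "- (b ^ 5) = 8 *\<^sub>R ((b * p * h) * (b * p * h))" by simp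
  moreover have "star (b * p * h) = b * p * h" by (simp add: star_mult b p h) (metis hp bh bp mult.assoc)
  ultimately have "pos (- (b ^ 5))" by (metis pos_scaleR pos_square zero_le_numeral)
  then have "b ^ 5 = 0" using 1 pos_antisym by blast
  then have "b = 0" using selfadjoint_power_eq_0 b by blast
  then show ?thesis using n(1) by (simp add: n_eq)
qed

lemma pos_decomposition:
  fixes a :: "'a :: unital_cstar"
  assumes a: "star a = a"
  obtains p q where "pos p" "pos q" "a = p - q" "p * q = 0" "q * p = 0"
    "\<And>y. y * a = a * y \<Longrightarrow> y * p = p * y" "\<And>y. y * a = a * y \<Longrightarrow> y * q = q * y"
proof -
  obtain m where m: "pos m" "star m = m" "m * m = a * a" "\<And>y. y * (a * a) = a * a * y \<Longrightarrow> y * m = m * y"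
    using pos_sqrt[OF pos_square[OF a]] by metis
  have am: "a * m = m * a" by (rule m) (simp add: mult.assoc)
  define p q where "p = (1/2) *\<^sub>R (m + a)" and "q = (1/2) *\<^sub>R (m - a)"
  have pq: "star p = p" "star q = q" "p * q = 0" "q * p = 0" "p + q = m" "a = p - q"
    by (auto simp: p_def q_def star_simps m a algebra_simps am simp flip: scaleR_left_distrib scaleR_2)
  have "pos p" "pos q"
    using pos_part_aux[OF pq(1,2,3,4)] pos_part_aux[OF pq(2,1,4,3)] pq(5) m(1) by (auto simp: add.commute[of q p])
  moreover have "y * p = p * y \<and> y * q = q * y" if y: "y * a = a * y" for y
  proof -
    have "y * m = m * y" by (rule m) (metis y mult.assoc)
    then show ?thesis using y by (simp add: p_def q_def algebra_simps)
  qed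
  ultimately show ?thesis using that pq by blast
qed

section \<open>Inverses and the top of the spectrum\<close>

lemma pos_inverse:
  fixes H :: "'a :: unital_cstar"
  assumes H: "pos (H - of_real e)" and e: "e > 0"
  obtains G where "G * H = 1" "H * G = 1" "star G = G" "\<And>y. y * H = H * y \<Longrightarrow> y * G = G * y"
proof -
  define s where "s = norm (H - of_real e)"
  \<comment> \<open>Since \<open>e \<le> H \<le> t\<close>, the element \<open>1 - H / t\<close> has
    norm at most \<open>1 - e / t < 1\<close>, and its geometric series inverts
    \<open>H / t\<close>.\<close>
  define t where "t = s + e"
  have t: "t > 0" "t \<ge> e" using e by (auto simp: t_def s_def add_nonneg_pos)
  have "norm (of_real t - H) \<le> t - e"
    using pos_norm_le[OF H, of s] by (simp add: s_def t_def algebra_simps)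
  define u where "u = (1 / t) *\<^sub>R (of_real t - H)"
  have u: "norm u < 1"
    using \<open>norm (of_real t - H) \<le> t - e\<close> t e by (simp add: u_def)
  have summ: "summable (\<lambda>n. u ^ n)"
    by (rule summable_norm_cancel, rule summable_comparison_test'[OF summable_geometric[of "norm u"], of 0])
      (use u norm_power_ineq[of u] in auto)
  define S where "S = (\<Sum>n. u ^ n)"
  have 1: "S = 1 + (\<Sum>n. u ^ Suc n)"
    unfolding S_def using suminf_split_initial_segment[OF summ, of 1] by simp
  have 2: "(\<Sum>n. u ^ Suc n) = u * S" "(\<Sum>n. u ^ Suc n) = S * u"
    unfolding S_def using suminf_mult[OF summ, of u] suminf_mult2[OF summ, of u] by (simp_all add: power_commutes)
  have S: "(1 - u) * S = 1" "S * (1 - u) = 1"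
    using 1 2 by (auto simp: algebra_simps)
  have Hu: "H = t *\<^sub>R (1 - u)" using t by (simp add: u_def algebra_simps of_real_def)
  define G where "G = (1 / t) *\<^sub>R S"
  have G: "G * H = 1" "H * G = 1" using t S by (auto simp: G_def Hu)
  have sH: "star H = H" using pos_selfadjoint[OF H] by (simp add: star_diff)
  have "star G * H = 1" using G(2) by (metis sH star_1 star_mult)
  then have "star G = G" using G by (metis mult.assoc mult_1 mult_1_right)
  moreover have "y * G = G * y" if "y * H = H * y" for y
    by (metis G mult.assoc mult_1 mult_1_right that)
  ultimately show ?thesis using that G by blast
qed

lemma pos_inverse_sqrt:
  fixes H :: "'a :: unital_cstar"
  assumes H: "pos (H - of_real e)" and e: "e > 0"
  obtains L where "star L = L" "L * H * L = 1"
proof -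
  obtain G where G: "G * H = 1" "H * G = 1" "star G = G" "\<And>y. y * H = H * y \<Longrightarrow> y * G = G * y"
    using pos_inverse[OF assms] by blast
  have "pos H" using pos_add[OF H pos_of_real[of e]] e by simp
  then obtain h where h: "star h = h" "h * h = H" "\<And>y. y * H = H * y \<Longrightarrow> y * h = h * y"
    using pos_sqrt by metis
  have hG: "h * G = G * h" by (rule G) (metis h(2) mult.assoc)
  have "G * h * H * (G * h) = G * (h * h) * (H * G)"
    by (metis G(4) h(2) hG mult.assoc)
  then have "G * h * H * (G * h) = 1" using G(1,2) h(2) by simp
  moreover have "star (G * h) = G * h" by (simp add: star_mult h(1) G(3) hG)
  ultimately show ?thesis using that by blast
qed

text \<open>An inverse \<open>g\<close> of \<open>w = norm q - q\<close> would be positive with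
  \<open>g \<le> norm g\<close>. Multiplying by \<open>w\<close> gives
  \<open>1 \<le> norm g * w\<close>, that is, \<open>q \<le> norm q - 1 / norm g\<close>, which is
  too small a bound for \<open>q\<close>.\<close>

lemma pos_top_not_invertible:
  fixes q :: "'a :: unital_cstar"
  assumes q: "pos q" and g: "g * (of_real (norm q) - q) = 1" "(of_real (norm q) - q) * g = 1"
  shows False
proof -
  let ?w = "of_real (norm q) - q"
  have w: "pos ?w" using pos_bounds(1)[OF pos_selfadjoint[OF q] order_refl] .
  then obtain h where h: "star h = h" "h * h = ?w" "\<And>y. y * ?w = ?w * y \<Longrightarrow> y * h = h * y"
    using pos_sqrt by metis
  have "star g * ?w = 1" using g(2) by (metis pos_selfadjoint[OF w] star_1 star_mult)
  then have sg: "star g = g" using g by (metis mult.assoc mult_1 mult_1_right)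
  have gh: "g * h = h * g" by (rule h) (simp add: g)
  have "g = g * ?w * g" using g by simp
  then have "g = (g * h) * (g * h)" by (metis gh h(2) mult.assoc)
  then have "pos g" by (metis gh h(1) pos_square sg star_mult)
  have "pos (of_real (norm g) - g)" by (rule pos_bounds[OF sg order_refl])
  then have "pos ((of_real (norm g) - g) * ?w)"
  proof (rule pos_mult_commuting[OF _ w])
    have "of_real (norm g) * ?w = ?w * of_real (norm g)" by (rule of_real_mult_commute)
    then show "(of_real (norm g) - g) * ?w = ?w * (of_real (norm g) - g)"
      using g by (simp only: left_diff_distrib[of "of_real (norm g)"] right_diff_distrib[of ?w "of_real (norm g)"])
  qed
  moreover have "(of_real (norm g) - g) * ?w = norm g *\<^sub>R ?w - 1"
    using g by (simp add: left_diff_distrib of_real_def)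
  ultimately have 1: "pos (norm g *\<^sub>R ?w - 1)" by simp
  have "g \<noteq> 0" using g by auto
  then have n: "norm g > 0" by simp
  have "pos ((1 / norm g) *\<^sub>R (norm g *\<^sub>R ?w - 1))" using 1 n by (intro pos_scaleR) auto
  also have "(1 / norm g) *\<^sub>R (norm g *\<^sub>R ?w - 1) = of_real (norm q - 1 / norm g) - q"
    using n by (simp add: algebra_simps of_real_def)
  finally have "norm q \<le> norm q - 1 / norm g" by (rule pos_le_bound[OF q])
  then show False using n by simp
qed

text \<open>The theorem of Fukamachi and Kaplansky. If \<open>x\<^sup>*x\<close> had a negative part, there would be
  \<open>y \<noteq> 0\<close> with \<open>- y\<^sup>*y\<close> and hence also \<open>yy\<^sup>*\<close> positive; but \<open>y\<^sup>*y\<close> and \<open>yy\<^sup>*\<close> have the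
  same nonzero spectrum.\<close>

theorem pos_star_mult: "pos (star x * x :: 'a :: unital_cstar)"
proof -
  have key: "y = 0" if "pos (- (star y * y))" for y :: 'a
  proof (rule ccontr)
    assume "y \<noteq> 0"
    define Q where "Q = - (star y * y)"
    define l where "l = norm Q"
    have l: "l > 0" using \<open>y \<noteq> 0\<close> by (simp add: l_def Q_def norm_star_mult)
    \<comment> \<open>The Cartesian decomposition \<open>y = c + ii * d\<close>. Since
      \<open>2 (c\<^sup>2 + d\<^sup>2)\<close> is the sum of \<open>star y * y\<close> and
      \<open>y * star y\<close>, adding \<open>Q\<close> leaves \<open>y * star y\<close>, which is
      thereby positive.\<close>
    define c d where "c = (1/2) *\<^sub>R (y + star y)" and "d = (1/2) *\<^sub>R (ii * (star y - y))"
    have "star c = c" by (simp add: c_def star_simps algebra_simps)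
    moreover have "star d = d"
      by (simp add: d_def star_simps star_ii) (simp add: ii_commute algebra_simps)
    moreover have dd: "d * d = - (1/4) *\<^sub>R ((star y - y) * (star y - y))"
    proof -
      have "(ii * (star y - y)) * (ii * (star y - y)) = (ii * ii) * ((star y - y) * (star y - y))"
        by (metis ii_commute mult.assoc)
      then show ?thesis by (simp add: d_def ii_square)
    qed
    ultimately have "pos (c * c + d * d)" by (intro pos_add pos_square)
    moreover have "2 *\<^sub>R (c * c + d * d) = star y * y + y * star y"
    proof -
      have "c * c = (1/4) *\<^sub>R ((y + star y) * (y + star y))" by (simp add: c_def)
      then have "c * c + d * d = (1/4) *\<^sub>R ((y + star y) * (y + star y) - (star y - y) * (star y - y))"
        unfolding dd by (simp add: scaleR_diff_right)
      also have "(y + star y) * (y + star y) - (star y - y) * (star y - y) = 2 *\<^sub>R (star y * y + y * star y)"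
        by (simp add: algebra_simps scaleR_2)
      finally show ?thesis by simp
    qed
    ultimately have "pos (star y * y + y * star y)" by (metis pos_scaleR zero_le_numeral)
    then have P: "pos (y * star y)" using pos_add[of "star y * y + y * star y" Q] that by (simp add: Q_def)
    have "pos ((of_real l + y * star y) - of_real l)" using P by simp
    then obtain G where G: "G * (of_real l + y * star y) = 1" "(of_real l + y * star y) * G = 1"
      using pos_inverse[of _ l] l by metis
    \<comment> \<open>An inverse of \<open>l + y * star y\<close> yields this inverse of
      \<open>l + star y * y = l - Q\<close>; this identity is the reason why the two products have
      the same nonzero spectrum.\<close>
    define W where "W = (1 / l) *\<^sub>R (1 - star y * G * y)"
    have lQ: "of_real l - Q = of_real l + star y * y" by (simp add: Q_def)
    have "(of_real l + star y * y) * (1 - star y * G * y)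
        = of_real l + star y * y - star y * ((of_real l + y * star y) * G) * y"
      by (simp add: algebra_simps of_real_def mult.assoc)
    then have *: "(of_real l + star y * y) * (1 - star y * G * y) = of_real l" using G by simp
    have 1: "(of_real l - Q) * W = 1"
      unfolding lQ W_def mult_scaleR_right * using l by (simp add: of_real_def)
    have "(1 - star y * G * y) * (of_real l + star y * y)
        = of_real l + star y * y - star y * (G * (of_real l + y * star y)) * y"
      by (simp add: algebra_simps of_real_def mult.assoc)
    then have *: "(1 - star y * G * y) * (of_real l + star y * y) = of_real l" using G by simp
    have 2: "W * (of_real l - Q) = 1"
      unfolding lQ W_def mult_scaleR_left * using l by (simp add: of_real_def)
    show False using pos_top_not_invertible[of Q W] 1 2 that by (simp add: Q_def l_def)
  qed
  have "star (star x * x) = star x * x" by (simp add: star_mult)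
  then obtain p q where pq: "pos p" "pos q" "star x * x = p - q" "p * q = 0" "q * p = 0"
    using pos_decomposition by metis
  have sq: "star q = q" using pq pos_selfadjoint by blast
  \<comment> \<open>For the negative part \<open>q\<close> of \<open>star x * x\<close>, the element
    \<open>x * q\<close> satisfies the hypothesis of \<open>key\<close>.\<close>
  have "star (x * q) * (x * q) = q * (star x * x) * q" by (simp add: star_mult sq mult.assoc)
  also have "\<dots> = - (q * (q * q))" unfolding pq(3) by (simp add: left_diff_distrib right_diff_distrib mult.assoc pq(4,5))
  finally have eq: "star (x * q) * (x * q) = - (q * (q * q))" .
  have q3: "pos (q * (q * q))"
    by (rule pos_mult_commuting[OF pq(2) pos_square[OF sq]]) (simp add: mult.assoc)
  then have "x * q = 0" using key[of "x * q"] eq by simp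
  then have "q * (q * q) = 0" using eq by simp
  then have "q ^ 3 = 0" by (simp add: eval_nat_numeral)
  then have "q = 0" using selfadjoint_power_eq_0 sq by blast
  then show ?thesis using pq by simp
qed

lemma pos_conj:
  fixes a x :: "'a :: unital_cstar"
  assumes "pos a"
  shows "pos (star x * a * x)"
proof -
  obtain h where "star h = h" "h * h = a" using pos_sqrt[OF assms] by metis
  then have "star x * a * x = star (h * x) * (h * x)" by (auto simp: star_mult mult.assoc)
  then show ?thesis using pos_star_mult by metis
qed

lemma pos_conj': "pos a \<Longrightarrow> pos (x * a * star x :: 'a :: unital_cstar)"
  using pos_conj[of a "star x"] by simp

lemma pos_zero_product:
  fixes P Q m :: "'a :: unital_cstar"
  assumes "star m = m" "m * m = P" "P * Q = 0" "star Q = Q"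
  shows "m * Q = 0" "Q * m = 0"
proof -
  have "star (m * Q) * (m * Q) = 0" using assms by (simp add: star_mult mult.assoc) (metis mult.assoc mult_zero_right)
  then show 1: "m * Q = 0" by (rule star_mult_eq_0D)
  then show "Q * m = 0" by (metis assms(1,4) star_0 star_mult)
qed

section \<open>Powers and the uniqueness of positive roots\<close>

lemma pos_power_add_diff:
  fixes r p :: "'a :: unital_cstar"
  assumes "pos r" "pos p" "r * p = p * r" "k \<ge> 1"
  shows "pos ((r + p) ^ k - r ^ k - p ^ k)"
  using assms(4)
proof (induction k rule: nat_induct_at_least)
  case (Suc k)
  have c: "r ^ k * p = p * r ^ k" "p ^ k * r = r * p ^ k"
    using power_commuting_commutes[of r p k] power_commuting_commutes[of p r k] assms(3) by auto
  have c2: "(r + p) * r ^ k = r ^ k * (r + p)" "(r + p) * p ^ k = p ^ k * (r + p)"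
    by (auto simp: algebra_simps c power_commutes)
  have "pos ((r + p) * ((r + p) ^ k - r ^ k - p ^ k))"
    using Suc assms by (intro pos_mult_commuting pos_add) (auto simp: right_diff_distrib left_diff_distrib c2 power_commutes)
  moreover have "pos (r * p ^ k)" "pos (p * r ^ k)"
    using assms by (auto intro!: pos_mult_commuting pos_power simp: c)
  ultimately have "pos ((r + p) * ((r + p) ^ k - r ^ k - p ^ k) + (r * p ^ k + p * r ^ k))"
    by (intro pos_add)
  also have "(r + p) * ((r + p) ^ k - r ^ k - p ^ k) + (r * p ^ k + p * r ^ k)
     = (r + p) ^ Suc k - r ^ Suc k - p ^ Suc k" by (simp add: algebra_simps)
  finally show ?case .
qed simp

text \<open>If \<open>p\<close> is the positive part of \<open>b - r\<close>, then \<open>b\<close>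
  acts on \<open>p\<close> as \<open>r + p\<close>, so \<open>b ^ k = r ^ k\<close> gives
  \<open>(r + p) ^ k * p = r ^ k * p\<close>. But \<open>(r + p) ^ k\<close> is at least
  \<open>r ^ k + p ^ k\<close>, which forces \<open>p ^ Suc k = 0\<close>. Exchanging
  \<open>b\<close> and \<open>r\<close> disposes of the negative part.\<close>

lemma pos_root_unique_commuting:
  fixes b r :: "'a :: unital_cstar"
  assumes b: "pos b" and r: "pos r" and c: "b * r = r * b" and k: "k \<ge> 1" and eq: "b ^ k = r ^ k"
  shows "b = r"
proof -
  have key: "p = 0" if h: "pos p" "pos b" "pos r" "b * r = r * b" "b ^ k = r ^ k" "b * p = (r + p) * p" "r * p = p * r" "b * p = p * b"
    for p b r :: 'a
  proof -
    have "b ^ n * p = (r + p) ^ n * p" for n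
    proof (induction n)
      case (Suc n)
      have "b ^ Suc n * p = b * (b ^ n * p)" by (simp add: mult.assoc)
      also have "\<dots> = b * p * (r + p) ^ n"
        using Suc h(7) by (metis distrib_left distrib_right mult.assoc power_commuting_commutes)
      also have "\<dots> = (r + p) ^ Suc n * p"
        using h(6,7) by (metis distrib_left distrib_right mult.assoc power_commuting_commutes power_Suc)
      finally show ?case .
    qed simp
    from this[of k] have 0: "((r + p) ^ k - r ^ k) * p = 0" using h(5) by (simp add: algebra_simps)
    have c: "p * (r + p) ^ k = (r + p) ^ k * p" "p * r ^ k = r ^ k * p"
      using power_commuting_commutes[of "r + p" p k] power_commuting_commutes[of r p k] h(7)
      by (auto simp: algebra_simps)
    have "pos (((r + p) ^ k - r ^ k - p ^ k) * p)"
      using pos_power_add_diff[of r p k] h k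
      by (intro pos_mult_commuting) (auto simp: right_diff_distrib left_diff_distrib c power_commutes)
    moreover have "((r + p) ^ k - r ^ k - p ^ k) * p = - (p ^ Suc k)"
      using 0 by (simp add: left_diff_distrib power_commutes)
    ultimately have "p ^ Suc k = 0" using pos_power[OF h(1)] pos_antisym by metis
    then show "p = 0" using selfadjoint_power_eq_0 pos_selfadjoint h(1) by blast
  qed
  have "star (b - r) = b - r" by (simp add: star_diff pos_selfadjoint[OF b] pos_selfadjoint[OF r])
  then obtain p q where pq: "pos p" "pos q" "b - r = p - q" "p * q = 0" "q * p = 0"
    "\<And>y. y * (b - r) = (b - r) * y \<Longrightarrow> y * p = p * y" "\<And>y. y * (b - r) = (b - r) * y \<Longrightarrow> y * q = q * y"
    using pos_decomposition by metis
  have cs: "b * p = p * b" "r * p = p * r" "b * q = q * b" "r * q = q * r"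
    using pq(6)[of b] pq(6)[of r] pq(7)[of b] pq(7)[of r] c by (auto simp: algebra_simps)
  have bb: "b = r + p - q" using pq(3) by (simp add: algebra_simps)
  then have rr: "r = b + q - p" by simp
  have "p = 0" by (rule key[OF pq(1) b r c eq _ cs(2) cs(1)]) (subst bb, simp add: left_diff_distrib pq(5))
  moreover have "q = 0" by (rule key[OF pq(2) r b c[symmetric] eq[symmetric] _ cs(3) cs(4)]) (subst rr, simp add: left_diff_distrib pq(4))
  ultimately show ?thesis using bb by simp
qed

text \<open>The root \<open>r\<close> obtained from the series commutes with whatever commutes with
  \<open>b ^ k = c ^ k\<close>, in particular with \<open>b\<close> and with \<open>c\<close>; each
  of them is compared with \<open>r\<close>.\<close>

lemma pos_root_unique:
  fixes b c :: "'a :: unital_cstar"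
  assumes "pos b" "pos c" "k \<ge> 1" "b ^ k = c ^ k"
  shows "b = c"
proof -
  obtain r where r: "pos r" "r ^ k = b ^ k" "\<And>y. y * b ^ k = b ^ k * y \<Longrightarrow> y * r = r * y"
    by (rule pos_root[OF pos_power[OF assms(1), of k] assms(3)]) auto
  have "b * r = r * b" "c * r = r * c"
    by (rule r; use assms(4) power_commutes in metis)+
  then show ?thesis
    using pos_root_unique_commuting[of b r k] pos_root_unique_commuting[of c r k] r assms by metis
qed

section \<open>Null elements of quasitraces\<close>

text \<open>The real part of a quasitrace. As additivity is assumed for commuting elements only,
  \<open>pos (y - x)\<close> by itself does not evidently give \<open>t x \<le> t y\<close>; the
  lemmas below recover what is needed of this for null elements.\<close>

locale quasitrace_functional =
  fixes t :: "'a :: unital_cstar \<Rightarrow> real"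
  assumes add: "star x = x \<Longrightarrow> star y = y \<Longrightarrow> x * y = y * x \<Longrightarrow> t (x + y) = t x + t y"
    and scale: "star x = x \<Longrightarrow> t (r *\<^sub>R x) = r * t x"
    and nonneg: "t (x * star x) \<ge> 0"
    and tracial: "t (x * star x) = t (star x * x)"
begin

lemma nonneg_pos: "pos x \<Longrightarrow> t x \<ge> 0"
  using nonneg by (metis pos_def)

lemma mono_commuting:
  assumes "pos x" "pos (y - x)" "x * y = y * x"
  shows "t x \<le> t y"
proof -
  have "t (x + (y - x)) = t x + t (y - x)"
    by (rule add) (use assms pos_selfadjoint in \<open>auto simp: right_diff_distrib left_diff_distrib\<close>)
  then show ?thesis using nonneg_pos[OF assms(2)] by simp
qed

text \<open>With \<open>D = d - \<epsilon>/2\<close> and \<open>a = c - \<epsilon>\<close>, the element \<open>H\<close> is the sum of \<open>D\<^sub>+\<close> and \<open>a\<^sub>-\<close>. It is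
  at least \<open>\<epsilon>/2\<close>, and conjugating by \<open>L = H\<^bsup>-1/2\<^esup>\<close> splits 1 into two commuting parts. The first is
  null because \<open>D\<^sub>+\<close> has a local unit dominated by a multiple of \<open>d\<close>; the second is equivalent to an element
  orthogonal to \<open>a\<^sub>+\<close>. This leaves no room for \<open>t a\<^sub>+\<close>.\<close>

lemma null_hereditary_aux:
  assumes c: "pos c" and cd: "pos (d - c)" and td: "t d = 0" and e: "e > 0"
  shows "t c \<le> e * t 1"
proof -
  have d: "pos d" using pos_add[OF c cd] by simp
  have sd: "star d = d" and sc: "star c = c" using d c pos_selfadjoint by auto
  have "star (d - of_real (e/2)) = d - of_real (e/2)" by (simp only: star_diff star_of_real sd)
  then obtain P Q where PQ: "pos P" "pos Q" "d - of_real (e/2) = P - Q" "P * Q = 0" "Q * P = 0"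
    by (rule pos_decomposition) blast
  have dPQ: "d = P - Q + of_real (e/2)" using PQ(3) by (simp add: algebra_simps)
  have sP: "star P = P" and sQ: "star Q = Q" using PQ pos_selfadjoint by auto
  have dQ: "d * Q = (e/2) *\<^sub>R Q - Q * Q" "Q * d = (e/2) *\<^sub>R Q - Q * Q"
    unfolding dPQ by (simp_all add: distrib_right distrib_left left_diff_distrib right_diff_distrib PQ(4,5) of_real_def)
  have nQ: "norm Q \<le> e/2"
  proof (cases "Q = 0")
    case False
    have "pos ((e/2) *\<^sub>R Q - Q * Q)"
      using pos_mult_commuting[OF d PQ(2)] dQ by simp
    then have "norm (Q * Q) \<le> norm ((e/2) *\<^sub>R Q)" using norm_mono pos_square[OF sQ] by blast
    then have "norm Q * norm Q \<le> (e/2) * norm Q"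
      using norm_star_mult[of Q] sQ e by (simp add: power2_eq_square)
    then show ?thesis using False by simp
  qed (use e in simp)
  \<comment> \<open>As a function of \<open>d\<close> this is the minimum of 1 and
    \<open>2 * d / e\<close>: it is 1 where \<open>P\<close> lives, and it is below a multiple of
    \<open>d\<close>, with which it commutes. Hence \<open>t w \<le> 0\<close>.\<close>
  define w where "w = 1 - (2/e) *\<^sub>R Q"
  have "w = (2/e) *\<^sub>R (of_real (e/2) - Q)" using e by (simp add: w_def algebra_simps of_real_def)
  moreover have "pos (of_real (e/2) - Q)" by (rule pos_bounds(1)[OF sQ nQ])
  ultimately have w: "pos w" using e by (simp add: pos_scaleR del: of_real_divide)
  have sw: "star w = w" using w pos_selfadjoint by blast
  have "(2/e) *\<^sub>R d - w = (2/e) *\<^sub>R P"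
    unfolding dPQ w_def using e by (simp add: algebra_simps of_real_def)
  then have "pos ((2/e) *\<^sub>R d - w)" using PQ(1) e by (simp add: pos_scaleR)
  moreover have "w * ((2/e) *\<^sub>R d) = ((2/e) *\<^sub>R d) * w"
    by (simp add: w_def left_diff_distrib right_diff_distrib dQ scaleR_diff_right)
  ultimately have "t w \<le> t ((2/e) *\<^sub>R d)" by (intro mono_commuting w)
  then have tw: "t w \<le> 0" using scale[OF sd] td by simp
  obtain m where m: "star m = m" "m * m = P" using pos_sqrt[OF PQ(1)] by metis
  have "m * Q = 0" "Q * m = 0" using pos_zero_product[OF m PQ(4) sQ] by auto
  then have wm: "w * m = m" "m * w = m" by (simp_all add: w_def left_diff_distrib right_diff_distrib)
  have "star (c - of_real e) = c - of_real e" by (simp add: star_diff sc)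
  then obtain p q where pq: "pos p" "pos q" "c - of_real e = p - q" "p * q = 0" "q * p = 0"
    by (rule pos_decomposition) blast
  have sp: "star p = p" and sq: "star q = q" using pq pos_selfadjoint by auto
  have cpq: "c = p - q + of_real e" using pq(3) by (simp add: algebra_simps)
  \<comment> \<open>Adding a piece of \<open>d\<close> to a piece of \<open>c\<close> is how
    \<open>c \<le> d\<close> is exploited for elements that need not commute: it makes
    \<open>(d - c) + Q + p\<close>, which is \<open>H - e / 2\<close>, positive.\<close>
  define H where "H = P + q"
  have "H - of_real (e/2) = (d - c) + Q + p"
    unfolding H_def dPQ cpq by (simp add: algebra_simps of_real_def flip: scaleR_left_distrib)
  then have "pos (H - of_real (e/2))" using cd PQ(2) pq(1) by (simp add: pos_add)
  then obtain L where L: "star L = L" "L * H * L = 1"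
    using pos_inverse_sqrt[of H "e/2"] e by auto
  define X Y where "X = L * P * L" and "Y = L * q * L"
  have XY: "X + Y = 1" using L(2) by (simp add: X_def Y_def H_def algebra_simps)
  have posXY: "pos X" "pos Y" using pos_conj[OF PQ(1), of L] pos_conj[OF pq(2), of L] L(1) by (auto simp: X_def Y_def)
  have "X * Y = Y * X" using XY by (metis add_diff_cancel_left' left_diff_distrib right_diff_distrib mult_1 mult_1_right)
  then have t1: "t 1 = t X + t Y" using add posXY pos_selfadjoint XY by metis
  \<comment> \<open>\<open>X\<close> is equivalent to \<open>K\<close>, for which \<open>w\<close>
    is a unit; so \<open>K\<close> is below the multiple \<open>norm K\<close> of \<open>w\<close>
    and commutes with it, and \<open>t w \<le> 0\<close> carries over.\<close>
  have tX: "t X \<le> 0"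
  proof -
    define K where "K = m * L * L * m"
    have "t X = t K"
      using tracial[of "L * m"] by (simp add: X_def K_def star_mult m(1) L(1) mult.assoc) (simp add: mult.assoc[symmetric] m(2)[symmetric])
    have K: "pos K" using pos_star_mult[of "L * m"] by (simp add: K_def star_mult m(1) L(1) mult.assoc)
    have wK: "w * K = K" "K * w = K" by (simp_all add: K_def mult.assoc wm) (simp add: mult.assoc[symmetric] wm)
    have "pos (w * (of_real (norm K) - K))"
      by (rule pos_mult_commuting[OF w pos_bounds(1)[OF pos_selfadjoint[OF K] order_refl]])
        (simp add: left_diff_distrib right_diff_distrib wK of_real_def)
    then have "pos (norm K *\<^sub>R w - K)" by (simp add: right_diff_distrib wK of_real_def)
    then have "t K \<le> t (norm K *\<^sub>R w)" by (intro mono_commuting K) (simp_all add: wK)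
    also have "\<dots> = norm K * t w" by (rule scale[OF sw])
    also have "\<dots> \<le> 0" using tw by (simp add: mult_nonneg_nonpos)
    finally show ?thesis using \<open>t X = t K\<close> by simp
  qed
  obtain n where n: "star n = n" "n * n = q" using pos_sqrt[OF pq(2)] by metis
  have np: "n * p = 0" "p * n = 0" using pos_zero_product[OF n pq(5) sp] by auto
  define y where "y = n * L * L * n"
  have y: "pos y" "star y = y"
    using pos_star_mult[of "L * n"] pos_selfadjoint by (auto simp: y_def star_mult n(1) L(1) mult.assoc)
  have tY: "t Y = t y"
    using tracial[of "L * n"] by (simp add: Y_def y_def star_mult n(1) L(1) mult.assoc) (simp add: mult.assoc[symmetric] n(2)[symmetric])
  have yp: "y * p = 0" "p * y = 0"
    by (simp_all add: y_def mult.assoc np) (simp add: mult.assoc[symmetric] np)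
  have "norm y = norm Y"
    using norm_star_mult[of "L * n"] norm_mult_star[of "L * n"]
    by (simp add: Y_def y_def star_mult n(1) L(1) mult.assoc) (metis mult.assoc n(2))
  also have "\<dots> \<le> 1"
    using pos_le_bound[OF posXY(2), of 1] posXY(1) XY by (simp add: algebra_simps) (metis add_diff_cancel_right')
  finally have "pos (of_real 1 - y)" using pos_bounds(1) y(2) by blast
  then have y1: "pos (1 - y)" by simp
  \<comment> \<open>The scaling makes \<open>s *\<^sub>R p\<close> a contraction, so that
    \<open>(1 - y) * (1 - s *\<^sub>R p) = 1 - (y + s *\<^sub>R p)\<close> is positive. As
    \<open>t y = t Y \<ge> t 1\<close>, nothing is left for \<open>p\<close>.\<close>
  define s where "s = 1 / (norm p + 1)"
  have s: "s > 0" by (simp add: s_def add_nonneg_pos)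
  have "norm (s *\<^sub>R p) \<le> 1" by (simp add: s_def add_nonneg_pos)
  then have "pos (of_real 1 - s *\<^sub>R p)" by (intro pos_bounds(1)) (simp_all add: star_scaleR sp)
  then have "pos ((1 - y) * (1 - s *\<^sub>R p))"
    using y1 by (intro pos_mult_commuting) (simp_all add: left_diff_distrib right_diff_distrib yp)
  then have z: "pos (1 - (y + s *\<^sub>R p))"
    by (simp add: left_diff_distrib right_diff_distrib yp algebra_simps)
  have "t (y + s *\<^sub>R p) = t y + s * t p"
    using add[of y "s *\<^sub>R p"] scale[OF sp] y(2) sp yp by (simp add: star_scaleR)
  moreover have "t (y + s *\<^sub>R p) \<le> t 1"
    using y pq(1) s z by (intro mono_commuting pos_add pos_scaleR) auto
  ultimately have "s * t p \<le> 0" using t1 tX tY by simp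
  then have tp: "t p \<le> 0" using s by (simp add: mult_le_0_iff)
  have "c + q = p + of_real e" unfolding cpq by simp
  moreover have "t (c + q) = t c + t q"
    by (rule add[OF sc sq]) (simp add: cpq distrib_left distrib_right left_diff_distrib right_diff_distrib pq of_real_mult_commute[of e q])
  moreover have "t (p + e *\<^sub>R 1) = t p + e * t 1"
    using add[of p "e *\<^sub>R 1"] scale[of 1] sp by (simp add: star_scaleR)
  ultimately show ?thesis using tp nonneg_pos[OF pq(2)] by (simp add: of_real_def)
qed

lemma null_hereditary:
  assumes "pos c" "pos (d - c)" "t d = 0"
  shows "t c = 0"
proof -
  have t1: "t 1 \<ge> 0" by (simp add: nonneg_pos)
  have "t c \<le> 0 + e" if "e > 0" for e
  proof -
    \<comment> \<open>The denominator \<open>t 1 + 1\<close> allows for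
      \<open>t 1 = 0\<close>.\<close>
    have "t c \<le> (e / (t 1 + 1)) * t 1"
      using assms that t1 by (intro null_hereditary_aux[of c d]) auto
    also have "\<dots> \<le> e" using t1 that by (simp add: field_simps)
    finally show ?thesis by simp
  qed
  then have "t c \<le> 0" by (rule field_le_epsilon)
  then show ?thesis using nonneg_pos[OF assms(1)] by simp
qed

text \<open>Expanding \<open>t ((r - e)\<^sup>2) \<ge> 0\<close> in the commuting elements
  \<open>r\<close> and 1 gives \<open>2 * t r \<le> e * t 1\<close> for all
  \<open>e > 0\<close>.\<close>

lemma null_sqrt:
  assumes r: "pos r" and "t (r * r) = 0"
  shows "t r = 0"
proof -
  have sr: "star r = r" using r pos_selfadjoint by blast
  have t1: "t 1 \<ge> 0" by (simp add: nonneg_pos)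
  have key: "2 * t r \<le> e * t 1" if e: "e > 0" for e
  proof -
    have "t (r * r + (- (2 * e)) *\<^sub>R r) = t (r * r) + t ((- (2 * e)) *\<^sub>R r)"
      by (rule add) (simp_all add: star_simps sr mult.assoc)
    moreover have "t ((r * r + (- (2 * e)) *\<^sub>R r) + (e * e) *\<^sub>R 1) = t (r * r + (- (2 * e)) *\<^sub>R r) + t ((e * e) *\<^sub>R 1)"
      by (rule add) (simp_all add: star_simps sr mult.assoc)
    moreover have "(r * r + (- (2 * e)) *\<^sub>R r) + (e * e) *\<^sub>R 1 = (r - e *\<^sub>R 1) * star (r - e *\<^sub>R 1)"
      by (simp add: star_simps sr algebra_simps flip: scaleR_left_distrib)
    ultimately have "0 \<le> 0 - (2 * e) * t r + (e * e) * t 1"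
      using nonneg[of "r - e *\<^sub>R 1"] assms scale[OF sr, of "- (2 * e)"] scale[of 1 "e * e"] by simp
    then have "e * (2 * t r) \<le> e * (e * t 1)" by (simp add: algebra_simps)
    then show ?thesis using e by simp
  qed
  have "2 * t r \<le> 0 + e" if "e > 0" for e
  proof -
    have "2 * t r \<le> (e / (t 1 + 1)) * t 1" using that t1 by (intro key) auto
    also have "\<dots> \<le> e" using t1 that by (simp add: field_simps)
    finally show ?thesis by simp
  qed
  then have "2 * t r \<le> 0" by (rule field_le_epsilon)
  then show ?thesis using nonneg_pos[OF r] by simp
qed

text \<open>\<open>null_sqrt\<close> descends through squares only, so \<open>r ^ k\<close> is first
  replaced by the higher power \<open>r ^ (2 ^ k)\<close>, which is null because it is below a
  multiple of \<open>r ^ k\<close>.\<close>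

lemma null_root:
  assumes r: "pos r" and "t (r ^ k) = 0"
  shows "t r = 0"
proof -
  have "t (r ^ (2 ^ k)) = 0"
  proof -
    have "k \<le> 2 ^ k" by (rule less_imp_le) (rule less_exp)
    define z where "z = r ^ (2 ^ k - k)"
    have eq: "r ^ (2 ^ k) = r ^ k * z" using \<open>k \<le> 2 ^ k\<close> by (simp add: z_def flip: power_add)
    have com: "r ^ k * z = z * r ^ k" by (simp add: z_def add.commute flip: power_add)
    have z: "pos z" by (simp add: z_def pos_power r)
    have "pos (r ^ k * (of_real (norm z) - z))"
      by (rule pos_mult_commuting[OF pos_power[OF r] pos_bounds(1)[OF pos_selfadjoint[OF z] order_refl]])
        (simp add: left_diff_distrib right_diff_distrib com of_real_def)
    then have "pos (norm z *\<^sub>R r ^ k - r ^ (2 ^ k))" by (simp add: right_diff_distrib eq of_real_def)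
    moreover have "t (norm z *\<^sub>R r ^ k) = 0"
      using scale[of "r ^ k"] assms(2) pos_selfadjoint[OF pos_power[OF r]] by simp
    ultimately show ?thesis using null_hereditary pos_power[OF r] by blast
  qed
  moreover have "t (r ^ (2 ^ j)) = 0 \<Longrightarrow> t r = 0" for j
  proof (induction j)
    case (Suc j)
    have "r ^ (2 ^ Suc j) = r ^ (2 ^ j) * r ^ (2 ^ j)" by (simp add: mult_2 flip: power_add)
    then show ?case using Suc null_sqrt[OF pos_power[OF r, of "2 ^ j"]] by simp
  qed simp
  ultimately show ?thesis by blast
qed

end

section \<open>Hilbert modules\<close>

definition inner_product :: "nat \<Rightarrow> (nat \<Rightarrow> 'a) \<Rightarrow> (nat \<Rightarrow> 'a) \<Rightarrow> 'a :: unital_cstar" where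
  "inner_product n v w = (\<Sum>j<n. star (v j) * w j)"

definition vec_norm :: "nat \<Rightarrow> (nat \<Rightarrow> 'a :: unital_cstar) \<Rightarrow> real" where
  "vec_norm n v = sqrt (norm (inner_product n v v))"

definition mat_vec :: "nat \<Rightarrow> (nat \<Rightarrow> nat \<Rightarrow> 'a) \<Rightarrow> (nat \<Rightarrow> 'a) \<Rightarrow> nat \<Rightarrow> 'a :: unital_cstar" where
  "mat_vec n x v i = (\<Sum>j<n. x i j * v j)"

lemma pos_inner_product: "pos (inner_product n v v)"
  unfolding inner_product_def by (intro pos_sum pos_star_mult)

lemma star_inner_product: "star (inner_product n v w) = inner_product n w v"
  by (simp add: inner_product_def star_simps)

lemma norm_component_le: "j < n \<Longrightarrow> norm (v j) \<le> vec_norm n v"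
proof -
  assume j: "j < n"
  have "inner_product n v v - star (v j) * v j = (\<Sum>i\<in>{..<n} - {j}. star (v i) * v i)"
    unfolding inner_product_def using j by (subst sum_diff1) auto
  then have "pos (inner_product n v v - star (v j) * v j)" by (simp add: pos_sum pos_star_mult)
  then have "norm (star (v j) * v j) \<le> norm (inner_product n v v)" using norm_mono pos_star_mult by blast
  then show ?thesis by (simp add: norm_star_mult vec_norm_def real_le_rsqrt)
qed

lemma vec_norm_nonneg [simp]: "vec_norm n v \<ge> 0"
  by (simp add: vec_norm_def)

lemma norm_inner_self: "norm (inner_product n v v) = (vec_norm n v)\<^sup>2"
  by (simp add: vec_norm_def)

lemma vec_norm_le_sum: "vec_norm n v \<le> (\<Sum>j<n. norm (v j))"
proof -
  have "norm (inner_product n v v) \<le> (\<Sum>j<n. (norm (v j))\<^sup>2)"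
    unfolding inner_product_def by (rule order_trans[OF norm_sum]) (simp add: norm_star_mult)
  then have "vec_norm n v \<le> L2_set (\<lambda>j. norm (v j)) {..<n}"
    by (simp add: vec_norm_def L2_set_def)
  also have "\<dots> \<le> (\<Sum>j<n. norm (v j))" by (rule L2_set_le_sum) simp
  finally show ?thesis .
qed

text \<open>The usual test vector \<open>v * a - N *\<^sub>R w\<close>, where \<open>a\<close> is
  the inner product of \<open>v\<close> and \<open>w\<close>. The inner product of \<open>v\<close>
  with itself cannot be moved past \<open>a\<close>; it is estimated by its norm \<open>N\<close>
  inside \<open>star a * _ * a\<close>.\<close>

theorem inner_product_Cauchy_Schwarz:
  "norm (inner_product n v w) \<le> vec_norm n v * vec_norm n w"
proof (cases "vec_norm n v = 0")
  case True
  then have "v j = 0" if "j < n" for j using norm_component_le[OF that, of v] by simp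
  then show ?thesis by (simp add: inner_product_def)
next
  case False
  define N where "N = norm (inner_product n v v)"
  define a where "a = inner_product n v w"
  define z where "z j = v j * a - N *\<^sub>R w j" for j
  have N: "N > 0" using False by (simp add: N_def vec_norm_def)
  have "inner_product n z z = star a * inner_product n v v * a - N *\<^sub>R (star a * inner_product n v w)
      - N *\<^sub>R (inner_product n w v * a) + (N * N) *\<^sub>R inner_product n w w"
    unfolding inner_product_def z_def
    by (simp add: star_simps left_diff_distrib right_diff_distrib sum.distrib sum_subtractf
        sum_distrib_left sum_distrib_right scaleR_sum_right scaleR_diff_right mult.assoc)
  also have "inner_product n w v = star a" by (simp add: a_def star_inner_product)
  finally have z: "inner_product n z z = star a * inner_product n v v * a - N *\<^sub>R (star a * a)
      - N *\<^sub>R (star a * a) + (N * N) *\<^sub>R inner_product n w w" by (simp add: a_def)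
  have "pos (of_real N - inner_product n v v)"
    unfolding N_def by (intro pos_bounds(1) pos_selfadjoint pos_inner_product order_refl)
  then have "pos (star a * (of_real N - inner_product n v v) * a)" by (rule pos_conj)
  then have "pos (inner_product n z z + star a * (of_real N - inner_product n v v) * a)"
    by (intro pos_add pos_inner_product)
  also have "inner_product n z z + star a * (of_real N - inner_product n v v) * a
      = N *\<^sub>R (N *\<^sub>R inner_product n w w - star a * a)"
    unfolding z by (simp add: algebra_simps of_real_def)
  finally have "pos (N *\<^sub>R (N *\<^sub>R inner_product n w w - star a * a))" .
  then have "pos ((1 / N) *\<^sub>R (N *\<^sub>R (N *\<^sub>R inner_product n w w - star a * a)))"
    using N by (intro pos_scaleR[of _ "1 / N"]) simp_all
  then have "pos (N *\<^sub>R inner_product n w w - star a * a)" using N by simp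
  then have "norm (star a * a) \<le> norm (N *\<^sub>R inner_product n w w)" by (intro norm_mono pos_star_mult)
  then have "(norm a)\<^sup>2 \<le> (vec_norm n v * vec_norm n w)\<^sup>2"
    using N by (simp add: norm_star_mult N_def norm_inner_self power_mult_distrib)
  then have "norm a \<le> vec_norm n v * vec_norm n w" by (rule power2_le_imp_le) simp
  then show ?thesis by (simp add: a_def)
qed

lemma vec_norm_triangle: "vec_norm n (\<lambda>j. v j + w j) \<le> vec_norm n v + vec_norm n w"
proof -
  have "inner_product n (\<lambda>j. v j + w j) (\<lambda>j. v j + w j)
     = inner_product n v v + inner_product n v w + inner_product n w v + inner_product n w w"
    by (simp add: inner_product_def star_add distrib_left distrib_right sum.distrib)
  then have "norm (inner_product n (\<lambda>j. v j + w j) (\<lambda>j. v j + w j))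
      \<le> (vec_norm n v)\<^sup>2 + vec_norm n v * vec_norm n w + vec_norm n w * vec_norm n v + (vec_norm n w)\<^sup>2"
    by (simp only:) (intro order_trans[OF norm_triangle_ineq] add_mono inner_product_Cauchy_Schwarz, auto simp: norm_inner_self)
  also have "\<dots> = (vec_norm n v + vec_norm n w)\<^sup>2" by (simp add: power2_eq_square algebra_simps)
  finally show ?thesis unfolding vec_norm_def[of n "\<lambda>j. v j + w j"] by (intro real_le_lsqrt) auto
qed

lemma inner_product_mat_vec:
  "inner_product n v (mat_vec n x w) = inner_product n (mat_vec n (\<lambda>i j. star (x j i)) v) w"
proof -
  have "inner_product n v (mat_vec n x w) = (\<Sum>i<n. \<Sum>j<n. star (v i) * x i j * w j)"
    by (simp add: inner_product_def mat_vec_def sum_distrib_left mult.assoc)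
  also have "\<dots> = (\<Sum>j<n. \<Sum>i<n. star (v i) * x i j * w j)" by (rule sum.swap)
  also have "\<dots> = inner_product n (mat_vec n (\<lambda>i j. star (x j i)) v) w"
    by (simp add: inner_product_def mat_vec_def star_sum star_mult sum_distrib_right)
  finally show ?thesis .
qed

text \<open>A crude bound. It makes the supremum in the matrix norm finite and shows that entrywise
  convergence implies convergence in norm.\<close>

lemma vec_norm_mat_vec_le: "vec_norm n (mat_vec n x v) \<le> (\<Sum>i<n. \<Sum>j<n. norm (x i j)) * vec_norm n v"
proof -
  have "norm (mat_vec n x v i) \<le> (\<Sum>j<n. norm (x i j)) * vec_norm n v" for i
    unfolding mat_vec_def sum_distrib_right
    by (intro sum_norm_le order_trans[OF norm_mult_ineq] mult_left_mono norm_component_le) auto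
  then have "(\<Sum>i<n. norm (mat_vec n x v i)) \<le> (\<Sum>i<n. \<Sum>j<n. norm (x i j)) * vec_norm n v"
    unfolding sum_distrib_right[of _ "{..<n}" "vec_norm n v"] by (intro sum_mono) (simp add: sum_distrib_right)
  then show ?thesis using vec_norm_le_sum[of n "mat_vec n x v"] by linarith
qed

section \<open>The universal algebra over a carrier type\<close>

context cstar_algebra
begin

lemma cscale_zero_left: "x \<in> carrier A \<Longrightarrow> cscale A 0 x = \<zero>"
  using cscale_add_left[of x 0 0] cscale_closed[of x 0]
  by (metis add.r_cancel_one' add.right_neutral)

lemma cscale_zero_right: "cscale A c \<zero> = \<zero>"
  using cscale_add_right[of \<zero> \<zero> c] cscale_closed[of \<zero> c] zero_closed r_zero add.r_cancel_one'
  by metis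

lemma neg_eq_cscale: "x \<in> carrier A \<Longrightarrow> \<ominus> x = cscale A (- 1) x"
proof -
  assume x: "x \<in> carrier A"
  have "cscale A (-1) x \<oplus> x = cscale A (-1 + 1) x"
    using x by (subst cscale_add_left) (auto simp: cscale_one)
  then show ?thesis using x cscale_closed[of x "-1"] minus_equality cscale_zero_left by simp
qed

lemma cnorm_zero: "cnorm A \<zero> = 0"
  using cnorm_eq_zero[of \<zero>] by simp

lemma cnorm_neg: "x \<in> carrier A \<Longrightarrow> cnorm A (\<ominus> x) = cnorm A x"
  by (simp add: neg_eq_cscale cnorm_cscale)

lemma cnorm_diff: "x \<in> carrier A \<Longrightarrow> y \<in> carrier A \<Longrightarrow> cnorm A (x \<ominus> y) \<le> cnorm A x + cnorm A y"
  using cnorm_triangle[of x "\<ominus> y"] by (simp add: a_minus_def cnorm_neg)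

lemma adj_zero: "adj A \<zero> = \<zero>"
  using adj_cscale[of \<zero> 0] adj_closed[of \<zero>] by (simp add: cscale_zero_left)

lemma adj_one: "adj A \<one> = \<one>"
  by (metis adj_adj adj_closed adj_mult l_one one_closed r_one)

lemma cnorm_adj: "x \<in> carrier A \<Longrightarrow> cnorm A (adj A x) = cnorm A x"
proof -
  have "cnorm A y \<le> cnorm A (adj A y)" if y: "y \<in> carrier A" for y
  proof (cases "cnorm A y = 0")
    case False
    have "cnorm A y * cnorm A y \<le> cnorm A (adj A y) * cnorm A y"
      using cstar_identity[OF y] cnorm_mult[OF adj_closed[OF y] y] by (simp add: power2_eq_square)
    then show ?thesis using False cnorm_nonneg[OF y] by simp
  qed (use cnorm_nonneg adj_closed y in simp)
  from this[of x] this[of "adj A x"] show "x \<in> carrier A \<Longrightarrow> ?thesis" by (simp add: adj_closed adj_adj)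
qed

lemma cnorm_one: "cnorm A \<one> \<le> 1"
proof -
  have "cnorm A \<one> = (cnorm A \<one>)\<^sup>2" using cstar_identity[of \<one>] by (simp add: adj_one)
  then show ?thesis by (metis nle_le one_le_numeral power2_eq_square cnorm_nonneg mult_le_cancel_left1 not_one_le_zero one_closed zero_less_one_class.zero_le_one mult_cancel_left1)
qed

end

text \<open>All unital \<open>C\<^sup>*\<close>-algebras carried by subsets of \<open>'a\<close> are collected into one, their
  \<open>\<ell>\<^sup>\<infinity>\<close>-product, which is an instance of the type class. The additional factor \<open>\<complex>\<close> makes
  the product nonzero.\<close>

typedef 'a univ = "{f :: complex \<times> ('a cstar \<Rightarrow> 'a).
    (\<forall>A. if cstar_algebra A then snd f A \<in> carrier A else snd f A = undefined) \<and>
    (\<exists>K. \<forall>A. cstar_algebra A \<longrightarrow> cnorm A (snd f A) \<le> K)}"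
proof
  show "(0, \<lambda>A. if cstar_algebra A then \<zero>\<^bsub>A\<^esub> else undefined) \<in> {f :: complex \<times> ('a cstar \<Rightarrow> 'a).
    (\<forall>A. if cstar_algebra A then snd f A \<in> carrier A else snd f A = undefined) \<and>
    (\<exists>K. \<forall>A. cstar_algebra A \<longrightarrow> cnorm A (snd f A) \<le> K)}"
    by (auto simp: cstar_algebra.cnorm_zero cstar_algebra_def ring.ring_simprules intro!: exI[of _ 0])
qed

definition scal :: "'a univ \<Rightarrow> complex" where "scal x = fst (Rep_univ x)"

definition component :: "'a cstar \<Rightarrow> 'a univ \<Rightarrow> 'a" where "component A x = snd (Rep_univ x) A"

definition univ_of :: "complex \<Rightarrow> ('a cstar \<Rightarrow> 'a) \<Rightarrow> 'a univ" where
  "univ_of z f = Abs_univ (z, \<lambda>A. if cstar_algebra A then f A else undefined)"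

lemma univ_eqI:
  assumes "scal x = scal y" "\<And>A. cstar_algebra A \<Longrightarrow> component A x = component A y"
  shows "x = y"
proof -
  have "snd (Rep_univ x) A = snd (Rep_univ y) A" for A
    using assms(2)[of A] Rep_univ[of x] Rep_univ[of y] unfolding component_def
    by (cases "cstar_algebra A") (auto split: if_splits dest!: spec[of _ A])
  then show ?thesis
    using assms(1) by (metis Rep_univ_inject ext prod_eq_iff scal_def)
qed

lemma component_closed [simp]: "cstar_algebra A \<Longrightarrow> component A x \<in> carrier A"
  using Rep_univ[of x] by (auto simp: component_def split: if_splits dest!: spec[of _ A])

lemma component_bounded: "\<exists>K. \<forall>A. cstar_algebra A \<longrightarrow> cnorm A (component A x) \<le> K"
  using Rep_univ[of x] by (auto simp: component_def)

lemma univ_of: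
  assumes "\<And>A. cstar_algebra A \<Longrightarrow> f A \<in> carrier A" "\<And>A. cstar_algebra A \<Longrightarrow> cnorm A (f A) \<le> K"
  shows "scal (univ_of z f) = z" "cstar_algebra A \<Longrightarrow> component A (univ_of z f) = f A"
proof -
  have "(z, \<lambda>A. if cstar_algebra A then f A else undefined) \<in> {f :: complex \<times> ('a cstar \<Rightarrow> 'a).
    (\<forall>A. if cstar_algebra A then snd f A \<in> carrier A else snd f A = undefined) \<and>
    (\<exists>K. \<forall>A. cstar_algebra A \<longrightarrow> cnorm A (snd f A) \<le> K)}"
    using assms by auto
  from Abs_univ_inverse[OF this]
  show "scal (univ_of z f) = z" "cstar_algebra A \<Longrightarrow> component A (univ_of z f) = f A"
    by (simp_all add: scal_def component_def univ_of_def)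
qed

instantiation univ :: (type) "{zero, one, plus, minus, uminus, times, scaleR}"
begin

definition "0 = univ_of 0 (\<lambda>A. \<zero>\<^bsub>A\<^esub>)"
definition "1 = univ_of 1 (\<lambda>A. \<one>\<^bsub>A\<^esub>)"
definition "x + y = univ_of (scal x + scal y) (\<lambda>A. component A x \<oplus>\<^bsub>A\<^esub> component A y)"
definition "x - y = univ_of (scal x - scal y) (\<lambda>A. component A x \<ominus>\<^bsub>A\<^esub> component A y)"
definition "- x = univ_of (- scal x) (\<lambda>A. \<ominus>\<^bsub>A\<^esub> component A x)"
definition "x * y = univ_of (scal x * scal y) (\<lambda>A. component A x \<otimes>\<^bsub>A\<^esub> component A y)"
definition "r *\<^sub>R x = univ_of (r *\<^sub>R scal x) (\<lambda>A. cscale A (of_real r) (component A x))"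

instance ..

end

definition univ_norm :: "'a univ \<Rightarrow> real" where
  "univ_norm x = Sup (insert (cmod (scal x)) {cnorm A (component A x) | A. cstar_algebra A})"

definition univ_star :: "'a univ \<Rightarrow> 'a univ" where
  "univ_star x = univ_of (cnj (scal x)) (\<lambda>A. adj A (component A x))"

definition univ_ii :: "'a univ" where
  "univ_ii = univ_of \<i> (\<lambda>A. cscale A \<i> \<one>\<^bsub>A\<^esub>)"

lemma cnorm_le_univ_norm: "cstar_algebra A \<Longrightarrow> cnorm A (component A x) \<le> univ_norm x"
  and cmod_le_univ_norm: "cmod (scal x) \<le> univ_norm x"
proof -
  obtain K where K: "\<forall>A. cstar_algebra A \<longrightarrow> cnorm A (component A x) \<le> K" using component_bounded by blast
  then have bdd: "bdd_above (insert (cmod (scal x)) {cnorm A (component A x) | A. cstar_algebra A})"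
    by (auto intro!: bdd_aboveI[of _ K])
  show "cstar_algebra A \<Longrightarrow> cnorm A (component A x) \<le> univ_norm x" "cmod (scal x) \<le> univ_norm x"
    unfolding univ_norm_def by (rule cSup_upper[OF _ bdd], auto)+
qed

lemma univ_norm_leI:
  "cmod (scal x) \<le> K \<Longrightarrow> (\<And>A. cstar_algebra A \<Longrightarrow> cnorm A (component A x) \<le> K) \<Longrightarrow> univ_norm x \<le> K"
  unfolding univ_norm_def by (rule cSup_least) auto

lemma univ_norm_nonneg: "0 \<le> univ_norm (x :: 'a univ)"
  using cmod_le_univ_norm[of x] norm_ge_zero order_trans by blast

lemma cstar_ring: "cstar_algebra A \<Longrightarrow> ring A"
  by (simp add: cstar_algebra_def)

lemma scal_comp_zero:
  "scal 0 = 0" "cstar_algebra A \<Longrightarrow> component A 0 = \<zero>\<^bsub>A\<^esub>"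
  unfolding zero_univ_def
  by (rule univ_of[where K=0]; simp add: cstar_algebra.cnorm_zero cstar_ring ring.ring_simprules)+

lemma scal_comp_one:
  "scal 1 = 1" "cstar_algebra A \<Longrightarrow> component A 1 = \<one>\<^bsub>A\<^esub>"
  unfolding one_univ_def
  by (rule univ_of[where K=1]; simp add: cstar_algebra.cnorm_one cstar_ring ring.ring_simprules)+

lemma scal_comp_plus:
  "scal (x + y) = scal x + scal y" "cstar_algebra A \<Longrightarrow> component A (x + y) = component A x \<oplus>\<^bsub>A\<^esub> component A y"
  unfolding plus_univ_def
  by (rule univ_of[where K="univ_norm x + univ_norm y"];
      simp add: cstar_ring ring.ring_simprules order_trans[OF cstar_algebra.cnorm_triangle] add_mono cnorm_le_univ_norm)+

lemma scal_comp_minus: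
  "scal (x - y) = scal x - scal y" "cstar_algebra A \<Longrightarrow> component A (x - y) = component A x \<ominus>\<^bsub>A\<^esub> component A y"
  unfolding minus_univ_def
  by (rule univ_of[where K="univ_norm x + univ_norm y"];
      simp add: cstar_ring[THEN ring.is_abelian_group, THEN abelian_group.minus_closed]
        order_trans[OF cstar_algebra.cnorm_diff] add_mono cnorm_le_univ_norm)+

lemma scal_comp_uminus:
  "scal (- x) = - scal x" "cstar_algebra A \<Longrightarrow> component A (- x) = \<ominus>\<^bsub>A\<^esub> component A x"
  unfolding uminus_univ_def
  by (rule univ_of[where K="univ_norm x"];
      simp add: cstar_ring ring.ring_simprules cstar_algebra.cnorm_neg cnorm_le_univ_norm)+

lemma scal_comp_times:
  "scal (x * y) = scal x * scal y" "cstar_algebra A \<Longrightarrow> component A (x * y) = component A x \<otimes>\<^bsub>A\<^esub> component A y"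
  unfolding times_univ_def
  by (rule univ_of[where K="univ_norm x * univ_norm y"];
      simp add: cstar_ring ring.ring_simprules order_trans[OF cstar_algebra.cnorm_mult] mult_mono cnorm_le_univ_norm
        univ_norm_nonneg cstar_algebra.cnorm_nonneg)+

lemma scal_comp_scaleR:
  "scal (r *\<^sub>R x) = r *\<^sub>R scal x" "cstar_algebra A \<Longrightarrow> component A (r *\<^sub>R x) = cscale A (of_real r) (component A x)"
  unfolding scaleR_univ_def
  by (rule univ_of[where K="\<bar>r\<bar> * univ_norm x"];
      simp add: cstar_algebra.cscale_closed cstar_algebra.cnorm_cscale mult_left_mono cnorm_le_univ_norm)+

lemma scal_comp_univ_star:
  "scal (univ_star x) = cnj (scal x)" "cstar_algebra A \<Longrightarrow> component A (univ_star x) = adj A (component A x)"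
  unfolding univ_star_def
  by (rule univ_of[where K="univ_norm x"]; simp add: cstar_algebra.adj_closed cstar_algebra.cnorm_adj cnorm_le_univ_norm)+

lemma scal_comp_univ_ii:
  "scal univ_ii = \<i>" "cstar_algebra A \<Longrightarrow> component A univ_ii = cscale A \<i> \<one>\<^bsub>A\<^esub>"
  unfolding univ_ii_def
  by (rule univ_of[where K=1]; simp add: cstar_algebra.cscale_closed cstar_algebra.cnorm_cscale
      cstar_algebra.cnorm_one cstar_ring ring.ring_simprules)+

lemmas scal_comp = scal_comp_zero scal_comp_one scal_comp_plus scal_comp_minus scal_comp_uminus
  scal_comp_times scal_comp_scaleR scal_comp_univ_star scal_comp_univ_ii

instance univ :: (type) real_algebra_1
proof
  fix x y z :: "'a univ" and r s :: real
  show "x + y + z = x + (y + z)" "x + y = y + x" "0 + x = x" "- x + x = 0" "x - y = x + - y"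
    by (rule univ_eqI; simp add: scal_comp cstar_ring ring.ring_simprules)+
  show "x * y * z = x * (y * z)" "1 * x = x" "x * 1 = x" "(x + y) * z = x * z + y * z" "x * (y + z) = x * y + x * z"
    by (rule univ_eqI; simp add: scal_comp cstar_ring ring.ring_simprules
        cstar_ring[THEN ring.is_monoid, THEN monoid.r_one] distrib_left distrib_right)+
  show "(0 :: 'a univ) \<noteq> 1" by (metis scal_comp(1,3) zero_neq_one)
  show "r *\<^sub>R (x + y) = r *\<^sub>R x + r *\<^sub>R y" "(r + s) *\<^sub>R x = r *\<^sub>R x + s *\<^sub>R x"
    "r *\<^sub>R s *\<^sub>R x = (r * s) *\<^sub>R x" "1 *\<^sub>R x = x" "(r *\<^sub>R x) * y = r *\<^sub>R (x * y)" "x * (r *\<^sub>R y) = r *\<^sub>R (x * y)"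
    by (rule univ_eqI; simp add: scal_comp cstar_algebra.cscale_add_right cstar_algebra.cscale_add_left
        cstar_algebra.cscale_cscale cstar_algebra.cscale_one cstar_algebra.cscale_mult_left
        cstar_algebra.cscale_mult_right algebra_simps)+
qed

instantiation univ :: (type) real_normed_algebra_1
begin

definition "norm = (univ_norm :: 'a univ \<Rightarrow> real)"
definition "dist x y = norm (x - y :: 'a univ)"
definition "uniformity = (INF e\<in>{0<..}. principal {(x :: 'a univ, y). dist x y < e})"
definition "open (U :: 'a univ set) \<longleftrightarrow> (\<forall>x\<in>U. \<forall>\<^sub>F (x', y) in uniformity. x' = x \<longrightarrow> y \<in> U)"
definition "sgn x = inverse (norm x) *\<^sub>R (x :: 'a univ)"

instance
proof
  note leI = univ_norm_leI[where ?'a='a, folded norm_univ_def]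
    and nonneg = univ_norm_nonneg[where ?'a='a, folded norm_univ_def]
    and cle = cnorm_le_univ_norm[where ?'a='a, folded norm_univ_def]
    and mle = cmod_le_univ_norm[where ?'a='a, folded norm_univ_def]
  fix x y :: "'a univ" and r :: real and U :: "'a univ set"
  show "dist x y = norm (x - y)" by (simp add: dist_univ_def)
  show "sgn x = inverse (norm x) *\<^sub>R x" by (simp add: sgn_univ_def)
  show "(uniformity :: ('a univ \<times> 'a univ) filter) = (INF e\<in>{0<..}. principal {(x, y). dist x y < e})"
    by (simp add: uniformity_univ_def)
  show "open U = (\<forall>x\<in>U. \<forall>\<^sub>F (x', y) in uniformity. x' = x \<longrightarrow> y \<in> U)" by (simp add: open_univ_def)
  show "norm x = 0 \<longleftrightarrow> x = 0"
  proof
    assume 0: "norm x = 0"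
    show "x = 0"
    proof (rule univ_eqI)
      show "scal x = scal 0" using mle[of x] 0 by (simp add: scal_comp)
      show "component A x = component A 0" if "cstar_algebra A" for A
        using cle[OF that, of x] 0 that cstar_algebra.cnorm_eq_zero[OF that, of "component A x"]
          cstar_algebra.cnorm_nonneg[OF that, of "component A x"] by (simp add: scal_comp)
    qed
  next
    assume x: "x = 0"
    have "norm x \<le> 0" by (rule leI) (auto simp: x scal_comp cstar_algebra.cnorm_zero)
    then show "norm x = 0" using nonneg[of x] by simp
  qed
  show "norm (x + y) \<le> norm x + norm y"
  proof (rule leI)
    show "cmod (scal (x + y)) \<le> norm x + norm y"
      by (simp add: scal_comp order_trans[OF norm_triangle_ineq] add_mono mle)
    show "cnorm A (component A (x + y)) \<le> norm x + norm y" if "cstar_algebra A" for A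
      using that by (simp add: scal_comp order_trans[OF cstar_algebra.cnorm_triangle] add_mono cle)
  qed
  have le: "norm (r *\<^sub>R x) \<le> \<bar>r\<bar> * norm x" for r and x :: "'a univ"
  proof (rule leI)
    show "cmod (scal (r *\<^sub>R x)) \<le> \<bar>r\<bar> * norm x"
      by (simp add: scal_comp mult_left_mono mle)
    show "cnorm A (component A (r *\<^sub>R x)) \<le> \<bar>r\<bar> * norm x" if "cstar_algebra A" for A
      using that by (simp add: scal_comp cstar_algebra.cnorm_cscale mult_left_mono cle)
  qed
  show "norm (r *\<^sub>R x) = \<bar>r\<bar> * norm x"
  proof (cases "r = 0")
    case True
    then show ?thesis using le[of r x] nonneg[of "r *\<^sub>R x"] by simp
  next
    case False
    have "norm ((1 / r) *\<^sub>R r *\<^sub>R x) \<le> \<bar>1 / r\<bar> * norm (r *\<^sub>R x)" by (rule le)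
    then have "\<bar>r\<bar> * norm x \<le> norm (r *\<^sub>R x)" using False by (simp add: field_simps)
    then show ?thesis using le[of r x] by simp
  qed
  show "norm (x * y) \<le> norm x * norm y"
  proof (rule leI)
    show "cmod (scal (x * y)) \<le> norm x * norm y"
      by (simp add: scal_comp norm_mult mult_mono mle nonneg)
    show "cnorm A (component A (x * y)) \<le> norm x * norm y" if "cstar_algebra A" for A
      using that by (simp add: scal_comp order_trans[OF cstar_algebra.cnorm_mult] mult_mono cle
          nonneg cstar_algebra.cnorm_nonneg)
  qed
  have "norm (1 :: 'a univ) \<le> 1"
    by (rule leI) (auto simp: scal_comp cstar_algebra.cnorm_one)
  then show "norm (1 :: 'a univ) = 1" using mle[of "1 :: 'a univ"] by (simp add: scal_comp)
qed

end

lemmas norm_univ_leI = univ_norm_leI[folded norm_univ_def]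
lemmas cnorm_le_norm = cnorm_le_univ_norm[folded norm_univ_def]
lemmas cmod_le_norm = cmod_le_univ_norm[folded norm_univ_def]

lemma component_Cauchy_limit:
  fixes X :: "nat \<Rightarrow> 'a univ"
  assumes "Cauchy X" and A: "cstar_algebra A"
  shows "\<exists>l\<in>carrier A. \<forall>e>0. \<exists>N. \<forall>n\<ge>N. cnorm A (component A (X n) \<ominus>\<^bsub>A\<^esub> l) < e"
proof -
  interpret cstar_algebra A by fact
  interpret M: Metric_space "carrier A" "cdist A" by (rule Metric_space_cdist)
  have "M.MCauchy (\<lambda>n. component A (X n))"
    unfolding M.MCauchy_def
  proof (intro conjI allI impI)
    fix e :: real assume "e > 0"
    then obtain N where N: "\<And>m n. m \<ge> N \<Longrightarrow> n \<ge> N \<Longrightarrow> norm (X m - X n) < e"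
      using CauchyD[OF assms(1)] by blast
    have "cdist A (component A (X m)) (component A (X n)) < e" if "N \<le> m" "N \<le> n" for m n
      using order_le_less_trans[OF cnorm_le_norm[OF A, of "X m - X n"] N] that A
      by (simp add: cdist_def scal_comp)
    then show "\<exists>N. \<forall>n n'. N \<le> n \<longrightarrow> N \<le> n' \<longrightarrow> cdist A (component A (X n)) (component A (X n')) < e" by blast
  qed (use A in auto)
  then obtain l where "limitin M.mtopology (\<lambda>n. component A (X n)) l sequentially"
    using complete unfolding M.mcomplete_def by blast
  then have l: "l \<in> carrier A" "\<forall>e>0. \<exists>N. \<forall>n\<ge>N. cdist A (component A (X n)) l < e"
    unfolding M.limit_metric_sequentially by blast+
  have "cdist A (component A (X n)) l = cnorm A (component A (X n) \<ominus>\<^bsub>A\<^esub> l)" for n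
    using A l(1) by (simp add: cdist_def)
  then show ?thesis using l by auto
qed

instance univ :: (type) banach
proof
  fix X :: "nat \<Rightarrow> 'a univ"
  assume C: "Cauchy X"
  define l where "l A = (SOME l. l \<in> carrier A \<and> (\<forall>e>0. \<exists>N. \<forall>n\<ge>N. cnorm A (component A (X n) \<ominus>\<^bsub>A\<^esub> l) < e))" for A
  have l: "l A \<in> carrier A" "\<And>e. e > 0 \<Longrightarrow> \<exists>N. \<forall>n\<ge>N. cnorm A (component A (X n) \<ominus>\<^bsub>A\<^esub> l A) < e" if "cstar_algebra A" for A
    using someI_ex[of "\<lambda>l. l \<in> carrier A \<and> (\<forall>e>0. \<exists>N. \<forall>n\<ge>N. cnorm A (component A (X n) \<ominus>\<^bsub>A\<^esub> l) < e)"]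
      component_Cauchy_limit[OF C that] unfolding l_def[symmetric] by blast+
  have "Cauchy (\<lambda>n. scal (X n))"
  proof (rule CauchyI)
    fix e :: real assume "e > 0"
    then obtain N where N: "\<And>m n. m \<ge> N \<Longrightarrow> n \<ge> N \<Longrightarrow> norm (X m - X n) < e"
      using CauchyD[OF C] by blast
    then show "\<exists>M. \<forall>m\<ge>M. \<forall>n\<ge>M. norm (scal (X m) - scal (X n)) < e"
      by (intro exI[of _ N]) (metis cmod_le_norm order_le_less_trans scal_comp_minus(1))
  qed
  then obtain z where z: "(\<lambda>n. scal (X n)) \<longlonglongrightarrow> z" using Cauchy_convergent convergent_def by blast
  \<comment> \<open>The estimate is uniform in the algebra \<open>A\<close>, since \<open>N\<close>
    comes from the norm of the product; this turns the componentwise limits into a limit in the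
    product.\<close>
  have near: "cnorm A (component A (X n) \<ominus>\<^bsub>A\<^esub> l A) \<le> e"
    if A: "cstar_algebra A" and N: "\<And>m. m \<ge> N \<Longrightarrow> norm (X n - X m) < e" for A n N e
  proof (rule field_le_epsilon)
    interpret cstar_algebra A by fact
    fix d :: real assume "d > 0"
    then obtain M where M: "\<And>m. m \<ge> M \<Longrightarrow> cnorm A (component A (X m) \<ominus>\<^bsub>A\<^esub> l A) < d" using l(2)[OF A] by blast
    let ?m = "max N M"
    have "component A (X n) \<ominus>\<^bsub>A\<^esub> l A = (component A (X n) \<ominus>\<^bsub>A\<^esub> component A (X ?m)) \<oplus>\<^bsub>A\<^esub> (component A (X ?m) \<ominus>\<^bsub>A\<^esub> l A)"
      using A l(1)[OF A] by (simp add: a_minus_def a_assoc) (simp add: a_assoc[symmetric] l_neg)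
    moreover have "cnorm A (component A (X n) \<ominus>\<^bsub>A\<^esub> component A (X ?m)) < e"
      using order_le_less_trans[OF cnorm_le_norm[OF A, of "X n - X ?m"] N] A by (simp add: scal_comp)
    moreover have "cnorm A (component A (X ?m) \<ominus>\<^bsub>A\<^esub> l A) < d" by (rule M) simp
    ultimately show "cnorm A (component A (X n) \<ominus>\<^bsub>A\<^esub> l A) \<le> e + d"
      using cnorm_triangle[of "component A (X n) \<ominus>\<^bsub>A\<^esub> component A (X ?m)" "component A (X ?m) \<ominus>\<^bsub>A\<^esub> l A"] A l(1)[OF A] by simp
  qed
  obtain N1 where N1: "\<And>m n. m \<ge> N1 \<Longrightarrow> n \<ge> N1 \<Longrightarrow> norm (X m - X n) < 1"
    using CauchyD[OF C, of 1] by auto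
  have bound: "cnorm A (l A) \<le> norm (X N1) + 1" if A: "cstar_algebra A" for A
  proof -
    interpret cstar_algebra A by fact
    have "l A = component A (X N1) \<ominus>\<^bsub>A\<^esub> (component A (X N1) \<ominus>\<^bsub>A\<^esub> l A)"
      using A l(1)[OF A] by (simp add: a_minus_def minus_add a_assoc[symmetric] r_neg)
    then have "cnorm A (l A) \<le> cnorm A (component A (X N1)) + cnorm A (component A (X N1) \<ominus>\<^bsub>A\<^esub> l A)"
      using A l(1)[OF A] cnorm_diff[of "component A (X N1)" "component A (X N1) \<ominus>\<^bsub>A\<^esub> l A"] by simp
    then show ?thesis
      using cnorm_le_norm[OF A, of "X N1"] near[OF A, of N1 N1 1] N1 by fastforce
  qed
  define L where "L = univ_of z l"
  have L: "scal L = z" "\<And>A. cstar_algebra A \<Longrightarrow> component A L = l A"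
    unfolding L_def using univ_of[of l "norm (X N1) + 1"] l(1) bound by auto
  have "X \<longlonglongrightarrow> L"
  proof (rule LIMSEQ_I)
    fix e :: real assume e: "e > 0"
    then obtain N where N: "\<And>m n. m \<ge> N \<Longrightarrow> n \<ge> N \<Longrightarrow> norm (X m - X n) < e/2"
      using CauchyD[OF C, of "e/2"] by auto
    have "norm (X n - L) < e" if n: "n \<ge> N" for n
    proof -
      have "norm (X n - L) \<le> e/2"
      proof (rule norm_univ_leI)
        have "(\<lambda>m. cmod (scal (X n) - scal (X m))) \<longlonglongrightarrow> cmod (scal (X n) - z)" by (intro tendsto_intros z)
        moreover have "\<forall>\<^sub>F m in sequentially. cmod (scal (X n) - scal (X m)) \<le> e/2"
          unfolding eventually_sequentially using N[OF n] cmod_le_norm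
          by (metis less_imp_le order_trans scal_comp_minus(1))
        ultimately show "cmod (scal (X n - L)) \<le> e/2"
          using tendsto_upperbound by (fastforce simp: scal_comp L)
        show "cnorm A (component A (X n - L)) \<le> e/2" if A: "cstar_algebra A" for A
          using near[OF A, of N n "e/2"] N[OF n] A by (simp add: scal_comp L)
      qed
      then show ?thesis using e by simp
    qed
    then show "\<exists>N. \<forall>n\<ge>N. norm (X n - L) < e" by blast
  qed
  then show "convergent X" by (auto simp: convergent_def)
qed

instantiation univ :: (type) unital_cstar
begin

definition "star = (univ_star :: 'a univ \<Rightarrow> 'a univ)"
definition "ii = (univ_ii :: 'a univ)"

instance
proof
  fix x y :: "'a univ" and r :: real
  show "star (star x) = x" "star (x + y) = star x + star y" "star (r *\<^sub>R x) = r *\<^sub>R star x" "star (x * y) = star y * star x"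
    unfolding star_univ_def
    by (rule univ_eqI; simp add: scal_comp cstar_algebra.adj_adj cstar_algebra.adj_add
        cstar_algebra.adj_cscale cstar_algebra.adj_mult)+
  show "star (ii :: 'a univ) = - ii"
    unfolding star_univ_def ii_univ_def
    by (rule univ_eqI; simp add: scal_comp cstar_algebra.adj_cscale cstar_algebra.adj_one cstar_ring
        ring.ring_simprules cstar_algebra.neg_eq_cscale cstar_algebra.cscale_closed cstar_algebra.cscale_cscale)
  show "ii * x = x * ii"
    unfolding ii_univ_def
    by (rule univ_eqI; simp add: scal_comp cstar_algebra.cscale_mult_left cstar_algebra.cscale_mult_right
        cstar_ring ring.ring_simprules cstar_ring[THEN ring.is_monoid, THEN monoid.r_one])
  show "(ii :: 'a univ) * ii = - 1"
    unfolding ii_univ_def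
    by (rule univ_eqI; simp add: scal_comp cstar_algebra.cscale_mult_left cstar_algebra.cscale_closed
        cstar_ring ring.ring_simprules cstar_algebra.cscale_cscale cstar_algebra.neg_eq_cscale)
  show "norm (star x * x) = (norm x)\<^sup>2"
  proof (rule antisym)
    show "norm (star x * x) \<le> (norm x)\<^sup>2"
    proof (rule norm_univ_leI)
      show "cmod (scal (star x * x)) \<le> (norm x)\<^sup>2"
        using cmod_le_norm[of x] by (simp add: star_univ_def scal_comp norm_mult power2_eq_square mult_mono)
      show "cnorm A (component A (star x * x)) \<le> (norm x)\<^sup>2" if "cstar_algebra A" for A
        using cnorm_le_norm[OF that, of x] that
        by (simp add: star_univ_def scal_comp cstar_algebra.cstar_identity power_mono cstar_algebra.cnorm_nonneg)
    qed
    have "norm x \<le> sqrt (norm (star x * x))"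
    proof (rule norm_univ_leI)
      show "cmod (scal x) \<le> sqrt (norm (star x * x))"
        using cmod_le_norm[of "star x * x"]
        by (intro real_le_rsqrt) (simp add: star_univ_def scal_comp norm_mult power2_eq_square)
      show "cnorm A (component A x) \<le> sqrt (norm (star x * x))" if "cstar_algebra A" for A
        using cnorm_le_norm[OF that, of "star x * x"] that
        by (intro real_le_rsqrt) (simp add: star_univ_def scal_comp cstar_algebra.cstar_identity)
    qed
    then show "(norm x)\<^sup>2 \<le> norm (star x * x)" by (metis norm_ge_zero real_le_rsqrt real_sqrt_le_iff real_sqrt_pow2 power_mono)
  qed
qed

end

lemma component_star: "cstar_algebra A \<Longrightarrow> component A (star x) = adj A (component A x)"
  by (simp add: star_univ_def scal_comp)

lemma component_ii: "cstar_algebra A \<Longrightarrow> component A ii = cscale A \<i> \<one>\<^bsub>A\<^esub>"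
  by (simp add: ii_univ_def scal_comp)

text \<open>The embedding as a direct factor: all other components, and the additional complex
  number, are 0. It does not preserve the unit.\<close>

definition emb :: "'a cstar \<Rightarrow> 'a \<Rightarrow> 'a univ" where
  "emb A x = univ_of 0 (\<lambda>B. if B = A \<and> x \<in> carrier A then x else \<zero>\<^bsub>B\<^esub>)"

lemma emb_components:
  assumes "cstar_algebra A" "x \<in> carrier A"
  shows "scal (emb A x) = 0" "component A (emb A x) = x"
    "cstar_algebra B \<Longrightarrow> B \<noteq> A \<Longrightarrow> component B (emb A x) = \<zero>\<^bsub>B\<^esub>"
proof -
  define f where "f B = (if B = A \<and> x \<in> carrier A then x else \<zero>\<^bsub>B\<^esub>)" for B
  have f: "f B \<in> carrier B" "cnorm B (f B) \<le> cnorm A x" if "cstar_algebra B" for B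
    using assms that
    by (auto simp: f_def cstar_ring ring.ring_simprules cstar_algebra.cnorm_zero cstar_algebra.cnorm_nonneg)
  have "emb A x = univ_of 0 f" by (simp add: emb_def f_def[abs_def])
  then have "scal (emb A x) = 0" "\<And>B. cstar_algebra B \<Longrightarrow> component B (emb A x) = f B"
    using univ_of[where f=f and K="cnorm A x" and z=0] f by auto
  then show "scal (emb A x) = 0" "component A (emb A x) = x"
    "cstar_algebra B \<Longrightarrow> B \<noteq> A \<Longrightarrow> component B (emb A x) = \<zero>\<^bsub>B\<^esub>"
    using assms by (auto simp: f_def)
qed

text \<open>Complex multiples of the unit, with \<open>ii\<close> as imaginary unit, for a type
  class whose scalars are real.\<close>

definition csc :: "complex \<Rightarrow> 'a :: unital_cstar" where
  "csc c = Re c *\<^sub>R 1 + Im c *\<^sub>R ii"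

lemma star_csc: "star (csc c) = csc (cnj c)"
  by (simp add: csc_def star_simps star_ii)

lemma csc_commute: "csc c * x = x * csc c"
  by (simp add: csc_def distrib_left distrib_right ii_commute)

lemma csc_mult: "csc c * csc d = csc (c * d)"
  by (simp add: csc_def algebra_simps ii_square scaleR_diff_left)

lemma csc_of_real: "csc (of_real r) = of_real r"
  by (simp add: csc_def of_real_def)

context cstar_algebra
begin

lemma univ_ext_emb:
  assumes "scal F = 0" "\<And>B. cstar_algebra B \<Longrightarrow> B \<noteq> A \<Longrightarrow> component B F = \<zero>\<^bsub>B\<^esub>"
  shows "F = emb A (component A F)"
proof -
  have A: "cstar_algebra A" by unfold_locales
  show ?thesis
  proof (rule univ_eqI)
    show "component B F = component B (emb A (component A F))" if "cstar_algebra B" for B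
      using assms(2)[OF that] emb_components[OF A component_closed[OF A]] that by (cases "B = A") auto
  qed (simp add: emb_components[OF A component_closed[OF A]] assms)
qed

lemma is_cstar: "cstar_algebra A" by unfold_locales

lemma component_emb [simp]: "x \<in> carrier A \<Longrightarrow> component A (emb A x) = x"
  by (rule emb_components(2)[OF is_cstar])

lemma emb_inj: "x \<in> carrier A \<Longrightarrow> y \<in> carrier A \<Longrightarrow> emb A x = emb A y \<longleftrightarrow> x = y"
  using component_emb by metis

lemmas emb_component_simps = scal_comp_plus scal_comp_minus scal_comp_uminus scal_comp_times scal_comp_scaleR
  component_star component_ii scal_comp_zero emb_components[OF is_cstar]

lemma emb_zero [simp]: "emb A \<zero> = 0"
  using univ_ext_emb[of 0] by (simp add: scal_comp is_cstar)

lemma emb_add: "x \<in> carrier A \<Longrightarrow> y \<in> carrier A \<Longrightarrow> emb A (x \<oplus> y) = emb A x + emb A y"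
  by (subst univ_ext_emb[of "emb A x + emb A y"])
    (auto simp: emb_component_simps is_cstar cstar_ring ring.ring_simprules)

lemma emb_neg: "x \<in> carrier A \<Longrightarrow> emb A (\<ominus> x) = - emb A x"
  using emb_add[of x "\<ominus> x"] by (simp add: r_neg eq_neg_iff_add_eq_0 add.commute)

lemma emb_minus: "x \<in> carrier A \<Longrightarrow> y \<in> carrier A \<Longrightarrow> emb A (x \<ominus> y) = emb A x - emb A y"
  by (simp add: a_minus_def emb_add emb_neg)

lemma emb_mult_left: "x \<in> carrier A \<Longrightarrow> F * emb A x = emb A (component A F \<otimes> x)"
  by (subst univ_ext_emb[of "F * emb A x"])
    (auto simp: emb_component_simps is_cstar cstar_ring ring.ring_simprules)

lemma emb_mult_right: "x \<in> carrier A \<Longrightarrow> emb A x * F = emb A (x \<otimes> component A F)"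
  by (subst univ_ext_emb[of "emb A x * F"])
    (auto simp: emb_component_simps is_cstar cstar_ring ring.ring_simprules)

lemma emb_mult: "x \<in> carrier A \<Longrightarrow> y \<in> carrier A \<Longrightarrow> emb A (x \<otimes> y) = emb A x * emb A y"
  by (simp add: emb_mult_left)

lemma component_csc: "component A (csc c) = cscale A c \<one>"
proof -
  have "component A (csc c) = cscale A (of_real (Re c)) \<one> \<oplus> cscale A (of_real (Im c) * \<i>) \<one>"
    by (simp add: csc_def scal_comp component_ii is_cstar cscale_cscale)
  also have "\<dots> = cscale A (of_real (Re c) + of_real (Im c) * \<i>) \<one>" by (simp add: cscale_add_left)
  finally show ?thesis by (metis complex_eq mult.commute)
qed

lemma emb_cscale: "x \<in> carrier A \<Longrightarrow> emb A (cscale A c x) = csc c * emb A x"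
  by (simp add: emb_mult_left component_csc cscale_mult_left)

lemma emb_adj: "x \<in> carrier A \<Longrightarrow> emb A (adj A x) = star (emb A x)"
  by (subst univ_ext_emb[of "star (emb A x)"])
    (auto simp: star_univ_def scal_comp emb_components[OF is_cstar] is_cstar cstar_algebra.adj_zero)

lemma norm_emb: "x \<in> carrier A \<Longrightarrow> norm (emb A x) = cnorm A x"
proof (rule antisym)
  assume x: "x \<in> carrier A"
  show "norm (emb A x) \<le> cnorm A x"
  proof (rule norm_univ_leI)
    show "cnorm B (component B (emb A x)) \<le> cnorm A x" if "cstar_algebra B" for B
      using that x emb_components[OF is_cstar x] by (cases "B = A") (auto simp: cnorm_nonneg cstar_algebra.cnorm_zero)
  qed (simp add: emb_components[OF is_cstar x] cnorm_nonneg x)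
  show "cnorm A x \<le> norm (emb A x)" using cnorm_le_norm[OF is_cstar, of "emb A x"] x by simp
qed

lemma emb_finsum:
  assumes "finite S" "\<And>k. k \<in> S \<Longrightarrow> f k \<in> carrier A"
  shows "emb A (\<Oplus>k\<in>S. f k) = (\<Sum>k\<in>S. emb A (f k))"
  using assms
proof (induction S rule: finite_induct)
  case (insert k S)
  then have "(\<Oplus>k\<in>insert k S. f k) = f k \<oplus> (\<Oplus>k\<in>S. f k)" by (intro finsum_insert) auto
  then show ?case using insert by (simp add: emb_add)
qed simp

lemma emb_unit: "x \<in> carrier A \<Longrightarrow> emb A \<one> * emb A x = emb A x" "x \<in> carrier A \<Longrightarrow> emb A x * emb A \<one> = emb A x"
  by (simp_all flip: emb_mult)

text \<open>Thus \<open>emb A \<one>\<close> is a central projection that cuts out the factor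
  \<open>A\<close>. Elements constructed in the universal algebra, such as roots, inverses and
  limits, are brought back by \<open>component A\<close>.\<close>

lemma emb_component: "F * emb A \<one> = emb A (component A F)" "emb A \<one> * F = emb A (component A F)"
  by (simp_all add: emb_mult_left emb_mult_right is_cstar)

lemma emb_component_limit:
  assumes "(\<lambda>k. emb A (x k)) \<longlonglongrightarrow> L" "\<And>k. x k \<in> carrier A"
  shows "emb A (component A L) = L"
proof -
  have "(\<lambda>k. emb A (x k) * emb A \<one>) \<longlonglongrightarrow> L * emb A \<one>" by (intro tendsto_intros assms)
  then show ?thesis using assms emb_unit(2) LIMSEQ_unique by (fastforce simp: emb_component)
qed

lemma limitin_norm_topology:
  assumes "\<And>k. x k \<in> carrier A"
  shows "limitin (norm_topology A) x l sequentially \<longleftrightarrow> l \<in> carrier A \<and> (\<lambda>k. emb A (x k)) \<longlonglongrightarrow> emb A l"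
proof -
  interpret M: Metric_space "carrier A" "cdist A" by (rule Metric_space_cdist)
  have "cdist A (x k) l = dist (emb A (x k)) (emb A l)" if "l \<in> carrier A" for k
    using assms that by (simp add: cdist_def dist_norm norm_emb flip: emb_minus)
  then show ?thesis
    unfolding M.limit_metric_sequentially using assms by (auto simp: lim_sequentially)
qed

lemma positives_iff: "a \<in> positives A \<longleftrightarrow> a \<in> carrier A \<and> pos (emb A a)"
proof
  assume "a \<in> positives A"
  then obtain x where "x \<in> carrier A" "a = adj A x \<otimes> x" by (auto simp: positives_def)
  then show "a \<in> carrier A \<and> pos (emb A a)" by (simp add: emb_mult emb_adj adj_closed pos_star_mult)
next
  assume a: "a \<in> carrier A \<and> pos (emb A a)"
  \<comment> \<open>\<open>h\<close> need not lie in the factor \<open>A\<close>, but its component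
    there is a root of \<open>a\<close> as well.\<close>
  then obtain h where h: "star h = h" "emb A a = h * h" by (auto simp: pos_def)
  then have "a = adj A (component A h) \<otimes> component A h"
    using a by (metis component_emb component_star is_cstar scal_comp_times(2))
  then show "a \<in> positives A" by (auto simp: positives_def is_cstar)
qed

lemma closed_norm_topologyI:
  assumes "S \<subseteq> carrier A"
    and "\<And>x l. (\<And>k. x k \<in> S) \<Longrightarrow> l \<in> carrier A \<Longrightarrow> (\<lambda>k. emb A (x k)) \<longlonglongrightarrow> emb A l \<Longrightarrow> l \<in> S"
  shows "closedin (norm_topology A) S"
proof -
  interpret M: Metric_space "carrier A" "cdist A" by (rule Metric_space_cdist)
  have "l \<in> S" if "range x \<subseteq> S" "limitin M.mtopology x l sequentially" for x l
    using that assms limitin_norm_topology[of x l] by blast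
  then show ?thesis unfolding M.metric_closedin_iff_sequentially_closed using assms(1) by blast
qed

end

section \<open>Matrix algebras\<close>

abbreviation emb_mat :: "'a cstar \<Rightarrow> (nat \<Rightarrow> nat \<Rightarrow> 'a) \<Rightarrow> nat \<Rightarrow> nat \<Rightarrow> 'a univ" where
  "emb_mat A x \<equiv> (\<lambda>i j. emb A (x i j))"

lemma mat_carrier:
  "x \<in> carrier (mat_alg A n) \<longleftrightarrow> (\<forall>i j. x i j \<in> carrier A) \<and> (\<forall>i j. i \<ge> n \<or> j \<ge> n \<longrightarrow> x i j = \<zero>\<^bsub>A\<^esub>)"
  by (simp add: mat_alg_def)

lemma mat_add: "(x \<oplus>\<^bsub>mat_alg A n\<^esub> y) i j = x i j \<oplus>\<^bsub>A\<^esub> y i j"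
  and mat_zero: "\<zero>\<^bsub>mat_alg A n\<^esub> i j = \<zero>\<^bsub>A\<^esub>"
  and mat_one: "\<one>\<^bsub>mat_alg A n\<^esub> i j = (if i < n \<and> i = j then \<one>\<^bsub>A\<^esub> else \<zero>\<^bsub>A\<^esub>)"
  and mat_cscale: "cscale (mat_alg A n) c x i j = cscale A c (x i j)"
  and mat_adj: "adj (mat_alg A n) x i j = adj A (x j i)"
  by (simp_all add: mat_alg_def)

lemma (in cstar_algebra) emb_mat_mult:
  assumes "x \<in> carrier (mat_alg A n)" "y \<in> carrier (mat_alg A n)"
  shows "emb A ((x \<otimes>\<^bsub>mat_alg A n\<^esub> y) i j) = (\<Sum>k<n. emb A (x i k) * emb A (y k j))"
    and "x \<otimes>\<^bsub>mat_alg A n\<^esub> y \<in> carrier (mat_alg A n)"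
proof -
  have c: "x i j \<in> carrier A" "y i j \<in> carrier A" for i j using assms by (auto simp: mat_carrier)
  show "x \<otimes>\<^bsub>mat_alg A n\<^esub> y \<in> carrier (mat_alg A n)"
    using c by (auto simp: mat_alg_def intro!: finsum_closed)
  show "emb A ((x \<otimes>\<^bsub>mat_alg A n\<^esub> y) i j) = (\<Sum>k<n. emb A (x i k) * emb A (y k j))"
  proof (cases "i < n \<and> j < n")
    case True
    then show ?thesis using c by (simp add: mat_alg_def emb_finsum emb_mult)
  next
    case False
    then have "emb A (x i k) * emb A (y k j) = 0" for k using assms by (auto simp: mat_carrier not_less)
    then show ?thesis using False by (auto simp: mat_alg_def)
  qed
qed

lemma (in cstar_algebra) ring_mat_alg: "ring (mat_alg A n)"
proof (rule ringI)
  let ?M = "mat_alg A n"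
  show "abelian_group ?M"
  proof (rule abelian_groupI)
    fix x y z assume "x \<in> carrier ?M" "y \<in> carrier ?M" "z \<in> carrier ?M"
    then have c: "\<And>i j. x i j \<in> carrier A" "\<And>i j. y i j \<in> carrier A" "\<And>i j. z i j \<in> carrier A"
      by (auto simp: mat_carrier)
    then show "x \<oplus>\<^bsub>?M\<^esub> y \<oplus>\<^bsub>?M\<^esub> z = x \<oplus>\<^bsub>?M\<^esub> (y \<oplus>\<^bsub>?M\<^esub> z)" "x \<oplus>\<^bsub>?M\<^esub> y = y \<oplus>\<^bsub>?M\<^esub> x" "\<zero>\<^bsub>?M\<^esub> \<oplus>\<^bsub>?M\<^esub> x = x"
      by (auto simp: mat_add mat_zero a_ac fun_eq_iff)
  next
    fix x y assume "x \<in> carrier ?M" "y \<in> carrier ?M"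
    then show "x \<oplus>\<^bsub>?M\<^esub> y \<in> carrier ?M" by (auto simp: mat_carrier mat_add)
  next
    fix x assume x: "x \<in> carrier ?M"
    show "\<exists>y\<in>carrier ?M. y \<oplus>\<^bsub>?M\<^esub> x = \<zero>\<^bsub>?M\<^esub>"
      by (rule bexI[of _ "\<lambda>i j. \<ominus> x i j"]) (use x in \<open>auto simp: mat_carrier mat_add mat_zero l_neg fun_eq_iff\<close>)
  qed (auto simp: mat_carrier mat_zero)
  show "Group.monoid ?M"
  proof (rule Group.monoid.intro)
    fix x y z assume xyz: "x \<in> carrier ?M" "y \<in> carrier ?M" "z \<in> carrier ?M"
    then have c: "\<And>i j. x i j \<in> carrier A" "\<And>i j. y i j \<in> carrier A" "\<And>i j. z i j \<in> carrier A"
      by (auto simp: mat_carrier)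
    show "x \<otimes>\<^bsub>?M\<^esub> y \<in> carrier ?M" using emb_mat_mult xyz by blast
    show "x \<otimes>\<^bsub>?M\<^esub> y \<otimes>\<^bsub>?M\<^esub> z = x \<otimes>\<^bsub>?M\<^esub> (y \<otimes>\<^bsub>?M\<^esub> z)"
    proof (intro ext)
      fix i j
      have 1: "x \<otimes>\<^bsub>?M\<^esub> y \<in> carrier ?M" "y \<otimes>\<^bsub>?M\<^esub> z \<in> carrier ?M" using emb_mat_mult xyz by blast+
      have "emb A ((x \<otimes>\<^bsub>?M\<^esub> y \<otimes>\<^bsub>?M\<^esub> z) i j) = (\<Sum>k<n. \<Sum>l<n. emb A (x i l) * emb A (y l k) * emb A (z k j))"
        using xyz 1 by (simp add: emb_mat_mult sum_distrib_right)
      also have "\<dots> = (\<Sum>l<n. \<Sum>k<n. emb A (x i l) * emb A (y l k) * emb A (z k j))" by (rule sum.swap)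
      also have "\<dots> = emb A ((x \<otimes>\<^bsub>?M\<^esub> (y \<otimes>\<^bsub>?M\<^esub> z)) i j)"
        using xyz 1 by (simp add: emb_mat_mult sum_distrib_left mult.assoc)
      finally show "(x \<otimes>\<^bsub>?M\<^esub> y \<otimes>\<^bsub>?M\<^esub> z) i j = (x \<otimes>\<^bsub>?M\<^esub> (y \<otimes>\<^bsub>?M\<^esub> z)) i j"
        using emb_inj emb_mat_mult(2)[OF 1(1) xyz(3)] emb_mat_mult(2)[OF xyz(1) 1(2)] unfolding mat_carrier by blast
    qed
  next
    show one: "\<one>\<^bsub>?M\<^esub> \<in> carrier ?M" by (auto simp: mat_carrier mat_one)
    fix x assume x: "x \<in> carrier ?M"
    then have c: "\<And>i j. x i j \<in> carrier A" "\<And>i j. i \<ge> n \<or> j \<ge> n \<Longrightarrow> x i j = \<zero>" by (auto simp: mat_carrier)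
    show "\<one>\<^bsub>?M\<^esub> \<otimes>\<^bsub>?M\<^esub> x = x"
    proof (intro ext)
      fix i j
      have "emb A ((\<one>\<^bsub>?M\<^esub> \<otimes>\<^bsub>?M\<^esub> x) i j) = (\<Sum>k<n. if k = i then emb A (x i j) else 0)"
        unfolding emb_mat_mult(1)[OF one x] by (rule sum.cong) (auto simp: mat_one emb_unit c)
      then show "(\<one>\<^bsub>?M\<^esub> \<otimes>\<^bsub>?M\<^esub> x) i j = x i j"
        using emb_inj[of "(\<one>\<^bsub>?M\<^esub> \<otimes>\<^bsub>?M\<^esub> x) i j" "x i j"] emb_mat_mult(2)[OF one x] c by (auto simp: mat_carrier not_less split: if_splits)
    qed
    show "x \<otimes>\<^bsub>?M\<^esub> \<one>\<^bsub>?M\<^esub> = x"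
    proof (intro ext)
      fix i j
      have "emb A ((x \<otimes>\<^bsub>?M\<^esub> \<one>\<^bsub>?M\<^esub>) i j) = (\<Sum>k<n. if k = j then emb A (x i j) else 0)"
        unfolding emb_mat_mult(1)[OF x one] by (rule sum.cong) (auto simp: mat_one emb_unit c)
      then show "(x \<otimes>\<^bsub>?M\<^esub> \<one>\<^bsub>?M\<^esub>) i j = x i j"
        using emb_inj[of "(x \<otimes>\<^bsub>?M\<^esub> \<one>\<^bsub>?M\<^esub>) i j" "x i j"] emb_mat_mult(2)[OF x one] c by (auto simp: mat_carrier not_less split: if_splits)
    qed
  qed
  fix x y z assume xyz: "x \<in> carrier ?M" "y \<in> carrier ?M" "z \<in> carrier ?M"
  then have c: "\<And>i j. x i j \<in> carrier A" "\<And>i j. y i j \<in> carrier A" "\<And>i j. z i j \<in> carrier A"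
    by (auto simp: mat_carrier)
  have s: "x \<oplus>\<^bsub>?M\<^esub> y \<in> carrier ?M" using xyz by (auto simp: mat_carrier mat_add)
  have m: "u \<otimes>\<^bsub>?M\<^esub> v \<in> carrier ?M" if "u \<in> carrier ?M" "v \<in> carrier ?M" for u v using emb_mat_mult that by blast
  have m': "(u \<otimes>\<^bsub>?M\<^esub> v) i j \<in> carrier A" if "u \<in> carrier ?M" "v \<in> carrier ?M" for u v i j
    using m[OF that] by (simp add: mat_carrier)
  show "(x \<oplus>\<^bsub>?M\<^esub> y) \<otimes>\<^bsub>?M\<^esub> z = x \<otimes>\<^bsub>?M\<^esub> z \<oplus>\<^bsub>?M\<^esub> y \<otimes>\<^bsub>?M\<^esub> z"
  proof (intro ext)
    fix i j
    have "emb A (((x \<oplus>\<^bsub>?M\<^esub> y) \<otimes>\<^bsub>?M\<^esub> z) i j) = emb A ((x \<otimes>\<^bsub>?M\<^esub> z \<oplus>\<^bsub>?M\<^esub> y \<otimes>\<^bsub>?M\<^esub> z) i j)"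
      using xyz s c by (simp add: emb_mat_mult mat_add emb_add m' distrib_right sum.distrib)
    then show "((x \<oplus>\<^bsub>?M\<^esub> y) \<otimes>\<^bsub>?M\<^esub> z) i j = (x \<otimes>\<^bsub>?M\<^esub> z \<oplus>\<^bsub>?M\<^esub> y \<otimes>\<^bsub>?M\<^esub> z) i j"
      using emb_inj m' s xyz by (simp add: mat_add)
  qed
  show "z \<otimes>\<^bsub>?M\<^esub> (x \<oplus>\<^bsub>?M\<^esub> y) = z \<otimes>\<^bsub>?M\<^esub> x \<oplus>\<^bsub>?M\<^esub> z \<otimes>\<^bsub>?M\<^esub> y"
  proof (intro ext)
    fix i j
    have "emb A ((z \<otimes>\<^bsub>?M\<^esub> (x \<oplus>\<^bsub>?M\<^esub> y)) i j) = emb A ((z \<otimes>\<^bsub>?M\<^esub> x \<oplus>\<^bsub>?M\<^esub> z \<otimes>\<^bsub>?M\<^esub> y) i j)"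
      using xyz s c by (simp add: emb_mat_mult mat_add emb_add m' distrib_left sum.distrib)
    then show "(z \<otimes>\<^bsub>?M\<^esub> (x \<oplus>\<^bsub>?M\<^esub> y)) i j = (z \<otimes>\<^bsub>?M\<^esub> x \<oplus>\<^bsub>?M\<^esub> z \<otimes>\<^bsub>?M\<^esub> y) i j"
      using emb_inj m' s xyz by (simp add: mat_add)
  qed
qed

section \<open>The operator norm on matrices\<close>

context cstar_algebra
begin

lemma module_norm_emb:
  assumes "\<And>j. v j \<in> carrier A"
  shows "module_norm A n v = vec_norm n (\<lambda>j. emb A (v j))"
proof -
  have "cnorm A (\<Oplus>j\<in>{..<n}. adj A (v j) \<otimes> v j) = norm (inner_product n (\<lambda>j. emb A (v j)) (\<lambda>j. emb A (v j)))"
    using assms by (subst norm_emb[symmetric])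
      (auto simp: emb_finsum emb_mult emb_adj adj_closed inner_product_def intro!: finsum_closed)
  then show ?thesis by (simp add: module_norm_def vec_norm_def)
qed

lemma mat_vec_closed:
  assumes "x \<in> carrier (mat_alg A n)" "\<And>j. v j \<in> carrier A"
  shows "(\<Oplus>j\<in>{..<n}. x i j \<otimes> v j) \<in> carrier A"
    and "emb A (\<Oplus>j\<in>{..<n}. x i j \<otimes> v j) = mat_vec n (emb_mat A x) (\<lambda>j. emb A (v j)) i"
proof -
  have "x i j \<in> carrier A" for j using assms by (simp add: mat_carrier)
  then show "(\<Oplus>j\<in>{..<n}. x i j \<otimes> v j) \<in> carrier A"
    "emb A (\<Oplus>j\<in>{..<n}. x i j \<otimes> v j) = mat_vec n (emb_mat A x) (\<lambda>j. emb A (v j)) i"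
    using assms(2) by (auto simp: emb_finsum emb_mult mat_vec_def intro!: finsum_closed)
qed

lemma mat_cnorm_eq:
  assumes x: "x \<in> carrier (mat_alg A n)"
  shows "cnorm (mat_alg A n) x = (SUP v\<in>{v. (\<forall>j. v j \<in> carrier A) \<and> vec_norm n (\<lambda>j. emb A (v j)) \<le> 1}.
    vec_norm n (mat_vec n (emb_mat A x) (\<lambda>j. emb A (v j))))"
proof -
  have "cnorm (mat_alg A n) x = (SUP v\<in>{v. (\<forall>j. v j \<in> carrier A) \<and> module_norm A n v \<le> 1}.
                 module_norm A n (\<lambda>i. \<Oplus>j\<in>{..<n}. x i j \<otimes> v j))" by (simp add: mat_alg_def)
  also have "\<dots> = (SUP v\<in>{v. (\<forall>j. v j \<in> carrier A) \<and> vec_norm n (\<lambda>j. emb A (v j)) \<le> 1}.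
    vec_norm n (mat_vec n (emb_mat A x) (\<lambda>j. emb A (v j))))"
    using mat_vec_closed[OF x] by (intro SUP_cong) (auto simp: module_norm_emb)
  finally show ?thesis .
qed

lemma vec_norm_zero [simp]: "vec_norm n (\<lambda>j. 0) = 0"
  by (simp add: vec_norm_def inner_product_def)

lemma vec_norm_scaleR: "vec_norm n (\<lambda>j. r *\<^sub>R v j) = \<bar>r\<bar> * vec_norm n v"
proof -
  have "inner_product n (\<lambda>j. r *\<^sub>R v j) (\<lambda>j. r *\<^sub>R v j) = (r * r) *\<^sub>R inner_product n v v"
    by (simp add: inner_product_def star_simps scaleR_sum_right)
  then show ?thesis by (simp add: vec_norm_def real_sqrt_mult)
qed

lemma mat_cnorm_leI:
  assumes x: "x \<in> carrier (mat_alg A n)" and K: "K \<ge> 0"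
    and le: "\<And>v. (\<And>j. v j \<in> carrier A) \<Longrightarrow>
      vec_norm n (mat_vec n (emb_mat A x) (\<lambda>j. emb A (v j))) \<le> K * vec_norm n (\<lambda>j. emb A (v j))"
  shows "cnorm (mat_alg A n) x \<le> K"
  unfolding mat_cnorm_eq[OF x]
proof (rule cSUP_least)
  show "{v. (\<forall>j. v j \<in> carrier A) \<and> vec_norm n (\<lambda>j. emb A (v j)) \<le> 1} \<noteq> {}"
    by (auto intro!: exI[of _ "\<lambda>j. \<zero>"])
  fix v assume v: "v \<in> {v. (\<forall>j. v j \<in> carrier A) \<and> vec_norm n (\<lambda>j. emb A (v j)) \<le> 1}"
  then have "vec_norm n (mat_vec n (emb_mat A x) (\<lambda>j. emb A (v j))) \<le> K * vec_norm n (\<lambda>j. emb A (v j))"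
    by (intro le) auto
  also have "\<dots> \<le> K * 1" using v K by (intro mult_left_mono) auto
  finally show "vec_norm n (mat_vec n (emb_mat A x) (\<lambda>j. emb A (v j))) \<le> K" by simp
qed

lemma mat_cnorm_bound:
  assumes x: "x \<in> carrier (mat_alg A n)" and v: "\<And>j. v j \<in> carrier A"
  shows "vec_norm n (mat_vec n (emb_mat A x) (\<lambda>j. emb A (v j)))
    \<le> cnorm (mat_alg A n) x * vec_norm n (\<lambda>j. emb A (v j))"
proof (cases "vec_norm n (\<lambda>j. emb A (v j)) = 0")
  case True
  then show ?thesis using vec_norm_mat_vec_le[of n "emb_mat A x" "\<lambda>j. emb A (v j)"] by simp
next
  case False
  let ?V = "{v. (\<forall>j. v j \<in> carrier A) \<and> vec_norm n (\<lambda>j. emb A (v j)) \<le> 1}"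
  let ?f = "\<lambda>v. vec_norm n (mat_vec n (emb_mat A x) (\<lambda>j. emb A (v j)))"
  define r where "r = vec_norm n (\<lambda>j. emb A (v j))"
  have r: "r > 0" using False vec_norm_nonneg[of n "\<lambda>j. emb A (v j)"] by (simp add: r_def order_less_le)
  define w where "w j = cscale A (of_real (1 / r)) (v j)" for j
  have w: "w j \<in> carrier A" "emb A (w j) = (1 / r) *\<^sub>R emb A (v j)" for j
    using v by (auto simp: w_def cscale_closed emb_cscale csc_def simp del: of_real_divide)
  have "w \<in> ?V" using r by (simp add: w vec_norm_scaleR) (simp add: r_def)
  moreover have "bdd_above (?f ` ?V)"
  proof (rule bdd_aboveI2)
    fix v assume "v \<in> ?V"
    then show "?f v \<le> (\<Sum>i<n. \<Sum>j<n. norm (emb A (x i j))) * 1"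
      by (intro order_trans[OF vec_norm_mat_vec_le] mult_left_mono) (auto intro!: sum_nonneg)
  qed
  ultimately have "?f w \<le> cnorm (mat_alg A n) x" unfolding mat_cnorm_eq[OF x] by (rule cSUP_upper)
  moreover have "mat_vec n (emb_mat A x) (\<lambda>j. emb A (w j)) = (\<lambda>i. (1 / r) *\<^sub>R mat_vec n (emb_mat A x) (\<lambda>j. emb A (v j)) i)"
    by (auto simp: mat_vec_def w scaleR_sum_right)
  ultimately have "(1 / r) * ?f v \<le> cnorm (mat_alg A n) x" using r by (simp add: vec_norm_scaleR)
  then have "?f v \<le> cnorm (mat_alg A n) x * r" using r by (simp add: field_simps)
  then show ?thesis by (simp add: r_def)
qed

lemma mat_cnorm_nonneg: "x \<in> carrier (mat_alg A n) \<Longrightarrow> 0 \<le> cnorm (mat_alg A n) x"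
proof -
  assume x: "x \<in> carrier (mat_alg A n)"
  have "bdd_above ((\<lambda>v. vec_norm n (mat_vec n (emb_mat A x) (\<lambda>j. emb A (v j)))) `
      {v. (\<forall>j. v j \<in> carrier A) \<and> vec_norm n (\<lambda>j. emb A (v j)) \<le> 1})"
  proof (rule bdd_aboveI2)
    fix v assume "v \<in> {v. (\<forall>j. v j \<in> carrier A) \<and> vec_norm n (\<lambda>j. emb A (v j)) \<le> 1}"
    then show "vec_norm n (mat_vec n (emb_mat A x) (\<lambda>j. emb A (v j))) \<le> (\<Sum>i<n. \<Sum>j<n. norm (emb A (x i j))) * 1"
      by (intro order_trans[OF vec_norm_mat_vec_le] mult_left_mono) (auto intro!: sum_nonneg)
  qed
  from cSUP_upper[OF _ this, of "\<lambda>j. \<zero>"]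
  show ?thesis unfolding mat_cnorm_eq[OF x] by (auto intro: order_trans[OF vec_norm_nonneg])
qed

text \<open>Apply \<open>x\<close> to the \<open>j\<close>-th unit vector and read off component
  \<open>i\<close>. Together with \<open>mat_cnorm_le_sum\<close>, the matrix norm and the norms of
  the entries control each other.\<close>

lemma mat_entry_le:
  assumes x: "x \<in> carrier (mat_alg A n)"
  shows "norm (emb A (x i j)) \<le> cnorm (mat_alg A n) x"
proof (cases "i < n \<and> j < n")
  case True
  define v where "v k = (if k = j then \<one> else \<zero>)" for k
  have v: "v k \<in> carrier A" for k by (simp add: v_def)
  have c: "x i k \<in> carrier A" for i k using x by (simp add: mat_carrier)
  have "inner_product n (\<lambda>j. emb A (v j)) (\<lambda>j. emb A (v j)) = (\<Sum>k<n. if k = j then emb A \<one> else 0)"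
    unfolding inner_product_def by (rule sum.cong) (auto simp: v_def adj_one emb_unit simp flip: emb_adj)
  then have "norm (inner_product n (\<lambda>j. emb A (v j)) (\<lambda>j. emb A (v j))) \<le> 1"
    using True cnorm_one by (simp add: norm_emb)
  then have v1: "vec_norm n (\<lambda>j. emb A (v j)) \<le> 1" by (simp add: vec_norm_def)
  have "mat_vec n (emb_mat A x) (\<lambda>j. emb A (v j)) i = (\<Sum>k<n. if k = j then emb A (x i j) else 0)"
    unfolding mat_vec_def by (rule sum.cong) (auto simp: v_def emb_unit c)
  then have "norm (emb A (x i j)) \<le> vec_norm n (mat_vec n (emb_mat A x) (\<lambda>j. emb A (v j)))"
    using norm_component_le[of i n "mat_vec n (emb_mat A x) (\<lambda>j. emb A (v j))"] True by simp
  also have "\<dots> \<le> cnorm (mat_alg A n) x * vec_norm n (\<lambda>j. emb A (v j))" by (rule mat_cnorm_bound[of x n v, OF x v])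
  also have "\<dots> \<le> cnorm (mat_alg A n) x * 1" using mat_cnorm_nonneg[OF x] v1 by (intro mult_left_mono) auto
  finally show ?thesis by simp
next
  case False
  then have "x i j = \<zero>" using x by (auto simp: mat_carrier)
  then show ?thesis using mat_cnorm_nonneg[OF x] by simp
qed

lemma mat_cnorm_le_sum:
  "x \<in> carrier (mat_alg A n) \<Longrightarrow> cnorm (mat_alg A n) x \<le> (\<Sum>i<n. \<Sum>j<n. norm (emb A (x i j)))"
  by (rule mat_cnorm_leI) (auto intro!: sum_nonneg vec_norm_mat_vec_le)

lemma mat_cnorm_triangle:
  assumes x: "x \<in> carrier (mat_alg A n)" and y: "y \<in> carrier (mat_alg A n)"
  shows "cnorm (mat_alg A n) (x \<oplus>\<^bsub>mat_alg A n\<^esub> y) \<le> cnorm (mat_alg A n) x + cnorm (mat_alg A n) y"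
proof (rule mat_cnorm_leI)
  show s: "x \<oplus>\<^bsub>mat_alg A n\<^esub> y \<in> carrier (mat_alg A n)" using x y by (auto simp: mat_carrier mat_add)
  fix v :: "nat \<Rightarrow> 'a" assume v: "\<And>j. v j \<in> carrier A"
  have "mat_vec n (emb_mat A (x \<oplus>\<^bsub>mat_alg A n\<^esub> y)) (\<lambda>j. emb A (v j))
     = (\<lambda>i. mat_vec n (emb_mat A x) (\<lambda>j. emb A (v j)) i + mat_vec n (emb_mat A y) (\<lambda>j. emb A (v j)) i)"
    using x y by (auto simp: mat_vec_def mat_add emb_add mat_carrier distrib_right sum.distrib)
  then show "vec_norm n (mat_vec n (emb_mat A (x \<oplus>\<^bsub>mat_alg A n\<^esub> y)) (\<lambda>j. emb A (v j)))
      \<le> (cnorm (mat_alg A n) x + cnorm (mat_alg A n) y) * vec_norm n (\<lambda>j. emb A (v j))"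
    using vec_norm_triangle[of n "mat_vec n (emb_mat A x) (\<lambda>j. emb A (v j))" "mat_vec n (emb_mat A y) (\<lambda>j. emb A (v j))"]
      mat_cnorm_bound[of x n v, OF x v] mat_cnorm_bound[of y n v, OF y v] by (simp add: distrib_right)
qed (use mat_cnorm_nonneg x y in simp)

lemma mat_cscale_closed: "x \<in> carrier (mat_alg A n) \<Longrightarrow> cscale (mat_alg A n) c x \<in> carrier (mat_alg A n)"
  by (auto simp: mat_carrier mat_cscale cscale_closed cscale_zero_right)

lemma vec_norm_csc: "vec_norm n (\<lambda>j. csc c * v j) = cmod c * vec_norm n v"
proof -
  have "star (csc c * v j) * (csc c * v j) = csc (cnj c * c) * (star (v j) * v j)" for j
    unfolding star_mult star_csc csc_mult[symmetric] by (metis csc_commute mult.assoc)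
  then have "inner_product n (\<lambda>j. csc c * v j) (\<lambda>j. csc c * v j) = csc (cnj c * c) * inner_product n v v"
    by (simp add: inner_product_def sum_distrib_left)
  also have "cnj c * c = of_real ((cmod c)\<^sup>2)" by (metis complex_norm_square mult.commute of_real_power)
  finally have "norm (inner_product n (\<lambda>j. csc c * v j) (\<lambda>j. csc c * v j)) = (cmod c)\<^sup>2 * norm (inner_product n v v)"
    unfolding csc_of_real by (simp add: of_real_def)
  then show ?thesis by (simp add: vec_norm_def real_sqrt_mult)
qed

lemma mat_cnorm_cscale:
  assumes x: "x \<in> carrier (mat_alg A n)"
  shows "cnorm (mat_alg A n) (cscale (mat_alg A n) c x) = cmod c * cnorm (mat_alg A n) x"
proof -
  have le: "cnorm (mat_alg A n) (cscale (mat_alg A n) c x) \<le> cmod c * cnorm (mat_alg A n) x"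
    if x: "x \<in> carrier (mat_alg A n)" for c x
  proof (rule mat_cnorm_leI[OF mat_cscale_closed[OF x]])
    fix v :: "nat \<Rightarrow> 'a" assume v: "\<And>j. v j \<in> carrier A"
    have "mat_vec n (emb_mat A (cscale (mat_alg A n) c x)) (\<lambda>j. emb A (v j))
       = (\<lambda>i. csc c * mat_vec n (emb_mat A x) (\<lambda>j. emb A (v j)) i)"
      using x by (auto simp: mat_vec_def mat_cscale emb_cscale mat_carrier sum_distrib_left mult.assoc)
    then show "vec_norm n (mat_vec n (emb_mat A (cscale (mat_alg A n) c x)) (\<lambda>j. emb A (v j)))
        \<le> cmod c * cnorm (mat_alg A n) x * vec_norm n (\<lambda>j. emb A (v j))"
      using mat_cnorm_bound[of x n v, OF x v] by (simp add: vec_norm_csc mult.assoc mult_left_mono)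
  qed (use mat_cnorm_nonneg x in simp)
  show ?thesis
  proof (cases "c = 0")
    case True
    then show ?thesis using le[OF x, of c] mat_cnorm_nonneg[OF mat_cscale_closed[OF x, of c]] by simp
  next
    case False
    have "cscale (mat_alg A n) (1 / c) (cscale (mat_alg A n) c x) = x"
      using x False by (auto simp: mat_cscale cscale_cscale cscale_one mat_carrier fun_eq_iff)
    then have "cnorm (mat_alg A n) x \<le> cmod (1 / c) * cnorm (mat_alg A n) (cscale (mat_alg A n) c x)"
      using le[OF mat_cscale_closed[OF x], of "1 / c" c] by simp
    then show ?thesis using le[OF x, of c] False by (simp add: norm_divide field_simps)
  qed
qed

lemma mat_cnorm_mult:
  assumes x: "x \<in> carrier (mat_alg A n)" and y: "y \<in> carrier (mat_alg A n)"
  shows "cnorm (mat_alg A n) (x \<otimes>\<^bsub>mat_alg A n\<^esub> y) \<le> cnorm (mat_alg A n) x * cnorm (mat_alg A n) y"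
proof (rule mat_cnorm_leI[OF emb_mat_mult(2)[OF x y]])
  fix v :: "nat \<Rightarrow> 'a" assume v: "\<And>j. v j \<in> carrier A"
  define w where "w i = (\<Oplus>j\<in>{..<n}. y i j \<otimes> v j)" for i
  have w: "w i \<in> carrier A" "emb A (w i) = mat_vec n (emb_mat A y) (\<lambda>j. emb A (v j)) i" for i
    using mat_vec_closed[of y n v, OF y v] by (auto simp: w_def)
  have "mat_vec n (emb_mat A (x \<otimes>\<^bsub>mat_alg A n\<^esub> y)) (\<lambda>j. emb A (v j)) i = mat_vec n (emb_mat A x) (\<lambda>i. emb A (w i)) i" for i
  proof -
    have "mat_vec n (emb_mat A (x \<otimes>\<^bsub>mat_alg A n\<^esub> y)) (\<lambda>j. emb A (v j)) i
        = (\<Sum>j<n. \<Sum>k<n. emb A (x i k) * emb A (y k j) * emb A (v j))"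
      by (simp add: mat_vec_def emb_mat_mult[OF x y] sum_distrib_right)
    also have "\<dots> = (\<Sum>k<n. \<Sum>j<n. emb A (x i k) * emb A (y k j) * emb A (v j))" by (rule sum.swap)
    finally show ?thesis by (simp add: w mat_vec_def sum_distrib_left mult.assoc)
  qed
  then have "vec_norm n (mat_vec n (emb_mat A (x \<otimes>\<^bsub>mat_alg A n\<^esub> y)) (\<lambda>j. emb A (v j)))
      = vec_norm n (mat_vec n (emb_mat A x) (\<lambda>i. emb A (w i)))" by presburger
  also have "\<dots> \<le> cnorm (mat_alg A n) x * vec_norm n (\<lambda>i. emb A (w i))" by (rule mat_cnorm_bound[of x n w, OF x w(1)])
  also have "\<dots> \<le> cnorm (mat_alg A n) x * (cnorm (mat_alg A n) y * vec_norm n (\<lambda>i. emb A (v i)))"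
    using mat_cnorm_bound[of y n v, OF y v] mat_cnorm_nonneg[OF x] by (simp add: w mult_left_mono)
  finally show "vec_norm n (mat_vec n (emb_mat A (x \<otimes>\<^bsub>mat_alg A n\<^esub> y)) (\<lambda>j. emb A (v j)))
    \<le> cnorm (mat_alg A n) x * cnorm (mat_alg A n) y * vec_norm n (\<lambda>i. emb A (v i))" by (simp add: mult.assoc)
qed (use mat_cnorm_nonneg x y in simp)

lemma mat_adj_closed: "x \<in> carrier (mat_alg A n) \<Longrightarrow> adj (mat_alg A n) x \<in> carrier (mat_alg A n)"
  by (auto simp: mat_carrier mat_adj adj_closed adj_zero)

lemma mat_adj_adj: "x \<in> carrier (mat_alg A n) \<Longrightarrow> adj (mat_alg A n) (adj (mat_alg A n) x) = x"
  by (auto simp: mat_carrier mat_adj adj_adj fun_eq_iff)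

text \<open>The squared norm of \<open>x v\<close> is the norm of the inner product of
  \<open>v\<close> with the product of the adjoint of \<open>x\<close>, \<open>x\<close> and
  \<open>v\<close>. The Cauchy-Schwarz inequality bounds it by the norm of the adjoint times
  \<open>x\<close>; that the adjoint is isometric follows by cancelling a factor as in
  \<open>norm_star\<close>.\<close>

lemma mat_cstar_identity:
  assumes x: "x \<in> carrier (mat_alg A n)"
  shows "cnorm (mat_alg A n) (adj (mat_alg A n) x \<otimes>\<^bsub>mat_alg A n\<^esub> x) = (cnorm (mat_alg A n) x)\<^sup>2"
proof -
  let ?M = "mat_alg A n"
  have ge: "(cnorm ?M x)\<^sup>2 \<le> cnorm ?M (adj ?M x \<otimes>\<^bsub>?M\<^esub> x)" if x: "x \<in> carrier ?M" for x
  proof -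
    have xx: "adj ?M x \<otimes>\<^bsub>?M\<^esub> x \<in> carrier ?M" using emb_mat_mult(2) mat_adj_closed x by blast
    have "cnorm ?M x \<le> sqrt (cnorm ?M (adj ?M x \<otimes>\<^bsub>?M\<^esub> x))"
    proof (rule mat_cnorm_leI[OF x])
      fix v :: "nat \<Rightarrow> 'a" assume v: "\<And>j. v j \<in> carrier A"
      let ?v = "\<lambda>j. emb A (v j)" and ?X = "emb_mat A x"
      have "mat_vec n (\<lambda>i j. star (?X j i)) (mat_vec n ?X ?v) = mat_vec n (emb_mat A (adj ?M x \<otimes>\<^bsub>?M\<^esub> x)) ?v"
      proof
        fix i
        have "mat_vec n (\<lambda>i j. star (?X j i)) (mat_vec n ?X ?v) i = (\<Sum>k<n. \<Sum>j<n. star (?X k i) * ?X k j * ?v j)"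
          by (simp add: mat_vec_def sum_distrib_left mult.assoc)
        also have "\<dots> = (\<Sum>j<n. \<Sum>k<n. star (?X k i) * ?X k j * ?v j)" by (rule sum.swap)
        also have "\<dots> = mat_vec n (emb_mat A (adj ?M x \<otimes>\<^bsub>?M\<^esub> x)) ?v i"
        proof -
          have "x i j \<in> carrier A" for i j using x by (simp add: mat_carrier)
          then show ?thesis
            by (simp add: mat_vec_def emb_mat_mult[OF mat_adj_closed[OF x] x] mat_adj emb_adj sum_distrib_right)
        qed
        finally show "mat_vec n (\<lambda>i j. star (?X j i)) (mat_vec n ?X ?v) i = mat_vec n (emb_mat A (adj ?M x \<otimes>\<^bsub>?M\<^esub> x)) ?v i" .
      qed
      then have "inner_product n ?v (mat_vec n (emb_mat A (adj ?M x \<otimes>\<^bsub>?M\<^esub> x)) ?v)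
          = inner_product n (mat_vec n ?X ?v) (mat_vec n ?X ?v)"
        using inner_product_mat_vec[of n ?v "\<lambda>i j. star (?X j i)" "mat_vec n ?X ?v"] by simp
      then have "(vec_norm n (mat_vec n ?X ?v))\<^sup>2 = norm (inner_product n ?v (mat_vec n (emb_mat A (adj ?M x \<otimes>\<^bsub>?M\<^esub> x)) ?v))"
        by (simp add: norm_inner_self)
      also have "\<dots> \<le> vec_norm n ?v * (cnorm ?M (adj ?M x \<otimes>\<^bsub>?M\<^esub> x) * vec_norm n ?v)"
        by (intro order_trans[OF inner_product_Cauchy_Schwarz] mult_left_mono mat_cnorm_bound xx v) simp
      also have "\<dots> = (sqrt (cnorm ?M (adj ?M x \<otimes>\<^bsub>?M\<^esub> x)) * vec_norm n ?v)\<^sup>2"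
        using mat_cnorm_nonneg[OF xx] by (simp add: power_mult_distrib power2_eq_square)
      finally show "vec_norm n (mat_vec n ?X ?v) \<le> sqrt (cnorm ?M (adj ?M x \<otimes>\<^bsub>?M\<^esub> x)) * vec_norm n ?v"
        by (rule power2_le_imp_le) (simp add: mat_cnorm_nonneg[OF xx])
    qed (simp add: mat_cnorm_nonneg[OF xx])
    then show ?thesis using mat_cnorm_nonneg[OF x] mat_cnorm_nonneg[OF xx]
      by (metis power_mono real_sqrt_pow2)
  qed
  have adj_le: "cnorm ?M x \<le> cnorm ?M (adj ?M x)" if x: "x \<in> carrier ?M" for x
  proof (cases "cnorm ?M x = 0")
    case False
    have "cnorm ?M x * cnorm ?M x \<le> cnorm ?M (adj ?M x) * cnorm ?M x"
      using order_trans[OF ge[OF x] mat_cnorm_mult[OF mat_adj_closed[OF x] x]] by (simp add: power2_eq_square)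
    then show ?thesis using False mat_cnorm_nonneg[OF x] by simp
  qed (use mat_cnorm_nonneg[OF mat_adj_closed[OF x]] in simp)
  have "cnorm ?M (adj ?M x) = cnorm ?M x"
    using adj_le[OF x] adj_le[OF mat_adj_closed[OF x]] mat_adj_adj[OF x] by simp
  then show ?thesis
    using ge[OF x] mat_cnorm_mult[OF mat_adj_closed[OF x] x] by (simp add: power2_eq_square)
qed

lemma mat_minus: "x \<in> carrier (mat_alg A n) \<Longrightarrow> y \<in> carrier (mat_alg A n) \<Longrightarrow>
    (x \<ominus>\<^bsub>mat_alg A n\<^esub> y) i j = x i j \<ominus> y i j"
proof -
  assume x: "x \<in> carrier (mat_alg A n)" and y: "y \<in> carrier (mat_alg A n)"
  interpret M: ring "mat_alg A n" by (rule ring_mat_alg)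
  have n: "(\<lambda>i j. \<ominus> y i j) \<in> carrier (mat_alg A n)" using y by (auto simp: mat_carrier)
  have "(\<lambda>i j. \<ominus> y i j) \<oplus>\<^bsub>mat_alg A n\<^esub> y = \<zero>\<^bsub>mat_alg A n\<^esub>"
    using y by (auto simp: mat_add mat_zero fun_eq_iff mat_carrier l_neg)
  then have "\<ominus>\<^bsub>mat_alg A n\<^esub> y = (\<lambda>i j. \<ominus> y i j)" using M.minus_equality n y by blast
  then show ?thesis by (simp add: a_minus_def mat_add)
qed

text \<open>Cauchy sequences converge entrywise, and the entries of the limit lie in
  \<open>A\<close> by \<open>emb_component_limit\<close>. The metric axioms are verified by hand,
  because \<open>Metric_space_cdist\<close> presupposes all axioms of \<open>cstar_algebra\<close>,
  of which completeness is one.\<close>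

lemma mat_complete: "Metric_space.mcomplete (carrier (mat_alg A n)) (cdist (mat_alg A n))"
proof -
  let ?M = "mat_alg A n"
  interpret M: ring ?M by (rule ring_mat_alg)
  have e_minus: "emb A ((x \<ominus>\<^bsub>?M\<^esub> y) i j) = emb A (x i j) - emb A (y i j)"
    if "x \<in> carrier ?M" "y \<in> carrier ?M" for x y i j
    using that by (simp add: mat_minus emb_minus mat_carrier)
  interpret D: Metric_space "carrier ?M" "cdist ?M"
  proof
    fix x y z
    show "0 \<le> cdist ?M x y" by (simp add: cdist_def mat_cnorm_nonneg)
    have "y \<ominus>\<^bsub>?M\<^esub> x = cscale ?M (-1) (x \<ominus>\<^bsub>?M\<^esub> y)" if "x \<in> carrier ?M" "y \<in> carrier ?M"
    proof (intro ext)
      fix i j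
      have "x i j \<in> carrier A" "y i j \<in> carrier A" using that by (auto simp: mat_carrier)
      then show "(y \<ominus>\<^bsub>?M\<^esub> x) i j = cscale ?M (-1) (x \<ominus>\<^bsub>?M\<^esub> y) i j"
        unfolding mat_minus[OF that] mat_minus[OF that(2,1)] mat_cscale
        by (simp add: minus_add minus_minus a_minus_def a_comm flip: neg_eq_cscale)
    qed
    then show "cdist ?M x y = cdist ?M y x"
      by (auto simp: cdist_def mat_cnorm_cscale)
    show "cdist ?M x y = 0 \<longleftrightarrow> x = y" if xy: "x \<in> carrier ?M" "y \<in> carrier ?M"
    proof
      assume 0: "cdist ?M x y = 0"
      have "emb A (x i j) - emb A (y i j) = 0" for i j
        using mat_entry_le[of "x \<ominus>\<^bsub>?M\<^esub> y" n i j] 0 xy by (simp add: cdist_def e_minus)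
      then have "x i j = y i j" for i j
        using xy emb_inj[of "x i j" "y i j"] by (auto simp: mat_carrier)
      then show "x = y" by blast
    next
      assume "x = y"
      then have "cdist ?M x y \<le> 0"
        using mat_cnorm_le_sum[of "x \<ominus>\<^bsub>?M\<^esub> y" n] xy by (simp add: cdist_def e_minus)
      then show "cdist ?M x y = 0" using xy mat_cnorm_nonneg[of "x \<ominus>\<^bsub>?M\<^esub> y" n] by (simp add: cdist_def)
    qed
    have "x \<ominus>\<^bsub>?M\<^esub> z = (x \<ominus>\<^bsub>?M\<^esub> y) \<oplus>\<^bsub>?M\<^esub> (y \<ominus>\<^bsub>?M\<^esub> z)"
      if "x \<in> carrier ?M" "y \<in> carrier ?M" "z \<in> carrier ?M"
      using that by (simp add: M.minus_eq M.a_assoc) (simp add: M.a_assoc[symmetric] M.l_neg)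
    then show "cdist ?M x z \<le> cdist ?M x y + cdist ?M y z"
      if "x \<in> carrier ?M" "y \<in> carrier ?M" "z \<in> carrier ?M"
      using that mat_cnorm_triangle[of "x \<ominus>\<^bsub>?M\<^esub> y" n "y \<ominus>\<^bsub>?M\<^esub> z"] by (simp add: cdist_def)
  qed
  show ?thesis
    unfolding D.mcomplete_def
  proof (intro allI impI)
    fix x assume "D.MCauchy x"
    then have x: "\<And>k. x k \<in> carrier ?M" and C: "\<And>e. e > 0 \<Longrightarrow> \<exists>N. \<forall>k k'. N \<le> k \<longrightarrow> N \<le> k' \<longrightarrow> cdist ?M (x k) (x k') < e"
      unfolding D.MCauchy_def by auto
    have "Cauchy (\<lambda>k. emb A (x k i j))" for i j
    proof (rule CauchyI)
      fix e :: real assume "e > 0"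
      from C[OF this] obtain N where N: "\<And>k k'. N \<le> k \<Longrightarrow> N \<le> k' \<Longrightarrow> cdist ?M (x k) (x k') < e" by blast
      have "norm (emb A (x k i j) - emb A (x k' i j)) < e" if "N \<le> k" "N \<le> k'" for k k'
        using N[OF that] mat_entry_le[of "x k \<ominus>\<^bsub>?M\<^esub> x k'" n i j] x by (simp add: cdist_def e_minus)
      then show "\<exists>M. \<forall>m\<ge>M. \<forall>n\<ge>M. norm (emb A (x m i j) - emb A (x n i j)) < e" by blast
    qed
    then have "\<exists>L. (\<lambda>k. emb A (x k i j)) \<longlonglongrightarrow> L" for i j using Cauchy_convergent convergent_def by blast
    then obtain L where L: "\<And>i j. (\<lambda>k. emb A (x k i j)) \<longlonglongrightarrow> L i j" by metis
    define l where "l i j = (if i < n \<and> j < n then component A (L i j) else \<zero>)" for i j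
    have l: "l \<in> carrier ?M" by (auto simp: l_def mat_carrier is_cstar)
    have el: "emb A (l i j) = L i j" if "i < n" "j < n" for i j
      using emb_component_limit[OF L, of i j] x that by (simp add: l_def mat_carrier)
    have "(\<lambda>k. \<Sum>i<n. \<Sum>j<n. norm (emb A (x k i j) - emb A (l i j))) \<longlonglongrightarrow> (\<Sum>i<n. \<Sum>j<n. norm (L i j - L i j))"
      by (intro tendsto_intros tendsto_sum) (auto simp: el intro!: L tendsto_intros)
    then have lim: "(\<lambda>k. \<Sum>i<n. \<Sum>j<n. norm (emb A (x k i j) - emb A (l i j))) \<longlonglongrightarrow> 0" by simp
    have "\<exists>N. \<forall>k\<ge>N. cdist ?M (x k) l < e" if "e > 0" for e
    proof -
      from order_tendstoD(2)[OF lim that] obtain N where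
        "\<And>k. k \<ge> N \<Longrightarrow> (\<Sum>i<n. \<Sum>j<n. norm (emb A (x k i j) - emb A (l i j))) < e"
        by (auto simp: eventually_sequentially)
      moreover have "cdist ?M (x k) l \<le> (\<Sum>i<n. \<Sum>j<n. norm (emb A (x k i j) - emb A (l i j)))" for k
        using mat_cnorm_le_sum[of "x k \<ominus>\<^bsub>?M\<^esub> l" n] x l by (simp add: cdist_def e_minus)
      ultimately show ?thesis by (meson order_le_less_trans)
    qed
    then show "\<exists>l. limitin D.mtopology x l sequentially"
      unfolding D.limit_metric_sequentially using x l by (intro exI[of _ l]) auto
  qed
qed

theorem cstar_mat_alg: "cstar_algebra (mat_alg A n)"
proof -
  let ?M = "mat_alg A n"
  interpret M: ring ?M by (rule ring_mat_alg)
  have c: "x i j \<in> carrier A" if "x \<in> carrier ?M" for x i j using that by (simp add: mat_carrier)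
  have eqI: "x = y" if "x \<in> carrier ?M" "y \<in> carrier ?M" "\<And>i j. emb A (x i j) = emb A (y i j)" for x y
  proof (intro ext)
    fix i j show "x i j = y i j" using that emb_inj c by blast
  qed
  show ?thesis
  proof
    fix x y c d assume x: "x \<in> carrier ?M"
    show "cscale ?M c x \<in> carrier ?M" by (rule mat_cscale_closed[OF x])
    show "cscale ?M (c + d) x = cscale ?M c x \<oplus>\<^bsub>?M\<^esub> cscale ?M d x"
      "cscale ?M c (cscale ?M d x) = cscale ?M (c * d) x" "cscale ?M 1 x = x"
      using x by (auto simp: fun_eq_iff mat_cscale mat_add cscale_add_left cscale_cscale cscale_one mat_carrier)
    show "adj ?M x \<in> carrier ?M" "adj ?M (adj ?M x) = x" using x mat_adj_closed mat_adj_adj by auto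
    show "adj ?M (cscale ?M c x) = cscale ?M (cnj c) (adj ?M x)"
      using x by (auto simp: fun_eq_iff mat_cscale mat_adj adj_cscale mat_carrier)
    show "0 \<le> cnorm ?M x" "cnorm ?M (cscale ?M c x) = cmod c * cnorm ?M x"
      "cnorm ?M (adj ?M x \<otimes>\<^bsub>?M\<^esub> x) = (cnorm ?M x)\<^sup>2"
      using x mat_cnorm_nonneg mat_cnorm_cscale mat_cstar_identity by auto
    show "cnorm ?M x = 0 \<longleftrightarrow> x = \<zero>\<^bsub>?M\<^esub>"
    proof
      assume "cnorm ?M x = 0"
      then show "x = \<zero>\<^bsub>?M\<^esub>" using mat_entry_le[OF x] x by (intro eqI) (auto simp: mat_zero)
    next
      assume "x = \<zero>\<^bsub>?M\<^esub>"
      then show "cnorm ?M x = 0" using mat_cnorm_le_sum[OF x] mat_cnorm_nonneg[OF x] by (simp add: mat_zero)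
    qed
    assume y: "y \<in> carrier ?M"
    show "cscale ?M c (x \<oplus>\<^bsub>?M\<^esub> y) = cscale ?M c x \<oplus>\<^bsub>?M\<^esub> cscale ?M c y"
      using x y by (auto simp: fun_eq_iff mat_cscale mat_add cscale_add_right mat_carrier)
    show "cscale ?M c x \<otimes>\<^bsub>?M\<^esub> y = cscale ?M c (x \<otimes>\<^bsub>?M\<^esub> y)"
      using x y mat_cscale_closed emb_mat_mult(2)
      by (intro eqI) (auto simp: emb_mat_mult mat_cscale emb_cscale c sum_distrib_left mult.assoc)
    have "csc c * (u * v) = u * (csc c * v)" for u v :: "'a univ" by (metis csc_commute mult.assoc)
    then show "x \<otimes>\<^bsub>?M\<^esub> cscale ?M c y = cscale ?M c (x \<otimes>\<^bsub>?M\<^esub> y)"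
      using x y mat_cscale_closed emb_mat_mult(2)
      by (intro eqI) (auto simp: emb_mat_mult mat_cscale emb_cscale c sum_distrib_left)
    show "adj ?M (x \<oplus>\<^bsub>?M\<^esub> y) = adj ?M x \<oplus>\<^bsub>?M\<^esub> adj ?M y"
      using x y by (auto simp: fun_eq_iff mat_adj mat_add adj_add mat_carrier)
    show "adj ?M (x \<otimes>\<^bsub>?M\<^esub> y) = adj ?M y \<otimes>\<^bsub>?M\<^esub> adj ?M x"
      using x y mat_adj_closed emb_mat_mult(2)
      by (intro eqI) (auto simp: emb_mat_mult mat_adj emb_adj c star_sum star_mult)
    show "cnorm ?M (x \<oplus>\<^bsub>?M\<^esub> y) \<le> cnorm ?M x + cnorm ?M y" "cnorm ?M (x \<otimes>\<^bsub>?M\<^esub> y) \<le> cnorm ?M x * cnorm ?M y"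
      using x y mat_cnorm_triangle mat_cnorm_mult by auto
  qed (rule mat_complete)
qed

lemma mat_limit:
  assumes "\<And>k. x k \<in> carrier (mat_alg A n)" "l \<in> carrier (mat_alg A n)"
  shows "limitin (norm_topology (mat_alg A n)) x l sequentially \<longleftrightarrow>
    (\<forall>i<n. \<forall>j<n. (\<lambda>k. emb A (x k i j)) \<longlonglongrightarrow> emb A (l i j))"
proof -
  let ?M = "mat_alg A n"
  interpret M: cstar_algebra ?M by (rule cstar_mat_alg)
  have nd: "norm (emb ?M (x k) - emb ?M l) = cnorm ?M (x k \<ominus>\<^bsub>?M\<^esub> l)" for k
    using assms by (simp add: M.norm_emb flip: M.emb_minus)
  have e_minus: "emb A ((x k \<ominus>\<^bsub>?M\<^esub> l) i j) = emb A (x k i j) - emb A (l i j)" for i j k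
    using assms by (simp add: mat_minus emb_minus mat_carrier)
  show ?thesis
    unfolding M.limitin_norm_topology[OF assms(1)]
  proof (intro iffI conjI allI impI)
    fix i j assume "l \<in> carrier ?M \<and> (\<lambda>k. emb ?M (x k)) \<longlonglongrightarrow> emb ?M l"
    then have "(\<lambda>k. norm (emb ?M (x k) - emb ?M l)) \<longlonglongrightarrow> 0" by (simp add: LIM_zero_iff tendsto_norm_zero)
    then have "(\<lambda>k. emb A (x k i j) - emb A (l i j)) \<longlonglongrightarrow> 0"
      by (rule Lim_null_comparison[rotated])
        (use mat_entry_le[of "x _ \<ominus>\<^bsub>?M\<^esub> l" n i j] assms in \<open>auto simp: nd e_minus\<close>)
    then show "(\<lambda>k. emb A (x k i j)) \<longlonglongrightarrow> emb A (l i j)" by (simp add: LIM_zero_iff)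
  next
    assume L: "\<forall>i<n. \<forall>j<n. (\<lambda>k. emb A (x k i j)) \<longlonglongrightarrow> emb A (l i j)"
    have "(\<lambda>k. \<Sum>i<n. \<Sum>j<n. norm (emb A (x k i j) - emb A (l i j))) \<longlonglongrightarrow> (\<Sum>i<n. \<Sum>j<n. norm (emb A (l i j) - emb A (l i j)))"
      using L by (intro tendsto_sum tendsto_intros) auto
    then have "(\<lambda>k. \<Sum>i<n. \<Sum>j<n. norm (emb A (x k i j) - emb A (l i j))) \<longlonglongrightarrow> 0" by simp
    then have "(\<lambda>k. emb ?M (x k) - emb ?M l) \<longlonglongrightarrow> 0"
      by (rule Lim_null_comparison[rotated])
        (use mat_cnorm_le_sum[of "x _ \<ominus>\<^bsub>?M\<^esub> l" n] assms in \<open>auto simp: nd e_minus\<close>)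
    then show "(\<lambda>k. emb ?M (x k)) \<longlonglongrightarrow> emb ?M l" by (simp add: LIM_zero_iff)
  qed (rule assms(2))
qed

end

section \<open>A Hahn--Banach theorem for commutative monoids\<close>

text \<open>The map \<open>neg\<close> plays the role of negation: it is only an inverse as far as \<open>p\<close> can see. This
  covers the monoid of formal differences of a commutative monoid without forming a quotient.\<close>

definition sublinear_on :: "('g, 'm) monoid_scheme \<Rightarrow> ('g \<Rightarrow> 'g) \<Rightarrow> ('g \<Rightarrow> real) \<Rightarrow> bool" where
  "sublinear_on G neg p \<longleftrightarrow>
     (\<forall>x\<in>carrier G. \<forall>y\<in>carrier G. p (x \<otimes>\<^bsub>G\<^esub> y) \<le> p x + p y) \<and>
     (\<forall>x\<in>carrier G. \<forall>n. p (x [^]\<^bsub>G\<^esub> (n::nat)) = real n * p x) \<and>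
     (\<forall>w\<in>carrier G. \<forall>x\<in>carrier G. p (w \<otimes>\<^bsub>G\<^esub> (x \<otimes>\<^bsub>G\<^esub> neg x)) = p w)"

context comm_monoid
begin

lemma sublinear_one: "sublinear_on G neg p \<Longrightarrow> p \<one> = 0"
  unfolding sublinear_on_def using nat_pow_0 by (metis mult_zero_left of_nat_0 one_closed)

lemma sublinear_lower:
  assumes p: "sublinear_on G neg p" and neg: "neg x \<in> carrier G" and x: "x \<in> carrier G" and w: "w \<in> carrier G"
  shows "p (w \<otimes> x) \<ge> p w - p (neg x)"
proof -
  have "p w = p (w \<otimes> (x \<otimes> neg x))" using p x w by (simp add: sublinear_on_def)
  also have "\<dots> = p ((w \<otimes> x) \<otimes> neg x)" using x neg w by (simp add: m_assoc)
  also have "\<dots> \<le> p (w \<otimes> x) + p (neg x)" using p x neg w by (simp add: sublinear_on_def)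
  finally show ?thesis by simp
qed

text \<open>Each member satisfies \<open>p x \<ge> - p0 (neg x)\<close>, so the infima are finite.
  For subadditivity the two summands refer to different members of the chain, the smaller of which
  serves both.\<close>

lemma sublinear_chain_inf:
  fixes C :: "('a \<Rightarrow> real) set"
  assumes neg: "\<And>x. x \<in> carrier G \<Longrightarrow> neg x \<in> carrier G"
    and C: "C \<noteq> {}" "\<And>p. p \<in> C \<Longrightarrow> sublinear_on G neg p"
    and chain: "\<And>p q. p \<in> C \<Longrightarrow> q \<in> C \<Longrightarrow> (\<forall>x. p x \<le> q x) \<or> (\<forall>x. q x \<le> p x)"
    and bound: "\<And>p x. p \<in> C \<Longrightarrow> x \<in> carrier G \<Longrightarrow> p x \<le> p0 x"
  shows "sublinear_on G neg (\<lambda>x. INF p\<in>C. p x)"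
    and "\<And>p x. p \<in> C \<Longrightarrow> x \<in> carrier G \<Longrightarrow> (INF p\<in>C. p x) \<le> p x"
proof -
  have bdd: "bdd_below ((\<lambda>p. p x) ` C)" if x: "x \<in> carrier G" for x
  proof (rule bdd_belowI2)
    fix p assume p: "p \<in> C"
    show "- p0 (neg x) \<le> p x"
      using sublinear_lower[OF C(2)[OF p] neg[OF x] x one_closed] sublinear_one[OF C(2)[OF p]] bound[OF p neg[OF x]] x
      by simp
  qed
  show le: "(INF p\<in>C. p x) \<le> p x" if "p \<in> C" "x \<in> carrier G" for p x
    by (rule cINF_lower[OF bdd[OF that(2)] that(1)])
  show "sublinear_on G neg (\<lambda>x. INF p\<in>C. p x)"
    unfolding sublinear_on_def
  proof (intro conjI ballI allI)
    fix x y assume xy: "x \<in> carrier G" "y \<in> carrier G"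
    have 1: "(INF p\<in>C. p (x \<otimes> y)) \<le> p x + q y" if pq: "p \<in> C" "q \<in> C" for p q
    proof -
      from chain[OF pq] obtain r where r: "r \<in> C" "\<forall>x. r x \<le> p x" "\<forall>x. r x \<le> q x" using pq by blast
      have "r (x \<otimes> y) \<le> r x + r y" using C(2)[OF r(1)] xy by (simp add: sublinear_on_def)
      then show ?thesis using le[OF r(1), of "x \<otimes> y"] r(2,3) xy by (meson add_mono m_closed order_trans)
    qed
    have "(INF p\<in>C. p (x \<otimes> y)) - q y \<le> (INF p\<in>C. p x)" if q: "q \<in> C" for q
      by (rule cINF_greatest[OF C(1)]) (use 1 q in \<open>simp add: algebra_simps\<close>)
    then have "(INF p\<in>C. p (x \<otimes> y)) - (INF p\<in>C. p x) \<le> (INF q\<in>C. q y)"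
      by (intro cINF_greatest[OF C(1)]) (simp add: algebra_simps)
    then show "(INF p\<in>C. p (x \<otimes> y)) \<le> (INF p\<in>C. p x) + (INF p\<in>C. p y)" by simp
  next
    fix x and n :: nat assume x: "x \<in> carrier G"
    have eq: "p (x [^] n) = real n * p x" if "p \<in> C" for p using C(2)[OF that] x by (simp add: sublinear_on_def)
    show "(INF p\<in>C. p (x [^] n)) = real n * (INF p\<in>C. p x)"
    proof (cases "n = 0")
      case True
      have "(INF p\<in>C. p \<one>) = (INF p\<in>C. (0::real))"
        by (intro INF_cong) (auto dest: sublinear_one[OF C(2)])
      then show ?thesis using True C(1) by simp
    next
      case False
      have "real n * (INF p\<in>C. p x) \<le> (INF p\<in>C. p (x [^] n))"
      proof (rule cINF_greatest[OF C(1)])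
        fix p assume p: "p \<in> C"
        show "real n * (INF p\<in>C. p x) \<le> p (x [^] n)" using le[OF p x] eq[OF p] by (simp add: mult_left_mono)
      qed
      moreover have "(INF p\<in>C. p (x [^] n)) / real n \<le> (INF p\<in>C. p x)"
      proof (rule cINF_greatest[OF C(1)])
        fix p assume p: "p \<in> C"
        show "(INF p\<in>C. p (x [^] n)) / real n \<le> p x"
          using le[OF p nat_pow_closed[OF x], of n] eq[OF p] False by (simp add: field_simps)
      qed
      ultimately show ?thesis using False by (simp add: field_simps)
    qed
  next
    fix w x assume "w \<in> carrier G" "x \<in> carrier G"
    then show "(INF p\<in>C. p (w \<otimes> (x \<otimes> neg x))) = (INF p\<in>C. p w)"
      using C(2) by (intro INF_cong) (auto simp: sublinear_on_def)
  qed
qed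

text \<open>\<open>q\<close> is \<open>p\<close> diminished by its failure to be additive in the
  direction \<open>y\<close>. Where \<open>p\<close> is minimal, \<open>q = p\<close>, and the last
  estimate becomes \<open>p x + p y \<le> p (x \<otimes> y)\<close>, the converse of
  subadditivity.\<close>

lemma sublinear_shift:
  assumes neg: "\<And>x. x \<in> carrier G \<Longrightarrow> neg x \<in> carrier G"
    and p: "sublinear_on G neg p" and y: "y \<in> carrier G"
  defines "q \<equiv> (\<lambda>x. INF k. p (x \<otimes> y [^] (k::nat)) - real k * p y)"
  shows "sublinear_on G neg q" and "\<And>x. x \<in> carrier G \<Longrightarrow> q x \<le> p x"
    and "\<And>x. x \<in> carrier G \<Longrightarrow> q x \<le> p (x \<otimes> y) - p y"
proof -
  have q_eq: "q x = (INF k. p (x \<otimes> y [^] (k::nat)) - real k * p y)" for x by (simp add: q_def)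
  have sub: "p (a \<otimes> b) \<le> p a + p b" if "a \<in> carrier G" "b \<in> carrier G" for a b
    using p that by (simp add: sublinear_on_def)
  have hom: "p (a [^] n) = real n * p a" if "a \<in> carrier G" for a and n :: nat
    using p that by (simp add: sublinear_on_def)
  have bdd: "bdd_below (range (\<lambda>k. p (x \<otimes> y [^] (k::nat)) - real k * p y))" if x: "x \<in> carrier G" for x
  proof (rule bdd_belowI2)
    fix k :: nat
    show "- p (neg x) \<le> p (x \<otimes> y [^] k) - real k * p y"
      using sublinear_lower[OF p neg[OF x] x, of "y [^] k"] hom[OF y] x y by (simp add: m_comm)
  qed
  have le: "q x \<le> p (x \<otimes> y [^] k) - real k * p y" if "x \<in> carrier G" for x and k :: nat
    unfolding q_def by (rule cINF_lower[OF bdd[OF that]]) simp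
  show "q x \<le> p x" if "x \<in> carrier G" for x using le[OF that, of 0] that by simp
  show "q x \<le> p (x \<otimes> y) - p y" if "x \<in> carrier G" for x using le[OF that, of 1] that y by simp
  show "sublinear_on G neg q"
    unfolding sublinear_on_def
  proof (intro conjI ballI allI)
    fix a b assume ab: "a \<in> carrier G" "b \<in> carrier G"
    have 1: "q (a \<otimes> b) \<le> (p (a \<otimes> y [^] k) - real k * p y) + (p (b \<otimes> y [^] l) - real l * p y)" for k l :: nat
    proof -
      have "(a \<otimes> b) \<otimes> y [^] (k + l) = (a \<otimes> y [^] k) \<otimes> (b \<otimes> y [^] l)"
        using ab y by (simp add: nat_pow_mult[symmetric] m_ac)
      then show ?thesis
        using le[of "a \<otimes> b" "k + l"] sub[of "a \<otimes> y [^] k" "b \<otimes> y [^] l"] ab y by (simp add: algebra_simps)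
    qed
    have "q (a \<otimes> b) - (p (b \<otimes> y [^] l) - real l * p y) \<le> q a" for l :: nat
      unfolding q_eq[of a] by (rule cINF_greatest) (use 1 in \<open>auto simp: algebra_simps\<close>)
    then have "q (a \<otimes> b) - q a \<le> q b"
      unfolding q_eq[of b] by (intro cINF_greatest) (auto simp: algebra_simps)
    then show "q (a \<otimes> b) \<le> q a + q b" by simp
  next
    fix x and n :: nat assume x: "x \<in> carrier G"
    show "q (x [^] n) = real n * q x"
    proof (cases "n = 0")
      case True
      then show ?thesis using hom[OF y] y by (simp add: q_def)
    next
      case False
      have "real n * q x \<le> q (x [^] n)"
        unfolding q_eq[of "x [^] n"]
      proof (rule cINF_greatest)
        fix k :: nat
        \<comment> \<open>Homogeneity compares the exponents \<open>k\<close> and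
          \<open>n * k\<close> of \<open>y\<close>; the surplus \<open>n * k - k\<close> is split
          off by subadditivity.\<close>
        have "x [^] n \<otimes> y [^] (n * k) = (x [^] n \<otimes> y [^] k) \<otimes> y [^] (n * k - k)"
          using x y False by (simp add: m_assoc nat_pow_mult)
        then have "p (x [^] n \<otimes> y [^] (n * k)) \<le> p (x [^] n \<otimes> y [^] k) + real (n * k - k) * p y"
          using sub[of "x [^] n \<otimes> y [^] k" "y [^] (n * k - k)"] hom[OF y] x y by simp
        moreover have e: "x [^] n \<otimes> y [^] (n * k) = (x \<otimes> y [^] k) [^] n"
          using x y by (simp add: nat_pow_distrib nat_pow_pow mult.commute)
        moreover have "real (n * k - k) = real n * real k - real k" using False by (simp add: of_nat_diff)
        then have "real (n * k - k) * p y = real n * (real k * p y) - real k * p y"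
          by (simp only: left_diff_distrib mult.assoc)
        moreover have "real n * q x \<le> real n * (p (x \<otimes> y [^] k) - real k * p y)"
          using le[OF x, of k] by (rule mult_left_mono) simp
        then have "real n * q x \<le> real n * p (x \<otimes> y [^] k) - real n * (real k * p y)"
          by (simp only: right_diff_distrib)
        moreover have "p ((x \<otimes> y [^] k) [^] n) = real n * p (x \<otimes> y [^] k)" using hom x y by simp
        ultimately show "real n * q x \<le> p (x [^] n \<otimes> y [^] k) - real k * p y"
          unfolding e by linarith
      qed simp
      moreover have "q (x [^] n) / real n \<le> q x"
        unfolding q_eq[of x]
      proof (rule cINF_greatest)
        fix k :: nat
        have "x [^] n \<otimes> y [^] (n * k) = (x \<otimes> y [^] k) [^] n"
          using x y by (simp add: nat_pow_distrib nat_pow_pow mult.commute)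
        then have "q (x [^] n) \<le> real n * (p (x \<otimes> y [^] k) - real k * p y)"
          using le[of "x [^] n" "n * k"] hom[of "x \<otimes> y [^] k" n] x y by (simp add: algebra_simps)
        then show "q (x [^] n) / real n \<le> p (x \<otimes> y [^] k) - real k * p y"
          using False by (simp add: field_simps)
      qed simp
      ultimately show ?thesis using False by (simp add: field_simps)
    qed
  next
    fix w x assume wx: "w \<in> carrier G" "x \<in> carrier G"
    have "p (w \<otimes> (x \<otimes> neg x) \<otimes> y [^] k) = p (w \<otimes> y [^] k)" for k :: nat
    proof -
      have "w \<otimes> (x \<otimes> neg x) \<otimes> y [^] k = (w \<otimes> y [^] k) \<otimes> (x \<otimes> neg x)"
        using wx neg y by (simp add: m_ac)
      then show ?thesis using p wx y by (simp add: sublinear_on_def)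
    qed
    then show "q (w \<otimes> (x \<otimes> neg x)) = q w" by (simp add: q_def)
  qed
qed

theorem additive_below_sublinear:
  assumes neg: "\<And>x. x \<in> carrier G \<Longrightarrow> neg x \<in> carrier G" and p0: "sublinear_on G neg p0"
  obtains f :: "'a \<Rightarrow> real" where
    "\<And>x y. x \<in> carrier G \<Longrightarrow> y \<in> carrier G \<Longrightarrow> f (x \<otimes> y) = f x + f y"
    "\<And>x. x \<in> carrier G \<Longrightarrow> f x \<le> p0 x"
    "\<And>x. x \<in> carrier G \<Longrightarrow> f (neg x) = - f x"
proof -
  define \<P> where "\<P> = {p. sublinear_on G neg p \<and> (\<forall>x. x \<notin> carrier G \<longrightarrow> p x = 0) \<and> (\<forall>x\<in>carrier G. p x \<le> p0 x)}"
  \<comment> \<open>The order is reversed, since \<open>predicate_Zorn\<close> yields maximal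
    elements. Members of \<open>\<P>\<close> vanish off the carrier, so that values there do not
    interfere with minimality.\<close>
  define P where "P p q \<longleftrightarrow> (\<forall>x. q x \<le> p x)" for p q :: "'a \<Rightarrow> real"
  have restrict: "sublinear_on G neg (\<lambda>x. if x \<in> carrier G then p x else 0)" if "sublinear_on G neg p" for p
    using that neg by (simp add: sublinear_on_def)
  have "\<exists>m\<in>\<P>. \<forall>a\<in>\<P>. P m a \<longrightarrow> a = m"
  proof (rule predicate_Zorn)
    show "partial_order_on \<P> (relation_of P \<P>)"
      by (rule partial_order_on_relation_ofI) (auto simp: P_def fun_eq_iff intro: order_trans order_antisym)
    fix C assume "C \<in> Chains (relation_of P \<P>)"
    then have C: "C \<subseteq> \<P>" "\<And>p q. p \<in> C \<Longrightarrow> q \<in> C \<Longrightarrow> P p q \<or> P q p"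
      by (auto simp: Chains_def relation_of_def)
    show "\<exists>u\<in>\<P>. \<forall>a\<in>C. P a u"
    proof (cases "C = {}")
      case True
      have "(\<lambda>x. if x \<in> carrier G then p0 x else 0) \<in> \<P>" using restrict[OF p0] by (auto simp: \<P>_def)
      then show ?thesis using True by blast
    next
      case False
      let ?u = "\<lambda>x. INF p\<in>C. p x"
      have 1: "sublinear_on G neg ?u" "\<And>p x. p \<in> C \<Longrightarrow> x \<in> carrier G \<Longrightarrow> ?u x \<le> p x"
        by (rule sublinear_chain_inf[where ?p0.0=p0, OF neg False]; use C in \<open>force simp: \<P>_def P_def\<close>)+
      obtain p where p: "p \<in> C" using False by blast
      have "?u x \<le> p0 x" if "x \<in> carrier G" for x
        using 1(2)[OF p that] C(1) p that by (fastforce simp: \<P>_def)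
      then have "(\<lambda>x. if x \<in> carrier G then ?u x else 0) \<in> \<P>"
        using restrict[OF 1(1)] by (auto simp: \<P>_def)
      moreover have "P a (\<lambda>x. if x \<in> carrier G then ?u x else 0)" if "a \<in> C" for a
      proof -
        have "a x = 0" if "x \<notin> carrier G" for x using C(1) that \<open>a \<in> C\<close> by (auto simp: \<P>_def)
        then show ?thesis using 1(2)[OF that] by (simp add: P_def)
      qed
      ultimately show ?thesis by blast
    qed
  qed
  then obtain f where f: "f \<in> \<P>" and min: "\<And>a. a \<in> \<P> \<Longrightarrow> P f a \<Longrightarrow> a = f" by blast
  have sf: "sublinear_on G neg f" using f by (simp add: \<P>_def)
  have add: "f (x \<otimes> y) = f x + f y" if x: "x \<in> carrier G" and y: "y \<in> carrier G" for x y
  proof -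
    define q where "q = (\<lambda>x. INF k. f (x \<otimes> y [^] (k::nat)) - real k * f y)"
    have q: "sublinear_on G neg q" "\<And>x. x \<in> carrier G \<Longrightarrow> q x \<le> f x" "\<And>x. x \<in> carrier G \<Longrightarrow> q x \<le> f (x \<otimes> y) - f y"
      using sublinear_shift[OF neg sf y] by (auto simp: q_def)
    have "(\<lambda>x. if x \<in> carrier G then q x else 0) \<in> \<P>"
      using restrict[OF q(1)] f q(2) by (fastforce simp: \<P>_def)
    moreover have "P f (\<lambda>x. if x \<in> carrier G then q x else 0)"
      using q(2) f by (auto simp: P_def \<P>_def)
    ultimately have "(\<lambda>x. if x \<in> carrier G then q x else 0) = f" by (rule min)
    from fun_cong[OF this, of x] have "q x = f x" using x by simp
    then have "f x + f y \<le> f (x \<otimes> y)" using q(3)[OF x] by simp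
    moreover have "f (x \<otimes> y) \<le> f x + f y" using sf x y by (simp add: sublinear_on_def)
    ultimately show ?thesis by simp
  qed
  have "f (neg x) = - f x" if x: "x \<in> carrier G" for x
  proof -
    have "f (\<one> \<otimes> (x \<otimes> neg x)) = f \<one>" using sf x by (simp add: sublinear_on_def)
    then show ?thesis using add[OF x neg[OF x]] sublinear_one[OF sf] x neg[OF x] by simp
  qed
  with add show ?thesis using that[of f] f by (auto simp: \<P>_def)
qed

end

section \<open>States on ordered monoids\<close>

locale positively_ordered_monoid = comm_monoid G for G (structure) +
  fixes le :: "'a \<Rightarrow> 'a \<Rightarrow> bool" (infix "\<preceq>" 50)
  assumes le_refl: "x \<in> carrier G \<Longrightarrow> x \<preceq> x"
    and le_trans: "\<lbrakk>x \<in> carrier G; y \<in> carrier G; z \<in> carrier G; x \<preceq> y; y \<preceq> z\<rbrakk> \<Longrightarrow> x \<preceq> z"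
    and le_mult: "\<lbrakk>x \<in> carrier G; y \<in> carrier G; z \<in> carrier G; w \<in> carrier G; x \<preceq> y; z \<preceq> w\<rbrakk> \<Longrightarrow> x \<otimes> z \<preceq> y \<otimes> w"
    and one_le: "x \<in> carrier G \<Longrightarrow> \<one> \<preceq> x"
begin

lemma le_pow: "\<lbrakk>x \<in> carrier G; y \<in> carrier G; x \<preceq> y\<rbrakk> \<Longrightarrow> x [^] (n::nat) \<preceq> y [^] n"
  by (induction n) (auto intro: le_refl le_mult)

lemma le_mult_right: "\<lbrakk>x \<in> carrier G; y \<in> carrier G\<rbrakk> \<Longrightarrow> x \<preceq> x \<otimes> y"
  using le_mult[of x x \<one> y] one_le[of y] le_refl[of x] by simp

text \<open>Iterating the relation \<open>L\<close> times keeps a single copy of \<open>s\<close>,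
  which in the end costs only \<open>N\<close> copies of \<open>u\<close>:
  \<open>t [^] (L * j) \<preceq> u [^] (L * m + N)\<close>. For \<open>L > N\<close> this excludes
  \<open>j > m\<close>.\<close>

lemma cancel_exponent:
  assumes t: "t \<in> carrier G" and u: "u \<in> carrier G" and s: "s \<in> carrier G"
    and unit: "\<exists>N. s \<preceq> u [^] (N::nat)"
    and nle: "\<And>m n :: nat. t [^] n \<preceq> u [^] m \<Longrightarrow> n \<le> m"
    and le: "t [^] (j::nat) \<otimes> s \<preceq> u [^] (m::nat) \<otimes> s"
  shows "j \<le> m"
proof (rule ccontr)
  assume "\<not> j \<le> m"
  obtain N :: nat where N: "s \<preceq> u [^] N" using unit by blast
  have iter: "t [^] (L * j) \<otimes> s \<preceq> u [^] (L * m) \<otimes> s" for L :: nat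
  proof (induction L)
    case 0 then show ?case using s by (simp add: le_refl)
  next
    case (Suc L)
    have 1: "t [^] (Suc L * j) \<otimes> s = t [^] j \<otimes> (t [^] (L * j) \<otimes> s)"
      using t s by (simp add: nat_pow_mult m_assoc[symmetric])
    have 2: "t [^] j \<otimes> (u [^] (L * m) \<otimes> s) = u [^] (L * m) \<otimes> (t [^] j \<otimes> s)"
      using t u s by (simp add: m_ac)
    have 3: "u [^] (Suc L * m) \<otimes> s = u [^] (L * m) \<otimes> (u [^] m \<otimes> s)"
      using u s by (simp add: nat_pow_mult m_assoc[symmetric] add.commute)
    have "t [^] j \<otimes> (t [^] (L * j) \<otimes> s) \<preceq> t [^] j \<otimes> (u [^] (L * m) \<otimes> s)"
       by (rule le_mult) (use Suc t u s in \<open>auto intro: le_refl\<close>)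
    moreover have "u [^] (L * m) \<otimes> (t [^] j \<otimes> s) \<preceq> u [^] (L * m) \<otimes> (u [^] m \<otimes> s)"
       by (rule le_mult) (use le t u s in \<open>auto intro: le_refl\<close>)
    ultimately show ?case unfolding 1 2 3 using t u s
      by (meson le_trans m_closed nat_pow_closed)
  qed
  define L where "L = Suc N"
  have A: "t [^] (L * j) \<preceq> t [^] (L * j) \<otimes> s" using t s by (intro le_mult_right) auto
  have B: "u [^] (L * m) \<otimes> s \<preceq> u [^] (L * m) \<otimes> u [^] N"  by (rule le_mult) (use u s N in \<open>auto intro: le_refl\<close>)
  have "t [^] (L * j) \<preceq> u [^] (L * m) \<otimes> s"
    by (rule le_trans[OF _ _ _ A iter]) (use t u s in auto)
  then have "t [^] (L * j) \<preceq> u [^] (L * m) \<otimes> u [^] N"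
    by (rule le_trans[OF _ _ _ _ B, rotated -1]) (use t u s in auto)
  then have "L * j \<le> L * m + N" using nle u by (simp add: nat_pow_mult)
  moreover have "L * Suc m \<le> L * j" using \<open>\<not> j \<le> m\<close> by (intro mult_le_mono) auto
  ultimately show False by (simp add: L_def)
qed

text \<open>The upper estimates for \<open>f x - f y\<close> that the order imposes on every
  additive monotone \<open>f\<close> with \<open>f u \<le> 1 \<le> f t\<close>. The common summand
  \<open>s\<close> makes up for the lack of cancellation, as in a Grothendieck group.\<close>

definition quotients :: "'a \<Rightarrow> 'a \<Rightarrow> 'a \<Rightarrow> 'a \<Rightarrow> real set" where
  "quotients t u x y = {(real m - real j) / real k | (k::nat) (j::nat) (m::nat) s.
     k > 0 \<and> s \<in> carrier G \<and> x [^] k \<otimes> t [^] j \<otimes> s \<preceq> u [^] m \<otimes> y [^] k \<otimes> s}"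

lemma quotientsI:
  "\<lbrakk>k > 0; s \<in> carrier G; x [^] k \<otimes> t [^] j \<otimes> s \<preceq> u [^] m \<otimes> y [^] k \<otimes> s\<rbrakk>
    \<Longrightarrow> (real m - real j) / real k \<in> quotients t u x y" for k j m :: nat
  unfolding quotients_def by blast

lemma quotients_add:
  assumes c: "t \<in> carrier G" "u \<in> carrier G" "x \<in> carrier G" "y \<in> carrier G" "x' \<in> carrier G" "y' \<in> carrier G"
    and d: "d \<in> quotients t u x y" and d': "d' \<in> quotients t u x' y'"
  shows "d + d' \<in> quotients t u (x \<otimes> x') (y \<otimes> y')"
proof -
  obtain k j m :: nat and s where 1: "d = (real m - real j) / real k" "k > 0" "s \<in> carrier G"
    "x [^] k \<otimes> t [^] j \<otimes> s \<preceq> u [^] m \<otimes> y [^] k \<otimes> s" using d by (auto simp: quotients_def)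
  obtain k' j' m' :: nat and s' where 2: "d' = (real m' - real j') / real k'" "k' > 0" "s' \<in> carrier G"
    "x' [^] k' \<otimes> t [^] j' \<otimes> s' \<preceq> u [^] m' \<otimes> y' [^] k' \<otimes> s'" using d' by (auto simp: quotients_def)
  let ?s = "s [^] k' \<otimes> s' [^] k"
  have "(x [^] k \<otimes> t [^] j \<otimes> s) [^] k' \<otimes> (x' [^] k' \<otimes> t [^] j' \<otimes> s') [^] k
      \<preceq> (u [^] m \<otimes> y [^] k \<otimes> s) [^] k' \<otimes> (u [^] m' \<otimes> y' [^] k' \<otimes> s') [^] k"
    by (rule le_mult) (use 1 2 c in \<open>auto intro!: le_pow\<close>)
  moreover have "(x [^] k \<otimes> t [^] j \<otimes> s) [^] k' \<otimes> (x' [^] k' \<otimes> t [^] j' \<otimes> s') [^] k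
      = (x \<otimes> x') [^] (k * k') \<otimes> t [^] (j * k' + j' * k) \<otimes> ?s"
    using 1 2 c by (simp add: nat_pow_distrib nat_pow_pow nat_pow_mult[symmetric] m_ac mult.commute)
  moreover have "(u [^] m \<otimes> y [^] k \<otimes> s) [^] k' \<otimes> (u [^] m' \<otimes> y' [^] k' \<otimes> s') [^] k
      = u [^] (m * k' + m' * k) \<otimes> (y \<otimes> y') [^] (k * k') \<otimes> ?s"
    using 1 2 c by (simp add: nat_pow_distrib nat_pow_pow nat_pow_mult[symmetric] m_ac mult.commute)
  ultimately have "(x \<otimes> x') [^] (k * k') \<otimes> t [^] (j * k' + j' * k) \<otimes> ?s
      \<preceq> u [^] (m * k' + m' * k) \<otimes> (y \<otimes> y') [^] (k * k') \<otimes> ?s" by simp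
  moreover have "d + d' = (real (m * k' + m' * k) - real (j * k' + j' * k)) / real (k * k')"
    unfolding 1(1) 2(1) using 1(2) 2(2) by (simp add: field_simps)
  moreover have "k * k' > 0" "?s \<in> carrier G" using 1 2 by auto
  ultimately show ?thesis unfolding quotients_def by blast
qed

text \<open>Goodearl and Handelman's extension theorem: the functional \<open>p\<^sub>0(x - y) = inf (quotients t u x y)\<close>
  forces additive functionals below it to satisfy \<open>f u \<le> 1 \<le> f t\<close>.\<close>

theorem state_exists:
  assumes t: "t \<in> carrier G" and u: "u \<in> carrier G"
    and unit: "\<And>x. x \<in> carrier G \<Longrightarrow> \<exists>N. x \<preceq> u [^] (N::nat)"
    and nle: "\<And>m n :: nat. t [^] n \<preceq> u [^] m \<Longrightarrow> n \<le> m"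
  obtains f :: "'a \<Rightarrow> real" where
    "\<And>x y. x \<in> carrier G \<Longrightarrow> y \<in> carrier G \<Longrightarrow> f (x \<otimes> y) = f x + f y"
    "\<And>x. x \<in> carrier G \<Longrightarrow> 0 \<le> f x"
    "\<And>x y. x \<in> carrier G \<Longrightarrow> y \<in> carrier G \<Longrightarrow> x \<preceq> y \<Longrightarrow> f x \<le> f y"
    "f u = 1" "1 \<le> f t"
proof -
  define H where "H = \<lparr>carrier = carrier G \<times> carrier G, monoid.mult = (\<lambda>a b. (fst a \<otimes> fst b, snd a \<otimes> snd b)), one = (\<one>, \<one>)\<rparr>"
  have H: "carrier H = carrier G \<times> carrier G" "\<And>a b. a \<otimes>\<^bsub>H\<^esub> b = (fst a \<otimes> fst b, snd a \<otimes> snd b)" "\<one>\<^bsub>H\<^esub> = (\<one>, \<one>)"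
    by (simp_all add: H_def)
  interpret H: comm_monoid H
    by (rule comm_monoidI) (auto simp: H m_ac)
  have pow: "a [^]\<^bsub>H\<^esub> (n::nat) = (fst a [^] n, snd a [^] n)" for a n
    by (induction n) (auto simp: H)
  define neg where "neg = (\<lambda>a :: 'a \<times> 'a. (snd a, fst a))"
  let ?D = "quotients t u"
  define p where "p a = Inf (?D (fst a) (snd a))" for a
  have D_ne: "\<exists>N. real N \<in> ?D x y" if "x \<in> carrier G" "y \<in> carrier G" for x y
  proof -
    obtain N :: nat where N: "x \<preceq> u [^] N" using unit[of x] \<open>x \<in> carrier G\<close> by auto
    have "u [^] N \<preceq> u [^] N \<otimes> y" using that u by (intro le_mult_right) auto
    then have "x \<preceq> u [^] N \<otimes> y" by (rule le_trans[OF _ _ _ N, rotated -1]) (use that u in auto)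
    then have "real N \<in> ?D x y" using quotientsI[of 1 \<one> x t 0 u N y] that u t by simp
    then show ?thesis by blast
  qed
  \<comment> \<open>A negative quotient on the diagonal would say
    \<open>t [^] j \<preceq> u [^] m\<close> with \<open>j > m\<close>, up to a common summand; this
    is where \<open>nle\<close> enters.\<close>
  have D_diag: "d \<ge> 0" if d: "d \<in> ?D w w" and w: "w \<in> carrier G" for d w
  proof -
    obtain k j m :: nat and s where 1: "d = (real m - real j) / real k" "k > 0" "s \<in> carrier G"
      "w [^] k \<otimes> t [^] j \<otimes> s \<preceq> u [^] m \<otimes> w [^] k \<otimes> s" using d by (auto simp: quotients_def)
    have "t [^] j \<otimes> (w [^] k \<otimes> s) \<preceq> u [^] m \<otimes> (w [^] k \<otimes> s)"
      using 1(3,4) w t u by (simp add: m_ac)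
    moreover have sc: "w [^] k \<otimes> s \<in> carrier G" using 1 w by simp
    ultimately have "j \<le> m" using cancel_exponent[OF t u sc unit[OF sc] nle] by blast
    then show ?thesis using 1 by simp
  qed
  \<comment> \<open>Adding a fixed element of the opposite set leads to the diagonal case.\<close>
  have bdd: "bdd_below (?D x y)" if xy: "x \<in> carrier G" "y \<in> carrier G" for x y
  proof -
    obtain e where e: "e \<in> ?D y x" using D_ne xy by blast
    have "- e \<le> d" if "d \<in> ?D x y" for d
      using D_diag[of "d + e" "x \<otimes> y"] quotients_add[OF t u xy xy(2,1) that e] xy by (simp add: m_comm)
    then show ?thesis by (rule bdd_belowI)
  qed
  have p_le: "p (x, y) \<le> d" if "d \<in> ?D x y" "x \<in> carrier G" "y \<in> carrier G" for d x y
    unfolding p_def using cInf_lower[OF _ bdd] that by simp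
  have p_ge: "c \<le> p (x, y)" if "\<And>d. d \<in> ?D x y \<Longrightarrow> c \<le> d" "x \<in> carrier G" "y \<in> carrier G" for c x y
    unfolding p_def using cInf_greatest[of "?D x y"] D_ne[OF that(2,3)] that(1) by auto
  have "sublinear_on H neg p"
    unfolding sublinear_on_def
  proof (intro conjI ballI allI)
    fix a b assume "a \<in> carrier H" "b \<in> carrier H"
    then obtain x y x' y' where ab: "a = (x, y)" "b = (x', y')" "x \<in> carrier G" "y \<in> carrier G" "x' \<in> carrier G" "y' \<in> carrier G"
      by (auto simp: H)
    have 1: "p (x \<otimes> x', y \<otimes> y') \<le> d + d'" if "d \<in> ?D x y" "d' \<in> ?D x' y'" for d d'
      using p_le quotients_add[OF t u ab(3-6) that] ab by simp
    have "p (x \<otimes> x', y \<otimes> y') - d' \<le> p (x, y)" if "d' \<in> ?D x' y'" for d'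
      using 1[OF _ that] by (intro p_ge ab) (simp add: algebra_simps)
    then have "p (x \<otimes> x', y \<otimes> y') - p (x, y) \<le> p (x', y')"
      by (intro p_ge ab) (simp add: algebra_simps)
    then show "p (a \<otimes>\<^bsub>H\<^esub> b) \<le> p a + p b" by (simp add: H ab)
  next
    fix a and n :: nat assume "a \<in> carrier H"
    then obtain x y where a: "a = (x, y)" "x \<in> carrier G" "y \<in> carrier G" by (auto simp: H)
    show "p (a [^]\<^bsub>H\<^esub> n) = real n * p a"
    proof (cases "n = 0")
      case True
      have "0 \<in> ?D \<one> \<one>" using quotientsI[of 1 \<one> \<one> t 0 u 0 \<one>] le_refl[of \<one>] t u by simp
      then have "p (\<one>, \<one>) \<le> 0" by (rule p_le) auto
      moreover have "0 \<le> p (\<one>, \<one>)" by (rule p_ge) (auto intro: D_diag)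
      ultimately show ?thesis using True by (simp add: H)
    next
      case False
      have "real n * p (x, y) \<le> p (x [^] n, y [^] n)"
      proof (rule p_ge)
        fix d assume "d \<in> ?D (x [^] n) (y [^] n)"
        then obtain k j m :: nat and s where 1: "d = (real m - real j) / real k" "k > 0" "s \<in> carrier G"
          "(x [^] n) [^] k \<otimes> t [^] j \<otimes> s \<preceq> u [^] m \<otimes> (y [^] n) [^] k \<otimes> s" by (auto simp: quotients_def)
        then have "(real m - real j) / real (n * k) \<in> ?D x y" using False a
          by (intro quotientsI[of _ s]) (auto simp: nat_pow_pow)
        then have "p (x, y) \<le> (real m - real j) / real (n * k)" by (rule p_le) (use a in auto)
        then have "real n * p (x, y) \<le> real n * ((real m - real j) / real (n * k))" by (rule mult_left_mono) simp
        also have "\<dots> = d" unfolding 1(1) using False by simp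
        finally show "real n * p (x, y) \<le> d" .
      qed (use a in auto)
      moreover have "p (x [^] n, y [^] n) / real n \<le> p (x, y)"
      proof (rule p_ge)
        fix d assume "d \<in> ?D x y"
        then obtain k j m :: nat and s where 1: "d = (real m - real j) / real k" "k > 0" "s \<in> carrier G"
          "x [^] k \<otimes> t [^] j \<otimes> s \<preceq> u [^] m \<otimes> y [^] k \<otimes> s" by (auto simp: quotients_def)
        have "(x [^] k \<otimes> t [^] j \<otimes> s) [^] n \<preceq> (u [^] m \<otimes> y [^] k \<otimes> s) [^] n"
          using 1 a t u by (intro le_pow) auto
        then have "(x [^] n) [^] k \<otimes> t [^] (j * n) \<otimes> s [^] n \<preceq> u [^] (m * n) \<otimes> (y [^] n) [^] k \<otimes> s [^] n"
          using 1 a t u by (simp add: nat_pow_distrib nat_pow_pow mult.commute)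
        then have "(real (m * n) - real (j * n)) / real k \<in> ?D (x [^] n) (y [^] n)" unfolding quotients_def using 1 by blast
        then have "p (x [^] n, y [^] n) \<le> (real (m * n) - real (j * n)) / real k" by (rule p_le) (use a in auto)
        also have "(real (m * n) - real (j * n)) / real k = real n * d" unfolding 1(1) by (simp add: algebra_simps)
        finally show "p (x [^] n, y [^] n) / real n \<le> d" using False by (simp add: field_simps)
      qed (use a in auto)
      ultimately show ?thesis using False by (simp add: pow a field_simps)
    qed
  next
    fix w a assume "w \<in> carrier H" "a \<in> carrier H"
    then obtain w1 w2 x y where wa: "w = (w1, w2)" "a = (x, y)" "w1 \<in> carrier G" "w2 \<in> carrier G" "x \<in> carrier G" "y \<in> carrier G"
      by (auto simp: H)
    have "?D (w1 \<otimes> (x \<otimes> y)) (w2 \<otimes> (y \<otimes> x)) = ?D w1 w2"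
    proof (intro equalityI subsetI)
      fix d assume "d \<in> ?D (w1 \<otimes> (x \<otimes> y)) (w2 \<otimes> (y \<otimes> x))"
      then obtain k j m :: nat and s where 1: "d = (real m - real j) / real k" "k > 0" "s \<in> carrier G"
        "(w1 \<otimes> (x \<otimes> y)) [^] k \<otimes> t [^] j \<otimes> s \<preceq> u [^] m \<otimes> (w2 \<otimes> (y \<otimes> x)) [^] k \<otimes> s" by (auto simp: quotients_def)
      have "w1 [^] k \<otimes> t [^] j \<otimes> ((x \<otimes> y) [^] k \<otimes> s) \<preceq> u [^] m \<otimes> w2 [^] k \<otimes> ((x \<otimes> y) [^] k \<otimes> s)"
        using 1(3,4) wa t u by (simp add: nat_pow_distrib m_ac)
      moreover have "(x \<otimes> y) [^] k \<otimes> s \<in> carrier G" using 1 wa by simp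
      ultimately show "d \<in> ?D w1 w2" unfolding quotients_def using 1(1,2) by blast
    next
      fix d assume "d \<in> ?D w1 w2"
      then obtain k j m :: nat and s where 1: "d = (real m - real j) / real k" "k > 0" "s \<in> carrier G"
        "w1 [^] k \<otimes> t [^] j \<otimes> s \<preceq> u [^] m \<otimes> w2 [^] k \<otimes> s" by (auto simp: quotients_def)
      have "(x \<otimes> y) [^] k \<otimes> (w1 [^] k \<otimes> t [^] j \<otimes> s) \<preceq> (x \<otimes> y) [^] k \<otimes> (u [^] m \<otimes> w2 [^] k \<otimes> s)"
         by (rule le_mult) (use 1 wa t u in \<open>auto intro: le_refl\<close>)
      then have "(w1 \<otimes> (x \<otimes> y)) [^] k \<otimes> t [^] j \<otimes> s \<preceq> u [^] m \<otimes> (w2 \<otimes> (y \<otimes> x)) [^] k \<otimes> s"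
        using 1(3) wa t u by (simp add: nat_pow_distrib m_ac)
      then show "d \<in> ?D (w1 \<otimes> (x \<otimes> y)) (w2 \<otimes> (y \<otimes> x))" unfolding quotients_def using 1(1-3) by blast
    qed
    then show "p (w \<otimes>\<^bsub>H\<^esub> (a \<otimes>\<^bsub>H\<^esub> neg a)) = p w" by (simp add: p_def H wa neg_def)
  qed
  moreover have "\<And>a. a \<in> carrier H \<Longrightarrow> neg a \<in> carrier H" by (auto simp: H neg_def)
  ultimately obtain f where f_add: "\<And>a b. a \<in> carrier H \<Longrightarrow> b \<in> carrier H \<Longrightarrow> f (a \<otimes>\<^bsub>H\<^esub> b) = f a + f b"
    and f_le: "\<And>a. a \<in> carrier H \<Longrightarrow> f a \<le> p a"
    and f_neg: "\<And>a. a \<in> carrier H \<Longrightarrow> f (neg a) = - f a"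
    using H.additive_below_sublinear[of neg p] by blast
  define F where "F x = f (x, \<one>)" for x
  have F_neg: "f (\<one>, x) = - F x" if "x \<in> carrier G" for x
    using f_neg[of "(x, \<one>)"] that by (simp add: H F_def neg_def)
  have F_diff: "f (x, y) = F x - F y" if "x \<in> carrier G" "y \<in> carrier G" for x y
    using f_add[of "(x, \<one>)" "(\<one>, y)"] F_neg that by (simp add: H F_def)
  have f_le_D: "f (x, y) \<le> real m - real j"
    if "x \<in> carrier G" "y \<in> carrier G" "x \<otimes> t [^] j \<preceq> u [^] m \<otimes> y" for x y and j m :: nat
  proof -
    have "real m - real j \<in> ?D x y" using quotientsI[of 1 \<one> x t j u m y] that t u by simp
    then show ?thesis using f_le[of "(x, y)"] p_le[of "real m - real j" x y] that by (simp add: H)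
  qed
  have F_add: "F (x \<otimes> y) = F x + F y" if "x \<in> carrier G" "y \<in> carrier G" for x y
    using f_add[of "(x, \<one>)" "(y, \<one>)"] that by (simp add: H F_def)
  have F_mono: "F x \<le> F y" if "x \<in> carrier G" "y \<in> carrier G" "x \<preceq> y" for x y
    using f_le_D[of x y 0 0] F_diff[of x y] that by simp
  have F1: "F \<one> = 0" using F_add[of \<one> \<one>] by simp
  have F_nonneg: "0 \<le> F x" if "x \<in> carrier G" for x using F_mono[of \<one> x] one_le that F1 by simp
  have Fu: "F u \<le> 1" using f_le_D[of u \<one> 0 1] u by (simp add: F_def le_refl)
  have Ft: "1 \<le> F t" using f_le_D[of \<one> t 1 0] F_neg[OF t] t by (simp add: le_refl)
  have F_pow: "F (u [^] (N::nat)) = real N * F u" for N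
    using u by (induction N) (auto simp: F1 F_add algebra_simps)
  obtain N :: nat where "t \<preceq> u [^] N" using unit[OF t] by blast
  then have "1 \<le> real N * F u" using F_mono[of t "u [^] N"] Ft F_pow t u by simp
  then have pos: "F u > 0" using F_nonneg[OF u] by (metis mult_eq_0_iff not_one_le_zero order_le_less)
  \<comment> \<open>\<open>F u\<close> may be less than 1; dividing by it normalizes at
    \<open>u\<close> and cannot decrease the value at \<open>t\<close>.\<close>
  show ?thesis
  proof (rule that[of "\<lambda>x. F x / F u"])
    show "1 \<le> F t / F u" using Ft Fu pos by (simp add: field_simps)
  qed (use pos F_add F_mono F_nonneg in \<open>auto simp: add_divide_distrib divide_right_mono\<close>)
qed

end

section \<open>Cuntz comparison of rectangular matrices\<close>

definition mat_conj :: "nat \<Rightarrow> (nat \<Rightarrow> nat \<Rightarrow> 'a) \<Rightarrow> (nat \<Rightarrow> nat \<Rightarrow> 'a) \<Rightarrow> nat \<Rightarrow> nat \<Rightarrow> 'a :: unital_cstar" where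
  "mat_conj m X D i j = (\<Sum>p<m. \<Sum>q<m. X i p * D p q * star (X j q))"

text \<open>Here \<open>B\<close> is an \<open>n \<times> n\<close> matrix, \<open>D\<close> an \<open>m \<times> m\<close> matrix, and the conjugating
  matrices are rectangular.\<close>

definition subequivalent :: "nat \<Rightarrow> nat \<Rightarrow> (nat \<Rightarrow> nat \<Rightarrow> 'a) \<Rightarrow> (nat \<Rightarrow> nat \<Rightarrow> 'a :: unital_cstar) \<Rightarrow> bool" where
  "subequivalent n m B D \<longleftrightarrow> (\<exists>X. \<forall>i<n. \<forall>j<n. (\<lambda>k. mat_conj m (X k) D i j) \<longlonglongrightarrow> B i j)"

definition mat_block :: "nat \<Rightarrow> (nat \<Rightarrow> nat \<Rightarrow> 'a) \<Rightarrow> (nat \<Rightarrow> nat \<Rightarrow> 'a) \<Rightarrow> nat \<Rightarrow> nat \<Rightarrow> 'a :: zero" where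
  "mat_block n B D i j = (if i < n \<and> j < n then B i j else if n \<le> i \<and> n \<le> j then D (i - n) (j - n) else 0)"

lemma mat_conj_conj:
  "mat_conj m X (mat_conj l Y D) i j = mat_conj l (\<lambda>i p. \<Sum>r<m. X i r * Y r p) D i j"
proof -
  have "mat_conj m X (mat_conj l Y D) i j
      = (\<Sum>r<m. \<Sum>s<m. \<Sum>p<l. \<Sum>q<l. X i r * Y r p * D p q * star (X j s * Y s q))"
    by (simp add: mat_conj_def sum_distrib_left sum_distrib_right mult.assoc star_mult)
  also have "\<dots> = (\<Sum>r<m. \<Sum>p<l. \<Sum>s<m. \<Sum>q<l. X i r * Y r p * D p q * star (X j s * Y s q))"
    by (intro sum.cong refl sum.swap)
  also have "\<dots> = (\<Sum>p<l. \<Sum>r<m. \<Sum>s<m. \<Sum>q<l. X i r * Y r p * D p q * star (X j s * Y s q))"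
    by (rule sum.swap)
  also have "\<dots> = (\<Sum>p<l. \<Sum>r<m. \<Sum>q<l. \<Sum>s<m. X i r * Y r p * D p q * star (X j s * Y s q))"
    by (intro sum.cong refl sum.swap)
  also have "\<dots> = (\<Sum>p<l. \<Sum>q<l. \<Sum>r<m. \<Sum>s<m. X i r * Y r p * D p q * star (X j s * Y s q))"
    by (intro sum.cong refl sum.swap)
  also have "\<dots> = (\<Sum>p<l. \<Sum>q<l. \<Sum>s<m. \<Sum>r<m. X i r * Y r p * D p q * star (X j s * Y s q))"
    by (intro sum.cong refl sum.swap)
  also have "\<dots> = mat_conj l (\<lambda>i p. \<Sum>r<m. X i r * Y r p) D i j"
    by (simp add: mat_conj_def sum_distrib_left sum_distrib_right mult.assoc star_sum)
  finally show ?thesis .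
qed

text \<open>A diagonal sequence: for each \<open>k\<close> the inner approximation is chosen so late
  that the finitely many entries are off by less than \<open>1 / Suc k\<close>.\<close>

lemma subequivalent_trans:
  assumes "subequivalent n m B C" and "subequivalent m l C D"
  shows "subequivalent n l B D"
proof -
  obtain X where X: "\<And>i j. i < n \<Longrightarrow> j < n \<Longrightarrow> (\<lambda>k. mat_conj m (X k) C i j) \<longlonglongrightarrow> B i j"
    using assms(1) by (auto simp: subequivalent_def)
  obtain Y where Y: "\<And>i j. i < m \<Longrightarrow> j < m \<Longrightarrow> (\<lambda>k. mat_conj l (Y k) D i j) \<longlonglongrightarrow> C i j"
    using assms(2) by (auto simp: subequivalent_def)
  have "\<exists>h. \<forall>i<n. \<forall>j<n. dist (mat_conj m (X k) (mat_conj l (Y h) D) i j) (mat_conj m (X k) C i j) < 1 / real (Suc k)" for k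
  proof -
    have "(\<lambda>h. mat_conj m (X k) (mat_conj l (Y h) D) i j) \<longlonglongrightarrow> mat_conj m (X k) C i j" for i j
      unfolding mat_conj_def[of m] by (intro tendsto_sum tendsto_intros Y) auto
    then have "\<forall>\<^sub>F h in sequentially. dist (mat_conj m (X k) (mat_conj l (Y h) D) i j) (mat_conj m (X k) C i j) < 1 / real (Suc k)" for i j
      by (rule tendstoD) simp
    then have "\<forall>\<^sub>F h in sequentially. \<forall>i\<in>{..<n}. \<forall>j\<in>{..<n}. dist (mat_conj m (X k) (mat_conj l (Y h) D) i j) (mat_conj m (X k) C i j) < 1 / real (Suc k)"
      by (intro eventually_ball_finite ballI) auto
    then show ?thesis by (auto simp: eventually_sequentially)
  qed
  then obtain h where h: "\<And>k i j. i < n \<Longrightarrow> j < n \<Longrightarrow>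
      dist (mat_conj m (X k) (mat_conj l (Y (h k)) D) i j) (mat_conj m (X k) C i j) < 1 / real (Suc k)"
    by metis
  have "(\<lambda>k. mat_conj m (X k) (mat_conj l (Y (h k)) D) i j) \<longlonglongrightarrow> B i j" if ij: "i < n" "j < n" for i j
  proof -
    have "(\<lambda>k. mat_conj m (X k) (mat_conj l (Y (h k)) D) i j - mat_conj m (X k) C i j) \<longlonglongrightarrow> 0"
      by (rule Lim_null_comparison[OF _ LIMSEQ_inverse_real_of_nat])
        (use h[OF ij] in \<open>auto simp: dist_norm inverse_eq_divide intro!: always_eventually less_imp_le\<close>)
    from tendsto_add[OF this X[OF ij]] show ?thesis by simp
  qed
  then show ?thesis unfolding subequivalent_def mat_conj_conj by (intro exI) auto
qed

lemma subequivalent_reindex: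
  assumes "\<And>i. i < n \<Longrightarrow> \<pi> i < m" and "\<And>i j. i < n \<Longrightarrow> j < n \<Longrightarrow> B i j = D (\<pi> i) (\<pi> j)"
  shows "subequivalent n m B D"
proof -
  define X where "X i p = (if p = \<pi> i then 1 else 0 :: 'a)" for i p
  have "mat_conj m X D i j = B i j" if "i < n" "j < n" for i j
  proof -
    have "mat_conj m X D i j = (\<Sum>p<m. \<Sum>q<m. if q = \<pi> j then (if p = \<pi> i then D p q else 0) else 0)"
      unfolding mat_conj_def by (intro sum.cong refl) (auto simp: X_def)
    then show ?thesis using assms that by simp
  qed
  then show ?thesis unfolding subequivalent_def by (intro exI[of _ "\<lambda>k. X"]) auto
qed

lemma subequivalent_refl: "subequivalent n n B B"
  by (rule subequivalent_reindex[of _ "\<lambda>i. i"]) auto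

lemma sum_lessThan_add: "(\<Sum>p<n+m. f p) = (\<Sum>p<n. f p) + (\<Sum>p<m. f (n + p))" for f :: "nat \<Rightarrow> 'a :: comm_monoid_add"
  by (induction m) (auto simp: add.assoc)

lemma mat_conj_block:
  "mat_conj (n + m) X (mat_block n B D) i j = mat_conj n X B i j + mat_conj m (\<lambda>i p. X i (n + p)) D i j"
proof -
  have "mat_conj (n + m) X (mat_block n B D) i j
     = (\<Sum>p<n. \<Sum>q<n. X i p * B p q * star (X j q)) + (\<Sum>p<m. \<Sum>q<m. X i (n + p) * D p q * star (X j (n + q)))"
    unfolding mat_conj_def sum_lessThan_add sum.distrib by (simp add: mat_block_def)
  then show ?thesis by (simp add: mat_conj_def)
qed

lemma subequivalent_block:
  assumes "subequivalent n n' B B'" "subequivalent m m' C C'"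
  shows "subequivalent (n + m) (n' + m') (mat_block n B C) (mat_block n' B' C')"
proof -
  obtain X where X: "\<And>i j. i < n \<Longrightarrow> j < n \<Longrightarrow> (\<lambda>k. mat_conj n' (X k) B' i j) \<longlonglongrightarrow> B i j"
    using assms(1) by (auto simp: subequivalent_def)
  obtain Y where Y: "\<And>i j. i < m \<Longrightarrow> j < m \<Longrightarrow> (\<lambda>k. mat_conj m' (Y k) C' i j) \<longlonglongrightarrow> C i j"
    using assms(2) by (auto simp: subequivalent_def)
  define Z where "Z k i p = (if i < n \<and> p < n' then X k i p else if n \<le> i \<and> n' \<le> p then Y k (i - n) (p - n') else 0)" for k i p
  have 1: "mat_conj n' (Z k) B' i j = (if i < n \<and> j < n then mat_conj n' (X k) B' i j else 0)" for k i j
    unfolding mat_conj_def by (auto simp: Z_def intro!: sum.neutral)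
  have 2: "mat_conj m' (\<lambda>i p. Z k i (n' + p)) C' i j = (if n \<le> i \<and> n \<le> j then mat_conj m' (Y k) C' (i - n) (j - n) else 0)" for k i j
    unfolding mat_conj_def by (auto simp: Z_def intro!: sum.neutral)
  have "(\<lambda>k. mat_conj (n' + m') (Z k) (mat_block n' B' C') i j) \<longlonglongrightarrow> mat_block n B C i j" if "i < n + m" "j < n + m" for i j
    unfolding mat_conj_block 1 2 using X[of i j] Y[of "i - n" "j - n"] that by (auto simp: mat_block_def)
  then show ?thesis unfolding subequivalent_def by blast
qed

lemma subequivalent_block_commute: "subequivalent (n + m) (m + n) (mat_block n B C) (mat_block m C B)"
  by (rule subequivalent_reindex[of _ "\<lambda>i. if i < n then m + i else i - n"]) (auto simp: mat_block_def)

section \<open>The Cuntz semigroup\<close>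

context cstar_algebra
begin

lemma sum_support:
  fixes f :: "nat \<Rightarrow> 'b :: comm_monoid_add"
  assumes "\<And>p. n \<le> p \<or> m \<le> p \<Longrightarrow> f p = 0"
  shows "(\<Sum>p<n. f p) = (\<Sum>p<m. f p)"
  by (rule sum.mono_neutral_cong) (use assms in auto)

lemma emb_mat_conj:
  assumes "x \<in> carrier (mat_alg A n)" "b \<in> carrier (mat_alg A n)"
  shows "emb A ((x \<otimes>\<^bsub>mat_alg A n\<^esub> b \<otimes>\<^bsub>mat_alg A n\<^esub> adj (mat_alg A n) x) i j) = mat_conj n (emb_mat A x) (emb_mat A b) i j"
proof -
  have "x i j \<in> carrier A" for i j using assms by (simp add: mat_carrier)
  then have "emb A ((x \<otimes>\<^bsub>mat_alg A n\<^esub> b \<otimes>\<^bsub>mat_alg A n\<^esub> adj (mat_alg A n) x) i j)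
    = (\<Sum>q<n. \<Sum>p<n. emb A (x i p) * emb A (b p q) * star (emb A (x j q)))"
    using assms by (simp add: emb_mat_mult mat_adj_closed mat_adj emb_adj sum_distrib_right)
  also have "\<dots> = mat_conj n (emb_mat A x) (emb_mat A b) i j" unfolding mat_conj_def by (rule sum.swap)
  finally show ?thesis .
qed

text \<open>The two sizes can be chosen independently, because zero rows and columns contribute
  nothing. The conjugating entries may come from the universal algebra, because the entries of
  \<open>b\<close> absorb everything outside the factor \<open>A\<close>.\<close>

lemma cuntz_le_iff:
  assumes a: "a \<in> carrier (mat_alg A n)" and b: "b \<in> carrier (mat_alg A m)"
  shows "cuntz_le A a b \<longleftrightarrow> subequivalent n m (emb_mat A a) (emb_mat A b)"
proof
  have b0: "emb A (b p q) = 0" if "m \<le> p \<or> m \<le> q" for p q using b that by (auto simp: mat_carrier)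
  have a0: "emb A (a i j) = 0" if "n \<le> i \<or> n \<le> j" for i j using a that by (auto simp: mat_carrier)
  {
    assume "cuntz_le A a b"
    then obtain N x where N: "a \<in> carrier (mat_alg A N)" "b \<in> carrier (mat_alg A N)"
      and x: "\<And>k. x k \<in> carrier (mat_alg A N)"
      and lim: "limitin (norm_topology (mat_alg A N)) (\<lambda>k. x k \<otimes>\<^bsub>mat_alg A N\<^esub> b \<otimes>\<^bsub>mat_alg A N\<^esub> adj (mat_alg A N) (x k)) a sequentially"
      by (auto simp: cuntz_le_def Let_def)
    interpret M: cstar_algebra "mat_alg A N" by (rule cstar_mat_alg)
    have L: "(\<lambda>k. mat_conj N (emb_mat A (x k)) (emb_mat A b) i j) \<longlonglongrightarrow> emb A (a i j)" if "i < N" "j < N" for i j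
      using lim mat_limit[of "\<lambda>k. x k \<otimes>\<^bsub>mat_alg A N\<^esub> b \<otimes>\<^bsub>mat_alg A N\<^esub> adj (mat_alg A N) (x k)" N a] that x N
      by (simp add: emb_mat_conj M.m_closed mat_adj_closed)
    have bN: "emb A (b p q) = 0" if "N \<le> p \<or> N \<le> q" for p q using N that by (auto simp: mat_carrier)
    define X where "X k i p = (if i < N then emb A (x k i p) else 0)" for k i p
    have "mat_conj m (X k) (emb_mat A b) i j = (if i < N \<and> j < N then mat_conj N (emb_mat A (x k)) (emb_mat A b) i j else 0)" for k i j
    proof -
      have "mat_conj m (X k) (emb_mat A b) i j = mat_conj N (X k) (emb_mat A b) i j"
      proof -
        have "(\<Sum>q<m. X k i p * emb_mat A b p q * star (X k j q)) = (\<Sum>q<N. X k i p * emb_mat A b p q * star (X k j q))" for p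
          by (rule sum_support) (auto simp: b0 bN)
        moreover have "(\<Sum>p<m. \<Sum>q<N. X k i p * emb_mat A b p q * star (X k j q)) = (\<Sum>p<N. \<Sum>q<N. X k i p * emb_mat A b p q * star (X k j q))"
          by (rule sum_support) (auto simp: b0 bN)
        ultimately show ?thesis by (simp add: mat_conj_def)
      qed
      then show ?thesis by (auto simp: X_def mat_conj_def)
    qed
    moreover have "emb A (a i j) = 0" if "\<not> (i < N \<and> j < N)" for i j using N that by (auto simp: mat_carrier)
    ultimately have "(\<lambda>k. mat_conj m (X k) (emb_mat A b) i j) \<longlonglongrightarrow> emb A (a i j)" for i j
      using L[of i j] by (cases "i < N \<and> j < N") auto
    then show "subequivalent n m (emb_mat A a) (emb_mat A b)" unfolding subequivalent_def by blast
  next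
    assume "subequivalent n m (emb_mat A a) (emb_mat A b)"
    then obtain X where X: "\<And>i j. i < n \<Longrightarrow> j < n \<Longrightarrow> (\<lambda>k. mat_conj m (X k) (emb_mat A b) i j) \<longlonglongrightarrow> emb A (a i j)"
      by (auto simp: subequivalent_def)
    \<comment> \<open>\<open>Suc\<close> because \<open>cuntz_le\<close> asks for a positive size,
      while \<open>n\<close> and \<open>m\<close> may be 0.\<close>
    define N where "N = Suc (max n m)"
    have aN: "a \<in> carrier (mat_alg A N)" and bN: "b \<in> carrier (mat_alg A N)"
      using a b by (auto simp: mat_carrier N_def)
    have bN0: "emb A (b p q) = 0" if "N \<le> p \<or> N \<le> q" for p q
      by (rule b0) (use that in \<open>auto simp: N_def\<close>)
    define x where "x k i p = (if i < n \<and> p < m then component A (X k i p) else \<zero>)" for k i p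
    have x: "x k \<in> carrier (mat_alg A N)" for k by (auto simp: x_def mat_carrier is_cstar N_def)
    interpret M: cstar_algebra "mat_alg A N" by (rule cstar_mat_alg)
    have eq: "emb A (X1 \<otimes> B1) = F * emb A B1" "emb A B1 * star (emb A X1) = emb A B1 * star F"
      if "X1 = component A F" "B1 \<in> carrier A" for X1 F B1
      using that emb_mult_left[of B1 F] emb_mult_right[of B1 "star F"] emb_mult_right[of B1 "star (emb A X1)"]
      by (simp_all add: component_star is_cstar)
    have "emb A (component A F) * emb A B1 * star (emb A (component A F')) = F * emb A B1 * star F'"
      if "B1 \<in> carrier A" for F F' B1
      using eq[of "component A F" F B1] eq[of "component A F'" F' B1] that
      by (simp add: emb_mult is_cstar mult.assoc)
    moreover have "b p q \<in> carrier A" for p q using b by (simp add: mat_carrier)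
    ultimately have "mat_conj m (emb_mat A (x k)) (emb_mat A b) i j = (if i < n \<and> j < n then mat_conj m (X k) (emb_mat A b) i j else 0)" for k i j
      unfolding mat_conj_def by (auto simp: x_def intro!: sum.neutral sum.cong)
    moreover have "mat_conj N (emb_mat A (x k)) (emb_mat A b) i j = mat_conj m (emb_mat A (x k)) (emb_mat A b) i j" for k i j
    proof -
      have "(\<Sum>q<N. emb_mat A (x k) i p * emb_mat A b p q * star (emb_mat A (x k) j q)) = (\<Sum>q<m. emb_mat A (x k) i p * emb_mat A b p q * star (emb_mat A (x k) j q))" for p
        by (rule sum_support) (auto simp: b0 bN0)
      moreover have "(\<Sum>p<N. \<Sum>q<m. emb_mat A (x k) i p * emb_mat A b p q * star (emb_mat A (x k) j q)) = (\<Sum>p<m. \<Sum>q<m. emb_mat A (x k) i p * emb_mat A b p q * star (emb_mat A (x k) j q))"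
        by (rule sum_support) (auto simp: b0 bN0)
      ultimately show ?thesis by (simp add: mat_conj_def)
    qed
    ultimately have "(\<lambda>k. mat_conj N (emb_mat A (x k)) (emb_mat A b) i j) \<longlonglongrightarrow> emb A (a i j)" for i j
      using X[of i j] a0[of i j] by (cases "i < n \<and> j < n") auto
    then have "limitin (norm_topology (mat_alg A N)) (\<lambda>k. x k \<otimes>\<^bsub>mat_alg A N\<^esub> b \<otimes>\<^bsub>mat_alg A N\<^esub> adj (mat_alg A N) (x k)) a sequentially"
      using mat_limit[of "\<lambda>k. x k \<otimes>\<^bsub>mat_alg A N\<^esub> b \<otimes>\<^bsub>mat_alg A N\<^esub> adj (mat_alg A N) (x k)" N a] x aN bN
      by (simp add: emb_mat_conj M.m_closed mat_adj_closed)
    then show "cuntz_le A a b"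
      unfolding cuntz_le_def Let_def using aN bN x by (intro exI[of _ N]) (auto simp: N_def)
  }
qed

lemma emb_block_sum:
  assumes "a \<in> carrier (mat_alg A n)" "b \<in> carrier (mat_alg A m)"
  shows "emb_mat A (block_sum A n a b) = mat_block n (emb_mat A a) (emb_mat A b)"
    and "block_sum A n a b \<in> carrier (mat_alg A (n + m))"
  using assms by (auto simp: block_sum_def mat_block_def fun_eq_iff mat_carrier)

section \<open>Positive matrices of varying size\<close>

lemma mat_positives_iff:
  "a \<in> positives (mat_alg A n) \<longleftrightarrow> a \<in> carrier (mat_alg A n) \<and>
    (\<exists>x\<in>carrier (mat_alg A n). \<forall>i j. emb A (a i j) = (\<Sum>k<n. star (emb A (x k i)) * emb A (x k j)))"
proof -
  let ?M = "mat_alg A n"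
  have e: "emb A ((adj ?M x \<otimes>\<^bsub>?M\<^esub> x) i j) = (\<Sum>k<n. star (emb A (x k i)) * emb A (x k j))" if "x \<in> carrier ?M" for x i j
  proof -
    have "x i j \<in> carrier A" for i j using that by (simp add: mat_carrier)
    then show ?thesis using that by (simp add: emb_mat_mult mat_adj_closed mat_adj emb_adj)
  qed
  have c: "adj ?M x \<otimes>\<^bsub>?M\<^esub> x \<in> carrier ?M" if "x \<in> carrier ?M" for x
    using emb_mat_mult(2) mat_adj_closed that by blast
  show ?thesis
  proof
    assume "a \<in> positives ?M"
    then show "a \<in> carrier ?M \<and> (\<exists>x\<in>carrier ?M. \<forall>i j. emb A (a i j) = (\<Sum>k<n. star (emb A (x k i)) * emb A (x k j)))"
      using e c by (auto simp: positives_def)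
  next
    assume a: "a \<in> carrier ?M \<and> (\<exists>x\<in>carrier ?M. \<forall>i j. emb A (a i j) = (\<Sum>k<n. star (emb A (x k i)) * emb A (x k j)))"
    then obtain x where x: "x \<in> carrier ?M" "\<forall>i j. emb A (a i j) = (\<Sum>k<n. star (emb A (x k i)) * emb A (x k j))"
      by blast
    then have x2: "emb A (a i j) = emb A ((adj ?M x \<otimes>\<^bsub>?M\<^esub> x) i j)" for i j using e by simp
    have "a i j = (adj ?M x \<otimes>\<^bsub>?M\<^esub> x) i j" for i j
      using x2[of i j] a c[OF x(1)] emb_inj by (simp add: mat_carrier)
    then have "a = adj ?M x \<otimes>\<^bsub>?M\<^esub> x" by blast
    then show "a \<in> positives ?M" using x(1) by (auto simp: positives_def)
  qed
qed

lemma positives_mat_mono: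
  assumes "a \<in> positives (mat_alg A n)" "n \<le> m"
  shows "a \<in> positives (mat_alg A m)"
proof -
  obtain x where x: "x \<in> carrier (mat_alg A n)" "\<And>i j. emb A (a i j) = (\<Sum>k<n. star (emb A (x k i)) * emb A (x k j))"
    and a: "a \<in> carrier (mat_alg A n)"
    using assms(1) unfolding mat_positives_iff by blast
  have "(\<Sum>k<n. star (emb A (x k i)) * emb A (x k j)) = (\<Sum>k<m. star (emb A (x k i)) * emb A (x k j))" for i j
    by (rule sum_support) (use x(1) assms(2) in \<open>auto simp: mat_carrier\<close>)
  moreover have "x \<in> carrier (mat_alg A m)" "a \<in> carrier (mat_alg A m)"
    using x(1) a assms(2) by (auto simp: mat_carrier)
  ultimately show ?thesis unfolding mat_positives_iff using x(2) by auto
qed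

lemma block_sum_positives:
  assumes a: "a \<in> positives (mat_alg A n)" and b: "b \<in> positives (mat_alg A m)"
  shows "block_sum A n a b \<in> positives (mat_alg A (n + m))"
proof -
  obtain x where x: "x \<in> carrier (mat_alg A n)" "\<And>i j. emb A (a i j) = (\<Sum>k<n. star (emb A (x k i)) * emb A (x k j))"
    and a: "a \<in> carrier (mat_alg A n)"
    using assms(1) unfolding mat_positives_iff by blast
  obtain y where y: "y \<in> carrier (mat_alg A m)" "\<And>i j. emb A (b i j) = (\<Sum>k<m. star (emb A (y k i)) * emb A (y k j))"
    and b: "b \<in> carrier (mat_alg A m)"
    using assms(2) unfolding mat_positives_iff by blast
  let ?z = "block_sum A n x y"
  have z: "?z \<in> carrier (mat_alg A (n + m))" using emb_block_sum(2) x y by blast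
  have ez: "emb A (?z k i) = mat_block n (emb_mat A x) (emb_mat A y) k i" for k i
    using emb_block_sum(1)[OF x(1) y(1)] by (metis)
  have "emb A (block_sum A n a b i j) = (\<Sum>k<n+m. star (emb A (?z k i)) * emb A (?z k j))" for i j
  proof -
    have "emb A (block_sum A n a b i j) = mat_block n (emb_mat A a) (emb_mat A b) i j"
      using emb_block_sum(1)[OF a b] by metis
    moreover have "x k i = \<zero>" if "i \<ge> n" for k i using x(1) that by (simp add: mat_carrier)
    ultimately show ?thesis
      unfolding sum_lessThan_add ez using x(2) y(2) by (auto simp: mat_block_def)
  qed
  then show ?thesis unfolding mat_positives_iff using z emb_block_sum(2)[OF a b] by blast
qed

lemma positives_mat_reindex:
  assumes d: "d \<in> positives (mat_alg A N)" and N: "N' \<le> N"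
    and c: "c \<in> carrier (mat_alg A N')" and eq: "\<And>i j. i < N' \<Longrightarrow> j < N' \<Longrightarrow> c i j = d (\<pi> i) (\<pi> j)"
  shows "c \<in> positives (mat_alg A N)"
proof -
  obtain x where x: "x \<in> carrier (mat_alg A N)" "\<And>i j. emb A (d i j) = (\<Sum>k<N. star (emb A (x k i)) * emb A (x k j))"
    using d unfolding mat_positives_iff by blast
  define y where "y k i = (if i < N' then x k (\<pi> i) else \<zero>)" for k i
  have "y \<in> carrier (mat_alg A N)" using x(1) N by (auto simp: mat_carrier y_def)
  moreover have "emb A (c i j) = (\<Sum>k<N. star (emb A (y k i)) * emb A (y k j))" for i j
    using x(2)[of "\<pi> i" "\<pi> j"] eq[of i j] c by (cases "i < N' \<and> j < N'") (auto simp: y_def mat_carrier not_less)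
  moreover have "c \<in> carrier (mat_alg A N)" using c N by (auto simp: mat_carrier)
  ultimately show ?thesis unfolding mat_positives_iff by blast
qed

lemma Minf_posE:
  assumes "a \<in> Minf_pos A"
  obtains n where "n \<ge> 1" "a \<in> positives (mat_alg A n)" "a \<in> carrier (mat_alg A n)"
proof -
  obtain n where n: "n \<ge> 1" "a \<in> positives (mat_alg A n)" using assms by (auto simp: Minf_pos_def)
  then have "a \<in> carrier (mat_alg A n)" by (simp add: mat_positives_iff)
  then show ?thesis using that n by blast
qed

lemma Minf_posI: "a \<in> positives (mat_alg A n) \<Longrightarrow> a \<in> Minf_pos A"
  using positives_mat_mono[of a n "max n 1"] by (auto simp: Minf_pos_def intro!: bexI[of _ "max n 1"])

text \<open>\<open>a\<close> may be known to be positive only in a size \<open>p\<close> larger than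
  the \<open>n\<close> at which the block sum is formed. The block sum at \<open>p\<close> then
  contains a gap of zeros, which a change of indices removes.\<close>

lemma block_sum_Minf_pos:
  assumes a: "a \<in> Minf_pos A" "a \<in> carrier (mat_alg A n)" and b: "b \<in> Minf_pos A"
  shows "block_sum A n a b \<in> Minf_pos A"
proof -
  obtain p where p: "a \<in> positives (mat_alg A p)" using a Minf_posE by blast
  obtain m where m: "b \<in> positives (mat_alg A m)" "b \<in> carrier (mat_alg A m)" using b Minf_posE by blast
  show ?thesis
  proof (cases "p \<le> n")
    case True
    then show ?thesis using positives_mat_mono[OF p] block_sum_positives m Minf_posI by blast
  next
    case False
    have "block_sum A n a b \<in> positives (mat_alg A (p + m))"
    proof (rule positives_mat_reindex[OF block_sum_positives[OF p m(1)], of "n + m" _ "\<lambda>i. if i < n then i else p + (i - n)"])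
      show "block_sum A n a b \<in> carrier (mat_alg A (n + m))" using emb_block_sum(2) a m by blast
      show "n + m \<le> p + m" using False by simp
      show "\<And>i j. i < n + m \<Longrightarrow> j < n + m \<Longrightarrow> block_sum A n a b i j =
          block_sum A p a b (if i < n then i else p + (i - n)) (if j < n then j else p + (j - n))"
        using False by (auto simp: block_sum_def)
    qed
    then show ?thesis by (rule Minf_posI)
  qed
qed

section \<open>Cuntz classes as a positively ordered monoid\<close>

lemma cuntz_le_refl: "a \<in> Minf_pos A \<Longrightarrow> cuntz_le A a a"
  using cuntz_le_iff subequivalent_refl Minf_posE by metis

lemma cuntz_le_trans:
  assumes "a \<in> Minf_pos A" "b \<in> Minf_pos A" "c \<in> Minf_pos A" "cuntz_le A a b" "cuntz_le A b c"
  shows "cuntz_le A a c"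
proof -
  obtain n m l where n: "a \<in> carrier (mat_alg A n)" and m: "b \<in> carrier (mat_alg A m)" and l: "c \<in> carrier (mat_alg A l)"
    using assms(1-3) Minf_posE by metis
  show ?thesis
    using assms(4,5) subequivalent_trans
    unfolding cuntz_le_iff[OF n m] cuntz_le_iff[OF m l] cuntz_le_iff[OF n l] by blast
qed

lemma cuntz_le_block_sum:
  assumes "a \<in> carrier (mat_alg A n)" "a' \<in> carrier (mat_alg A n')" "b \<in> Minf_pos A" "b' \<in> Minf_pos A"
    "cuntz_le A a a'" "cuntz_le A b b'"
  shows "cuntz_le A (block_sum A n a b) (block_sum A n' a' b')"
proof -
  obtain m m' where m: "b \<in> carrier (mat_alg A m)" "b' \<in> carrier (mat_alg A m')"
    using assms Minf_posE by metis
  have "subequivalent (n + m) (n' + m') (emb_mat A (block_sum A n a b)) (emb_mat A (block_sum A n' a' b'))"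
    unfolding emb_block_sum(1)[OF assms(1) m(1)] emb_block_sum(1)[OF assms(2) m(2)]
    using assms(5,6) cuntz_le_iff[OF assms(1,2)] cuntz_le_iff[OF m] by (intro subequivalent_block) auto
  then show ?thesis
    using cuntz_le_iff[OF emb_block_sum(2)[OF assms(1) m(1)] emb_block_sum(2)[OF assms(2) m(2)]] by blast
qed

lemma cuntz_le_block_sum_commute:
  assumes "a \<in> carrier (mat_alg A n)" "b \<in> carrier (mat_alg A m)"
  shows "cuntz_le A (block_sum A n a b) (block_sum A m b a)"
  using cuntz_le_iff[OF emb_block_sum(2)[OF assms] emb_block_sum(2)[OF assms(2,1)]]
    subequivalent_block_commute emb_block_sum(1)[OF assms] emb_block_sum(1)[OF assms(2,1)] by metis

abbreviation zmat :: "nat \<Rightarrow> nat \<Rightarrow> 'a" where "zmat \<equiv> (\<lambda>i j. \<zero>)"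

lemma zmat_carrier: "zmat \<in> carrier (mat_alg A n)"
  by (auto simp: mat_carrier)

lemma zmat_Minf_pos: "zmat \<in> Minf_pos A"
  by (rule Minf_posI[of _ 1]) (auto simp: mat_positives_iff zmat_carrier intro!: bexI[of _ zmat])

lemma zmat_cuntz_le:
  assumes "a \<in> Minf_pos A"
  shows "cuntz_le A zmat a"
proof -
  obtain n where n: "a \<in> carrier (mat_alg A n)" using Minf_posE[OF assms] by blast
  \<comment> \<open>Regarded as a matrix of size 0, the zero matrix is subequivalent to anything
    vacuously.\<close>
  show ?thesis using cuntz_le_iff[OF zmat_carrier n, of 0] by (simp add: subequivalent_def)
qed

lemma equiv_cuntz_rel: "equiv (Minf_pos A) (cuntz_rel A)"
  by (rule equivI) (auto simp: cuntz_rel_def refl_on_def sym_def trans_def cuntz_le_refl intro: cuntz_le_trans)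

definition cls :: "(nat \<Rightarrow> nat \<Rightarrow> 'a) \<Rightarrow> (nat \<Rightarrow> nat \<Rightarrow> 'a) set" where
  "cls a = cuntz_rel A `` {a}"

lemma cls_in: "a \<in> Minf_pos A \<Longrightarrow> cls a \<in> cuntz_semigroup A"
  by (simp add: cls_def cuntz_semigroup_def quotientI)

lemma cuntz_semigroupE:
  assumes "x \<in> cuntz_semigroup A"
  obtains a where "a \<in> Minf_pos A" "x = cls a"
  using assms by (auto simp: cuntz_semigroup_def cls_def elim!: quotientE)

lemma mem_cls: "b \<in> cls a \<longleftrightarrow> a \<in> Minf_pos A \<and> b \<in> Minf_pos A \<and> cuntz_le A a b \<and> cuntz_le A b a"
  by (auto simp: cls_def cuntz_rel_def)

lemma cls_eq_iff: "a \<in> Minf_pos A \<Longrightarrow> b \<in> Minf_pos A \<Longrightarrow> cls a = cls b \<longleftrightarrow> cuntz_le A a b \<and> cuntz_le A b a"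
  unfolding cls_def using eq_equiv_class_iff[OF equiv_cuntz_rel] by (auto simp: cuntz_rel_def)

lemma class_le_iff:
  assumes "a \<in> Minf_pos A" "b \<in> Minf_pos A"
  shows "cuntz_class_le A (cls a) (cls b) \<longleftrightarrow> cuntz_le A a b"
proof
  assume "cuntz_class_le A (cls a) (cls b)"
  then obtain a' b' where "a' \<in> cls a" "b' \<in> cls b" "cuntz_le A a' b'" by (auto simp: cuntz_class_le_def)
  then show "cuntz_le A a b" using cuntz_le_trans unfolding mem_cls by metis
next
  assume "cuntz_le A a b"
  then show "cuntz_class_le A (cls a) (cls b)" unfolding cuntz_class_le_def using mem_cls cuntz_le_refl assms by blast
qed

lemma cuntz_add_cls:
  assumes n: "n \<ge> 1" and a: "a \<in> Minf_pos A" "a \<in> carrier (mat_alg A n)" and b: "b \<in> Minf_pos A"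
  shows "cuntz_add A (cls a) (cls b) = cls (block_sum A n a b)"
proof (intro equalityI subsetI)
  fix c assume "c \<in> cuntz_add A (cls a) (cls b)"
  then obtain n' a' b' where h: "n' \<ge> 1" "a' \<in> cls a" "a' \<in> carrier (mat_alg A n')" "b' \<in> cls b"
    "(block_sum A n' a' b', c) \<in> cuntz_rel A" by (auto simp: cuntz_add_def)
  have "c \<in> cls (block_sum A n' a' b')" using h(5) by (simp add: cls_def)
  also have "cls (block_sum A n' a' b') = cls (block_sum A n a b)"
    using h a b by (subst cls_eq_iff) (auto simp: mem_cls intro!: cuntz_le_block_sum block_sum_Minf_pos)
  finally show "c \<in> cls (block_sum A n a b)" .
next
  fix c assume "c \<in> cls (block_sum A n a b)"
  then have "(block_sum A n a b, c) \<in> cuntz_rel A" by (simp add: cls_def)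
  moreover have "a \<in> cls a" "b \<in> cls b" using a b by (auto simp: mem_cls cuntz_le_refl)
  ultimately show "c \<in> cuntz_add A (cls a) (cls b)" using n a by (auto simp: cuntz_add_def)
qed

definition cuntz_monoid :: "(nat \<Rightarrow> nat \<Rightarrow> 'a) set monoid" where
  "cuntz_monoid = \<lparr>carrier = cuntz_semigroup A, monoid.mult = cuntz_add A, one = cuntz_zero A\<rparr>"

lemma block_sum_assoc: "block_sum A n a (block_sum A m b c) = block_sum A (n + m) (block_sum A n a b) c"
  by (auto simp: block_sum_def fun_eq_iff)

lemma block_sum_zmat: "a \<in> carrier (mat_alg A n) \<Longrightarrow> block_sum A n a zmat = a"
  by (auto simp: block_sum_def fun_eq_iff mat_carrier not_less)

lemma cuntz_zero_eq: "cuntz_zero A = cls zmat"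
  by (simp add: cuntz_zero_def cls_def)

lemma positively_ordered_cuntz: "positively_ordered_monoid cuntz_monoid (cuntz_class_le A)"
proof -
  have add: "\<exists>n. n \<ge> 1 \<and> a \<in> carrier (mat_alg A n) \<and> cuntz_add A (cls a) (cls b) = cls (block_sum A n a b)"
    if "a \<in> Minf_pos A" "b \<in> Minf_pos A" for a b
    using that cuntz_add_cls Minf_posE by metis
  have comm: "cuntz_add A (cls a) (cls b) = cuntz_add A (cls b) (cls a)" if ab: "a \<in> Minf_pos A" "b \<in> Minf_pos A" for a b
  proof -
    obtain n m where nm: "n \<ge> 1" "a \<in> carrier (mat_alg A n)" "m \<ge> 1" "b \<in> carrier (mat_alg A m)"
      using ab Minf_posE by metis
    show ?thesis unfolding cuntz_add_cls[OF nm(1) ab(1) nm(2) ab(2)] cuntz_add_cls[OF nm(3) ab(2) nm(4) ab(1)]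
      using ab nm by (subst cls_eq_iff) (auto intro!: cuntz_le_block_sum_commute block_sum_Minf_pos)
  qed
  have right_zero: "cuntz_add A (cls a) (cls zmat) = cls a" if a: "a \<in> Minf_pos A" for a
    using Minf_posE[OF a] cuntz_add_cls[OF _ a _ zmat_Minf_pos] block_sum_zmat by metis
  have "comm_monoid cuntz_monoid"
  proof (rule comm_monoidI)
    fix x y assume xy: "x \<in> carrier cuntz_monoid" "y \<in> carrier cuntz_monoid"
    then obtain a b where ab: "a \<in> Minf_pos A" "x = cls a" "b \<in> Minf_pos A" "y = cls b"
      by (auto simp: cuntz_monoid_def elim!: cuntz_semigroupE)
    obtain n where n: "n \<ge> 1" "a \<in> carrier (mat_alg A n)" using ab Minf_posE by metis
    show "x \<otimes>\<^bsub>cuntz_monoid\<^esub> y \<in> carrier cuntz_monoid"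
      using cuntz_add_cls[OF n(1) ab(1) n(2) ab(3)] cls_in[OF block_sum_Minf_pos[OF ab(1) n(2) ab(3)]] ab
      by (simp add: cuntz_monoid_def)
    show "x \<otimes>\<^bsub>cuntz_monoid\<^esub> y = y \<otimes>\<^bsub>cuntz_monoid\<^esub> x" using comm ab by (simp add: cuntz_monoid_def)
    show "\<one>\<^bsub>cuntz_monoid\<^esub> \<otimes>\<^bsub>cuntz_monoid\<^esub> x = x"
      using comm[OF zmat_Minf_pos ab(1)] right_zero[OF ab(1)] ab by (simp add: cuntz_monoid_def cuntz_zero_eq)
    fix z assume "z \<in> carrier cuntz_monoid"
    then obtain c where c: "c \<in> Minf_pos A" "z = cls c" by (auto simp: cuntz_monoid_def elim!: cuntz_semigroupE)
    obtain m where m: "m \<ge> 1" "b \<in> carrier (mat_alg A m)" using ab Minf_posE by metis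
    have ab': "block_sum A n a b \<in> Minf_pos A" "block_sum A n a b \<in> carrier (mat_alg A (n + m))"
      using block_sum_Minf_pos[OF ab(1) n(2) ab(3)] emb_block_sum(2)[OF n(2) m(2)] by auto
    have bc': "block_sum A m b c \<in> Minf_pos A" using block_sum_Minf_pos[OF ab(3) m(2) c(1)] .
    have "cuntz_add A (cuntz_add A (cls a) (cls b)) (cls c) = cls (block_sum A (n + m) (block_sum A n a b) c)"
      unfolding cuntz_add_cls[OF n(1) ab(1) n(2) ab(3)] using n by (intro cuntz_add_cls ab' c) auto
    also have "\<dots> = cuntz_add A (cls a) (cuntz_add A (cls b) (cls c))"
      unfolding cuntz_add_cls[OF m(1) ab(3) m(2) c(1)] cuntz_add_cls[OF n(1) ab(1) n(2) bc'] block_sum_assoc ..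
    finally show "x \<otimes>\<^bsub>cuntz_monoid\<^esub> y \<otimes>\<^bsub>cuntz_monoid\<^esub> z = x \<otimes>\<^bsub>cuntz_monoid\<^esub> (y \<otimes>\<^bsub>cuntz_monoid\<^esub> z)"
      using ab c by (simp add: cuntz_monoid_def)
  qed (simp add: cuntz_monoid_def cuntz_zero_eq cls_in zmat_Minf_pos)
  then interpret comm_monoid cuntz_monoid .
  show ?thesis
  proof
    fix x assume "x \<in> carrier cuntz_monoid"
    then obtain a where a: "a \<in> Minf_pos A" "x = cls a" by (auto simp: cuntz_monoid_def elim!: cuntz_semigroupE)
    then show "cuntz_class_le A x x" by (simp add: class_le_iff cuntz_le_refl)
    show "cuntz_class_le A \<one>\<^bsub>cuntz_monoid\<^esub> x"
      using a by (simp add: cuntz_monoid_def cuntz_zero_eq class_le_iff zmat_Minf_pos zmat_cuntz_le)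
    fix y z assume "y \<in> carrier cuntz_monoid" "z \<in> carrier cuntz_monoid"
    then obtain b c where b: "b \<in> Minf_pos A" "y = cls b" and c: "c \<in> Minf_pos A" "z = cls c"
      by (auto simp: cuntz_monoid_def elim!: cuntz_semigroupE)
    show "cuntz_class_le A x z" if "cuntz_class_le A x y" "cuntz_class_le A y z"
      using that a b c cuntz_le_trans by (metis class_le_iff)
    fix w assume "w \<in> carrier cuntz_monoid"
    then obtain d where d: "d \<in> Minf_pos A" "w = cls d" by (auto simp: cuntz_monoid_def elim!: cuntz_semigroupE)
    assume le: "cuntz_class_le A x y" "cuntz_class_le A z w"
    obtain n m where n: "n \<ge> 1" "a \<in> carrier (mat_alg A n)" and m: "m \<ge> 1" "b \<in> carrier (mat_alg A m)"
      using a b Minf_posE by metis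
    have "cuntz_le A (block_sum A n a c) (block_sum A m b d)"
      using le a b c d n m by (intro cuntz_le_block_sum) (auto simp: class_le_iff)
    then show "cuntz_class_le A (x \<otimes>\<^bsub>cuntz_monoid\<^esub> z) (y \<otimes>\<^bsub>cuntz_monoid\<^esub> w)"
      using cuntz_add_cls[OF n(1) a(1) n(2) c(1)] cuntz_add_cls[OF m(1) b(1) m(2) d(1)] a b c d
        block_sum_Minf_pos[OF a(1) n(2) c(1)] block_sum_Minf_pos[OF b(1) m(2) d(1)]
      by (simp add: cuntz_monoid_def class_le_iff)
  qed
qed

lemma cuntz_monoid_simps: "carrier cuntz_monoid = cuntz_semigroup A" "x \<otimes>\<^bsub>cuntz_monoid\<^esub> y = cuntz_add A x y"
    "\<one>\<^bsub>cuntz_monoid\<^esub> = cuntz_zero A"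
  by (simp_all add: cuntz_monoid_def)

lemma cuntz_multiple_pow:
  assumes "x \<in> cuntz_semigroup A"
  shows "cuntz_multiple A n x = x [^]\<^bsub>cuntz_monoid\<^esub> n"
proof -
  interpret positively_ordered_monoid cuntz_monoid "cuntz_class_le A" by (rule positively_ordered_cuntz)
  show ?thesis
  proof (induction n)
    case (Suc n)
    have "cuntz_multiple A (Suc n) x = x \<otimes>\<^bsub>cuntz_monoid\<^esub> x [^]\<^bsub>cuntz_monoid\<^esub> n"
      using Suc by (simp add: cuntz_multiple_def cuntz_monoid_simps)
    then show ?case using nat_pow_Suc2[of x n] assms by (simp add: cuntz_monoid_simps)
  qed (simp add: cuntz_multiple_def cuntz_monoid_def)
qed

text \<open>A case of Rordam's comparison theorem.\<close>

theorem separating_dimension_function: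
  assumes au: "almost_unperforated A" and a: "a \<in> Minf_pos A" and b: "b \<in> Minf_pos A"
    and unit: "\<And>c. c \<in> Minf_pos A \<Longrightarrow> \<exists>N. cuntz_class_le A (cls c) (cls b [^]\<^bsub>cuntz_monoid\<^esub> (N::nat))"
    and nle: "\<not> cuntz_le A a b"
  obtains d where "d \<in> dimension_functions A" "d b = 1" "1 \<le> d a"
proof -
  interpret positively_ordered_monoid cuntz_monoid "cuntz_class_le A" by (rule positively_ordered_cuntz)
  have t: "cls a \<in> carrier cuntz_monoid" and u: "cls b \<in> carrier cuntz_monoid"
    using a b by (auto simp: cuntz_monoid_simps cls_in)
  have nle': "\<not> cuntz_class_le A (cls a) (cls b)" using nle a b by (simp add: class_le_iff)
  \<comment> \<open>By almost unperforation, \<open>n > m\<close> would put the class of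
    \<open>a\<close> below that of \<open>b\<close>. This is the condition on exponents that
    \<open>state_exists\<close> requires.\<close>
  have nle2: "n \<le> m" if le: "cuntz_class_le A (cls a [^]\<^bsub>cuntz_monoid\<^esub> (n::nat)) (cls b [^]\<^bsub>cuntz_monoid\<^esub> (m::nat))" for m n
  proof (rule ccontr)
    assume nm: "\<not> n \<le> m"
    show False
    proof (cases "m = 0")
      case False
      then show ?thesis
        using au le nm nle' t u unfolding almost_unperforated_def
        by (metis cuntz_monoid_simps(1) cuntz_multiple_pow not_gr_zero not_le)
    next
      \<comment> \<open>\<open>almost_unperforated\<close> speaks of \<open>m > 0\<close> only. For
        \<open>m = 0\<close> the class of \<open>a\<close> is below zero, and hence below that of
        \<open>b\<close>.\<close>
      case True
      obtain k where k: "n = Suc k" using nm by (cases n) auto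
      have "cuntz_class_le A (cls a) (cls a [^]\<^bsub>cuntz_monoid\<^esub> n)"
        using le_mult_right[OF t, of "cls a [^]\<^bsub>cuntz_monoid\<^esub> k"] nat_pow_Suc2[OF t, of k] t k by simp
      moreover have "cuntz_class_le A (cls a [^]\<^bsub>cuntz_monoid\<^esub> n) \<one>\<^bsub>cuntz_monoid\<^esub>" using le True by simp
      ultimately have "cuntz_class_le A (cls a) \<one>\<^bsub>cuntz_monoid\<^esub>"
        using le_trans[of "cls a" "cls a [^]\<^bsub>cuntz_monoid\<^esub> n"] t by blast
      then show False using le_trans[of "cls a" "\<one>\<^bsub>cuntz_monoid\<^esub>" "cls b"] one_le[OF u] t u nle' by blast
    qed
  qed
  have unit2: "\<exists>N. cuntz_class_le A x (cls b [^]\<^bsub>cuntz_monoid\<^esub> (N::nat))" if "x \<in> carrier cuntz_monoid" for x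
    using that unit by (auto simp: cuntz_monoid_simps elim!: cuntz_semigroupE)
  show thesis
  proof (rule state_exists[OF t u unit2 nle2])
  fix f :: "(nat \<Rightarrow> nat \<Rightarrow> 'a) set \<Rightarrow> real"
  assume f: "\<And>x y. x \<in> carrier cuntz_monoid \<Longrightarrow> y \<in> carrier cuntz_monoid \<Longrightarrow> f (x \<otimes>\<^bsub>cuntz_monoid\<^esub> y) = f x + f y"
    "\<And>x. x \<in> carrier cuntz_monoid \<Longrightarrow> 0 \<le> f x"
    "\<And>x y. x \<in> carrier cuntz_monoid \<Longrightarrow> y \<in> carrier cuntz_monoid \<Longrightarrow> cuntz_class_le A x y \<Longrightarrow> f x \<le> f y"
    "f (cls b) = 1" "1 \<le> f (cls a)"
  define d where "d = (\<lambda>c\<in>Minf_pos A. ennreal (f (cls c)))"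
  have "d \<in> dimension_functions A"
    unfolding dimension_functions_def
  proof (intro CollectI conjI allI impI ballI)
    show "d \<in> extensional (Minf_pos A)" by (simp add: d_def)
  next
    fix n c e assume n: "1 \<le> n" and c: "c \<in> positives (mat_alg A n)" and e: "e \<in> Minf_pos A"
    have c': "c \<in> Minf_pos A" "c \<in> carrier (mat_alg A n)" using c Minf_posI by (auto simp: mat_positives_iff)
    have "f (cls (block_sum A n c e)) = f (cls c) + f (cls e)"
      using f(1)[of "cls c" "cls e"] cuntz_add_cls[OF n c' e] cls_in c' e by (simp add: cuntz_monoid_simps)
    then show "d (block_sum A n c e) = d c + d e"
      using block_sum_Minf_pos[OF c' e] c' e f(2) cls_in by (simp add: d_def cuntz_monoid_simps)
  next
    fix c e assume "c \<in> Minf_pos A" "e \<in> Minf_pos A" "cuntz_le A c e"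
    then show "d c \<le> d e" using f(3)[of "cls c" "cls e"] by (simp add: d_def cuntz_monoid_simps cls_in class_le_iff ennreal_leI)
  qed
  moreover have "d b = 1" "1 \<le> d a" using f(4,5) a b by (simp_all add: d_def ennreal_leI flip: ennreal_1)
  ultimately show thesis using that by blast
  qed
qed

end

section \<open>Full elements are order units\<close>

text \<open>Only row 0 of \<open>X\<close> matters: \<open>e\<close> is a row times \<open>D\<close>
  times the adjoint of the row. Unlike subequivalence this is an exact identity, and it is additive
  over block sums.\<close>

definition representable :: "nat \<Rightarrow> (nat \<Rightarrow> nat \<Rightarrow> 'a) \<Rightarrow> 'a :: unital_cstar \<Rightarrow> bool" where
  "representable m D e \<longleftrightarrow> (\<exists>X. e = mat_conj m X D 0 0)"

lemma representable_block:
  assumes "representable n B e" "representable m D f"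
  shows "representable (n + m) (mat_block n B D) (e + f)"
proof -
  obtain X Y where X: "e = mat_conj n X B 0 0" "f = mat_conj m Y D 0 0" using assms by (auto simp: representable_def)
  define Z where "Z i p = (if p < n then X i p else Y i (p - n))" for i p
  have "mat_conj n Z B 0 0 = e" "mat_conj m (\<lambda>i p. Z i (n + p)) D 0 0 = f"
    by (simp_all add: X mat_conj_def Z_def)
  then show ?thesis unfolding representable_def mat_conj_block by (intro exI[of _ Z]) simp
qed

lemma representable_sum_list:
  assumes "\<And>e. e \<in> set es \<Longrightarrow> representable n B e"
  shows "representable (length es * n) ((mat_block n B ^^ length es) (\<lambda>i j. 0)) (sum_list es)"
  using assms
proof (induction es)
  case Nil
  show ?case by (auto simp: representable_def mat_conj_def)
next
  case (Cons e es)
  then show ?case using representable_block[of n B e "length es * n"] by simp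
qed

lemma representable_diagonal:
  assumes "i < n"
  shows "representable n B (z * B i i * star z)"
proof -
  have 1: "(\<Sum>q<n. y * B p q * star (if q = i then z else 0)) = y * B p i * star z" for p y
  proof -
    have "(\<Sum>q<n. y * B p q * star (if q = i then z else 0)) = (\<Sum>q<n. if q = i then y * B p i * star z else 0)"
      by (intro sum.cong refl) auto
    then show ?thesis using assms by simp
  qed
  have "mat_conj n (\<lambda>_ p. if p = i then z else 0) B 0 0 = (\<Sum>p<n. if p = i then z * B i i * star z else 0)"
    unfolding mat_conj_def 1 by (intro sum.cong refl) auto
  then have "z * B i i * star z = mat_conj n (\<lambda>_ p. if p = i then z else 0) B 0 0" using assms by simp
  then show ?thesis unfolding representable_def by blast
qed

lemma representable_conj:
  assumes "representable n B e"
  shows "representable n B (u * e * star u)"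
proof -
  obtain X where X: "e = mat_conj n X B 0 0" using assms by (auto simp: representable_def)
  have "u * e * star u = mat_conj n (\<lambda>i p. u * X i p) B 0 0"
    by (simp add: X mat_conj_def sum_distrib_left sum_distrib_right star_mult mult.assoc)
  then show ?thesis by (auto simp: representable_def)
qed

context cstar_algebra
begin

lemma block_sum_power:
  assumes b: "b \<in> Minf_pos A" "b \<in> carrier (mat_alg A n)" and n: "n \<ge> 1"
  defines "R \<equiv> (\<lambda>K. (block_sum A n b ^^ K) zmat)"
  shows "R K \<in> Minf_pos A" "R K \<in> carrier (mat_alg A (K * n))"
    "emb_mat A (R K) = (mat_block n (emb_mat A b) ^^ K) (\<lambda>i j. 0)"
    "cls (R K) = cls b [^]\<^bsub>cuntz_monoid\<^esub> K"
proof -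
  interpret positively_ordered_monoid cuntz_monoid "cuntz_class_le A" by (rule positively_ordered_cuntz)
  have "R K \<in> Minf_pos A \<and> R K \<in> carrier (mat_alg A (K * n)) \<and>
    emb_mat A (R K) = (mat_block n (emb_mat A b) ^^ K) (\<lambda>i j. 0) \<and> cls (R K) = cls b [^]\<^bsub>cuntz_monoid\<^esub> K"
  proof (induction K)
    case 0
    then show ?case by (simp add: R_def zmat_Minf_pos zmat_carrier cuntz_monoid_simps cuntz_zero_eq)
  next
    case (Suc K)
    have R: "R (Suc K) = block_sum A n b (R K)" by (simp add: R_def)
    have c: "cls b \<in> carrier cuntz_monoid" by (simp add: cuntz_monoid_simps cls_in b)
    have "cls (R (Suc K)) = cls b \<otimes>\<^bsub>cuntz_monoid\<^esub> cls b [^]\<^bsub>cuntz_monoid\<^esub> K"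
      unfolding R using cuntz_add_cls[OF n b, of "R K"] Suc by (simp add: cuntz_monoid_simps)
    also have "\<dots> = cls b [^]\<^bsub>cuntz_monoid\<^esub> Suc K" using nat_pow_Suc2[OF c] by simp
    finally have "cls (R (Suc K)) = cls b [^]\<^bsub>cuntz_monoid\<^esub> Suc K" .
    moreover have "emb_mat A (R (Suc K)) = (mat_block n (emb_mat A b) ^^ Suc K) (\<lambda>i j. 0)"
      unfolding R using emb_block_sum(1)[OF b(2), of "R K" "K * n"] Suc by simp
    ultimately show ?case
      using Suc block_sum_Minf_pos[OF b] emb_block_sum(2)[OF b(2), of "R K" "K * n"] by (simp add: R)
  qed
  then show "R K \<in> Minf_pos A" "R K \<in> carrier (mat_alg A (K * n))"
    "emb_mat A (R K) = (mat_block n (emb_mat A b) ^^ K) (\<lambda>i j. 0)" "cls (R K) = cls b [^]\<^bsub>cuntz_monoid\<^esub> K" by auto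
qed

lemma one_mat_pow:
  "\<one>\<^bsub>mat_alg A m\<^esub> = (block_sum A 1 (corner_embed A \<one>) ^^ m) zmat"
proof (induction m)
  case 0 show ?case by (auto simp: mat_one fun_eq_iff)
next
  case (Suc m)
  have "\<one>\<^bsub>mat_alg A (Suc m)\<^esub> = block_sum A 1 (corner_embed A \<one>) \<one>\<^bsub>mat_alg A m\<^esub>"
  proof (intro ext)
    fix i j
    show "\<one>\<^bsub>mat_alg A (Suc m)\<^esub> i j = block_sum A 1 (corner_embed A \<one>) \<one>\<^bsub>mat_alg A m\<^esub> i j"
      by (cases i; cases j) (auto simp: mat_one block_sum_def corner_embed_def)
  qed
  then show ?case using Suc by simp
qed

lemma corner_one: "corner_embed A \<one> \<in> Minf_pos A" "corner_embed A \<one> \<in> carrier (mat_alg A 1)"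
proof -
  show c: "corner_embed A \<one> \<in> carrier (mat_alg A 1)" by (auto simp: corner_embed_def mat_carrier)
  have "star (emb A \<one>) * emb A \<one> = emb A \<one>" by (simp add: adj_one flip: emb_adj emb_mult)
  then have "corner_embed A \<one> \<in> positives (mat_alg A 1)"
    unfolding mat_positives_iff using c by (auto intro!: bexI[of _ "corner_embed A \<one>"] simp: corner_embed_def)
  then show "corner_embed A \<one> \<in> Minf_pos A" by (rule Minf_posI)
qed

lemma le_one_power:
  assumes "c \<in> positives (mat_alg A m)"
  shows "cuntz_class_le A (cls c) (cls (corner_embed A \<one>) [^]\<^bsub>cuntz_monoid\<^esub> m)"
proof -
  obtain x where c: "c \<in> carrier (mat_alg A m)" and x: "x \<in> carrier (mat_alg A m)"
    "\<And>i j. emb A (c i j) = (\<Sum>k<m. star (emb A (x k i)) * emb A (x k j))"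
    using assms unfolding mat_positives_iff by blast
  have xc: "x i j \<in> carrier A" for i j using x(1) by (simp add: mat_carrier)
  note R = block_sum_power[OF corner_one order_refl, of m, folded one_mat_pow, simplified]
  have "subequivalent m m (emb_mat A c) (emb_mat A \<one>\<^bsub>mat_alg A m\<^esub>)"
    unfolding subequivalent_def
  proof (intro exI allI impI)
    fix i j
    have "mat_conj m (\<lambda>i p. star (emb A (x p i))) (emb_mat A \<one>\<^bsub>mat_alg A m\<^esub>) i j
      = (\<Sum>p<m. \<Sum>q<m. if q = p then star (emb A (x p i)) * emb A (x q j) else 0)"
      unfolding mat_conj_def by (intro sum.cong refl) (auto simp: mat_one mult.assoc emb_unit xc)
    also have "\<dots> = emb A (c i j)" by (simp add: x(2))
    finally show "(\<lambda>k. mat_conj m (\<lambda>i p. star (emb A (x p i))) (emb_mat A \<one>\<^bsub>mat_alg A m\<^esub>) i j) \<longlonglongrightarrow> emb A (c i j)" by simp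
  qed
  then have "cuntz_le A c \<one>\<^bsub>mat_alg A m\<^esub>" using cuntz_le_iff[OF c R(2)] by simp
  then have "cuntz_class_le A (cls c) (cls \<one>\<^bsub>mat_alg A m\<^esub>)" using class_le_iff Minf_posI[OF assms] R(1) by blast
  then show ?thesis using R(4) by simp
qed

text \<open>The sum \<open>S\<close> of the elements \<open>z b\<^sub>i\<^sub>i z\<^sup>*\<close> is
  within 1/2 of the unit, hence invertible in \<open>A\<close>, and conjugation by an inverse root
  turns it into the unit. So the unit is represented exactly by \<open>K\<close> copies of
  \<open>b\<close>, and a matrix \<open>c\<close> of size \<open>m\<close> is below \<open>m\<close>
  copies of the unit.\<close>

theorem full_order_unit:
  assumes b: "b \<in> Minf_pos A" "b \<in> positives (mat_alg A n)" and n: "n \<ge> 1"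
    and zs: "set zs \<subseteq> carrier A"
    and full: "norm (emb A \<one> - (\<Sum>z\<leftarrow>zs. \<Sum>i<n. emb A z * emb A (b i i) * star (emb A z))) \<le> 1 / 2"
    and c: "c \<in> Minf_pos A"
  shows "\<exists>N. cuntz_class_le A (cls c) (cls b [^]\<^bsub>cuntz_monoid\<^esub> (N::nat))"
proof -
  interpret positively_ordered_monoid cuntz_monoid "cuntz_class_le A" by (rule positively_ordered_cuntz)
  have bc: "b \<in> carrier (mat_alg A n)" using b(2) by (simp add: mat_positives_iff)
  have b_diag: "pos (emb A (b i i))" for i
    using b(2) unfolding mat_positives_iff by (auto intro!: pos_sum pos_star_mult)
  let ?es = "concat (map (\<lambda>z. map (\<lambda>i. emb A z * emb A (b i i) * star (emb A z)) [0..<n]) zs)"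
  define S where "S = (\<Sum>z\<leftarrow>zs. \<Sum>i<n. emb A z * emb A (b i i) * star (emb A z))"
  have S: "S = sum_list ?es"
    unfolding S_def by (induction zs) (simp_all add: interv_sum_list_conv_sum_set_nat atLeast0LessThan)
  have posS: "pos S"
    unfolding S_def by (induction zs) (auto intro!: pos_add pos_sum pos_conj' b_diag)
  define e where "e = emb A \<one>"
  have e: "e * e = e" "star e = e" by (simp_all add: e_def adj_one flip: emb_adj emb_mult)
  have ec: "e * F = F * e" for F by (simp add: e_def emb_component)
  \<comment> \<open>The summand \<open>1 - e\<close> completes \<open>S\<close> to an element near
    the unit of the universal algebra, where inverse roots are available.\<close>
  define H where "H = S + (1 - e)"
  have "norm (1 - H) \<le> 1 / 2" using full by (simp add: H_def S_def[symmetric] e_def[symmetric])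
  moreover have sH: "star H = H" using pos_selfadjoint[OF posS] by (simp add: H_def star_simps e)
  ultimately have "pos (of_real (1 / 2) - (1 - H))" by (intro pos_bounds(1)) (simp_all add: star_diff)
  also have "of_real (1 / 2) - (1 - H) = H - of_real (1 / 2)"
  proof -
    have "of_real (1 / 2) + of_real (1 / 2) = (1 :: 'a univ)" by (metis field_sum_of_halves of_real_1 of_real_add)
    then show ?thesis by (simp add: algebra_simps del: of_real_divide)
  qed
  finally obtain L where L: "star L = L" "L * H * L = 1"
    using pos_inverse_sqrt[of H "1 / 2"] by auto
  let ?u = "e * L"
  have "e * (L * H * L) = e" using L by simp
  moreover have "e * (L * H * L) = (e * L) * S * star (e * L)"
  proof -
    have "e * H = e * S" by (simp add: H_def distrib_left right_diff_distrib e)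
    moreover have "e * (L * H * L) = L * (e * H) * L" by (metis ec mult.assoc)
    moreover have "(e * L) * S * star (e * L) = L * (e * S) * L" by (simp add: star_mult L e mult.assoc) (metis ec e(1) mult.assoc)
    ultimately show ?thesis by simp
  qed
  ultimately have eS: "e = ?u * S * star ?u" by simp
  define K where "K = length ?es"
  have "representable n (emb_mat A b) x" if "x \<in> set ?es" for x
    using that by (auto intro!: representable_diagonal[of _ n "emb_mat A b"])
  note R = block_sum_power[OF b(1) bc n, of K]
  have "representable (K * n) ((mat_block n (emb_mat A b) ^^ K) (\<lambda>i j. 0)) S"
    unfolding S K_def by (rule representable_sum_list) fact
  then have "representable (K * n) (emb_mat A ((block_sum A n b ^^ K) zmat)) S" by (simp only: R(3))
  then have "representable (K * n) (emb_mat A ((block_sum A n b ^^ K) zmat)) e"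
    using representable_conj eS by metis
  then obtain X where X: "mat_conj (K * n) X (emb_mat A ((block_sum A n b ^^ K) zmat)) 0 0 = e"
    by (auto simp: representable_def)
  have "subequivalent 1 (K * n) (emb_mat A (corner_embed A \<one>)) (emb_mat A ((block_sum A n b ^^ K) zmat))"
    unfolding subequivalent_def using X by (intro exI[of _ "\<lambda>k. X"]) (auto simp: corner_embed_def e_def)
  then have "cuntz_le A (corner_embed A \<one>) ((block_sum A n b ^^ K) zmat)"
    using cuntz_le_iff[OF corner_one(2) R(2)] by simp
  then have 1: "cuntz_class_le A (cls (corner_embed A \<one>)) (cls b [^]\<^bsub>cuntz_monoid\<^esub> K)"
    using class_le_iff[OF corner_one(1) R(1)] R(4) by simp
  obtain m where m: "c \<in> positives (mat_alg A m)" using c Minf_posE by blast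
  have cc: "cls c \<in> carrier cuntz_monoid" "cls b \<in> carrier cuntz_monoid" "cls (corner_embed A \<one>) \<in> carrier cuntz_monoid"
    using c b corner_one by (auto simp: cuntz_monoid_simps cls_in)
  have "cuntz_class_le A (cls (corner_embed A \<one>) [^]\<^bsub>cuntz_monoid\<^esub> m) ((cls b [^]\<^bsub>cuntz_monoid\<^esub> K) [^]\<^bsub>cuntz_monoid\<^esub> m)"
    using 1 cc by (intro le_pow) auto
  then have "cuntz_class_le A (cls c) ((cls b [^]\<^bsub>cuntz_monoid\<^esub> K) [^]\<^bsub>cuntz_monoid\<^esub> m)"
    by (rule le_trans[OF _ _ _ le_one_power[OF m], rotated -1]) (use cc in auto)
  then show ?thesis using cc by (auto simp: nat_pow_pow)
qed

section \<open>Quasitraces from tracial states\<close>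

lemma trace_zero: "\<tau> \<in> tracial_states A \<Longrightarrow> \<tau> \<zero> = 0"
proof -
  assume t: "\<tau> \<in> tracial_states A"
  then have "\<tau> (\<zero> \<oplus> \<zero>) = \<tau> \<zero> + \<tau> \<zero>" unfolding tracial_states_def by blast
  then show ?thesis by simp
qed

lemma trace_finsum:
  assumes t: "\<tau> \<in> tracial_states A" and S: "finite S" "\<And>k. k \<in> S \<Longrightarrow> f k \<in> carrier A"
  shows "\<tau> (\<Oplus>k\<in>S. f k) = (\<Sum>k\<in>S. \<tau> (f k))"
  using S
proof (induction S rule: finite_induct)
  case (insert k S)
  then have "(\<Oplus>k\<in>insert k S. f k) = f k \<oplus> (\<Oplus>k\<in>S. f k)" by (intro finsum_insert) auto
  moreover have "\<tau> (f k \<oplus> (\<Oplus>k\<in>S. f k)) = \<tau> (f k) + \<tau> (\<Oplus>k\<in>S. f k)"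
    using t insert unfolding tracial_states_def by (auto intro!: finsum_closed)
  ultimately show ?case using insert by simp
qed (simp add: trace_zero[OF t])

lemma abelian_sub_subset: "abelian_sub_cstar A S \<Longrightarrow> S \<subseteq> carrier A"
proof -
  interpret M: Metric_space "carrier A" "cdist A" by (rule Metric_space_cdist)
  assume "abelian_sub_cstar A S"
  then have "S \<subseteq> topspace M.mtopology" unfolding abelian_sub_cstar_def using closedin_subset by blast
  then show ?thesis by simp
qed

lemma tracial_quasitracial:
  assumes t: "\<tau> \<in> tracial_states A"
  shows "quasitracial A \<tau>"
proof -
  have add: "\<tau> (x \<oplus> y) = \<tau> x + \<tau> y" if "x \<in> carrier A" "y \<in> carrier A" for x y
    using t that by (simp add: tracial_states_def)
  have sc: "\<tau> (cscale A c x) = c * \<tau> x" if "x \<in> carrier A" for x c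
    using t that by (simp add: tracial_states_def)
  show ?thesis unfolding quasitracial_def
  proof (intro conjI ballI allI impI)
    fix x assume x: "x \<in> carrier A"
    have "x \<otimes> adj A x = adj A (adj A x) \<otimes> adj A x" using x by (simp add: adj_adj)
    then have "x \<otimes> adj A x \<in> positives A" using x unfolding positives_def by (blast intro: adj_closed)
    then show "\<tau> (x \<otimes> adj A x) \<in> \<real>\<^sub>\<ge>\<^sub>0" using t by (simp add: tracial_states_def)
    show "\<tau> (x \<otimes> adj A x) = \<tau> (adj A x \<otimes> x)" using t x adj_closed by (simp add: tracial_states_def)
  next
    fix a b assume "a \<in> carrier A" "b \<in> carrier A"
    then show "\<tau> (a \<oplus> cscale A \<i> b) = \<tau> a + \<i> * \<tau> b" by (simp add: add sc cscale_closed)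
  next
    fix S x y c assume "abelian_sub_cstar A S" "x \<in> S"
    then show "\<tau> (cscale A c x) = c * \<tau> x" using abelian_sub_subset sc by blast
    assume "abelian_sub_cstar A S" "x \<in> S" "y \<in> S"
    then show "\<tau> (x \<oplus> y) = \<tau> x + \<tau> y" using abelian_sub_subset add by blast
  qed
qed

lemma sum_nonneg_Reals:
  fixes f :: "'b \<Rightarrow> complex"
  shows "(\<And>i. i \<in> S \<Longrightarrow> f i \<in> \<real>\<^sub>\<ge>\<^sub>0) \<Longrightarrow> sum f S \<in> \<real>\<^sub>\<ge>\<^sub>0"
  by (induction S rule: infinite_finite_induct) (auto intro: nonneg_Reals_add_I)

text \<open>Summing over the nonzero diagonal entries makes \<open>T\<close> independent of
  \<open>n\<close>; \<open>quasitrace_ext\<close> asks for one function that serves all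
  sizes.\<close>

lemma tracial_extends:
  assumes t: "\<tau> \<in> tracial_states A"
  defines "T \<equiv> (\<lambda>x :: nat \<Rightarrow> nat \<Rightarrow> 'a. \<Sum>i\<in>{i. x i i \<noteq> \<zero>}. \<tau> (x i i))"
  assumes n: "n \<ge> 1"
  shows "extends_to_mat A \<tau> n T"
proof -
  let ?M = "mat_alg A n"
  interpret M: cstar_algebra ?M by (rule cstar_mat_alg)
  have add: "\<tau> (x \<oplus> y) = \<tau> x + \<tau> y" if "x \<in> carrier A" "y \<in> carrier A" for x y
    using t that by (simp add: tracial_states_def)
  have sc: "\<tau> (cscale A c x) = c * \<tau> x" if "x \<in> carrier A" for x c
    using t that by (simp add: tracial_states_def)
  have T: "T x = (\<Sum>i<n. \<tau> (x i i))" if "x \<in> carrier ?M" for x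
    unfolding T_def using that trace_zero[OF t]
    by (intro sum.mono_neutral_left) (auto simp: mat_carrier not_le[symmetric])
  have c: "x i j \<in> carrier A" if "x \<in> carrier ?M" for x i j using that by (simp add: mat_carrier)
  have T_add: "T (x \<oplus>\<^bsub>?M\<^esub> y) = T x + T y" if "x \<in> carrier ?M" "y \<in> carrier ?M" for x y
    using that by (simp add: T mat_add add c sum.distrib)
  have T_sc: "T (cscale ?M z x) = z * T x" if "x \<in> carrier ?M" for x z
    using that by (simp add: T mat_cscale_closed mat_cscale sc c sum_distrib_left)
  have xx: "T (x \<otimes>\<^bsub>?M\<^esub> adj ?M x) = (\<Sum>i<n. \<Sum>k<n. \<tau> (x i k \<otimes> adj A (x i k)))" if x: "x \<in> carrier ?M" for x
    unfolding T[OF M.m_closed[OF x mat_adj_closed[OF x]]]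
  proof (intro sum.cong refl)
    fix i assume "i \<in> {..<n}"
    then show "\<tau> ((x \<otimes>\<^bsub>?M\<^esub> adj ?M x) i i) = (\<Sum>k<n. \<tau> (x i k \<otimes> adj A (x i k)))"
      using c[OF x] by (simp add: mat_alg_def trace_finsum[OF t] adj_closed)
  qed
  have xx': "T (adj ?M x \<otimes>\<^bsub>?M\<^esub> x) = (\<Sum>i<n. \<Sum>k<n. \<tau> (adj A (x k i) \<otimes> x k i))" if x: "x \<in> carrier ?M" for x
    unfolding T[OF M.m_closed[OF mat_adj_closed[OF x] x]]
  proof (intro sum.cong refl)
    fix i assume "i \<in> {..<n}"
    then show "\<tau> ((adj ?M x \<otimes>\<^bsub>?M\<^esub> x) i i) = (\<Sum>k<n. \<tau> (adj A (x k i) \<otimes> x k i))"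
      using c[OF x] by (simp add: mat_alg_def trace_finsum[OF t] adj_closed)
  qed
  show ?thesis unfolding extends_to_mat_def
  proof (intro conjI ballI)
    fix a assume a: "a \<in> carrier A"
    have "corner_embed A a \<in> carrier ?M" using a n by (auto simp: corner_embed_def mat_carrier)
    then have "T (corner_embed A a) = (\<Sum>i<n. if i = 0 then \<tau> a else 0)"
      unfolding T[OF \<open>corner_embed A a \<in> carrier ?M\<close>]
      by (intro sum.cong refl) (auto simp: corner_embed_def trace_zero[OF t])
    then show "T (corner_embed A a) = \<tau> a" using n by simp
  next
    show "quasitracial ?M T" unfolding quasitracial_def
    proof (intro conjI ballI allI impI)
      fix x assume x: "x \<in> carrier ?M"
      have q: "\<tau> (y \<otimes> adj A y) \<in> \<real>\<^sub>\<ge>\<^sub>0 \<and> \<tau> (y \<otimes> adj A y) = \<tau> (adj A y \<otimes> y)" if "y \<in> carrier A" for y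
        using bspec[OF conjunct1[OF tracial_quasitracial[OF t, unfolded quasitracial_def]] that] .
      show "T (x \<otimes>\<^bsub>?M\<^esub> adj ?M x) \<in> \<real>\<^sub>\<ge>\<^sub>0" unfolding xx[OF x] by (intro sum_nonneg_Reals) (rule conjunct1[OF q[OF c[OF x]]])
      have "T (x \<otimes>\<^bsub>?M\<^esub> adj ?M x) = (\<Sum>i<n. \<Sum>k<n. \<tau> (adj A (x i k) \<otimes> x i k))"
        unfolding xx[OF x] using q c[OF x] by simp
      also have "\<dots> = T (adj ?M x \<otimes>\<^bsub>?M\<^esub> x)" unfolding xx'[OF x] by (rule sum.swap)
      finally show "T (x \<otimes>\<^bsub>?M\<^esub> adj ?M x) = T (adj ?M x \<otimes>\<^bsub>?M\<^esub> x)" .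
    next
      fix a b assume "a \<in> carrier ?M" "b \<in> carrier ?M"
      then show "T (a \<oplus>\<^bsub>?M\<^esub> cscale ?M \<i> b) = T a + \<i> * T b" by (simp add: T_add T_sc M.cscale_closed)
    next
      fix S x y c assume "abelian_sub_cstar ?M S" "x \<in> S"
      then show "T (cscale ?M c x) = c * T x" using M.abelian_sub_subset T_sc by blast
      assume "abelian_sub_cstar ?M S" "x \<in> S" "y \<in> S"
      then show "T (x \<oplus>\<^bsub>?M\<^esub> y) = T x + T y" using M.abelian_sub_subset T_add by blast
    qed
  qed
qed

lemma tracial_quasitrace: "\<tau> \<in> tracial_states A \<Longrightarrow> \<tau> \<in> quasitraces A"
  unfolding quasitraces_def using tracial_quasitracial tracial_extends
  by (auto simp: tracial_states_def)

text \<open>The chosen function need not be the sum of the values at the diagonal entries. From here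
  on it is known only as some quasitracial extension.\<close>

lemma quasitrace_ext_extends:
  assumes "\<tau> \<in> tracial_states A" "n \<ge> 1"
  shows "extends_to_mat A \<tau> n (quasitrace_ext A \<tau>)"
proof -
  have "\<exists>T. \<forall>n\<ge>1. extends_to_mat A \<tau> n T" using tracial_extends[OF assms(1)] by blast
  from someI_ex[OF this] show ?thesis using assms(2) unfolding quasitrace_ext_def by blast
qed

text \<open>The bicommutant of \<open>F\<close>. Since \<open>F\<close> is commutative, the
  bicommutant lies in the commutant and is therefore commutative; self-adjointness of
  \<open>F\<close> makes it closed under \<open>adj\<close>. Linearity of quasitraces is available
  inside such subalgebras only.\<close>

lemma double_commutant_abelian:
  assumes F: "F \<subseteq> carrier A" and sa: "\<And>f. f \<in> F \<Longrightarrow> adj A f = f"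
    and comm: "\<And>f g. f \<in> F \<Longrightarrow> g \<in> F \<Longrightarrow> f \<otimes> g = g \<otimes> f"
  obtains S where "abelian_sub_cstar A S" "F \<subseteq> S"
proof -
  define C where "C = {y \<in> carrier A. \<forall>f\<in>F. y \<otimes> f = f \<otimes> y}"
  define S where "S = {x \<in> carrier A. \<forall>y\<in>C. x \<otimes> y = y \<otimes> x}"
  have FC: "F \<subseteq> C" using F comm by (auto simp: C_def)
  have FS: "F \<subseteq> S" using F by (auto simp: S_def C_def)
  have SC: "S \<subseteq> C" using FC by (auto simp: S_def C_def)
  have adjC: "adj A y \<in> C" if "y \<in> C" for y
  proof -
    have "adj A y \<otimes> f = f \<otimes> adj A y" if "f \<in> F" for f
    proof -
      have yf: "y \<in> carrier A" "f \<in> carrier A" "y \<otimes> f = f \<otimes> y" using \<open>y \<in> C\<close> that F by (auto simp: C_def)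
      have "adj A y \<otimes> f = adj A (f \<otimes> y)" using yf(1,2) sa[OF that] by (simp add: adj_mult)
      also have "\<dots> = f \<otimes> adj A y" unfolding yf(3)[symmetric] using yf(1,2) sa[OF that] by (simp add: adj_mult)
      finally show ?thesis .
    qed
    then show ?thesis using that by (auto simp: C_def adj_closed)
  qed
  have "abelian_sub_cstar A S" unfolding abelian_sub_cstar_def
  proof (intro conjI ballI allI)
    show "closedin (norm_topology A) S"
    proof (rule closed_norm_topologyI)
      fix x l assume x: "\<And>k. x k \<in> S" and l: "l \<in> carrier A" and lim: "(\<lambda>k. emb A (x k)) \<longlonglongrightarrow> emb A l"
      have "l \<otimes> y = y \<otimes> l" if y: "y \<in> C" for y
      proof -
        have yc: "y \<in> carrier A" using y by (simp add: C_def)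
        have "(\<lambda>k. emb A (x k) * emb A y) \<longlonglongrightarrow> emb A l * emb A y" by (intro tendsto_intros lim)
        moreover have "(\<lambda>k. emb A y * emb A (x k)) \<longlonglongrightarrow> emb A y * emb A l" by (intro tendsto_intros lim)
        moreover have "emb A (x k) * emb A y = emb A y * emb A (x k)" for k
          using x[of k] y yc by (auto simp: S_def simp flip: emb_mult)
        ultimately have "emb A l * emb A y = emb A y * emb A l" using LIMSEQ_unique by fastforce
        then show ?thesis using l yc emb_inj by (simp flip: emb_mult)
      qed
      then show "l \<in> S" using l by (simp add: S_def)
    qed (auto simp: S_def)
    show "\<zero> \<in> S" by (auto simp: S_def C_def)
    fix x assume x: "x \<in> S"
    have xc: "x \<in> carrier A" using x by (simp add: S_def)
    have "adj A x \<otimes> y = y \<otimes> adj A x" if y: "y \<in> C" for y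
    proof -
      have yc: "y \<in> carrier A" using y by (simp add: C_def)
      have "x \<otimes> adj A y = adj A y \<otimes> x" using x adjC[OF y] by (simp add: S_def)
      then have "adj A (x \<otimes> adj A y) = adj A (adj A y \<otimes> x)" by simp
      then show ?thesis using xc yc by (simp add: adj_mult adj_closed adj_adj)
    qed
    then show "adj A x \<in> S" using xc by (simp add: S_def adj_closed)
    show "cscale A c x \<in> S" for c using x by (auto simp: S_def C_def cscale_closed cscale_mult_left cscale_mult_right)
    fix y assume y: "y \<in> S"
    have yc: "y \<in> carrier A" using y by (simp add: S_def)
    show "x \<oplus> y \<in> S" using x y by (auto simp: S_def C_def l_distr r_distr)
    show "x \<otimes> y \<in> S"
    proof -
      have "x \<otimes> y \<otimes> z = z \<otimes> (x \<otimes> y)" if z: "z \<in> C" for z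
      proof -
        have "z \<in> carrier A" "x \<otimes> z = z \<otimes> x" "y \<otimes> z = z \<otimes> y" using z x y by (auto simp: S_def C_def)
        then show ?thesis using xc yc by (metis m_assoc)
      qed
      then show ?thesis using xc yc by (simp add: S_def)
    qed
    show "x \<otimes> y = y \<otimes> x" using x y SC by (auto simp: S_def)
  qed
  then show ?thesis using that FS by blast
qed

lemma quasitrace_functional_component:
  assumes T: "quasitracial A T"
  shows "quasitrace_functional (\<lambda>F. Re (T (component A F)))"
proof
  fix x y :: "'a univ" and r :: real
  have c: "component A x \<in> carrier A" for x by (simp add: is_cstar)
  have Tc: "T (component A x \<otimes> adj A (component A x)) \<in> \<real>\<^sub>\<ge>\<^sub>0"
    "T (component A x \<otimes> adj A (component A x)) = T (adj A (component A x) \<otimes> component A x)" for x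
    using bspec[OF conjunct1[OF T[unfolded quasitracial_def]] c[of x]] by auto
  show "0 \<le> Re (T (component A (x * star x)))"
    using Tc(1)[of x] by (simp add: scal_comp component_star is_cstar complex_nonneg_Reals_iff)
  show "Re (T (component A (x * star x))) = Re (T (component A (star x * x)))"
    using Tc(2)[of x] by (simp add: scal_comp component_star is_cstar)
  assume x: "star x = x"
  then have sx: "adj A (component A x) = component A x" by (metis component_star is_cstar)
  obtain S where S: "abelian_sub_cstar A S" "{component A x} \<subseteq> S"
    using double_commutant_abelian[of "{component A x}"] sx c by auto
  then have "T (cscale A (of_real r) (component A x)) = of_real r * T (component A x)"
    using T by (auto simp: quasitracial_def)
  then show "Re (T (component A (r *\<^sub>R x))) = r * Re (T (component A x))" by (simp add: scal_comp is_cstar)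
  assume y: "star y = y" and xy: "x * y = y * x"
  have sy: "adj A (component A y) = component A y" using y by (metis component_star is_cstar)
  have "component A x \<otimes> component A y = component A y \<otimes> component A x"
    using xy by (metis is_cstar scal_comp_times(2))
  then have "f \<otimes> g = g \<otimes> f" if "f \<in> {component A x, component A y}" "g \<in> {component A x, component A y}" for f g
    using that by auto
  moreover have "adj A f = f" if "f \<in> {component A x, component A y}" for f using that sx sy by auto
  moreover have "{component A x, component A y} \<subseteq> carrier A" using c by auto
  ultimately obtain S where S: "abelian_sub_cstar A S" "{component A x, component A y} \<subseteq> S"
    by (metis (full_types) double_commutant_abelian)
  then have "T (component A x \<oplus> component A y) = T (component A x) + T (component A y)"
    using T by (auto simp: quasitracial_def)
  then show "Re (T (component A (x + y))) = Re (T (component A x)) + Re (T (component A y))"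
    by (simp add: scal_comp is_cstar)
qed

end

text \<open>Half of the double sum of all \<open>star (u i - u j) * (u i - u j)\<close>: an operator
  form of the Cauchy-Schwarz inequality for sums.\<close>

lemma norm_sum_square_le:
  fixes u :: "nat \<Rightarrow> 'a :: unital_cstar"
  shows "pos (real n *\<^sub>R (\<Sum>i<n. star (u i) * u i) - star (\<Sum>i<n. u i) * (\<Sum>i<n. u i))"
proof -
  have "(\<Sum>i<n. \<Sum>j<n. star (u i - u j) * (u i - u j))
    = (\<Sum>i<n. \<Sum>j<n. star (u i) * u i) - (\<Sum>i<n. \<Sum>j<n. star (u i) * u j)
      - (\<Sum>i<n. \<Sum>j<n. star (u j) * u i) + (\<Sum>i<n. \<Sum>j<n. star (u j) * u j)"
    by (simp add: star_diff left_diff_distrib right_diff_distrib sum_subtractf sum.distrib)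
  also have "(\<Sum>i<n. \<Sum>j<n. star (u j) * u i) = (\<Sum>i<n. \<Sum>j<n. star (u i) * u j)" by (rule sum.swap)
  also have "(\<Sum>i<n. \<Sum>j<n. star (u i) * u j) = star (\<Sum>i<n. u i) * (\<Sum>i<n. u i)"
    by (simp add: star_sum sum_product)
  also have "(\<Sum>i<n. \<Sum>j<n. star (u i) * u i) = real n *\<^sub>R (\<Sum>i<n. star (u i) * u i)"
    by (simp add: sum_constant_scaleR scaleR_sum_right del: sum_constant)
  also have "(\<Sum>i<n. \<Sum>j<n. star (u j) * u j) = real n *\<^sub>R (\<Sum>i<n. star (u i) * u i)"
    by (simp add: sum_constant_scaleR del: sum_constant)
  finally have "(\<Sum>i<n. \<Sum>j<n. star (u i - u j) * (u i - u j))
    = 2 *\<^sub>R (real n *\<^sub>R (\<Sum>i<n. star (u i) * u i) - star (\<Sum>i<n. u i) * (\<Sum>i<n. u i))"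
    by (simp only: scaleR_2 scaleR_diff_right) (simp only: algebra_simps)
  moreover have "pos (\<Sum>i<n. \<Sum>j<n. star (u i - u j) * (u i - u j))"
    by (intro pos_sum pos_star_mult)
  ultimately have "pos ((1/2) *\<^sub>R (2 *\<^sub>R (real n *\<^sub>R (\<Sum>i<n. star (u i) * u i) - star (\<Sum>i<n. u i) * (\<Sum>i<n. u i))))"
    by (metis pos_scaleR half_gt_zero less_imp_le zero_less_one)
  then show ?thesis by simp
qed

lemma (in quasitrace_functional) add_orthogonal_sum:
  fixes n :: nat
  assumes "\<And>i. i < n \<Longrightarrow> star (x i) = x i" "\<And>i j. i < n \<Longrightarrow> j < n \<Longrightarrow> i \<noteq> j \<Longrightarrow> x i * x j = 0"
  shows "t (\<Sum>i<n. x i) = (\<Sum>i<n. t (x i))"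
  using assms
proof (induction n)
  case 0
  show ?case using scale[of 0 0] by simp
next
  case (Suc n)
  have z: "x i * x n = 0" "x n * x i = 0" if "i < n" for i using Suc.prems(2)[of i n] Suc.prems(2)[of n i] that by auto
  have "t ((\<Sum>i<n. x i) + x n) = t (\<Sum>i<n. x i) + t (x n)"
    by (rule add) (simp_all add: star_sum Suc.prems sum_distrib_left sum_distrib_right z)
  then show ?case using Suc by simp
qed

context cstar_algebra
begin

section \<open>Matrix units and the diagonal of a positive matrix\<close>

definition unit_mat :: "nat \<Rightarrow> nat \<Rightarrow> nat \<Rightarrow> nat \<Rightarrow> 'a" where
  "unit_mat i j = (\<lambda>p q. if p = i \<and> q = j then \<one> else \<zero>)"

lemma unit_mat_carrier: "i < n \<Longrightarrow> j < n \<Longrightarrow> unit_mat i j \<in> carrier (mat_alg A n)"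
  by (auto simp: unit_mat_def mat_carrier)

lemma mat_eqI:
  assumes "x \<in> carrier (mat_alg A n)" "y \<in> carrier (mat_alg A n)" "\<And>i j. i < n \<Longrightarrow> j < n \<Longrightarrow> emb A (x i j) = emb A (y i j)"
  shows "x = y"
proof (intro ext)
  fix i j
  show "x i j = y i j"
    using assms(1,2) assms(3)[of i j] emb_inj[of "x i j" "y i j"] by (cases "i < n \<and> j < n") (auto simp: mat_carrier not_less)
qed

lemma emb_unit_mat: "emb A (unit_mat i j p q) = (if p = i \<and> q = j then emb A \<one> else 0)"
  by (simp add: unit_mat_def)

lemma unit_mat_adj: "adj (mat_alg A n) (unit_mat i j) = unit_mat j i"
  by (auto simp: unit_mat_def mat_adj fun_eq_iff adj_one adj_zero)

lemma unit_mat_mult: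
  assumes "i < n" "j < n" "k < n" "l < n"
  shows "unit_mat i j \<otimes>\<^bsub>mat_alg A n\<^esub> unit_mat k l = (if j = k then unit_mat i l else \<zero>\<^bsub>mat_alg A n\<^esub>)"
proof (rule mat_eqI[of _ n])
  have e: "emb A \<one> * emb A \<one> = emb A \<one>" by (simp add: emb_unit)
  fix p q assume "p < n" "q < n"
  have "(\<Sum>r<n. emb A (unit_mat i j p r) * emb A (unit_mat k l r q))
      = (\<Sum>r<n. if r = j then (if p = i \<and> q = l \<and> j = k then emb A \<one> else 0) else 0)"
    by (intro sum.cong refl) (auto simp: emb_unit_mat e)
  then show "emb A ((unit_mat i j \<otimes>\<^bsub>mat_alg A n\<^esub> unit_mat k l) p q)
      = emb A ((if j = k then unit_mat i l else \<zero>\<^bsub>mat_alg A n\<^esub>) p q)"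
    using assms by (simp add: emb_mat_mult unit_mat_carrier emb_unit_mat mat_zero)
qed (use assms emb_mat_mult(2) unit_mat_carrier in \<open>auto simp: mat_carrier mat_zero\<close>)

lemma unit_mat_conj:
  assumes "i < n" and b: "b \<in> carrier (mat_alg A n)"
  shows "unit_mat 0 i \<otimes>\<^bsub>mat_alg A n\<^esub> b \<otimes>\<^bsub>mat_alg A n\<^esub> unit_mat i 0 = corner_embed A (b i i)"
proof (rule mat_eqI[of _ n])
  have 0: "0 < n" using assms by simp
  have u: "unit_mat 0 i \<in> carrier (mat_alg A n)" "unit_mat i 0 \<in> carrier (mat_alg A n)"
    using assms 0 by (auto intro: unit_mat_carrier)
  have bc: "b i j \<in> carrier A" for i j using b by (simp add: mat_carrier)
  show ub: "unit_mat 0 i \<otimes>\<^bsub>mat_alg A n\<^esub> b \<otimes>\<^bsub>mat_alg A n\<^esub> unit_mat i 0 \<in> carrier (mat_alg A n)"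
    using emb_mat_mult(2) u b by blast
  show "corner_embed A (b i i) \<in> carrier (mat_alg A n)"
    using 0 bc by (auto simp: corner_embed_def mat_carrier)
  fix p q assume "p < n" "q < n"
  have 1: "emb A ((unit_mat 0 i \<otimes>\<^bsub>mat_alg A n\<^esub> b) p r) = (if p = 0 then emb A (b i r) else 0)" for r
  proof -
    have "(\<Sum>k<n. emb A (unit_mat 0 i p k) * emb A (b k r)) = (\<Sum>k<n. if k = i then (if p = 0 then emb A (b i r) else 0) else 0)"
      by (intro sum.cong refl) (auto simp: emb_unit_mat emb_unit bc)
    then show ?thesis using emb_mat_mult(1)[OF u(1) b] assms by simp
  qed
  have "(\<Sum>k<n. emb A ((unit_mat 0 i \<otimes>\<^bsub>mat_alg A n\<^esub> b) p k) * emb A (unit_mat i 0 k q))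
      = (\<Sum>k<n. if k = i then (if p = 0 \<and> q = 0 then emb A (b i i) else 0) else 0)"
    by (intro sum.cong refl) (auto simp: 1 emb_unit_mat emb_unit bc)
  then show "emb A ((unit_mat 0 i \<otimes>\<^bsub>mat_alg A n\<^esub> b \<otimes>\<^bsub>mat_alg A n\<^esub> unit_mat i 0) p q) = emb A (corner_embed A (b i i) p q)"
    using emb_mat_mult(1)[OF emb_mat_mult(2)[OF u(1) b] u(2)] assms by (simp add: corner_embed_def)
qed

lemma sum_unit_mat: "(\<Sum>i<n. emb (mat_alg A n) (unit_mat i i)) = emb (mat_alg A n) \<one>\<^bsub>mat_alg A n\<^esub>"
proof -
  let ?M = "mat_alg A n"
  interpret M: cstar_algebra ?M by (rule cstar_mat_alg)
  have "(\<Oplus>\<^bsub>?M\<^esub>i\<in>{..<m}. unit_mat i i) = (\<lambda>p q. if p < m \<and> p = q then \<one> else \<zero>)" if "m \<le> n" for m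
    using that
  proof (induction m)
    case 0 show ?case by (simp add: fun_eq_iff mat_zero)
  next
    case (Suc m)
    have "(\<Oplus>\<^bsub>?M\<^esub>i\<in>{..<Suc m}. unit_mat i i) = unit_mat m m \<oplus>\<^bsub>?M\<^esub> (\<Oplus>\<^bsub>?M\<^esub>i\<in>{..<m}. unit_mat i i)"
      unfolding lessThan_Suc using Suc.prems by (intro M.finsum_insert) (auto intro!: unit_mat_carrier)
    then show ?case using Suc by (auto simp: fun_eq_iff mat_add unit_mat_def)
  qed
  from this[of n] have "(\<Oplus>\<^bsub>?M\<^esub>i\<in>{..<n}. unit_mat i i) = \<one>\<^bsub>?M\<^esub>" by (auto simp: fun_eq_iff mat_one)
  then show ?thesis using M.emb_finsum[of "{..<n}" "\<lambda>i. unit_mat i i"] unit_mat_carrier by simp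
qed

text \<open>A positive matrix \<open>b\<close> is dominated by \<open>n diag(b)\<close>, on which a quasitrace is determined by its
  restriction to the algebra.\<close>

lemma quasitrace_null_of_diagonal:
  assumes T: "extends_to_mat A \<tau> n T" and n: "n \<ge> 1" and b: "b \<in> positives (mat_alg A n)"
    and diag: "\<And>i. i < n \<Longrightarrow> \<tau> (b i i) = 0"
  shows "Re (T b) = 0"
proof -
  let ?M = "mat_alg A n"
  interpret M: cstar_algebra ?M by (rule cstar_mat_alg)
  interpret t: quasitrace_functional "\<lambda>F. Re (T (component ?M F))"
    by (rule M.quasitrace_functional_component) (use T in \<open>simp add: extends_to_mat_def\<close>)
  let ?t = "\<lambda>F. Re (T (component ?M F))"
  have bc: "b \<in> carrier ?M" and pb: "pos (emb ?M b)" using b by (auto simp: M.positives_iff)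
  have be: "b i j \<in> carrier A" for i j using bc by (simp add: mat_carrier)
  obtain h where h: "star h = h" "h * h = emb ?M b" using pos_sqrt[OF pb] by metis
  define e where "e i = emb ?M (unit_mat i i)" for i
  define v where "v i = emb ?M (unit_mat 0 i)" for i
  have u: "unit_mat i j \<in> carrier ?M" if "i < n" "j < n" for i j using that by (rule unit_mat_carrier)
  have e: "star (e i) = e i" if "i < n" for i using u that by (simp add: e_def unit_mat_adj flip: M.emb_adj)
  have ee: "e i * e j = 0" if "i < n" "j < n" "i \<noteq> j" for i j
    using u that by (simp add: e_def unit_mat_mult flip: M.emb_mult)
  have vv: "star (v i) * v i = e i" if "i < n" for i
    using u that n by (simp add: e_def v_def unit_mat_adj unit_mat_mult flip: M.emb_mult M.emb_adj)
  have vbv: "v i * emb ?M b * star (v i) = emb ?M (corner_embed A (b i i))" if "i < n" for i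
    using u that n bc unit_mat_conj[OF that bc]
    by (simp add: v_def unit_mat_adj M.m_closed flip: M.emb_mult M.emb_adj)
  \<comment> \<open>As \<open>h\<close> is a root of \<open>b\<close>, these elements add up to
    \<open>h\<close> times the unit, while the products \<open>star (?u i) * ?u i\<close> are the
    mutually orthogonal diagonal pieces of \<open>b\<close>.\<close>
  let ?u = "\<lambda>i. h * e i"
  have uu: "star (?u i) * ?u i = e i * emb ?M b * e i" if "i < n" for i
    by (simp add: star_mult h(1) e[OF that] h(2)[symmetric] mult.assoc)
  \<comment> \<open>The trace property is used twice, to pass from \<open>e i * b * e i\<close>
    through \<open>h * e i * h\<close> to \<open>v i * b * star (v i)\<close>. This is the entry
    \<open>b i i\<close> moved to the corner, where \<open>T\<close> restricts to
    \<open>\<tau>\<close>.\<close>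
  have tu: "?t (star (?u i) * ?u i) = 0" if i: "i < n" for i
  proof -
    have ei: "e i * e i = e i" using u i by (simp add: e_def unit_mat_mult flip: M.emb_mult)
    have "?t (star (?u i) * ?u i) = ?t (?u i * star (?u i))" by (rule t.tracial[symmetric])
    also have "?u i * star (?u i) = (h * star (v i)) * star (h * star (v i))"
      by (simp add: star_mult h(1) e[OF i] mult.assoc) (metis ei vv[OF i] mult.assoc)
    also have "?t \<dots> = ?t (star (h * star (v i)) * (h * star (v i)))" by (rule t.tracial)
    also have "star (h * star (v i)) * (h * star (v i)) = v i * emb ?M b * star (v i)"
      by (simp add: star_mult h(1) h(2)[symmetric] mult.assoc)
    also have "\<dots> = emb ?M (corner_embed A (b i i))" by (rule vbv[OF i])
    also have "?t \<dots> = 0"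
    proof -
      have "corner_embed A (b i i) \<in> carrier ?M" using n be by (auto simp: corner_embed_def mat_carrier)
      moreover have "T (corner_embed A (b i i)) = \<tau> (b i i)" using T be by (simp add: extends_to_mat_def)
      ultimately show ?thesis using diag[OF i] by simp
    qed
    finally show ?thesis .
  qed
  define d where "d = real n *\<^sub>R (\<Sum>i<n. star (?u i) * ?u i)"
  have "pos (d - star (\<Sum>i<n. ?u i) * (\<Sum>i<n. ?u i))" unfolding d_def by (rule norm_sum_square_le)
  also have "(\<Sum>i<n. ?u i) = h * emb ?M \<one>\<^bsub>?M\<^esub>" unfolding e_def sum_unit_mat[symmetric] by (simp add: sum_distrib_left)
  also have "star (h * emb ?M \<one>\<^bsub>?M\<^esub>) * (h * emb ?M \<one>\<^bsub>?M\<^esub>) = emb ?M \<one>\<^bsub>?M\<^esub> * (h * h) * emb ?M \<one>\<^bsub>?M\<^esub>"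
    by (simp add: star_mult h(1) mult.assoc M.adj_one flip: M.emb_adj)
  also have "\<dots> = emb ?M b" unfolding h(2) using bc by (simp add: M.emb_unit mult.assoc)
  finally have db: "pos (d - emb ?M b)" .
  have "?t (\<Sum>i<n. star (?u i) * ?u i) = (\<Sum>i<n. ?t (star (?u i) * ?u i))"
  proof (rule t.add_orthogonal_sum)
    fix i j assume ij: "i < n" "j < n" "i \<noteq> j"
    have "star (?u i) * ?u i * (star (?u j) * ?u j) = e i * emb ?M b * (e i * e j) * emb ?M b * e j"
      unfolding uu[OF ij(1)] uu[OF ij(2)] by (simp add: mult.assoc)
    then show "star (?u i) * ?u i * (star (?u j) * ?u j) = 0" using ee[OF ij] by simp
  qed (simp add: star_mult)
  then have "?t (\<Sum>i<n. star (?u i) * ?u i) = 0" using tu by simp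
  then have "?t d = 0"
    unfolding d_def using t.scale[of "\<Sum>i<n. star (?u i) * ?u i" "real n"] by (simp add: star_sum star_mult)
  then have "?t (emb ?M b) = 0" using t.null_hereditary[OF pb db] by simp
  then show ?thesis using bc by simp
qed

section \<open>Roots in matrix algebras of varying size\<close>

lemma component_power: "k \<ge> 1 \<Longrightarrow> component A (F ^ k) = component A F [^] (k::nat)"
proof (induction k rule: nat_induct_at_least)
  case (Suc k)
  have "F ^ Suc k = F ^ k * F" by (simp add: power_commutes)
  then show ?case using Suc by (simp add: scal_comp is_cstar)
qed (simp add: is_cstar)

lemma emb_pow:
  assumes "x \<in> carrier A" and "k \<ge> 1"
  shows "emb A (x [^] (k::nat)) = emb A x ^ k"
  using assms(2)
proof (induction k rule: nat_induct_at_least)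
  case (Suc k)
  then show ?case using assms(1) by (simp add: emb_mult power_commutes)
qed (use assms(1) in simp)

lemma pow_root_exists:
  assumes b: "b \<in> positives A" and k: "k \<ge> 1"
  obtains r where "r \<in> positives A" "r [^] (k::nat) = b"
proof -
  have bc: "b \<in> carrier A" "pos (emb A b)" using b by (auto simp: positives_iff)
  obtain \<rho> where \<rho>: "pos \<rho>" "\<rho> ^ k = emb A b" using pos_root[OF bc(2) k] by metis
  obtain h where h: "star h = h" "\<rho> = h * h" using \<rho> by (auto simp: pos_def)
  have "component A \<rho> = adj A (component A h) \<otimes> component A h"
    using h by (metis component_star is_cstar scal_comp_times(2))
  then have "component A \<rho> \<in> positives A" by (auto simp: positives_def is_cstar)
  moreover have "component A \<rho> [^] k = b" using component_power[OF k, of \<rho>] \<rho>(2) bc by simp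
  ultimately show ?thesis using that by blast
qed

lemma pow_root_unique:
  assumes "r \<in> positives A" "s \<in> positives A" "k \<ge> 1" "r [^] (k::nat) = s [^] k"
  shows "r = s"
proof -
  have "emb A r ^ k = emb A s ^ k" using assms emb_pow[of r k] emb_pow[of s k] by (simp add: positives_iff)
  then have "emb A r = emb A s" using pos_root_unique[of "emb A r" "emb A s" k] assms by (simp add: positives_iff)
  then show ?thesis using assms emb_inj by (simp add: positives_iff)
qed

lemma mat_mult_mono:
  assumes "x \<in> carrier (mat_alg A n)" "y \<in> carrier (mat_alg A n)" "n \<le> m"
  shows "x \<otimes>\<^bsub>mat_alg A n\<^esub> y = x \<otimes>\<^bsub>mat_alg A m\<^esub> y"
proof (rule mat_eqI[of _ m])
  have m: "x \<in> carrier (mat_alg A m)" "y \<in> carrier (mat_alg A m)" using assms by (auto simp: mat_carrier)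
  show "x \<otimes>\<^bsub>mat_alg A m\<^esub> y \<in> carrier (mat_alg A m)" using emb_mat_mult(2) m by blast
  show "x \<otimes>\<^bsub>mat_alg A n\<^esub> y \<in> carrier (mat_alg A m)" using emb_mat_mult(2)[OF assms(1,2)] assms(3) by (auto simp: mat_carrier)
  fix i j
  show "emb A ((x \<otimes>\<^bsub>mat_alg A n\<^esub> y) i j) = emb A ((x \<otimes>\<^bsub>mat_alg A m\<^esub> y) i j)"
    unfolding emb_mat_mult(1)[OF m] emb_mat_mult(1)[OF assms(1,2)]
    by (rule sum_support) (use assms in \<open>auto simp: mat_carrier\<close>)
qed

text \<open>The exponent 0 has to be excluded, as it gives the unit matrix, which depends on the
  size.\<close>

lemma mat_pow_mono:
  assumes x: "x \<in> carrier (mat_alg A n)" and nm: "n \<le> m" and k: "k \<ge> 1"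
  shows "x [^]\<^bsub>mat_alg A n\<^esub> (k::nat) = x [^]\<^bsub>mat_alg A m\<^esub> k"
  using k
proof (induction k rule: nat_induct_at_least)
  case base
  interpret N: ring "mat_alg A n" by (rule ring_mat_alg)
  interpret M: ring "mat_alg A m" by (rule ring_mat_alg)
  have "x \<in> carrier (mat_alg A m)" using x nm by (auto simp: mat_carrier)
  then show ?case using x by simp
next
  case (Suc k)
  interpret N: ring "mat_alg A n" by (rule ring_mat_alg)
  show ?case using Suc mat_mult_mono[OF N.nat_pow_closed[OF x] x nm, of k] by simp
qed

text \<open>The definite description ranges over all sizes; two candidates are compared in the
  larger of their sizes, where \<open>pow_root_unique\<close> applies.\<close>

lemma Minf_root:
  assumes b: "b \<in> positives (mat_alg A n)" and n: "n \<ge> 1" and k: "k \<ge> 1"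
  shows "Minf_root A k b \<in> positives (mat_alg A n)" "Minf_root A k b [^]\<^bsub>mat_alg A n\<^esub> k = b"
proof -
  interpret N: cstar_algebra "mat_alg A n" by (rule cstar_mat_alg)
  obtain r where r: "r \<in> positives (mat_alg A n)" "r [^]\<^bsub>mat_alg A n\<^esub> k = b"
    using N.pow_root_exists[OF b k] by blast
  have uniq: "s = r" if "b \<in> positives (mat_alg A n')" "s \<in> positives (mat_alg A n')" "s [^]\<^bsub>mat_alg A n'\<^esub> k = b" for s n'
  proof -
    let ?m = "max n n'"
    interpret M: cstar_algebra "mat_alg A ?m" by (rule cstar_mat_alg)
    have c: "r \<in> carrier (mat_alg A n)" "s \<in> carrier (mat_alg A n')" using r that by (auto simp: mat_positives_iff)
    have "s \<in> positives (mat_alg A ?m)" "r \<in> positives (mat_alg A ?m)"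
      using positives_mat_mono[OF that(2), of ?m] positives_mat_mono[OF r(1), of ?m] by auto
    moreover have "s [^]\<^bsub>mat_alg A ?m\<^esub> k = r [^]\<^bsub>mat_alg A ?m\<^esub> k"
      using mat_pow_mono[OF c(1) _ k, of ?m] mat_pow_mono[OF c(2) _ k, of ?m] r that by simp
    ultimately show ?thesis using M.pow_root_unique k by blast
  qed
  have "Minf_root A k b = r"
    unfolding Minf_root_def
  proof (rule the_equality)
    show "\<exists>n\<ge>1. b \<in> positives (mat_alg A n) \<and> r \<in> positives (mat_alg A n) \<and> r [^]\<^bsub>mat_alg A n\<^esub> k = b"
      using n b r by blast
  qed (use uniq in blast)
  then show "Minf_root A k b \<in> positives (mat_alg A n)" "Minf_root A k b [^]\<^bsub>mat_alg A n\<^esub> k = b" using r by auto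
qed

text \<open>Every root of \<open>b\<close> has the null element \<open>b\<close> as a power, so it
  is null itself by \<open>null_root\<close>; the sequence in the definition of the dimension
  function is 0 from \<open>k = 1\<close> on.\<close>

theorem dim_of_trace_null:
  assumes t: "\<tau> \<in> tracial_states A" and b: "b \<in> positives (mat_alg A n)" and n: "n \<ge> 1"
    and diag: "\<And>i. i < n \<Longrightarrow> \<tau> (b i i) = 0"
  shows "dim_of_quasitrace A \<tau> b = 0"
proof -
  let ?M = "mat_alg A n" and ?T = "quasitrace_ext A \<tau>"
  interpret M: cstar_algebra ?M by (rule cstar_mat_alg)
  have T: "extends_to_mat A \<tau> n ?T" by (rule quasitrace_ext_extends[OF t n])
  interpret t: quasitrace_functional "\<lambda>F. Re (?T (component ?M F))"
    by (rule M.quasitrace_functional_component) (use T in \<open>simp add: extends_to_mat_def\<close>)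
  have Tb: "Re (?T b) = 0" by (rule quasitrace_null_of_diagonal[OF T n b diag])
  have "Re (?T (Minf_root A k b)) = 0" if k: "k \<ge> 1" for k
  proof -
    let ?r = "Minf_root A k b"
    have r: "?r \<in> carrier ?M" "pos (emb ?M ?r)" using Minf_root[OF b n k] by (auto simp: M.positives_iff)
    have bc: "b \<in> carrier ?M" using b by (simp add: M.positives_iff)
    have "emb ?M ?r ^ k = emb ?M b" using M.emb_pow[OF r(1) k] Minf_root(2)[OF b n k] by simp
    then have "Re (?T (component ?M (emb ?M ?r))) = 0" using t.null_root[OF r(2), of k] Tb bc by simp
    then show ?thesis using r by simp
  qed
  then have "(\<lambda>k. Re (?T (Minf_root A k b))) \<longlonglongrightarrow> 0"
    by (intro tendsto_eventually eventually_sequentiallyI[of 1]) auto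
  then have "lim (\<lambda>k. Re (?T (Minf_root A k b))) = 0" by (rule limI)
  then show ?thesis using Minf_posI[OF b] by (simp add: dim_of_quasitrace_def)
qed

end

section \<open>Algebras of continuous functions\<close>

text \<open>The disc is a closed subset of a product of compact sets: intervals in the first
  \<open>n\<close> coordinates and \<open>{0}\<close> in the others.\<close>

lemma compactin_euclidean_disc: "compactin (Euclidean_space n) (euclidean_disc n)"
proof -
  let ?D = "{x :: nat \<Rightarrow> real. (\<forall>i. n \<le> i \<longrightarrow> x i = 0) \<and> (\<Sum>i<n. (x i)\<^sup>2) \<le> 1}"
  let ?K = "PiE UNIV (\<lambda>i. if i < n then {-1..1} else {0 :: real})"
  have D: "euclidean_disc n = ?D" by (auto simp: euclidean_disc_def topspace_Euclidean_space)
  have "compactin (powertop_real UNIV) ?K"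
    unfolding compactin_PiE by auto
  moreover have "?D \<subseteq> ?K"
  proof
    fix x assume x: "x \<in> ?D"
    have "\<bar>x i\<bar> \<le> 1" if i: "i < n" for i
    proof -
      have "(x i)\<^sup>2 \<le> (\<Sum>i<n. (x i)\<^sup>2)" using i by (intro member_le_sum) auto
      then have "(x i)\<^sup>2 \<le> 1" using x by auto
      then show ?thesis by (simp only: abs_square_le_1)
    qed
    then show "x \<in> ?K" using x by (auto simp: abs_le_iff minus_le_iff)
  qed
  moreover have "closedin (powertop_real UNIV) ?D"
  proof -
    have "closed {x :: nat \<Rightarrow> real. x i = 0}" for i
      by (intro closed_Collect_eq continuous_on_product_coordinates continuous_on_const)
    then have "closed (\<Inter>i\<in>{n..}. {x :: nat \<Rightarrow> real. x i = 0})" by (intro closed_INT) auto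
    moreover have "closed {x :: nat \<Rightarrow> real. (\<Sum>i<n. (x i)\<^sup>2) \<le> 1}"
      by (intro closed_Collect_le continuous_intros continuous_on_product_coordinates)
    ultimately have "closed ((\<Inter>i\<in>{n..}. {x :: nat \<Rightarrow> real. x i = 0}) \<inter> {x. (\<Sum>i<n. (x i)\<^sup>2) \<le> 1})" by (rule closed_Int)
    also have "(\<Inter>i\<in>{n..}. {x :: nat \<Rightarrow> real. x i = 0}) \<inter> {x. (\<Sum>i<n. (x i)\<^sup>2) \<le> 1} = ?D" by auto
    finally show ?thesis by (simp add: euclidean_product_topology)
  qed
  ultimately have "compactin (powertop_real UNIV) ?D" by (rule closed_compactin)
  then show ?thesis unfolding D Euclidean_space_def by (auto simp: compactin_subtopology)
qed

text \<open>The images of the closed discs are compact, and finitely many of them cover the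
  space.\<close>

lemma finite_CW_complex_compact:
  assumes "finite_CW_complex X"
  shows "compact_space X"
proof -
  obtain N dim \<Phi> where
    cont: "\<And>e::nat. e < N \<Longrightarrow> continuous_map (subtopology (Euclidean_space (dim e)) (euclidean_disc (dim e))) X (\<Phi> e)"
    and cover: "(\<Union>e<N. \<Phi> e ` euclidean_open_disc (dim e)) = topspace X"
    using assms unfolding finite_CW_complex_def by (elim conjE exE) metis
  have c: "compactin X (\<Phi> e ` euclidean_disc (dim e))" if "e < N" for e
    using image_compactin[OF _ cont[OF that]] compactin_euclidean_disc by simp
  then have "compactin X (\<Union>e\<in>{..<N}. \<Phi> e ` euclidean_disc (dim e))" by (intro compactin_Union) auto
  moreover have "(\<Union>e\<in>{..<N}. \<Phi> e ` euclidean_disc (dim e)) = topspace X"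
  proof
    show "(\<Union>e\<in>{..<N}. \<Phi> e ` euclidean_disc (dim e)) \<subseteq> topspace X" using c compactin_subset_topspace by fastforce
    have "euclidean_open_disc d \<subseteq> euclidean_disc d" for d
      by (auto simp: euclidean_open_disc_def euclidean_disc_def)
    then show "topspace X \<subseteq> (\<Union>e\<in>{..<N}. \<Phi> e ` euclidean_disc (dim e))" unfolding cover[symmetric] by blast
  qed
  ultimately show ?thesis by (simp add: compact_space_def)
qed

section \<open>The algebra of continuous functions on a compact space\<close>

lemma continuous_map_complex_mult:
  fixes f g :: "'x \<Rightarrow> complex"
  shows "continuous_map X euclidean f \<Longrightarrow> continuous_map X euclidean g \<Longrightarrow> continuous_map X euclidean (\<lambda>x. f x * g x)"
  by (simp add: continuous_map_atin tendsto_mult)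

lemma continuous_map_complex_cnj:
  "continuous_map X euclidean f \<Longrightarrow> continuous_map X euclidean (\<lambda>x. cnj (f x))"
  by (simp add: continuous_map_atin tendsto_cnj)

lemma continuous_map_complex_of_real:
  "continuous_map X euclideanreal f \<Longrightarrow> continuous_map X euclidean (\<lambda>x. complex_of_real (f x))"
  by (simp add: continuous_map_atin tendsto_of_real)

lemma continuous_map_complex_Re:
  "continuous_map X euclidean f \<Longrightarrow> continuous_map X euclideanreal (\<lambda>x. Re (f x))"
  by (simp add: continuous_map_atin tendsto_Re)

lemma cont_alg_simps:
  "f \<in> carrier (cont_alg X) \<longleftrightarrow> continuous_map X euclidean f \<and> (\<forall>x. x \<notin> topspace X \<longrightarrow> f x = 0)"
  "f \<otimes>\<^bsub>cont_alg X\<^esub> g = (\<lambda>x. f x * g x)" "f \<oplus>\<^bsub>cont_alg X\<^esub> g = (\<lambda>x. f x + g x)"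
  "\<zero>\<^bsub>cont_alg X\<^esub> = (\<lambda>x. 0)" "\<one>\<^bsub>cont_alg X\<^esub> = (\<lambda>x. if x \<in> topspace X then 1 else 0)"
  "cscale (cont_alg X) c f = (\<lambda>x. c * f x)" "adj (cont_alg X) f = (\<lambda>x. cnj (f x))"
  "cnorm (cont_alg X) f = (SUP x\<in>topspace X. cmod (f x))"
  by (simp_all add: cont_alg_def)

lemma ring_cont_alg: "ring (cont_alg X)"
proof (rule ringI)
  show "abelian_group (cont_alg X)"
  proof (rule abelian_groupI)
    fix f assume "f \<in> carrier (cont_alg X)"
    then show "\<exists>g\<in>carrier (cont_alg X). g \<oplus>\<^bsub>cont_alg X\<^esub> f = \<zero>\<^bsub>cont_alg X\<^esub>"
      by (intro bexI[of _ "\<lambda>x. - f x"]) (auto simp: cont_alg_simps)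
  qed (auto simp: cont_alg_simps fun_eq_iff intro: continuous_map_add)
  show "Group.monoid (cont_alg X)"
  proof (rule Group.monoid.intro)
    have "continuous_map X euclidean (\<lambda>x. if x \<in> topspace X then 1 else 0 :: complex)"
      by (rule continuous_map_eq[of _ _ "\<lambda>x. 1"]) auto
    then show "\<one>\<^bsub>cont_alg X\<^esub> \<in> carrier (cont_alg X)" by (simp add: cont_alg_simps)
  qed (auto simp: cont_alg_simps fun_eq_iff intro: continuous_map_complex_mult)
qed (auto simp: cont_alg_simps fun_eq_iff algebra_simps)

lemma cont_alg_bdd:
  assumes "compact_space X" and f: "f \<in> carrier (cont_alg X)"
  shows "bdd_above ((\<lambda>x. cmod (f x)) ` topspace X)"
proof -
  have "compactin X (topspace X)" using assms(1) by (simp add: compact_space_def)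
  then have "compactin euclidean (f ` topspace X)" using f by (intro image_compactin) (auto simp: cont_alg_simps)
  then have "bounded (f ` topspace X)" using compact_imp_bounded by simp
  then obtain K where "\<And>x. x \<in> topspace X \<Longrightarrow> cmod (f x) \<le> K" by (auto simp: bounded_iff)
  then show ?thesis by (auto intro!: bdd_aboveI2)
qed

lemma cont_alg_norm_ge:
  "compact_space X \<Longrightarrow> f \<in> carrier (cont_alg X) \<Longrightarrow> x \<in> topspace X \<Longrightarrow> cmod (f x) \<le> cnorm (cont_alg X) f"
  unfolding cont_alg_simps by (rule cSUP_upper[OF _ cont_alg_bdd]) (auto simp: cont_alg_simps)

lemma cont_alg_norm_le:
  "topspace X \<noteq> {} \<Longrightarrow> (\<And>x. x \<in> topspace X \<Longrightarrow> cmod (f x) \<le> K) \<Longrightarrow> cnorm (cont_alg X) f \<le> K"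
  unfolding cont_alg_simps by (rule cSUP_least)

lemma cont_alg_minus:
  assumes "f \<in> carrier (cont_alg X)" "g \<in> carrier (cont_alg X)"
  shows "f \<ominus>\<^bsub>cont_alg X\<^esub> g = (\<lambda>x. f x - g x)"
proof -
  interpret ring "cont_alg X" by (rule ring_cont_alg)
  have "\<ominus>\<^bsub>cont_alg X\<^esub> g = (\<lambda>x. - g x)"
    using assms by (intro minus_equality) (auto simp: cont_alg_simps)
  then show ?thesis by (simp add: a_minus_def cont_alg_simps)
qed

theorem cstar_cont_alg:
  assumes X: "compact_space X" "topspace X \<noteq> {}"
  shows "cstar_algebra (cont_alg X)"
proof -
  let ?C = "cont_alg X"
  interpret R: ring ?C by (rule ring_cont_alg)
  note ge = cont_alg_norm_ge[OF X(1)] and le = cont_alg_norm_le[OF X(2)]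
  obtain x0 where x0: "x0 \<in> topspace X" using X by blast
  have nonneg: "0 \<le> cnorm ?C f" if "f \<in> carrier ?C" for f using ge[OF that x0] norm_ge_zero order_trans by blast
  have zero: "cnorm ?C f = 0 \<longleftrightarrow> f = \<zero>\<^bsub>?C\<^esub>" if f: "f \<in> carrier ?C" for f
  proof
    assume 0: "cnorm ?C f = 0"
    have "f x = 0" for x using ge[OF f, of x] 0 f by (cases "x \<in> topspace X") (auto simp: cont_alg_simps(1))
    then show "f = \<zero>\<^bsub>?C\<^esub>" by (auto simp: cont_alg_simps)
  next
    assume "f = \<zero>\<^bsub>?C\<^esub>"
    then have "cnorm ?C f \<le> 0" by (intro le) (simp add: cont_alg_simps)
    then show "cnorm ?C f = 0" using nonneg[OF f] by simp
  qed
  have triangle: "cnorm ?C (f \<oplus>\<^bsub>?C\<^esub> g) \<le> cnorm ?C f + cnorm ?C g" if "f \<in> carrier ?C" "g \<in> carrier ?C" for f g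
    by (rule le) (auto simp: cont_alg_simps(3) intro!: order_trans[OF norm_triangle_ineq] add_mono ge that)
  have sc: "cnorm ?C (cscale ?C c f) = cmod c * cnorm ?C f" if f: "f \<in> carrier ?C" for c f
  proof (rule antisym)
    show "cnorm ?C (cscale ?C c f) \<le> cmod c * cnorm ?C f"
      by (rule le) (auto simp: cont_alg_simps(6) norm_mult intro!: mult_left_mono ge f)
    have cf: "cscale ?C c f \<in> carrier ?C"
      using f by (auto simp: cont_alg_simps intro!: continuous_map_complex_mult)
    show "cmod c * cnorm ?C f \<le> cnorm ?C (cscale ?C c f)"
    proof (cases "c = 0")
      case False
      have "cnorm ?C f \<le> cnorm ?C (cscale ?C c f) / cmod c"
        using ge[OF cf] False by (intro le) (simp add: cont_alg_simps(6) norm_mult field_simps)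
      then show ?thesis using False by (simp add: field_simps)
    qed (use nonneg[OF cf] in simp)
  qed
  interpret D: Metric_space "carrier ?C" "cdist ?C"
  proof
    fix f g h
    show "0 \<le> cdist ?C f g" by (simp add: cdist_def nonneg)
    show "cdist ?C f g = cdist ?C g f"
      by (simp add: cdist_def cont_alg_minus cont_alg_simps(8) norm_minus_commute)
    show "cdist ?C f g = 0 \<longleftrightarrow> f = g" if "f \<in> carrier ?C" "g \<in> carrier ?C"
      using that zero[OF R.minus_closed[OF that]] by (simp add: cdist_def) (simp add: cont_alg_minus cont_alg_simps(4) fun_eq_iff)
    show "cdist ?C f h \<le> cdist ?C f g + cdist ?C g h" if "f \<in> carrier ?C" "g \<in> carrier ?C" "h \<in> carrier ?C"
      using that triangle[of "f \<ominus>\<^bsub>?C\<^esub> g" "g \<ominus>\<^bsub>?C\<^esub> h"] by (simp add: cdist_def) (simp add: cont_alg_minus cont_alg_simps(3))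
  qed
  have complete: "D.mcomplete" unfolding D.mcomplete_def
  proof (intro allI impI)
    fix f assume "D.MCauchy f"
    then have f: "\<And>n. f n \<in> carrier ?C" and C: "\<And>e. e > 0 \<Longrightarrow> \<exists>N. \<forall>m n. N \<le> m \<longrightarrow> N \<le> n \<longrightarrow> cdist ?C (f m) (f n) < e"
      unfolding D.MCauchy_def by auto
    have d: "dist (f m x) (f n x) \<le> cdist ?C (f m) (f n)" if "x \<in> topspace X" for m n x
      using ge[of "f m \<ominus>\<^bsub>?C\<^esub> f n" x] that f by (simp add: cdist_def dist_norm) (simp add: cont_alg_minus)
    have 1: "\<exists>N. \<forall>m n x. N \<le> m \<longrightarrow> N \<le> n \<longrightarrow> x \<in> topspace X \<longrightarrow> dist (f m x) (f n x) < e" if "e > 0" for e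
      using C[OF that] d order_le_less_trans by meson
    have 2: "\<forall>\<^sub>F n in sequentially. continuous_map X Met_TC.mtopology (f n)"
      using f by (simp add: cont_alg_simps)
    have 3: "Met_TC.mcomplete TYPE(complex)" using complete_UNIV by simp
    obtain g where g: "continuous_map X euclidean g"
      "\<And>e. 0 < e \<Longrightarrow> \<forall>\<^sub>F n in sequentially. \<forall>x\<in>topspace X. dist (f n x) (g x) < e"
      by (rule Met_TC.continuous_map_uniformly_Cauchy_limit[OF 3 2 1]) (simp_all add: that)
    define h where "h x = (if x \<in> topspace X then g x else 0)" for x
    have h: "h \<in> carrier ?C"
      using continuous_map_eq[OF g(1), of h] by (auto simp: cont_alg_simps h_def)
    have "\<exists>N. \<forall>n\<ge>N. f n \<in> carrier ?C \<and> cdist ?C (f n) h < e" if e: "e > 0" for e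
    proof -
      have "\<forall>\<^sub>F n in sequentially. \<forall>x\<in>topspace X. dist (f n x) (g x) < e/2" by (rule g(2)) (use e in simp)
      then obtain N where N: "\<And>n x. n \<ge> N \<Longrightarrow> x \<in> topspace X \<Longrightarrow> dist (f n x) (g x) < e/2"
        by (auto simp: eventually_sequentially)
      have "cdist ?C (f n) h \<le> e/2" if "n \<ge> N" for n
      proof -
        have "cnorm ?C (f n \<ominus>\<^bsub>?C\<^esub> h) \<le> e/2"
          using N[OF that] by (intro le) (force simp: cont_alg_minus f h h_def dist_norm)
        then show ?thesis using f h by (simp add: cdist_def)
      qed
      then have "\<forall>n\<ge>N. f n \<in> carrier ?C \<and> cdist ?C (f n) h < e" using f e by fastforce
      then show ?thesis by blast
    qed
    then show "\<exists>h. limitin D.mtopology f h sequentially"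
      unfolding D.limit_metric_sequentially using h by blast
  qed
  show ?thesis
  proof
    fix f g c d assume f: "f \<in> carrier ?C"
    show "cscale ?C c f \<in> carrier ?C" "adj ?C f \<in> carrier ?C"
      using f by (auto simp: cont_alg_simps intro!: continuous_map_complex_mult continuous_map_complex_cnj)
    show "cnorm ?C (adj ?C f \<otimes>\<^bsub>?C\<^esub> f) = (cnorm ?C f)\<^sup>2"
    proof (rule antisym)
      have "cmod ((adj ?C f \<otimes>\<^bsub>?C\<^esub> f) x) = (cmod (f x))\<^sup>2" for x
        by (simp add: cont_alg_simps norm_mult power2_eq_square)
      then show "cnorm ?C (adj ?C f \<otimes>\<^bsub>?C\<^esub> f) \<le> (cnorm ?C f)\<^sup>2"
        by (intro le) (auto intro!: power_mono ge f)
      have ff: "adj ?C f \<otimes>\<^bsub>?C\<^esub> f \<in> carrier ?C"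
        using f by (auto simp: cont_alg_simps intro!: continuous_map_complex_mult continuous_map_complex_cnj)
      have "cnorm ?C f \<le> sqrt (cnorm ?C (adj ?C f \<otimes>\<^bsub>?C\<^esub> f))"
      proof (rule le)
        fix x assume "x \<in> topspace X"
        from ge[OF ff this] show "cmod (f x) \<le> sqrt (cnorm ?C (adj ?C f \<otimes>\<^bsub>?C\<^esub> f))"
          by (intro real_le_rsqrt) (simp add: \<open>\<And>x. cmod ((adj ?C f \<otimes>\<^bsub>?C\<^esub> f) x) = (cmod (f x))\<^sup>2\<close>)
      qed
      then show "(cnorm ?C f)\<^sup>2 \<le> cnorm ?C (adj ?C f \<otimes>\<^bsub>?C\<^esub> f)"
        using nonneg[OF f] nonneg[OF ff] by (metis power_mono real_sqrt_pow2)
    qed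
    assume g: "g \<in> carrier ?C"
    show "cnorm ?C (f \<otimes>\<^bsub>?C\<^esub> g) \<le> cnorm ?C f * cnorm ?C g"
      by (rule le) (auto simp: cont_alg_simps(2) norm_mult intro!: mult_mono ge f g nonneg)
  qed (use nonneg zero triangle sc complete in \<open>auto simp: cont_alg_simps(1-7) algebra_simps\<close>)
qed

lemma cont_alg_finsum:
  assumes "finite S" "\<And>k. k \<in> S \<Longrightarrow> f k \<in> carrier (cont_alg X)"
  shows "(\<Oplus>\<^bsub>cont_alg X\<^esub>k\<in>S. f k) x = (\<Sum>k\<in>S. f k x)"
  using assms
proof (induction S rule: finite_induct)
  case empty
  interpret ring "cont_alg X" by (rule ring_cont_alg)
  show ?case by (simp add: cont_alg_simps)
next
  case (insert k S)
  interpret ring "cont_alg X" by (rule ring_cont_alg)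
  have "(\<Oplus>\<^bsub>cont_alg X\<^esub>k\<in>insert k S. f k) = f k \<oplus>\<^bsub>cont_alg X\<^esub> (\<Oplus>\<^bsub>cont_alg X\<^esub>k\<in>S. f k)"
    using insert by (intro finsum_insert) auto
  then show ?case using insert by (simp add: cont_alg_simps(3))
qed

lemma mat_cont_mult:
  assumes "x \<in> carrier (mat_alg (cont_alg X) k)" "y \<in> carrier (mat_alg (cont_alg X) k)"
  shows "(x \<otimes>\<^bsub>mat_alg (cont_alg X) k\<^esub> y) a b \<xi> = (\<Sum>c<k. x a c \<xi> * y c b \<xi>)"
proof -
  interpret ring "cont_alg X" by (rule ring_cont_alg)
  have c: "x a b \<in> carrier (cont_alg X)" "y a b \<in> carrier (cont_alg X)" for a b using assms by (auto simp: mat_carrier)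
  show ?thesis
  proof (cases "a < k \<and> b < k")
    case True
    then have "(x \<otimes>\<^bsub>mat_alg (cont_alg X) k\<^esub> y) a b = (\<Oplus>\<^bsub>cont_alg X\<^esub>c\<in>{..<k}. x a c \<otimes>\<^bsub>cont_alg X\<^esub> y c b)"
      by (simp add: mat_alg_def)
    then show ?thesis using c by (simp add: cont_alg_finsum) (simp add: cont_alg_simps(2))
  next
    case False
    then have "x a c \<xi> * y c b \<xi> = 0" for c using assms by (auto simp: mat_carrier cont_alg_simps(4) not_less)
    then have "(\<Sum>c<k. x a c \<xi> * y c b \<xi>) = 0" by (intro sum.neutral) blast
    moreover have "(x \<otimes>\<^bsub>mat_alg (cont_alg X) k\<^esub> y) a b \<xi> = 0" proof -
      have "(x \<otimes>\<^bsub>mat_alg (cont_alg X) k\<^esub> y) a b = \<zero>\<^bsub>cont_alg X\<^esub>" using False by (auto simp: mat_alg_def)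
      then show ?thesis by (simp add: cont_alg_simps(4))
    qed
    ultimately show ?thesis by simp
  qed
qed

text \<open>At a single point the matrix of numbers has operator norm at most the norm of the matrix
  of functions: a vector \<open>u\<close> of numbers is tested as the vector of constant
  functions.\<close>

lemma mat_cont_norm_ge:
  assumes X: "compact_space X" "topspace X \<noteq> {}" and w: "w \<in> carrier (mat_alg (cont_alg X) k)" and \<xi>: "\<xi> \<in> topspace X"
  shows "L2_set (\<lambda>a. cmod (\<Sum>b<k. w a b \<xi> * u b)) {..<k} \<le> cnorm (mat_alg (cont_alg X) k) w * L2_set (\<lambda>a. cmod (u a)) {..<k}"
proof -
  interpret C: cstar_algebra "cont_alg X" by (rule cstar_cont_alg[OF X])
  define v where "v j = (\<lambda>x. if x \<in> topspace X then u j else 0)" for j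
  have v: "v j \<in> carrier (cont_alg X)" for j
    using continuous_map_eq[of X euclidean "\<lambda>x. u j" "v j"] by (auto simp: cont_alg_simps v_def)
  have wc: "w a b \<in> carrier (cont_alg X)" for a b using w by (simp add: mat_carrier)
  define z where "z a = (\<Oplus>\<^bsub>cont_alg X\<^esub>b\<in>{..<k}. w a b \<otimes>\<^bsub>cont_alg X\<^esub> v b)" for a
  have z: "z a \<in> carrier (cont_alg X)" for a unfolding z_def using wc v by (auto intro!: C.finsum_closed)
  have z_eval: "z a \<xi> = (\<Sum>b<k. w a b \<xi> * u b)" for a
    unfolding z_def using wc v by (simp add: cont_alg_finsum) (simp add: cont_alg_simps(2) v_def \<xi>)
  have mod_eval: "(\<Oplus>\<^bsub>cont_alg X\<^esub>j\<in>{..<k}. adj (cont_alg X) (f j) \<otimes>\<^bsub>cont_alg X\<^esub> f j) x = of_real (\<Sum>j<k. (cmod (f j x))\<^sup>2)"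
    if "\<And>j. f j \<in> carrier (cont_alg X)" for f x
    using that
    by (simp add: cont_alg_finsum C.adj_closed) (simp add: cont_alg_simps(2,7) complex_norm_square[symmetric] mult.commute)
  have mod_closed: "(\<Oplus>\<^bsub>cont_alg X\<^esub>j\<in>{..<k}. adj (cont_alg X) (f j) \<otimes>\<^bsub>cont_alg X\<^esub> f j) \<in> carrier (cont_alg X)"
    if "\<And>j. f j \<in> carrier (cont_alg X)" for f
    using that C.adj_closed by (auto intro!: C.finsum_closed)
  have "(\<Sum>a<k. (cmod (z a \<xi>))\<^sup>2) \<le> cnorm (cont_alg X) (\<Oplus>\<^bsub>cont_alg X\<^esub>j\<in>{..<k}. adj (cont_alg X) (z j) \<otimes>\<^bsub>cont_alg X\<^esub> z j)"
    using cont_alg_norm_ge[OF X(1) mod_closed[of z, OF z] \<xi>] mod_eval[of z, OF z]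
    by (simp add: norm_of_real sum_nonneg del: of_real_sum)
  then have 1: "L2_set (\<lambda>a. cmod (z a \<xi>)) {..<k} \<le> module_norm (cont_alg X) k z"
    by (simp add: L2_set_def module_norm_def)
  have "cnorm (cont_alg X) (\<Oplus>\<^bsub>cont_alg X\<^esub>j\<in>{..<k}. adj (cont_alg X) (v j) \<otimes>\<^bsub>cont_alg X\<^esub> v j) \<le> (\<Sum>j<k. (cmod (u j))\<^sup>2)"
    using mod_eval[of v, OF v] by (intro cont_alg_norm_le[OF X(2)]) (simp add: v_def norm_of_real sum_nonneg del: of_real_sum)
  then have 2: "module_norm (cont_alg X) k v \<le> L2_set (\<lambda>a. cmod (u a)) {..<k}"
    by (simp add: L2_set_def module_norm_def)
  have "module_norm (cont_alg X) k z \<le> cnorm (mat_alg (cont_alg X) k) w * module_norm (cont_alg X) k v"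
    using C.mat_cnorm_bound[of w k v, OF w v] C.mat_vec_closed(2)[of w k v, OF w v]
    by (simp add: C.module_norm_emb z v) (simp add: z_def)
  then show ?thesis
    using 1 2 C.mat_cnorm_nonneg[OF w] unfolding z_eval by (meson mult_left_mono order_trans)
qed

section \<open>Projections in matrix algebras\<close>

text \<open>With the columns of \<open>E\<close> as vectors, the trace of \<open>W\<close> is the
  sum of the inner products of each column with its image under \<open>W\<close>, and the squared
  length of a column is the corresponding diagonal entry of \<open>E\<close>. The point is that the
  bound involves the trace of \<open>E\<close> and not the size \<open>k\<close>.\<close>

lemma projection_trace_bound:
  fixes E W :: "nat \<Rightarrow> nat \<Rightarrow> complex"
  assumes sa: "\<And>a b. E a b = cnj (E b a)" and idem: "\<And>a b. (\<Sum>c<k. E a c * E c b) = E a b"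
    and EW: "\<And>a b. (\<Sum>c<k. E a c * W c b) = W a b" and WE: "\<And>a b. (\<Sum>c<k. W a c * E c b) = W a b"
    and r: "\<And>u. L2_set (\<lambda>a. cmod (\<Sum>b<k. W a b * u b)) {..<k} \<le> r * L2_set (\<lambda>a. cmod (u a)) {..<k}"
  shows "cmod (\<Sum>a<k. W a a) \<le> r * Re (\<Sum>a<k. E a a)"
proof -
  have "W a a = (\<Sum>c<k. cnj (E c a) * (\<Sum>d<k. W c d * E d a))" for a
    unfolding WE using EW[of a a] sa by (metis (no_types, lifting) sum.cong)
  moreover have "cmod (\<Sum>c<k. cnj (E c a) * (\<Sum>d<k. W c d * E d a)) \<le> r * (\<Sum>c<k. (cmod (E c a))\<^sup>2)" for a
  proof -
    have "cmod (\<Sum>c<k. cnj (E c a) * (\<Sum>d<k. W c d * E d a)) \<le> (\<Sum>c<k. \<bar>cmod (E c a)\<bar> * \<bar>cmod (\<Sum>d<k. W c d * E d a)\<bar>)"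
      by (rule order_trans[OF norm_sum]) (simp add: norm_mult)
    also have "\<dots> \<le> L2_set (\<lambda>c. cmod (E c a)) {..<k} * L2_set (\<lambda>c. cmod (\<Sum>d<k. W c d * E d a)) {..<k}"
      by (rule L2_set_mult_ineq)
    also have "\<dots> \<le> L2_set (\<lambda>c. cmod (E c a)) {..<k} * (r * L2_set (\<lambda>c. cmod (E c a)) {..<k})"
      using r[of "\<lambda>d. E d a"] by (intro mult_left_mono) (auto simp: L2_set_nonneg)
    also have "\<dots> = r * (\<Sum>c<k. (cmod (E c a))\<^sup>2)"
      by (simp add: L2_set_def mult.commute[of r] mult.assoc[symmetric] sum_nonneg)
    finally show ?thesis .
  qed
  ultimately have "cmod (W a a) \<le> r * (\<Sum>c<k. (cmod (E c a))\<^sup>2)" for a by metis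
  moreover have "(\<Sum>c<k. (cmod (E c a))\<^sup>2) = Re (E a a)" for a
  proof -
    have "E a a = (\<Sum>c<k. of_real ((cmod (E c a))\<^sup>2))"
      unfolding idem[of a a, symmetric]
    proof (rule sum.cong[OF refl])
      fix c show "E a c * E c a = of_real ((cmod (E c a))\<^sup>2)"
        unfolding sa[of a c] complex_norm_square by (simp only: mult.commute)
    qed
    then show ?thesis by (metis Re_complex_of_real of_real_sum)
  qed
  ultimately have "cmod (W a a) \<le> r * Re (E a a)" for a by metis
  then have "cmod (\<Sum>a<k. W a a) \<le> (\<Sum>a<k. r * Re (E a a))" by (intro sum_norm_le) auto
  then show ?thesis by (simp add: sum_distrib_left)
qed

lemma projection_trace_sum:
  fixes E :: "nat \<Rightarrow> nat \<Rightarrow> complex"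
  assumes sa: "\<And>a b. E a b = cnj (E b a)" and idem: "\<And>a b. (\<Sum>c<k. E a c * E c b) = E a b"
  shows "(\<Sum>a<k. E a a) = of_real (\<Sum>a<k. \<Sum>c<k. (cmod (E a c))\<^sup>2)"
proof -
  have "E a a = of_real (\<Sum>c<k. (cmod (E a c))\<^sup>2)" for a
  proof -
    have "E a c * E c a = of_real ((cmod (E a c))\<^sup>2)" for c
      unfolding sa[of c a] complex_norm_square ..
    then show ?thesis using idem[of a a] by simp
  qed
  then show ?thesis by simp
qed

text \<open>A nonzero column of \<open>E\<close> is fixed by \<open>E\<close>. The Cauchy-Schwarz
  inequality bounds its squared length \<open>N\<close> by \<open>N\<close> times the squared
  Hilbert-Schmidt norm of \<open>E\<close>, which is the trace.\<close>

lemma projection_trace_ge_1: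
  fixes E :: "nat \<Rightarrow> nat \<Rightarrow> complex"
  assumes sa: "\<And>a b. E a b = cnj (E b a)" and idem: "\<And>a b. (\<Sum>c<k. E a c * E c b) = E a b"
    and nz: "a0 < k" "E a0 b0 \<noteq> 0"
  shows "1 \<le> Re (\<Sum>a<k. E a a)"
proof -
  define N where "N = (\<Sum>a<k. (cmod (E a b0))\<^sup>2)"
  have "(cmod (E a0 b0))\<^sup>2 \<le> N" unfolding N_def using nz by (intro member_le_sum) auto
  then have N: "N > 0" using nz by (smt (verit) zero_less_norm_iff zero_less_power)
  have "(cmod (E a b0))\<^sup>2 \<le> (\<Sum>c<k. (cmod (E a c))\<^sup>2) * N" for a
  proof -
    have "cmod (E a b0) \<le> (\<Sum>c<k. \<bar>cmod (E a c)\<bar> * \<bar>cmod (E c b0)\<bar>)"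
      unfolding idem[of a b0, symmetric] by (rule order_trans[OF norm_sum]) (simp add: norm_mult)
    also have "\<dots> \<le> L2_set (\<lambda>c. cmod (E a c)) {..<k} * L2_set (\<lambda>c. cmod (E c b0)) {..<k}" by (rule L2_set_mult_ineq)
    finally have "(cmod (E a b0))\<^sup>2 \<le> (L2_set (\<lambda>c. cmod (E a c)) {..<k} * L2_set (\<lambda>c. cmod (E c b0)) {..<k})\<^sup>2"
      by (intro power_mono) auto
    then show ?thesis by (simp add: L2_set_def power_mult_distrib N_def sum_nonneg)
  qed
  then have "N \<le> (\<Sum>a<k. (\<Sum>c<k. (cmod (E a c))\<^sup>2) * N)" unfolding N_def[of] by (intro sum_mono)
  then have "N \<le> (\<Sum>a<k. \<Sum>c<k. (cmod (E a c))\<^sup>2) * N" by (simp add: sum_distrib_right)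
  then have "1 \<le> (\<Sum>a<k. \<Sum>c<k. (cmod (E a c))\<^sup>2)" using N by simp
  then show ?thesis unfolding projection_trace_sum[OF sa idem] by simp
qed

text \<open>For the matrix units \<open>e\<^sub>p\<^sub>q\<close>, the sum of all \<open>(E e\<^sub>p\<^sub>q E) G (E e\<^sub>p\<^sub>q E)\<^sup>*\<close> is the trace of \<open>G\<close> times \<open>E\<close>.\<close>

lemma projection_average:
  fixes E G :: "nat \<Rightarrow> nat \<Rightarrow> complex"
  assumes sa: "\<And>a b. E a b = cnj (E b a)" and idem: "\<And>a b. (\<Sum>c<k. E a c * E c b) = E a b"
    and EG: "\<And>a b. (\<Sum>c<k. E a c * G c b) = G a b"
  shows "(\<Sum>p<k. \<Sum>q<k. \<Sum>s<k. (\<Sum>r<k. (E a p * E q r) * G r s) * cnj (E b p * E q s)) = (\<Sum>s<k. G s s) * E a b"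
proof -
  have "(\<Sum>r<k. (E a p * E q r) * G r s) = E a p * G q s" for p q s
    using EG[of q s] by (simp add: mult.assoc sum_distrib_left[symmetric])
  then have "(\<Sum>p<k. \<Sum>q<k. \<Sum>s<k. (\<Sum>r<k. (E a p * E q r) * G r s) * cnj (E b p * E q s))
      = (\<Sum>p<k. \<Sum>q<k. \<Sum>s<k. (E a p * E p b) * (E s q * G q s))"
    using sa[symmetric] by (simp add: mult_ac)
  also have "\<dots> = (\<Sum>p<k. E a p * E p b) * (\<Sum>q<k. \<Sum>s<k. E s q * G q s)"
    by (subst sum_distrib_right) (simp only: sum_distrib_left)
  also have "(\<Sum>q<k. \<Sum>s<k. E s q * G q s) = (\<Sum>s<k. \<Sum>q<k. E s q * G q s)" by (rule sum.swap)
  also have "\<dots> = (\<Sum>s<k. G s s)" by (simp add: EG)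
  finally show ?thesis unfolding idem by (rule trans) (rule mult.commute)
qed

section \<open>Building blocks\<close>

text \<open>The corner described by equations. It is also used for the images of units in later
  stages, as the connecting maps need not preserve units.\<close>

definition corner :: "'a cstar \<Rightarrow> 'a \<Rightarrow> 'a set" where
  "corner M p = {x \<in> carrier M. p \<otimes>\<^bsub>M\<^esub> x = x \<and> x \<otimes>\<^bsub>M\<^esub> p = x}"

context cstar_algebra begin

lemma corner_closed:
  assumes p: "p \<in> projections A"
  shows "p \<in> corner A p" "\<zero> \<in> corner A p"
    "x \<in> corner A p \<Longrightarrow> y \<in> corner A p \<Longrightarrow> x \<oplus> y \<in> corner A p"
    "x \<in> corner A p \<Longrightarrow> y \<in> corner A p \<Longrightarrow> x \<otimes> y \<in> corner A p"
    "x \<in> corner A p \<Longrightarrow> cscale A c x \<in> corner A p"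
    "x \<in> corner A p \<Longrightarrow> adj A x \<in> corner A p"
proof -
  have pc: "p \<in> carrier A" "p \<otimes> p = p" "adj A p = p" using p by (auto simp: projections_def)
  show "p \<in> corner A p" "\<zero> \<in> corner A p" using pc by (auto simp: corner_def)
  show "x \<in> corner A p \<Longrightarrow> y \<in> corner A p \<Longrightarrow> x \<oplus> y \<in> corner A p"
    using pc by (simp add: corner_def l_distr r_distr)
  show "x \<in> corner A p \<Longrightarrow> cscale A c x \<in> corner A p"
    using pc by (simp add: corner_def cscale_mult_left cscale_mult_right cscale_closed)
  show "x \<in> corner A p \<Longrightarrow> adj A x \<in> corner A p"
  proof -
    assume "x \<in> corner A p"
    then have x: "x \<in> carrier A" "p \<otimes> x = x" "x \<otimes> p = x" by (auto simp: corner_def)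
    then show ?thesis using adj_mult[OF pc(1) x(1)] adj_mult[OF x(1) pc(1)] pc by (simp add: corner_def adj_closed)
  qed
  show "x \<otimes> y \<in> corner A p" if "x \<in> corner A p" "y \<in> corner A p"
  proof -
    have x: "x \<in> carrier A" "p \<otimes> x = x" and y: "y \<in> carrier A" "y \<otimes> p = y" using that by (auto simp: corner_def)
    have "p \<otimes> (x \<otimes> y) = x \<otimes> y" using m_assoc[OF pc(1) x(1) y(1)] x(2) by simp
    moreover have "(x \<otimes> y) \<otimes> p = x \<otimes> y" using m_assoc[OF x(1) y(1) pc(1)] y(2) by simp
    ultimately show ?thesis using x y by (simp add: corner_def)
  qed
qed

lemma carrier_corner_alg:
  assumes p: "p \<in> projections A"
  shows "carrier (corner_alg A p) = corner A p"
proof -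
  have pc: "p \<in> carrier A" "p \<otimes> p = p" using p by (auto simp: projections_def)
  show ?thesis
  proof
    show "carrier (corner_alg A p) \<subseteq> corner A p"
    proof
      fix z assume "z \<in> carrier (corner_alg A p)"
      then obtain x where x: "x \<in> carrier A" and z: "z = p \<otimes> x \<otimes> p" by (auto simp: corner_alg_def)
      have "p \<otimes> z = z" unfolding z using x pc by (simp add: m_assoc[symmetric])
      moreover have "z \<otimes> p = z" unfolding z using x pc by (simp add: m_assoc)
      ultimately show "z \<in> corner A p" using x pc z by (simp add: corner_def)
    qed
    show "corner A p \<subseteq> carrier (corner_alg A p)"
    proof
      fix x assume "x \<in> corner A p"
      then have "x \<in> carrier A" "x = p \<otimes> x \<otimes> p" by (auto simp: corner_def)
      then show "x \<in> carrier (corner_alg A p)" by (auto simp: corner_alg_def)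
    qed
  qed
qed

end

lemma corner_alg_simps:
  "x \<otimes>\<^bsub>corner_alg B p\<^esub> y = x \<otimes>\<^bsub>B\<^esub> y" "x \<oplus>\<^bsub>corner_alg B p\<^esub> y = x \<oplus>\<^bsub>B\<^esub> y" "\<zero>\<^bsub>corner_alg B p\<^esub> = \<zero>\<^bsub>B\<^esub>"
  "\<one>\<^bsub>corner_alg B p\<^esub> = p" "cscale (corner_alg B p) = cscale B" "adj (corner_alg B p) = adj B" "cnorm (corner_alg B p) = cnorm B"
  by (simp_all add: corner_alg_def)

text \<open>A plain fold, so that sums in a building block can be handled with closure properties
  alone.\<close>

definition lsum :: "('a, 'b) ring_scheme \<Rightarrow> 'a list \<Rightarrow> 'a" where
  "lsum R xs = foldr (\<oplus>\<^bsub>R\<^esub>) xs \<zero>\<^bsub>R\<^esub>"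

lemma lsum_simps: "lsum R [] = \<zero>\<^bsub>R\<^esub>" "lsum R (x # xs) = x \<oplus>\<^bsub>R\<^esub> lsum R xs"
  by (simp_all add: lsum_def)

abbreviation commutator_sum :: "'a cstar \<Rightarrow> 'a list \<Rightarrow> 'a" where
  "commutator_sum B zs \<equiv>
    lsum B (map (\<lambda>z. z \<otimes>\<^bsub>B\<^esub> adj B z \<oplus>\<^bsub>B\<^esub> cscale B (-1) (adj B z \<otimes>\<^bsub>B\<^esub> z)) zs)"

lemma sum_list_map_concat:
  fixes f :: "'a \<Rightarrow> 'b :: monoid_add"
  shows "sum_list (map f (concat xss)) = (\<Sum>xs\<leftarrow>xss. sum_list (map f xs))"
  by (induction xss) simp_all

locale building_block =
  fixes t :: nat and X :: "nat \<Rightarrow> 'x topology" and k :: "nat \<Rightarrow> nat" and P :: "nat \<Rightarrow> nat \<Rightarrow> nat \<Rightarrow> 'x \<Rightarrow> complex"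
  assumes compact: "i < t \<Longrightarrow> compact_space (X i)" and nonempty: "i < t \<Longrightarrow> topspace (X i) \<noteq> {}"
    and P: "i < t \<Longrightarrow> P i \<in> projections (mat_alg (cont_alg (X i)) (k i))"
begin

abbreviation M where "M i \<equiv> mat_alg (cont_alg (X i)) (k i)"

abbreviation B where "B \<equiv> AH_building_block t X k P"

lemma cstar_M: "i < t \<Longrightarrow> cstar_algebra (M i)"
  by (intro cstar_algebra.cstar_mat_alg cstar_cont_alg compact nonempty)

lemma carrier_iff: "x \<in> carrier B \<longleftrightarrow> x \<in> extensional {..<t} \<and> (\<forall>i<t. x i \<in> corner (M i) (P i))"
  using cstar_algebra.carrier_corner_alg[OF cstar_M P]
  by (auto simp: AH_building_block_def direct_sum_alg_def PiE_iff)

lemma block_simps: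
  assumes "i < t"
  shows "(x \<otimes>\<^bsub>B\<^esub> y) i = x i \<otimes>\<^bsub>M i\<^esub> y i" "(x \<oplus>\<^bsub>B\<^esub> y) i = x i \<oplus>\<^bsub>M i\<^esub> y i" "\<zero>\<^bsub>B\<^esub> i = \<zero>\<^bsub>M i\<^esub>" "\<one>\<^bsub>B\<^esub> i = P i"
    "cscale B c x i = cscale (M i) c (x i)" "adj B x i = adj (M i) (x i)"
  using assms by (simp_all add: AH_building_block_def direct_sum_alg_def corner_alg_simps)

lemma block_extensional:
  "x \<otimes>\<^bsub>B\<^esub> y \<in> extensional {..<t}" "x \<oplus>\<^bsub>B\<^esub> y \<in> extensional {..<t}" "\<zero>\<^bsub>B\<^esub> \<in> extensional {..<t}"
  "\<one>\<^bsub>B\<^esub> \<in> extensional {..<t}" "cscale B c x \<in> extensional {..<t}" "adj B x \<in> extensional {..<t}"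
  by (simp_all add: AH_building_block_def direct_sum_alg_def)

lemma block_closed:
  "\<zero>\<^bsub>B\<^esub> \<in> carrier B" "\<one>\<^bsub>B\<^esub> \<in> carrier B"
  "x \<in> carrier B \<Longrightarrow> y \<in> carrier B \<Longrightarrow> x \<oplus>\<^bsub>B\<^esub> y \<in> carrier B"
  "x \<in> carrier B \<Longrightarrow> y \<in> carrier B \<Longrightarrow> x \<otimes>\<^bsub>B\<^esub> y \<in> carrier B"
  "x \<in> carrier B \<Longrightarrow> cscale B c x \<in> carrier B" "x \<in> carrier B \<Longrightarrow> adj B x \<in> carrier B"
  by (simp_all add: carrier_iff block_simps block_extensional cstar_algebra.corner_closed[OF cstar_M P])

lemma lsum_closed: "set xs \<subseteq> carrier B \<Longrightarrow> lsum B xs \<in> carrier B"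
  by (induction xs) (auto simp: lsum_simps block_closed)

lemma comp_in_M: "x \<in> carrier B \<Longrightarrow> i < t \<Longrightarrow> x i \<in> carrier (M i)"
  by (simp add: carrier_iff corner_def)

lemma eval_simps:
  assumes i: "i < t"
  shows "x \<in> carrier B \<Longrightarrow> y \<in> carrier B \<Longrightarrow> (x \<otimes>\<^bsub>B\<^esub> y) i a b \<xi> = (\<Sum>c<k i. x i a c \<xi> * y i c b \<xi>)"
    "(x \<oplus>\<^bsub>B\<^esub> y) i a b \<xi> = x i a b \<xi> + y i a b \<xi>" "\<zero>\<^bsub>B\<^esub> i a b \<xi> = 0"
    "cscale B c x i a b \<xi> = c * x i a b \<xi>" "adj B x i a b \<xi> = cnj (x i b a \<xi>)"
  using i by (simp_all add: block_simps mat_cont_mult comp_in_M mat_add mat_zero mat_cscale mat_adj cont_alg_simps)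

lemma eval_lsum: "i < t \<Longrightarrow> lsum B xs i a b \<xi> = (\<Sum>x\<leftarrow>xs. x i a b \<xi>)"
  by (induction xs) (simp_all add: lsum_simps eval_simps)

lemma entry:
  assumes "x \<in> carrier B" "i < t"
  shows "continuous_map (X i) euclidean (x i a b)" "\<xi> \<notin> topspace (X i) \<Longrightarrow> x i a b \<xi> = 0"
    "a \<ge> k i \<or> b \<ge> k i \<Longrightarrow> x i a b \<xi> = 0"
  using comp_in_M[OF assms] by (auto simp: mat_carrier cont_alg_simps)

lemma block_eqI:
  assumes x: "x \<in> carrier B" and y: "y \<in> carrier B"
    and eq: "\<And>i a b \<xi>. i < t \<Longrightarrow> \<xi> \<in> topspace (X i) \<Longrightarrow> x i a b \<xi> = y i a b \<xi>"
  shows "x = y"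
proof (rule extensionalityI[of _ "{..<t}"])
  show "x \<in> extensional {..<t}" "y \<in> extensional {..<t}" using x y by (simp_all add: carrier_iff)
  fix i assume "i \<in> {..<t}"
  then have i: "i < t" by simp
  have "x i a b \<xi> = y i a b \<xi>" for a b \<xi>
    using eq[OF i] entry(2)[OF x i] entry(2)[OF y i] by (cases "\<xi> \<in> topspace (X i)") auto
  then show "x i = y i" by (intro ext)
qed

lemma block_norm_ge: "i < t \<Longrightarrow> cnorm (M i) (w i) \<le> cnorm B w"
  by (auto simp: AH_building_block_def direct_sum_alg_def corner_alg_simps)

definition tr where "tr x i \<xi> = (\<Sum>a<k i. x i a a \<xi>)"

lemma tr_simps:
  assumes i: "i < t"
  shows "tr (x \<oplus>\<^bsub>B\<^esub> y) i \<xi> = tr x i \<xi> + tr y i \<xi>" "tr (cscale B c x) i \<xi> = c * tr x i \<xi>" "tr \<zero>\<^bsub>B\<^esub> i \<xi> = 0"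
    "tr (lsum B xs) i \<xi> = (\<Sum>x\<leftarrow>xs. tr x i \<xi>)"
proof -
  show add: "tr (x \<oplus>\<^bsub>B\<^esub> y) i \<xi> = tr x i \<xi> + tr y i \<xi>" and zero: "tr \<zero>\<^bsub>B\<^esub> i \<xi> = 0" for x y
    using i by (simp_all add: tr_def eval_simps sum.distrib)
  show "tr (cscale B c x) i \<xi> = c * tr x i \<xi>" using i by (simp add: tr_def eval_simps sum_distrib_left)
  show "tr (lsum B xs) i \<xi> = (\<Sum>x\<leftarrow>xs. tr x i \<xi>)" by (induction xs) (simp_all add: lsum_simps add zero)
qed

lemma tr_commute:
  assumes "i < t" "x \<in> carrier B" "y \<in> carrier B"
  shows "tr (x \<otimes>\<^bsub>B\<^esub> y) i \<xi> = tr (y \<otimes>\<^bsub>B\<^esub> x) i \<xi>"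
  using assms unfolding tr_def by (simp add: eval_simps(1)) (subst sum.swap, simp add: mult.commute)

lemma tr_square:
  assumes "i < t" "x \<in> carrier B"
  shows "tr (adj B x \<otimes>\<^bsub>B\<^esub> x) i \<xi> = of_real (\<Sum>a<k i. \<Sum>b<k i. (cmod (x i b a \<xi>))\<^sup>2)"
  using assms by (simp add: tr_def eval_simps block_closed complex_norm_square mult.commute del: of_real_power)

lemma tr_commutator_sum:
  assumes "i < t" "set zs \<subseteq> carrier B"
  shows "tr (commutator_sum B zs) i \<xi> = 0"
  using assms(2) by (induction zs) (simp_all add: lsum_simps tr_simps assms(1) block_closed tr_commute[of i _ "adj B _"])

definition block_of where
  "block_of F = (\<lambda>i\<in>{..<t}. \<lambda>a b \<xi>. if a < k i \<and> b < k i \<and> \<xi> \<in> topspace (X i) then F i a b \<xi> else 0)"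

lemma eval_block_of:
  "i < t \<Longrightarrow> block_of F i a b \<xi> = (if a < k i \<and> b < k i \<and> \<xi> \<in> topspace (X i) then F i a b \<xi> else 0)"
  by (simp add: block_of_def)

lemma block_of_closed:
  assumes cont: "\<And>i a b. i < t \<Longrightarrow> a < k i \<Longrightarrow> b < k i \<Longrightarrow> continuous_map (X i) euclidean (F i a b)"
    and left: "\<And>i a b \<xi>. i < t \<Longrightarrow> a < k i \<Longrightarrow> b < k i \<Longrightarrow> (\<Sum>c<k i. P i a c \<xi> * F i c b \<xi>) = F i a b \<xi>"
    and right: "\<And>i a b \<xi>. i < t \<Longrightarrow> a < k i \<Longrightarrow> b < k i \<Longrightarrow> (\<Sum>c<k i. F i a c \<xi> * P i c b \<xi>) = F i a b \<xi>"
  shows "block_of F \<in> carrier B"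
proof -
  have "block_of F i \<in> corner (M i) (P i)" if i: "i < t" for i
  proof -
    have PM: "P i \<in> carrier (M i)" using P[OF i] by (simp add: projections_def)
    have P0: "P i a b \<xi> = 0" if "a \<ge> k i \<or> b \<ge> k i" for a b \<xi>
      using PM that by (auto simp: mat_carrier cont_alg_simps)
    have entry: "block_of F i a b \<in> carrier (cont_alg (X i))" for a b
    proof (cases "a < k i \<and> b < k i")
      case True
      have "continuous_map (X i) euclidean (block_of F i a b)"
        by (rule continuous_map_eq[OF cont[of i a b]]) (use i True in \<open>auto simp: eval_block_of\<close>)
      then show ?thesis using i by (simp add: cont_alg_simps eval_block_of)
    next
      case False
      then have "block_of F i a b = (\<lambda>\<xi>. 0)" using i by (auto simp: eval_block_of fun_eq_iff)
      then show ?thesis by (simp add: cont_alg_simps)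
    qed
    have FM: "block_of F i \<in> carrier (M i)" using entry i by (auto simp: mat_carrier eval_block_of cont_alg_simps(4) fun_eq_iff)
    have "(\<Sum>c<k i. P i a c \<xi> * block_of F i c b \<xi>) = block_of F i a b \<xi>" for a b \<xi>
    proof (cases "a < k i \<and> b < k i \<and> \<xi> \<in> topspace (X i)")
      case True
      then have "(\<Sum>c<k i. P i a c \<xi> * block_of F i c b \<xi>) = (\<Sum>c<k i. P i a c \<xi> * F i c b \<xi>)"
        using i by (intro sum.cong) (auto simp: eval_block_of)
      then show ?thesis using left[OF i] True i by (simp add: eval_block_of)
    next
      case False
      then have "P i a c \<xi> * block_of F i c b \<xi> = 0" for c using i P0[of a c \<xi>] by (auto simp: eval_block_of)
      then have "(\<Sum>c<k i. P i a c \<xi> * block_of F i c b \<xi>) = 0" by (intro sum.neutral) blast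
      then show ?thesis using False i by (auto simp: eval_block_of)
    qed
    then have 1: "P i \<otimes>\<^bsub>M i\<^esub> block_of F i = block_of F i" by (intro ext) (simp add: mat_cont_mult PM FM)
    have "(\<Sum>c<k i. block_of F i a c \<xi> * P i c b \<xi>) = block_of F i a b \<xi>" for a b \<xi>
    proof (cases "a < k i \<and> b < k i \<and> \<xi> \<in> topspace (X i)")
      case True
      then have "(\<Sum>c<k i. block_of F i a c \<xi> * P i c b \<xi>) = (\<Sum>c<k i. F i a c \<xi> * P i c b \<xi>)"
        using i by (intro sum.cong) (auto simp: eval_block_of)
      then show ?thesis using right[OF i] True i by (simp add: eval_block_of)
    next
      case False
      then have "block_of F i a c \<xi> * P i c b \<xi> = 0" for c using i P0[of c b \<xi>] by (auto simp: eval_block_of)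
      then have "(\<Sum>c<k i. block_of F i a c \<xi> * P i c b \<xi>) = 0" by (intro sum.neutral) blast
      then show ?thesis using False i by (auto simp: eval_block_of)
    qed
    then have 2: "block_of F i \<otimes>\<^bsub>M i\<^esub> P i = block_of F i" by (intro ext) (simp add: mat_cont_mult PM FM)
    show ?thesis using FM 1 2 by (simp add: corner_def)
  qed
  then show ?thesis by (simp add: carrier_iff) (simp add: block_of_def)
qed

lemma eval_unit:
  assumes "x \<in> carrier B" "i < t"
  shows "(\<Sum>c<k i. P i a c \<xi> * x i c b \<xi>) = x i a b \<xi>" "(\<Sum>c<k i. x i a c \<xi> * P i c b \<xi>) = x i a b \<xi>"
proof -
  have PM: "P i \<in> carrier (M i)" using P[OF assms(2)] by (simp add: projections_def)
  have x: "x i \<in> carrier (M i)" "P i \<otimes>\<^bsub>M i\<^esub> x i = x i" "x i \<otimes>\<^bsub>M i\<^esub> P i = x i"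
    using assms by (auto simp: carrier_iff corner_def)
  show "(\<Sum>c<k i. P i a c \<xi> * x i c b \<xi>) = x i a b \<xi>" using mat_cont_mult[OF PM x(1), of a b \<xi>] x(2) by simp
  show "(\<Sum>c<k i. x i a c \<xi> * P i c b \<xi>) = x i a b \<xi>" using mat_cont_mult[OF x(1) PM, of a b \<xi>] x(3) by simp
qed

lemma block_corner_closed:
  assumes e: "e \<in> projections B"
  shows "e \<in> corner B e" "\<zero>\<^bsub>B\<^esub> \<in> corner B e"
    "x \<in> corner B e \<Longrightarrow> y \<in> corner B e \<Longrightarrow> x \<oplus>\<^bsub>B\<^esub> y \<in> corner B e"
    "x \<in> corner B e \<Longrightarrow> y \<in> corner B e \<Longrightarrow> x \<otimes>\<^bsub>B\<^esub> y \<in> corner B e"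
    "x \<in> corner B e \<Longrightarrow> cscale B c x \<in> corner B e"
    "x \<in> corner B e \<Longrightarrow> adj B x \<in> corner B e"
    "set xs \<subseteq> corner B e \<Longrightarrow> lsum B xs \<in> corner B e"
proof -
  have ec: "e \<in> carrier B" "adj B e = e" "e \<otimes>\<^bsub>B\<^esub> e = e" using e by (auto simp: projections_def)
  have pr: "e i \<in> projections (M i)" if "i < t" for i
    using arg_cong[OF ec(2), of "\<lambda>f. f i"] arg_cong[OF ec(3), of "\<lambda>f. f i"] that comp_in_M[OF ec(1) that]
    by (simp add: projections_def block_simps)
  have iff: "x \<in> corner B e \<longleftrightarrow> x \<in> carrier B \<and> (\<forall>i<t. x i \<in> corner (M i) (e i))" for x
  proof
    assume "x \<in> corner B e"
    then have x: "x \<in> carrier B" "e \<otimes>\<^bsub>B\<^esub> x = x" "x \<otimes>\<^bsub>B\<^esub> e = x" by (auto simp: corner_def)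
    have "e i \<otimes>\<^bsub>M i\<^esub> x i = x i" "x i \<otimes>\<^bsub>M i\<^esub> e i = x i" if "i < t" for i
      using x(2,3) block_simps(1)[OF that] by metis+
    then show "x \<in> carrier B \<and> (\<forall>i<t. x i \<in> corner (M i) (e i))"
      using x(1) comp_in_M[OF x(1)] by (simp add: corner_def)
  next
    assume x: "x \<in> carrier B \<and> (\<forall>i<t. x i \<in> corner (M i) (e i))"
    have "e \<otimes>\<^bsub>B\<^esub> x = x" "x \<otimes>\<^bsub>B\<^esub> e = x"
      by (rule extensionalityI[of _ "{..<t}"], use x in \<open>simp_all add: block_extensional block_simps carrier_iff corner_def\<close>)+
    then show "x \<in> corner B e" using x by (simp add: corner_def)
  qed
  note c = cstar_algebra.corner_closed[OF cstar_M pr]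
  show "e \<in> corner B e" using ec by (simp add: corner_def)
  show z: "\<zero>\<^bsub>B\<^esub> \<in> corner B e" by (simp add: iff block_closed block_simps c)
  show a: "x \<in> corner B e \<Longrightarrow> y \<in> corner B e \<Longrightarrow> x \<oplus>\<^bsub>B\<^esub> y \<in> corner B e" for x y by (simp add: iff block_closed block_simps c)
  show "x \<in> corner B e \<Longrightarrow> y \<in> corner B e \<Longrightarrow> x \<otimes>\<^bsub>B\<^esub> y \<in> corner B e"
    "x \<in> corner B e \<Longrightarrow> cscale B c x \<in> corner B e" "x \<in> corner B e \<Longrightarrow> adj B x \<in> corner B e"
    by (simp_all add: iff block_closed block_simps c)
  show "set xs \<subseteq> corner B e \<Longrightarrow> lsum B xs \<in> corner B e"
    by (induction xs) (auto simp: lsum_simps z intro: a)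
qed

text \<open>The hypothesis is a relation in the corner of \<open>e\<close>, up to
  \<open>\<delta> / 3\<close>. Commutators have trace 0 and \<open>adj B s\<close> times
  \<open>s\<close> has nonnegative trace, so pointwise traces give
  \<open>C * f \<ge> (\<delta> - \<delta> / 3) * d\<close>, where \<open>f\<close> is the trace of
  \<open>g\<close>, the product of \<open>adj B h\<close> and \<open>h\<close>, and \<open>d\<close>
  is that of \<open>e\<close>. Averaging \<open>g\<close> over compressed matrix units then yields
  \<open>e\<close> exactly. The second equation, in which \<open>\<eta>\<close> fills up a
  difference, bounds the sum of all \<open>v v\<^sup>*\<close> by a constant that involves
  \<open>C\<close> and \<open>\<delta>\<close> only; this controls the error when \<open>h\<close>
  is replaced by its limit.\<close>

lemma finite_stage:
  assumes e: "e \<in> projections B" and h: "h \<in> corner B e" and z: "set zs \<subseteq> corner B e" and s: "s \<in> corner B e"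
    and \<delta>: "\<delta> > 0" and C: "C > 0"
    and w: "cnorm B (cscale B (of_real (- \<delta>)) e \<oplus>\<^bsub>B\<^esub> cscale B (of_real C) (adj B h \<otimes>\<^bsub>B\<^esub> h) \<oplus>\<^bsub>B\<^esub>
        commutator_sum B zs \<oplus>\<^bsub>B\<^esub> cscale B (-1) (adj B s \<otimes>\<^bsub>B\<^esub> s)) \<le> \<delta> / 3"
  shows "\<exists>vs \<eta>. set vs \<subseteq> carrier B \<and> \<eta> \<in> carrier B \<and>
    lsum B (map (\<lambda>v. v \<otimes>\<^bsub>B\<^esub> (adj B h \<otimes>\<^bsub>B\<^esub> h) \<otimes>\<^bsub>B\<^esub> adj B v) vs) = e \<and>
    lsum B (map (\<lambda>v. v \<otimes>\<^bsub>B\<^esub> adj B v) vs) \<oplus>\<^bsub>B\<^esub> adj B \<eta> \<otimes>\<^bsub>B\<^esub> \<eta> = cscale B (of_real (3 * C / (2 * \<delta>))) e"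
proof -
  \<comment> \<open>The constant in \<open>f \<ge> c * d\<close> below: one third of
    \<open>\<delta>\<close> is lost to the error term.\<close>
  define c where "c = 2 * \<delta> / (3 * C)"
  have c: "c > 0" "1 / c = 3 * C / (2 * \<delta>)" using \<delta> C by (simp_all add: c_def)
  note cl = block_corner_closed[OF e]
  define W where "W = cscale B (of_real (- \<delta>)) e \<oplus>\<^bsub>B\<^esub> cscale B (of_real C) (adj B h \<otimes>\<^bsub>B\<^esub> h) \<oplus>\<^bsub>B\<^esub>
        commutator_sum B zs \<oplus>\<^bsub>B\<^esub> cscale B (-1) (adj B s \<otimes>\<^bsub>B\<^esub> s)"
  have "set (map (\<lambda>z. z \<otimes>\<^bsub>B\<^esub> adj B z \<oplus>\<^bsub>B\<^esub> cscale B (-1) (adj B z \<otimes>\<^bsub>B\<^esub> z)) zs) \<subseteq> corner B e"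
    using z by (auto intro!: cl)
  then have W: "W \<in> corner B e" unfolding W_def by (intro cl h s)
  have car: "x \<in> carrier B" if "x \<in> corner B e" for x using that by (simp add: corner_def)
  have ec: "e \<in> carrier B" and hc: "h \<in> carrier B" and sc: "s \<in> carrier B" and Wc: "W \<in> carrier B"
    and zc: "set zs \<subseteq> carrier B" using car cl(1) h s W z by blast+
  define g where "g = adj B h \<otimes>\<^bsub>B\<^esub> h"
  have g: "g \<in> corner B e" unfolding g_def by (intro cl h)
  note gc = car[OF g]
  have sa: "e i a b \<xi> = cnj (e i b a \<xi>)" if "i < t" for i a b \<xi>
  proof -
    have "adj B e = e" using e by (simp add: projections_def)
    then show ?thesis using eval_simps(5)[OF that, of e a b \<xi>] by simp
  qed
  have left: "(\<Sum>c<k i. e i a c \<xi> * x i c b \<xi>) = x i a b \<xi>" and right: "(\<Sum>c<k i. x i a c \<xi> * e i c b \<xi>) = x i a b \<xi>"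
    if "i < t" "x \<in> corner B e" for i x a b \<xi>
  proof -
    have x: "x \<in> carrier B" "e \<otimes>\<^bsub>B\<^esub> x = x" "x \<otimes>\<^bsub>B\<^esub> e = x" using that by (auto simp: corner_def)
    show "(\<Sum>c<k i. e i a c \<xi> * x i c b \<xi>) = x i a b \<xi>" using eval_simps(1)[OF that(1) ec x(1), of a b \<xi>] x(2) by simp
    show "(\<Sum>c<k i. x i a c \<xi> * e i c b \<xi>) = x i a b \<xi>" using eval_simps(1)[OF that(1) x(1) ec, of a b \<xi>] x(3) by simp
  qed
  define f where "f i \<xi> = Re (tr g i \<xi>)" for i \<xi>
  have g_tr: "tr g i \<xi> = of_real (f i \<xi>)" if "i < t" for i \<xi>
    unfolding f_def g_def tr_square[OF that hc] by simp
  define d where "d i \<xi> = Re (tr e i \<xi>)" for i \<xi>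
  have e_tr: "tr e i \<xi> = of_real (d i \<xi>)" if "i < t" for i \<xi>
    unfolding d_def tr_def projection_trace_sum[OF sa[OF that] left[OF that cl(1)]] by simp
  have d0: "d i \<xi> \<ge> 0" if "i < t" for i \<xi>
    unfolding d_def tr_def projection_trace_sum[OF sa[OF that] left[OF that cl(1)]] by (simp add: sum_nonneg)
  have f_ge: "f i \<xi> \<ge> c * d i \<xi>" if i: "i < t" and \<xi>: "\<xi> \<in> topspace (X i)" for i \<xi>
  proof -
    have "cmod (tr W i \<xi>) \<le> (\<delta> / 3) * d i \<xi>" unfolding d_def tr_def
    proof (rule projection_trace_bound[of "\<lambda>a b. e i a b \<xi>" "k i" "\<lambda>a b. W i a b \<xi>"])
      show "\<And>a b. e i a b \<xi> = cnj (e i b a \<xi>)" by (rule sa[OF i])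
      show "\<And>a b. (\<Sum>c<k i. e i a c \<xi> * e i c b \<xi>) = e i a b \<xi>" by (rule left[OF i cl(1)])
      show "\<And>a b. (\<Sum>c<k i. e i a c \<xi> * W i c b \<xi>) = W i a b \<xi>" by (rule left[OF i W])
      show "\<And>a b. (\<Sum>c<k i. W i a c \<xi> * e i c b \<xi>) = W i a b \<xi>" by (rule right[OF i W])
      fix u
      have "cnorm (M i) (W i) \<le> \<delta> / 3" using block_norm_ge[OF i, of W] w unfolding W_def by linarith
      then show "L2_set (\<lambda>a. cmod (\<Sum>b<k i. W i a b \<xi> * u b)) {..<k i} \<le> \<delta> / 3 * L2_set (\<lambda>a. cmod (u a)) {..<k i}"
        by (intro order_trans[OF mat_cont_norm_ge[OF compact[OF i] nonempty[OF i] comp_in_M[OF Wc i] \<xi>]] mult_right_mono) (auto simp: L2_set_nonneg)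
    qed
    then have "Re (tr W i \<xi>) \<le> (\<delta> / 3) * d i \<xi>" "- Re (tr W i \<xi>) \<le> (\<delta> / 3) * d i \<xi>"
      using abs_Re_le_cmod[of "tr W i \<xi>"] by linarith+
    moreover have W_tr: "tr W i \<xi> = of_real (- \<delta> * d i \<xi> + C * f i \<xi> - (\<Sum>a<k i. \<Sum>b<k i. (cmod (s i b a \<xi>))\<^sup>2))"
      unfolding W_def tr_simps(1,2)[OF i] tr_commutator_sum[OF i zc] tr_square[OF i sc] e_tr[OF i] g_def[symmetric] g_tr[OF i]
      by simp
    moreover have "(\<Sum>a<k i. \<Sum>b<k i. (cmod (s i b a \<xi>))\<^sup>2) \<ge> 0" by (simp add: sum_nonneg)
    ultimately have "C * f i \<xi> \<ge> (2 * \<delta> / 3) * d i \<xi>" unfolding W_tr Re_complex_of_real by linarith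
    then show ?thesis using C by (simp add: c_def field_simps)
  qed
  \<comment> \<open>Where \<open>e\<close> vanishes so does \<open>f\<close>, and the maximum keeps
    the denominator positive. Elsewhere the trace \<open>d\<close> of the projection is at least 1,
    so that \<open>f \<ge> c\<close> and \<open>m = f\<close>.\<close>
  define m where "m i \<xi> = max (f i \<xi>) c" for i \<xi>
  have m0: "m i \<xi> > 0" for i \<xi> using c by (simp add: m_def)
  have cont_f: "continuous_map (X i) euclideanreal (f i)" and cont_d: "continuous_map (X i) euclideanreal (d i)" if "i < t" for i
    unfolding f_def d_def tr_def
    by (intro continuous_map_complex_Re continuous_map_sum entry(1)[OF gc that] entry(1)[OF ec that] finite_lessThan)+
  have cont_m: "continuous_map (X i) euclideanreal (m i)" if "i < t" for i
    unfolding m_def by (intro continuous_map_real_max cont_f that) simp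
  have d_le: "d i \<xi> / m i \<xi> \<le> 1 / c" if "i < t" "\<xi> \<in> topspace (X i)" for i \<xi>
    using f_ge[OF that] m0[of i \<xi>] c by (simp add: field_simps m_def)
  have fm: "f i \<xi> / m i \<xi> = 1" if i: "i < t" and \<xi>: "\<xi> \<in> topspace (X i)" and nz: "e i a b \<xi> \<noteq> 0" for i \<xi> a b
  proof -
    have "a < k i" using entry(3)[OF ec i, of a b \<xi>] nz by (meson not_le)
    then have "1 \<le> d i \<xi>" unfolding d_def tr_def
      using projection_trace_ge_1[of "\<lambda>a b. e i a b \<xi>", OF sa[OF i] left[OF i cl(1)] _ nz] by simp
    then have "c * 1 \<le> c * d i \<xi>" using c by (intro mult_left_mono) auto
    then have "m i \<xi> = f i \<xi>" using f_ge[OF i \<xi>] by (simp add: m_def)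
    then show ?thesis using m0[of i \<xi>] by simp
  qed
  define \<psi> where "\<psi> i \<xi> = 1 / sqrt (m i \<xi>)" for i \<xi>
  have \<psi>: "complex_of_real (\<psi> i \<xi>) * complex_of_real (\<psi> i \<xi>) = of_real (1 / m i \<xi>)" for i \<xi>
    using m0[of i \<xi>] by (simp add: \<psi>_def flip: of_real_mult of_real_divide)
  have cont_\<psi>: "continuous_map (X i) euclideanreal (\<psi> i)" if "i < t" for i
  proof -
    have "continuous_map (X i) euclideanreal (\<lambda>\<xi>. sqrt (m i \<xi>))" by (rule continuous_map_sqrt[OF cont_m[OF that]])
    then show ?thesis unfolding \<psi>_def using m0[of i]
      by (intro continuous_map_real_divide) (auto simp: less_imp_neq[symmetric])
  qed
  \<comment> \<open>The matrix unit with indices \<open>p\<close> and \<open>q\<close> in summand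
    \<open>j\<close>, compressed by \<open>e\<close> and scaled by \<open>\<psi>\<close>, the square
    root of \<open>1 / m\<close>.\<close>
  define V where "V j p q = block_of (\<lambda>i a b \<xi>. if i = j then of_real (\<psi> i \<xi>) * (e i a p \<xi> * e i q b \<xi>) else 0)" for j p q
  have Vc: "V j p q \<in> carrier B" for j p q unfolding V_def
  proof (rule block_of_closed)
    fix i a b assume i: "i < t"
    show "continuous_map (X i) euclidean (\<lambda>\<xi>. if i = j then complex_of_real (\<psi> i \<xi>) * (e i a p \<xi> * e i q b \<xi>) else 0)"
    proof -
      have "continuous_map (X i) euclidean (\<lambda>\<xi>. complex_of_real (\<psi> i \<xi>) * (e i a p \<xi> * e i q b \<xi>))"
        by (intro continuous_map_complex_mult continuous_map_complex_of_real cont_\<psi> entry(1)[OF ec] i)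
      then show ?thesis by (cases "i = j") simp_all
    qed
    fix \<xi>
    show "(\<Sum>c<k i. P i a c \<xi> * (if i = j then complex_of_real (\<psi> i \<xi>) * (e i c p \<xi> * e i q b \<xi>) else 0)) =
       (if i = j then complex_of_real (\<psi> i \<xi>) * (e i a p \<xi> * e i q b \<xi>) else 0)"
    proof -
      have "(\<Sum>c<k i. P i a c \<xi> * (of_real (\<psi> i \<xi>) * (e i c p \<xi> * e i q b \<xi>))) =
          of_real (\<psi> i \<xi>) * ((\<Sum>c<k i. P i a c \<xi> * e i c p \<xi>) * e i q b \<xi>)"
        by (simp add: sum_distrib_left sum_distrib_right mult_ac)
      then show ?thesis unfolding eval_unit(1)[OF ec i] by (cases "i = j") simp_all
    qed
    show "(\<Sum>c<k i. (if i = j then complex_of_real (\<psi> i \<xi>) * (e i a p \<xi> * e i q c \<xi>) else 0) * P i c b \<xi>) =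
       (if i = j then complex_of_real (\<psi> i \<xi>) * (e i a p \<xi> * e i q b \<xi>) else 0)"
    proof -
      have "(\<Sum>c<k i. (of_real (\<psi> i \<xi>) * (e i a p \<xi> * e i q c \<xi>)) * P i c b \<xi>) =
          of_real (\<psi> i \<xi>) * (e i a p \<xi> * (\<Sum>c<k i. e i q c \<xi> * P i c b \<xi>))"
        by (simp add: sum_distrib_left mult_ac)
      then show ?thesis unfolding eval_unit(2)[OF ec i] by (cases "i = j") simp_all
    qed
  qed
  have eval_V: "V j p q i a b \<xi> = (if i = j then of_real (\<psi> i \<xi>) * (e i a p \<xi> * e i q b \<xi>) else 0)"
    if "i < t" "\<xi> \<in> topspace (X i)" for j p q i a b \<xi>
    using that entry(3)[OF ec that(1), of a p \<xi>] entry(3)[OF ec that(1), of q b \<xi>] by (auto simp: V_def eval_block_of)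
  define vs where "vs = concat (map (\<lambda>j. concat (map (\<lambda>p. map (V j p) [0..<k j]) [0..<k j])) [0..<t])"
  have vs: "set vs \<subseteq> carrier B" using Vc by (auto simp: vs_def)
  have sum_vs: "(\<Sum>v\<leftarrow>vs. G v) = (\<Sum>j<t. \<Sum>p<k j. \<Sum>q<k j. G (V j p q))" for G :: "_ \<Rightarrow> complex"
    by (simp add: vs_def sum_list_map_concat interv_sum_list_conv_sum_set_nat atLeast0LessThan comp_def)
  \<comment> \<open>An instance of \<open>projection_average\<close> at each point, to which only
    the summand \<open>j = i\<close> contributes. It is used for \<open>x = g\<close> and for
    \<open>x = e\<close>.\<close>
  have combo: "lsum B (map (\<lambda>v. v \<otimes>\<^bsub>B\<^esub> x \<otimes>\<^bsub>B\<^esub> adj B v) vs) i a b \<xi> = of_real (1 / m i \<xi>) * (tr x i \<xi> * e i a b \<xi>)"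
    if x: "x \<in> corner B e" and i: "i < t" and \<xi>: "\<xi> \<in> topspace (X i)" for x i a b \<xi>
  proof -
    have "(V j p q \<otimes>\<^bsub>B\<^esub> x \<otimes>\<^bsub>B\<^esub> adj B (V j p q)) i a b \<xi> =
        (if j = i then of_real (1 / m i \<xi>) * (\<Sum>s<k i. (\<Sum>r<k i. (e i a p \<xi> * e i q r \<xi>) * x i r s \<xi>) * cnj (e i b p \<xi> * e i q s \<xi>)) else 0)" for j p q
      unfolding \<psi>[symmetric]
      by (simp add: eval_simps[OF i] Vc car[OF x] block_closed eval_V[OF i \<xi>] sum_distrib_left sum_distrib_right mult_ac)
    then have "lsum B (map (\<lambda>v. v \<otimes>\<^bsub>B\<^esub> x \<otimes>\<^bsub>B\<^esub> adj B v) vs) i a b \<xi> =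
        (\<Sum>j<t. \<Sum>p<k j. \<Sum>q<k j. if j = i then of_real (1 / m i \<xi>) * (\<Sum>s<k i. (\<Sum>r<k i. (e i a p \<xi> * e i q r \<xi>) * x i r s \<xi>) * cnj (e i b p \<xi> * e i q s \<xi>)) else 0)"
      by (simp add: eval_lsum[OF i] comp_def sum_vs)
    also have "\<dots> = (\<Sum>j<t. if j = i then (\<Sum>p<k i. \<Sum>q<k i. of_real (1 / m i \<xi>) * (\<Sum>s<k i. (\<Sum>r<k i. (e i a p \<xi> * e i q r \<xi>) * x i r s \<xi>) * cnj (e i b p \<xi> * e i q s \<xi>))) else 0)"
      by (intro sum.cong) auto
    also have "\<dots> = of_real (1 / m i \<xi>) * (\<Sum>p<k i. \<Sum>q<k i. \<Sum>s<k i. (\<Sum>r<k i. (e i a p \<xi> * e i q r \<xi>) * x i r s \<xi>) * cnj (e i b p \<xi> * e i q s \<xi>))"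
      using i by (simp only: sum.delta finite_lessThan lessThan_iff if_True sum_distrib_left)
    also have "\<dots> = of_real (1 / m i \<xi>) * (tr x i \<xi> * e i a b \<xi>)"
      using projection_average[of "\<lambda>a b. e i a b \<xi>" "k i" "\<lambda>a b. x i a b \<xi>", OF sa[OF i] left[OF i cl(1)] left[OF i x]]
      by (simp only: tr_def)
    finally show ?thesis .
  qed
  have lsum_vs: "set (map F vs) \<subseteq> carrier B \<Longrightarrow> lsum B (map F vs) \<in> carrier B" for F by (rule lsum_closed)
  have 1: "lsum B (map (\<lambda>v. v \<otimes>\<^bsub>B\<^esub> g \<otimes>\<^bsub>B\<^esub> adj B v) vs) = e"
  proof (rule block_eqI[OF lsum_vs ec])
    show "set (map (\<lambda>v. v \<otimes>\<^bsub>B\<^esub> g \<otimes>\<^bsub>B\<^esub> adj B v) vs) \<subseteq> carrier B" using vs gc by (auto intro!: block_closed)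
    fix i a b \<xi> assume i: "i < t" and \<xi>: "\<xi> \<in> topspace (X i)"
    have "complex_of_real (1 / m i \<xi>) * (of_real (f i \<xi>) * e i a b \<xi>) = of_real (f i \<xi> / m i \<xi>) * e i a b \<xi>" by simp
    also have "\<dots> = e i a b \<xi>" using fm[OF i \<xi>, of a b] by (cases "e i a b \<xi> = 0") auto
    finally show "lsum B (map (\<lambda>v. v \<otimes>\<^bsub>B\<^esub> g \<otimes>\<^bsub>B\<^esub> adj B v) vs) i a b \<xi> = e i a b \<xi>"
      unfolding combo[OF g i \<xi>] g_tr[OF i] .
  qed
  \<comment> \<open>The sum of all \<open>v v\<^sup>*\<close> is \<open>d / m\<close> times
    \<open>e\<close>, with \<open>d / m \<le> 1 / c\<close>. This is a root of what is missing to
    \<open>1 / c\<close> times \<open>e\<close>.\<close>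
  define \<eta> where "\<eta> = block_of (\<lambda>i a b \<xi>. of_real (sqrt (1 / c - d i \<xi> / m i \<xi>)) * e i a b \<xi>)"
  have \<eta>: "\<eta> \<in> carrier B" unfolding \<eta>_def
  proof (rule block_of_closed)
    fix i a b assume i: "i < t"
    show "continuous_map (X i) euclidean (\<lambda>\<xi>. complex_of_real (sqrt (1 / c - d i \<xi> / m i \<xi>)) * e i a b \<xi>)"
    proof -
      have "continuous_map (X i) euclideanreal (\<lambda>\<xi>. d i \<xi> / m i \<xi>)"
        using m0[of i] by (intro continuous_map_real_divide cont_d cont_m i) (auto simp: less_imp_neq[symmetric])
      then have "continuous_map (X i) euclideanreal (\<lambda>\<xi>. 1 / c - d i \<xi> / m i \<xi>)"
        by (intro continuous_map_diff) simp_all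
      then show ?thesis
        by (intro continuous_map_complex_mult continuous_map_complex_of_real entry(1)[OF ec i]) (rule continuous_map_sqrt)
    qed
    fix \<xi>
    show "(\<Sum>ca<k i. P i a ca \<xi> * (complex_of_real (sqrt (1 / c - d i \<xi> / m i \<xi>)) * e i ca b \<xi>)) =
       complex_of_real (sqrt (1 / c - d i \<xi> / m i \<xi>)) * e i a b \<xi>"
      unfolding eval_unit(1)[OF ec i, of a \<xi> b, symmetric] sum_distrib_left by (simp only: mult_ac)
    show "(\<Sum>ca<k i. (complex_of_real (sqrt (1 / c - d i \<xi> / m i \<xi>)) * e i a ca \<xi>) * P i ca b \<xi>) =
       complex_of_real (sqrt (1 / c - d i \<xi> / m i \<xi>)) * e i a b \<xi>"
      unfolding eval_unit(2)[OF ec i, of a \<xi> b, symmetric] sum_distrib_left by (simp only: mult_ac)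
  qed
  have eval_\<eta>: "\<eta> i a b \<xi> = of_real (sqrt (1 / c - d i \<xi> / m i \<xi>)) * e i a b \<xi>" if "i < t" "\<xi> \<in> topspace (X i)" for i a b \<xi>
    using that entry(3)[OF ec that(1), of a b \<xi>] by (auto simp: \<eta>_def eval_block_of)
  have \<eta>\<eta>: "(adj B \<eta> \<otimes>\<^bsub>B\<^esub> \<eta>) i a b \<xi> = of_real (1 / c - d i \<xi> / m i \<xi>) * e i a b \<xi>" if i: "i < t" and \<xi>: "\<xi> \<in> topspace (X i)" for i a b \<xi>
  proof -
    define q where "q = sqrt (1 / c - d i \<xi> / m i \<xi>)"
    have q: "complex_of_real q * of_real q = of_real (1 / c - d i \<xi> / m i \<xi>)"
      using d_le[OF i \<xi>] by (simp add: q_def flip: of_real_mult of_real_diff)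
    have "(adj B \<eta> \<otimes>\<^bsub>B\<^esub> \<eta>) i a b \<xi> = (\<Sum>c<k i. cnj (of_real q * e i c a \<xi>) * (of_real q * e i c b \<xi>))"
      by (simp add: eval_simps[OF i] \<eta> block_closed eval_\<eta>[OF i \<xi>] q_def)
    also have "\<dots> = (\<Sum>c<k i. (of_real q * of_real q) * (e i a c \<xi> * e i c b \<xi>))"
      by (simp add: sa[OF i, of a, symmetric] mult_ac)
    also have "\<dots> = of_real (1 / c - d i \<xi> / m i \<xi>) * e i a b \<xi>"
      unfolding q by (simp only: sum_distrib_left[symmetric] left[OF i cl(1)])
    finally show ?thesis .
  qed
  \<comment> \<open>Inserting \<open>e\<close> makes \<open>combo\<close> applicable with
    \<open>x = e\<close>.\<close>
  have VV: "map (\<lambda>v. v \<otimes>\<^bsub>B\<^esub> adj B v) vs = map (\<lambda>v. v \<otimes>\<^bsub>B\<^esub> e \<otimes>\<^bsub>B\<^esub> adj B v) vs"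
  proof (rule map_cong[OF refl])
    fix v assume "v \<in> set vs"
    then obtain j p q where v: "v = V j p q" by (auto simp: vs_def)
    have "V j p q \<otimes>\<^bsub>B\<^esub> e = V j p q"
    proof (rule block_eqI[OF block_closed(4)[OF Vc ec] Vc])
      fix i a b \<xi> assume i: "i < t" and \<xi>: "\<xi> \<in> topspace (X i)"
      show "(V j p q \<otimes>\<^bsub>B\<^esub> e) i a b \<xi> = V j p q i a b \<xi>"
      proof -
        have "(\<Sum>c<k i. (of_real (\<psi> i \<xi>) * (e i a p \<xi> * e i q c \<xi>)) * e i c b \<xi>) =
            of_real (\<psi> i \<xi>) * (e i a p \<xi> * (\<Sum>c<k i. e i q c \<xi> * e i c b \<xi>))"
          by (simp add: sum_distrib_left mult_ac)
        then show ?thesis unfolding left[OF i cl(1)] eval_simps(1)[OF i Vc ec] eval_V[OF i \<xi>] by (cases "i = j") simp_all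
      qed
    qed
    then show "v \<otimes>\<^bsub>B\<^esub> adj B v = v \<otimes>\<^bsub>B\<^esub> e \<otimes>\<^bsub>B\<^esub> adj B v" by (simp add: v)
  qed
  have 2: "lsum B (map (\<lambda>v. v \<otimes>\<^bsub>B\<^esub> adj B v) vs) \<oplus>\<^bsub>B\<^esub> adj B \<eta> \<otimes>\<^bsub>B\<^esub> \<eta> = cscale B (of_real (1 / c)) e"
    unfolding VV
  proof (rule block_eqI)
    have "set (map (\<lambda>v. v \<otimes>\<^bsub>B\<^esub> e \<otimes>\<^bsub>B\<^esub> adj B v) vs) \<subseteq> carrier B" using vs ec by (auto intro!: block_closed)
    then show "lsum B (map (\<lambda>v. v \<otimes>\<^bsub>B\<^esub> e \<otimes>\<^bsub>B\<^esub> adj B v) vs) \<oplus>\<^bsub>B\<^esub> adj B \<eta> \<otimes>\<^bsub>B\<^esub> \<eta> \<in> carrier B"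
      by (intro block_closed lsum_vs \<eta>)
    show "cscale B (of_real (1 / c)) e \<in> carrier B" by (intro block_closed ec)
    fix i a b \<xi> assume i: "i < t" and \<xi>: "\<xi> \<in> topspace (X i)"
    show "(lsum B (map (\<lambda>v. v \<otimes>\<^bsub>B\<^esub> e \<otimes>\<^bsub>B\<^esub> adj B v) vs) \<oplus>\<^bsub>B\<^esub> adj B \<eta> \<otimes>\<^bsub>B\<^esub> \<eta>) i a b \<xi> = cscale B (of_real (1 / c)) e i a b \<xi>"
      unfolding eval_simps(2,4)[OF i] combo[OF cl(1) i \<xi>] e_tr[OF i] \<eta>\<eta>[OF i \<xi>]
      by (simp add: algebra_simps)
  qed
  show ?thesis using vs \<eta> 1[unfolded g_def] 2[unfolded c(2)] by blast
qed

end

section \<open>Separating a cone from a central projection\<close>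

text \<open>The Hahn-Banach theorem for monoids yields additive functionals only. The defect
  \<open>h s = f (s *\<^sub>R x) - s * f x\<close> is additive and vanishes at integers, so a bound
  on \<open>[0, 1)\<close> holds everywhere; and a bounded additive function is 0.\<close>

lemma additive_bounded_linear:
  fixes f :: "'a :: real_normed_vector \<Rightarrow> real"
  assumes add: "\<And>x y. f (x + y) = f x + f y" and bound: "\<And>x. \<bar>f x\<bar> \<le> norm x"
  shows "linear f"
proof (rule linearI[OF add])
  fix r :: real and x
  have f0: "f 0 = 0" using add[of 0 0] by simp
  have minus: "f (- x) = - f x" for x using add[of x "- x"] f0 by simp
  define h where "h s = f (s *\<^sub>R x) - s * f x" for s
  have h_add: "h (s + t) = h s + h t" for s t by (simp add: h_def scaleR_add_left add algebra_simps)
  have h_nat: "h (real n * s) = real n * h s" for n s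
    by (induction n) (simp_all add: h_add distrib_right, simp add: h_def f0)
  have h1: "h 1 = 0" by (simp add: h_def)
  have h_minus: "h (- s) = - h s" for s by (simp add: h_def minus)
  have h_int: "h (of_int k) = 0" for k
  proof (cases "k \<ge> 0")
    case True
    then show ?thesis using h_nat[of "nat k" 1] h1 by simp
  next
    case False
    then show ?thesis using h_nat[of "nat (- k)" 1] h1 h_minus[of "of_int k"] by simp
  qed
  have "\<bar>h s\<bar> \<le> 2 * norm x" if "0 \<le> s" "s < 1" for s
  proof -
    have "\<bar>h s\<bar> \<le> \<bar>f (s *\<^sub>R x)\<bar> + s * \<bar>f x\<bar>" using that by (simp add: h_def abs_mult order_trans[OF abs_triangle_ineq4])
    also have "\<dots> \<le> s * norm x + s * norm x" using bound[of "s *\<^sub>R x"] bound[of x] that by (intro add_mono mult_left_mono) auto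
    also have "\<dots> \<le> 1 * norm x + 1 * norm x" using that by (intro add_mono mult_right_mono) auto
    finally show ?thesis by simp
  qed
  then have frac: "\<bar>h s\<bar> \<le> 2 * norm x" for s
    using h_add[of "frac s" "of_int \<lfloor>s\<rfloor>"] h_int[of "\<lfloor>s\<rfloor>"] frac_ge_0[of s] frac_lt_1[of s] by (simp add: frac_def)
  have "h r = 0"
  proof (rule ccontr)
    assume "h r \<noteq> 0"
    then obtain n :: nat where "2 * norm x < real n * \<bar>h r\<bar>" using reals_Archimedean3[of "\<bar>h r\<bar>"] by auto
    then show False using frac[of "real n * r"] h_nat[of n r] by (simp add: abs_mult)
  qed
  then show "f (r *\<^sub>R x) = r *\<^sub>R f x" by (simp add: h_def)
qed

text \<open>Hahn-Banach for the gauge \<open>p x\<close>, the infimum of all \<open>t\<close> with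
  \<open>t *\<^sub>R e - e * re x \<in> Q\<close>. By \<open>Q_pos\<close> it is at most
  \<open>norm x\<close>, and \<open>Q_e\<close> keeps it from being minus infinity. A linear
  functional below it is nonnegative on the self-adjoint part of the cone and takes the value 1 at
  \<open>e\<close>.\<close>

lemma cone_functional:
  fixes e :: "'a :: unital_cstar"
  assumes e: "star e = e" "e * e = e" and comm: "\<And>x. e * x = x * e"
    and Q_add: "\<And>x y. x \<in> Q \<Longrightarrow> y \<in> Q \<Longrightarrow> x + y \<in> Q"
    and Q_scale: "\<And>r x. r > 0 \<Longrightarrow> x \<in> Q \<Longrightarrow> r *\<^sub>R x \<in> Q"
    and Q_pos: "\<And>a. pos a \<Longrightarrow> e * a \<in> Q"
    and Q_e: "\<And>t. t *\<^sub>R e \<in> Q \<Longrightarrow> 0 \<le> t"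
  obtains f :: "'a \<Rightarrow> real" where "linear f" "f e = 1"
    "\<And>x. star x = x \<Longrightarrow> e * x \<in> Q \<Longrightarrow> 0 \<le> f x" "\<And>x. star x = - x \<Longrightarrow> f x = 0"
proof -
  \<comment> \<open>The gauge sees only the self-adjoint part, which makes \<open>f\<close> vanish
    on skew-adjoint elements.\<close>
  define re where "re x = (1/2) *\<^sub>R (x + star x)" for x :: 'a
  define D where "D x = {t. t *\<^sub>R e - e * re x \<in> Q}" for x
  define p where "p x = Inf (D x)" for x
  have re_add: "re (x + y) = re x + re y" and re_scale: "re (r *\<^sub>R x) = r *\<^sub>R re x" for x y r
    by (simp_all add: re_def star_simps algebra_simps)
  have re_sa: "star (re x) = re x" for x by (simp add: re_def star_simps add.commute)
  have re_id: "re x = x" if "star x = x" for x using that by (simp add: re_def scaleR_2[symmetric])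
  have re_norm: "norm (re x) \<le> norm x" for x
    using norm_triangle_ineq[of x "star x"] by (simp add: re_def)
  have Q0: "0 \<in> Q" using Q_pos[of 0] by simp
  have norm_D: "norm x \<in> D x" for x
    using Q_pos[OF pos_bounds(1)[OF re_sa re_norm], of x] by (simp add: D_def right_diff_distrib of_real_def)
  have D_add: "s + t \<in> D (x + y)" if "s \<in> D x" "t \<in> D y" for s t x y
    using Q_add[of "s *\<^sub>R e - e * re x" "t *\<^sub>R e - e * re y"] that by (simp add: D_def re_add algebra_simps)
  have D_scale: "r * s \<in> D (r *\<^sub>R x)" if "s \<in> D x" "r > 0" for r s x
    using Q_scale[of r "s *\<^sub>R e - e * re x"] that by (simp add: D_def re_scale algebra_simps)
  have D0: "0 \<le> t" if "t \<in> D 0" for t using that Q_e by (simp add: D_def re_def)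
  have D_bound: "- norm x \<le> t" if "t \<in> D x" for x t
    using D0[of "t + norm (- x)"] D_add[OF that norm_D[of "- x"]] by simp
  have bdd: "bdd_below (D x)" for x by (rule bdd_belowI) (rule D_bound)
  have p_le: "p x \<le> t" if "t \<in> D x" for x t unfolding p_def by (rule cInf_lower[OF that bdd])
  have p_ge: "s \<le> p x" if "\<And>t. t \<in> D x \<Longrightarrow> s \<le> t" for x s
    unfolding p_def using norm_D that by (intro cInf_greatest) auto
  have p_add: "p (x + y) \<le> p x + p y" for x y
  proof -
    have "p (x + y) - s \<le> p y" if "s \<in> D x" for s
    proof (rule p_ge)
      fix t assume "t \<in> D y"
      from p_le[OF D_add[OF that this]] show "p (x + y) - s \<le> t" by linarith
    qed
    then have "p (x + y) - p y \<le> p x" by (intro p_ge) (simp add: algebra_simps)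
    then show ?thesis by simp
  qed
  have p0: "p 0 = 0"
  proof (rule antisym)
    show "p 0 \<le> 0" using p_le[OF norm_D[of 0]] by simp
    show "0 \<le> p 0" by (rule p_ge) (rule D0)
  qed
  have p_scale_le: "p (r *\<^sub>R x) \<le> r * p x" if "r > 0" for r x
  proof -
    have "p (r *\<^sub>R x) / r \<le> p x"
      using p_le[OF D_scale[OF _ that]] that by (intro p_ge) (simp add: divide_le_eq mult.commute)
    then show ?thesis using that by (simp add: divide_le_eq mult.commute)
  qed
  have p_scale: "p (real n *\<^sub>R x) = real n * p x" for n x
  proof (cases "n = 0")
    case False
    have "p ((1 / real n) *\<^sub>R (real n *\<^sub>R x)) \<le> (1 / real n) * p (real n *\<^sub>R x)" using False by (intro p_scale_le) simp
    then have "real n * p x \<le> p (real n *\<^sub>R x)" using False by (simp add: field_simps)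
    then show ?thesis using p_scale_le[of "real n" x] False by simp
  qed (simp add: p0)
  define G :: "'a monoid" where "G = \<lparr>carrier = UNIV, mult = (+), one = 0\<rparr>"
  interpret G: comm_monoid G by unfold_locales (simp_all add: G_def add_ac)
  have pow: "x [^]\<^bsub>G\<^esub> n = real n *\<^sub>R x" for x and n :: nat
    by (induction n) (simp_all add: G_def G.nat_pow_Suc[unfolded G_def] scaleR_add_left add.commute nat_pow_def)
  have sub: "sublinear_on G uminus p"
    unfolding sublinear_on_def pow by (simp add: p_scale) (simp add: G_def p_add)
  have G_simps: "x \<otimes>\<^bsub>G\<^esub> y = x + y" "x \<in> carrier G" for x y by (simp_all add: G_def)
  obtain f :: "'a \<Rightarrow> real" where f: "\<And>x y. f (x + y) = f x + f y" and f_le: "\<And>x. f x \<le> p x" and f_minus: "\<And>x. f (- x) = - f x"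
  proof (rule G.additive_below_sublinear[of uminus p, unfolded G_simps(1), OF _ sub])
    fix f :: "'a \<Rightarrow> real"
    assume f: "\<And>x y. x \<in> carrier G \<Longrightarrow> y \<in> carrier G \<Longrightarrow> f (x + y) = f x + f y"
      "\<And>x. x \<in> carrier G \<Longrightarrow> f x \<le> p x" "\<And>x. x \<in> carrier G \<Longrightarrow> f (- x) = - f x"
    show thesis by (rule that; rule f) (rule G_simps(2))+
  qed (simp add: G_simps)
  have f_D: "f x \<le> t" if "t \<in> D x" for x t using f_le[of x] p_le[OF that] by simp
  have "\<bar>f x\<bar> \<le> norm x" for x using f_D[OF norm_D[of x]] f_D[OF norm_D[of "- x"]] f_minus[of x] by simp
  then have "linear f" by (rule additive_bounded_linear[OF f])
  moreover have nonneg: "0 \<le> f x" if "star x = x" "e * x \<in> Q" for x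
  proof -
    have "re (- x) = - x" using that by (intro re_id) (simp add: star_minus)
    then have "0 \<in> D (- x)" using that by (simp add: D_def)
    then show ?thesis using f_D[of 0 "- x"] f_minus[of x] by simp
  qed
  moreover have "f x = 0" if "star x = - x" for x
  proof -
    have "0 \<in> D x" "0 \<in> D (- x)" using that Q0 by (simp_all add: D_def re_def star_minus)
    then show ?thesis using f_D[of 0 x] f_D[of 0 "- x"] f_minus[of x] by simp
  qed
  moreover have "f e = 1"
  proof -
    have "1 \<in> D e" "-1 \<in> D (- e)" using Q0 re_id[of e] re_id[of "- e"] e by (simp_all add: D_def star_minus)
    then show ?thesis using f_D[of 1 e] f_D[of "-1" "- e"] f_minus[of e] by simp
  qed
  ultimately show thesis using that by blast
qed

context cstar_algebra begin

section \<open>Tracial states with a prescribed null element\<close>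

definition commutators :: "'a list \<Rightarrow> 'a univ" where
  "commutators zs = (\<Sum>z\<leftarrow>zs. emb A z * star (emb A z) - star (emb A z) * emb A z)"

lemma commutators_append: "commutators (zs @ ws) = commutators zs + commutators ws"
  by (simp add: commutators_def)

lemma commutators_scale:
  assumes "set zs \<subseteq> carrier A" "r \<ge> 0"
  shows "commutators (map (cscale A (of_real (sqrt r))) zs) = r *\<^sub>R commutators zs"
  using assms(1)
proof (induction zs)
  case (Cons z zs)
  have "csc (of_real (sqrt r)) * emb A z = sqrt r *\<^sub>R emb A z" unfolding csc_of_real by (simp add: of_real_def)
  then show ?case using Cons assms(2) by (simp add: commutators_def emb_cscale star_simps algebra_simps)
qed (simp add: commutators_def)

text \<open>The cone \<open>Q\<close> contains \<open>- y\<close> and, for each \<open>z\<close>,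
  the difference \<open>star z * z - z * star z\<close>. A positive functional that is nonnegative
  on \<open>Q\<close> therefore vanishes at \<open>y\<close>, and applying it to \<open>z\<close>
  and to the adjoint of \<open>z\<close> gives the trace property on squares.\<close>

theorem tracial_state_of_cone:
  assumes y: "y \<in> positives A"
    and nonneg: "\<And>t C zs. C \<ge> 0 \<Longrightarrow> set zs \<subseteq> carrier A \<Longrightarrow>
      pos (t *\<^sub>R emb A \<one> + C *\<^sub>R emb A y + commutators zs) \<Longrightarrow> 0 \<le> t"
  obtains \<tau> where "\<tau> \<in> tracial_states A" "\<tau> y = 0"
proof -
  define e where "e = emb A \<one>"
  have e: "star e = e" "e * e = e" "\<And>x. e * x = x * e"
    by (simp_all add: e_def emb_component adj_one flip: emb_adj emb_mult)
  have yc: "y \<in> carrier A" and ypos: "pos (emb A y)" using y by (auto simp: positives_iff)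
  define Q where "Q = {x. \<exists>C\<ge>0. \<exists>zs. set zs \<subseteq> carrier A \<and> pos (x + C *\<^sub>R emb A y + commutators zs)}"
  have Q_add: "x + x' \<in> Q" if x: "x \<in> Q" and x': "x' \<in> Q" for x x'
  proof -
    obtain C zs where C: "C \<ge> 0" "set zs \<subseteq> carrier A" and p: "pos (x + C *\<^sub>R emb A y + commutators zs)"
      using x by (auto simp: Q_def)
    obtain C' zs' where C': "C' \<ge> 0" "set zs' \<subseteq> carrier A" and p': "pos (x' + C' *\<^sub>R emb A y + commutators zs')"
      using x' by (auto simp: Q_def)
    have eq: "(x + C *\<^sub>R emb A y + commutators zs) + (x' + C' *\<^sub>R emb A y + commutators zs') =
        (x + x') + (C + C') *\<^sub>R emb A y + commutators (zs @ zs')"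
      by (simp add: commutators_append scaleR_add_left)
    show ?thesis unfolding Q_def using pos_add[OF p p', unfolded eq] C C'
      by (intro CollectI exI[of _ "C + C'"] conjI exI[of _ "zs @ zs'"]) auto
  qed
  have Q_scale: "r *\<^sub>R x \<in> Q" if r: "r > 0" and x: "x \<in> Q" for r x
  proof -
    obtain C zs where C: "C \<ge> 0" "set zs \<subseteq> carrier A" and p: "pos (x + C *\<^sub>R emb A y + commutators zs)"
      using x by (auto simp: Q_def)
    have "r *\<^sub>R (x + C *\<^sub>R emb A y + commutators zs) =
        r *\<^sub>R x + (r * C) *\<^sub>R emb A y + commutators (map (cscale A (of_real (sqrt r))) zs)"
      using r C by (simp add: commutators_scale scaleR_add_right)
    then show ?thesis unfolding Q_def using pos_scaleR[OF p, of r] r C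
      by (intro CollectI exI[of _ "r * C"] conjI exI[of _ "map (cscale A (of_real (sqrt r))) zs"]) (auto intro: cscale_closed)
  qed
  have Q_pos: "e * a \<in> Q" if "pos a" for a
  proof -
    have "pos (star e * a * e)" by (rule pos_conj[OF that])
    then have "pos (e * a)" by (metis e mult.assoc)
    then show ?thesis unfolding Q_def by (intro CollectI exI[of _ 0] conjI exI[of _ "[]"]) (auto simp: commutators_def)
  qed
  have Q_e: "0 \<le> t" if "t *\<^sub>R e \<in> Q" for t using that nonneg by (auto simp: Q_def e_def)
  obtain f :: "'a univ \<Rightarrow> real" where lin: "linear f" and fe: "f e = 1"
    and f_Q: "\<And>x. star x = x \<Longrightarrow> e * x \<in> Q \<Longrightarrow> 0 \<le> f x" and f_skew: "\<And>x. star x = - x \<Longrightarrow> f x = 0"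
    using cone_functional[of e Q, OF e Q_add Q_scale Q_pos Q_e] by blast
  interpret f: linear f by (rule lin)
  \<comment> \<open>The complex linear functional with real part \<open>f\<close>, where
    \<open>ii\<close> acts as the imaginary unit.\<close>
  define T where "T x = Complex (f x) (- f (ii * x))" for x
  have T_add: "T (x + x') = T x + T x'" and T_minus: "T (x - x') = T x - T x'" for x x'
    by (simp_all add: T_def f.add f.diff distrib_left right_diff_distrib complex_eq_iff)
  have T_csc: "T (csc c * x) = c * T x" for c x
  proof -
    have "ii * (ii * x) = - x" unfolding mult.assoc[symmetric] ii_square by simp
    moreover have "csc c * x = Re c *\<^sub>R x + Im c *\<^sub>R (ii * x)" by (simp add: csc_def distrib_right)
    ultimately have "f (csc c * x) = Re c * f x + Im c * f (ii * x)" "f (ii * (csc c * x)) = Re c * f (ii * x) - Im c * f x"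
      by (simp_all add: f.add f.scale f.diff distrib_left f.neg)
    then show ?thesis by (simp add: T_def complex_eq_iff)
  qed
  have T_sa: "T x = of_real (f x)" if "star x = x" for x
  proof -
    have "star (ii * x) = - (ii * x)" using that ii_commute[of x] by (simp add: star_mult star_ii)
    then show ?thesis using f_skew by (simp add: T_def complex_eq_iff)
  qed
  have f_pos: "0 \<le> f x" if "pos x" for x using that Q_pos by (intro f_Q) (auto simp: pos_selfadjoint)
  have fy: "f (emb A y) = 0"
  proof (rule antisym)
    have "- emb A y \<in> Q"
      unfolding Q_def by (intro CollectI exI[of _ 1] conjI exI[of _ "[]"]) (auto simp: commutators_def)
    moreover have "e * - emb A y = - emb A y" using yc by (simp add: e_def emb_unit)
    ultimately have "0 \<le> f (- emb A y)" using pos_selfadjoint[OF ypos] by (intro f_Q) (auto simp: star_minus)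
    then show "f (emb A y) \<le> 0" by (simp add: f.neg)
  qed (rule f_pos[OF ypos])
  have trace_le: "f (emb A z * star (emb A z)) \<le> f (star (emb A z) * emb A z)" if z: "z \<in> carrier A" for z
  proof -
    let ?x = "star (emb A z) * emb A z - emb A z * star (emb A z)"
    have "?x \<in> Q" unfolding Q_def using z
      by (intro CollectI exI[of _ 0] conjI exI[of _ "[z]"]) (auto simp: commutators_def)
    moreover have "e * ?x = ?x"
    proof -
      have "?x = emb A (adj A z \<otimes> z \<ominus> z \<otimes> adj A z)" using z by (simp add: emb_minus emb_mult emb_adj adj_closed)
      then show ?thesis unfolding e_def using z by (simp only: emb_unit adj_closed m_closed minus_closed)
    qed
    ultimately have "0 \<le> f ?x" by (intro f_Q) (auto simp: star_simps)
    then show ?thesis by (simp add: f.diff)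
  qed
  have trace_square: "T (star (emb A z) * emb A z) = T (emb A z * star (emb A z))" if z: "z \<in> carrier A" for z
  proof -
    have "f (star (emb A z) * emb A z) \<le> f (emb A z * star (emb A z))"
      using trace_le[OF adj_closed[OF z]] z by (simp add: emb_adj)
    then show ?thesis using trace_le[OF z] by (simp add: T_sa star_mult)
  qed
  have trace: "T (star (emb A b) * emb A a) = T (emb A a * star (emb A b))" if a: "a \<in> carrier A" and b: "b \<in> carrier A" for a b
  proof -
    \<comment> \<open>Polarization: \<open>S\<close> is sesquilinear and vanishes on the diagonal,
      so the values at \<open>a \<oplus> b\<close> and at \<open>a \<oplus> cscale A \<i> b\<close>
      together give 0 off the diagonal.\<close>
    define S where "S x x' = T (star x' * x) - T (x * star x')" for x x'
    have S_add: "S (x + x') (x + x') = S x x + S x' x' + S x x' + S x' x" for x x'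
      by (simp add: S_def star_add distrib_left distrib_right T_add)
    have S_i: "S x (csc \<i> * x') = - \<i> * S x x'" "S (csc \<i> * x') x = \<i> * S x' x" for x x'
    proof -
      have "star (csc \<i> * x') * x = csc (- \<i>) * (star x' * x)" "x * star (csc \<i> * x') = csc (- \<i>) * (x * star x')"
        "star x * (csc \<i> * x') = csc \<i> * (star x * x')" "csc \<i> * x' * star x = csc \<i> * (x' * star x)"
        by (simp_all add: star_mult star_csc) (metis csc_commute mult.assoc)+
      then show "S x (csc \<i> * x') = - \<i> * S x x'" "S (csc \<i> * x') x = \<i> * S x' x"
        by (simp_all only: S_def T_csc right_diff_distrib)
    qed
    have S0: "S (emb A z) (emb A z) = 0" if "z \<in> carrier A" for z using trace_square[OF that] by (simp add: S_def)
    have "S (emb A a) (emb A b) + S (emb A b) (emb A a) = 0"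
      using S0[of "a \<oplus> b"] S0[OF a] S0[OF b] a b by (simp add: emb_add S_add)
    moreover have "- \<i> * S (emb A a) (emb A b) + \<i> * S (emb A b) (emb A a) = 0"
      using S0[of "a \<oplus> cscale A \<i> b"] S0[OF a] S0[of "cscale A \<i> b"] a b
      by (simp add: cscale_closed emb_add S_add) (simp add: emb_cscale S_i)
    ultimately have "S (emb A a) (emb A b) = 0" by (auto simp: algebra_simps add_eq_0_iff)
    then show ?thesis by (simp add: S_def)
  qed
  define \<tau> where "\<tau> = (\<lambda>a\<in>carrier A. T (emb A a))"
  have "\<tau> \<in> tracial_states A"
    unfolding tracial_states_def
  proof (intro CollectI conjI ballI allI)
    fix x x' c assume x: "x \<in> carrier A"
    show "\<tau> (cscale A c x) = c * \<tau> x" using x by (simp add: \<tau>_def cscale_closed emb_cscale T_csc)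
    assume x': "x' \<in> carrier A"
    show "\<tau> (x \<oplus> x') = \<tau> x + \<tau> x'" using x x' by (simp add: \<tau>_def emb_add T_add)
    show "\<tau> (x \<otimes> x') = \<tau> (x' \<otimes> x)"
      using trace[OF x' adj_closed[OF x]] x x' by (simp add: \<tau>_def emb_mult emb_adj)
  next
    fix x assume "x \<in> positives A"
    then have "x \<in> carrier A" "pos (emb A x)" by (auto simp: positives_iff)
    then show "\<tau> x \<in> \<real>\<^sub>\<ge>\<^sub>0" using f_pos[of "emb A x"] T_sa[OF pos_selfadjoint[of "emb A x"]] by (simp add: \<tau>_def)
  next
    show "\<tau> \<one> = 1" using T_sa[OF e(1)] fe by (simp add: \<tau>_def e_def)
  qed (simp add: \<tau>_def)
  moreover have "\<tau> y = 0" using T_sa[OF pos_selfadjoint[OF ypos]] fy yc by (simp add: \<tau>_def)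
  ultimately show thesis by (rule that)
qed

end

section \<open>Inductive limits\<close>

lemma star_hom_closed: "star_hom A B f \<Longrightarrow> x \<in> carrier A \<Longrightarrow> f x \<in> carrier B"
  and star_hom_adj: "star_hom A B f \<Longrightarrow> x \<in> carrier A \<Longrightarrow> f (adj A x) = adj B (f x)"
  and star_hom_cscale: "star_hom A B f \<Longrightarrow> x \<in> carrier A \<Longrightarrow> f (cscale A c x) = cscale B c (f x)"
  and star_hom_add: "star_hom A B f \<Longrightarrow> x \<in> carrier A \<Longrightarrow> y \<in> carrier A \<Longrightarrow> f (x \<oplus>\<^bsub>A\<^esub> y) = f x \<oplus>\<^bsub>B\<^esub> f y"
  and star_hom_mult: "star_hom A B f \<Longrightarrow> x \<in> carrier A \<Longrightarrow> y \<in> carrier A \<Longrightarrow> f (x \<otimes>\<^bsub>A\<^esub> y) = f x \<otimes>\<^bsub>B\<^esub> f y"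
  by (simp_all add: star_hom_def)

lemmas star_hom_simps = star_hom_closed star_hom_adj star_hom_cscale star_hom_add star_hom_mult

lemma star_hom_comp:
  assumes f: "star_hom A B f" and g: "star_hom B C g"
  shows "star_hom A C (\<lambda>x. g (f x))"
  unfolding star_hom_def by (simp add: star_hom_simps[OF f] star_hom_simps[OF g])

lemma star_hom_projection:
  assumes f: "star_hom A B f" and p: "p \<in> projections A"
  shows "f p \<in> projections B"
  using p star_hom_adj[OF f, of p] star_hom_mult[OF f, of p p] by (simp add: projections_def star_hom_closed[OF f])

lemma star_hom_corner:
  assumes f: "star_hom A B f" and p: "p \<in> carrier A" and x: "x \<in> corner A p"
  shows "f x \<in> corner B (f p)"
  using p x star_hom_mult[OF f, of p x] star_hom_mult[OF f, of x p] by (simp add: corner_def star_hom_closed[OF f])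

lemma star_hom_lsum:
  assumes f: "star_hom A B f" and closed: "\<And>xs. set xs \<subseteq> carrier A \<Longrightarrow> lsum A xs \<in> carrier A"
    and zero: "f \<zero>\<^bsub>A\<^esub> = \<zero>\<^bsub>B\<^esub>" and xs: "set xs \<subseteq> carrier A"
  shows "f (lsum A xs) = lsum B (map f xs)"
  using xs by (induction xs) (simp_all add: lsum_simps zero star_hom_add[OF f] closed)

context building_block begin

lemma cscale_0: "x \<in> carrier B \<Longrightarrow> cscale B 0 x = \<zero>\<^bsub>B\<^esub>"
  by (rule block_eqI) (simp_all add: block_closed eval_simps)

lemma one_projection: "\<one>\<^bsub>B\<^esub> \<in> projections B"
proof -
  have "adj B \<one>\<^bsub>B\<^esub> = \<one>\<^bsub>B\<^esub>" "\<one>\<^bsub>B\<^esub> \<otimes>\<^bsub>B\<^esub> \<one>\<^bsub>B\<^esub> = \<one>\<^bsub>B\<^esub>"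
    by (rule extensionalityI[of _ "{..<t}"]; use P in \<open>simp add: block_extensional block_simps projections_def\<close>)+
  then show ?thesis by (simp add: projections_def block_closed)
qed

lemma one_corner: "corner B \<one>\<^bsub>B\<^esub> = carrier B"
proof -
  have "\<one>\<^bsub>B\<^esub> \<otimes>\<^bsub>B\<^esub> x = x" "x \<otimes>\<^bsub>B\<^esub> \<one>\<^bsub>B\<^esub> = x" if x: "x \<in> carrier B" for x
    by (rule extensionalityI[of _ "{..<t}"]; use x in \<open>simp add: block_extensional block_simps carrier_iff corner_def\<close>)+
  then show ?thesis by (auto simp: corner_def)
qed

end

context cstar_algebra begin

lemma emb_hom:
  assumes f: "star_hom B A f"
  shows "x \<in> carrier B \<Longrightarrow> y \<in> carrier B \<Longrightarrow> emb A (f (x \<oplus>\<^bsub>B\<^esub> y)) = emb A (f x) + emb A (f y)"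
    "x \<in> carrier B \<Longrightarrow> y \<in> carrier B \<Longrightarrow> emb A (f (x \<otimes>\<^bsub>B\<^esub> y)) = emb A (f x) * emb A (f y)"
    "x \<in> carrier B \<Longrightarrow> emb A (f (adj B x)) = star (emb A (f x))"
    "x \<in> carrier B \<Longrightarrow> emb A (f (cscale B c x)) = csc c * emb A (f x)"
  by (simp_all add: star_hom_simps[OF f] emb_add emb_mult emb_adj emb_cscale)

lemma emb_hom_block:
  assumes B: "building_block t X k P" and f: "star_hom (AH_building_block t X k P) A f"
  shows "set xs \<subseteq> carrier (AH_building_block t X k P) \<Longrightarrow>
    emb A (f (lsum (AH_building_block t X k P) xs)) = (\<Sum>x\<leftarrow>xs. emb A (f x))"
proof -
  interpret building_block t X k P by (rule B)
  have "f \<zero>\<^bsub>B\<^esub> = cscale A 0 (f \<zero>\<^bsub>B\<^esub>)"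
    using star_hom_cscale[OF f block_closed(1), of 0] cscale_0[OF block_closed(1)] by simp
  then have "f \<zero>\<^bsub>B\<^esub> = \<zero>" using cscale_zero_left[OF star_hom_closed[OF f block_closed(1)]] by simp
  then show "set xs \<subseteq> carrier B \<Longrightarrow> emb A (f (lsum B xs)) = (\<Sum>x\<leftarrow>xs. emb A (f x))"
    by (induction xs) (simp_all add: lsum_simps emb_hom[OF f] lsum_closed)
qed

end

lemma (in building_block) hom_lsum:
  assumes B': "building_block t' X' k' P'" and f: "star_hom B (AH_building_block t' X' k' P') f" and xs: "set xs \<subseteq> carrier B"
  shows "f (lsum B xs) = lsum (AH_building_block t' X' k' P') (map f xs)"
proof (rule star_hom_lsum[OF f lsum_closed _ xs])
  interpret B': building_block t' X' k' P' by (rule B')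
  have "f \<zero>\<^bsub>B\<^esub> = cscale B'.B 0 (f \<zero>\<^bsub>B\<^esub>)"
    using star_hom_cscale[OF f block_closed(1), of 0] cscale_0[OF block_closed(1)] by simp
  then show "f \<zero>\<^bsub>B\<^esub> = \<zero>\<^bsub>B'.B\<^esub>" using B'.cscale_0[OF star_hom_closed[OF f block_closed(1)]] by simp
qed

lemma projection_norm_le_1:
  fixes q :: "'b :: unital_cstar"
  assumes "star q = q" "q * q = q"
  shows "norm q \<le> 1"
proof -
  have "(norm q)\<^sup>2 = norm q" using norm_star_mult[of q] assms by simp
  then show ?thesis by (auto simp: power2_eq_square)
qed

text \<open>Conjugation preserves the order, so \<open>- norm d \<le> d \<le> norm d\<close>
  confines the sum between multiples of the sum of all \<open>F v * star (F v)\<close>. The bound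
  does not depend on the length of \<open>vs\<close>.\<close>

lemma norm_conj_sum_le:
  fixes d :: "'b :: unital_cstar"
  assumes d: "star d = d" and le: "pos (of_real K - (\<Sum>v\<leftarrow>vs. F v * star (F v)))" and K: "K \<ge> 0"
  shows "norm (\<Sum>v\<leftarrow>vs. F v * d * star (F v)) \<le> norm d * K"
proof (rule norm_le_of_bounds)
  define S where "S = (\<Sum>v\<leftarrow>vs. F v * star (F v))"
  have 0: "pos (of_real (norm d) * (of_real K - S))"
    using pos_scaleR[OF le[folded S_def], of "norm d"] by (simp add: of_real_def)
  have "pos (of_real (norm d) * S - (\<Sum>v\<leftarrow>vs. F v * d * star (F v)))"
    unfolding S_def
  proof (induction vs)
    case (Cons v vs)
    have "pos (F v * (of_real (norm d) - d) * star (F v))" by (intro pos_conj' pos_bounds d) simp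
    moreover have "F v * of_real (norm d) = of_real (norm d) * F v" by (rule of_real_mult_commute[symmetric])
    ultimately have "pos (of_real (norm d) * (F v * star (F v)) - F v * d * star (F v))"
      by (simp add: algebra_simps del: of_real_mult)
    from pos_add[OF this Cons] show ?case by (simp add: algebra_simps)
  qed simp
  from pos_add[OF 0 this] show "pos (of_real (norm d * K) - (\<Sum>v\<leftarrow>vs. F v * d * star (F v)))"
    by (simp add: right_diff_distrib)
  have "pos (of_real (norm d) * S + (\<Sum>v\<leftarrow>vs. F v * d * star (F v)))"
    unfolding S_def
  proof (induction vs)
    case (Cons v vs)
    have "pos (F v * (of_real (norm d) + d) * star (F v))" by (intro pos_conj' pos_bounds d) simp
    moreover have "F v * of_real (norm d) = of_real (norm d) * F v" by (rule of_real_mult_commute[symmetric])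
    ultimately have "pos (of_real (norm d) * (F v * star (F v)) + F v * d * star (F v))"
      by (simp add: algebra_simps del: of_real_mult)
    from pos_add[OF this Cons] show ?case by (simp add: algebra_simps)
  qed simp
  from pos_add[OF 0 this] show "pos (of_real (norm d * K) + (\<Sum>v\<leftarrow>vs. F v * d * star (F v)))"
    by (simp add: right_diff_distrib)
  show "0 \<le> norm d * K" using K by simp
qed

locale AH_limit = cstar_algebra A for A :: "'a cstar" (structure) +
  fixes t :: "nat \<Rightarrow> nat" and X :: "nat \<Rightarrow> nat \<Rightarrow> 'x topology" and k :: "nat \<Rightarrow> nat \<Rightarrow> nat"
    and P :: "nat \<Rightarrow> nat \<Rightarrow> nat \<Rightarrow> nat \<Rightarrow> 'x \<Rightarrow> complex" and \<phi> \<mu>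
  assumes block: "building_block (t n) (X n) (k n) (P n)"
    and limit: "is_inductive_limit (\<lambda>n. AH_building_block (t n) (X n) (k n) (P n)) \<phi> A \<mu>"
begin

abbreviation stage where "stage n \<equiv> AH_building_block (t n) (X n) (k n) (P n)"

lemma hom: "star_hom (stage n) (stage (Suc n)) (\<phi> n)" "star_hom (stage n) A (\<mu> n)"
  and compatible: "x \<in> carrier (stage n) \<Longrightarrow> \<mu> (Suc n) (\<phi> n x) = \<mu> n x"
  and norm_limit: "x \<in> carrier (stage n) \<Longrightarrow> (\<lambda>m. cnorm (stage (n + m)) (iterated_map \<phi> n m x)) \<longlonglongrightarrow> cnorm A (\<mu> n x)"
  and dense: "norm_topology A closure_of (\<Union>n. \<mu> n ` carrier (stage n)) = carrier A"
  using limit by (simp_all add: is_inductive_limit_def)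

lemma hom_iterated: "star_hom (stage n) (stage (n + m)) (iterated_map \<phi> n m)"
proof (induction m)
  case 0
  then show ?case by (simp add: star_hom_def)
next
  case (Suc m)
  from star_hom_comp[OF Suc hom(1)[of "n + m"]] show ?case by simp
qed

lemma compatible_iterated: "x \<in> carrier (stage n) \<Longrightarrow> \<mu> (n + m) (iterated_map \<phi> n m x) = \<mu> n x"
  by (induction m) (simp_all add: compatible star_hom_closed[OF hom_iterated])

text \<open>A sequence with one term in every stage is wanted, so that several elements can be
  approximated in the same stage. The term \<open>g n\<close> is nearly optimal in stage
  \<open>n\<close>, and the optimal distances decrease, as each stage maps into the later
  ones.\<close>

lemma approximable:
  assumes a: "a \<in> carrier A"
  obtains g where "\<And>n. g n \<in> carrier (stage n)" "(\<lambda>n. emb A (\<mu> n (g n))) \<longlonglongrightarrow> emb A a"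
proof -
  define D where "D n = (\<lambda>x. norm (emb A a - emb A (\<mu> n x))) ` carrier (stage n)" for n
  have bdd: "bdd_below (D n)" for n by (intro bdd_belowI[of _ 0]) (auto simp: D_def)
  have ne: "D n \<noteq> {}" for n using building_block.block_closed(1)[OF block[of n]] by (auto simp: D_def)
  have "\<exists>x\<in>carrier (stage n). norm (emb A a - emb A (\<mu> n x)) < Inf (D n) + 1 / real (Suc n)" for n
    using cInf_less_iff[OF ne bdd, of n "Inf (D n) + 1 / real (Suc n)"] by (auto simp: D_def)
  then obtain g where g: "\<And>n. g n \<in> carrier (stage n)"
    and g_norm: "\<And>n. norm (emb A a - emb A (\<mu> n (g n))) < Inf (D n) + 1 / real (Suc n)" by metis
  have "(\<lambda>n. emb A (\<mu> n (g n))) \<longlonglongrightarrow> emb A a"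
  proof (rule LIMSEQ_I)
    fix r :: real assume r: "r > 0"
    interpret D: Metric_space "carrier A" "cdist A" by (rule Metric_space_cdist)
    have "a \<in> D.mtopology closure_of (\<Union>n. \<mu> n ` carrier (stage n))" using a dense by simp
    then obtain n x where x: "x \<in> carrier (stage n)" and "cdist A a (\<mu> n x) < r / 2"
      unfolding D.metric_closure_of using r by (auto simp: D.in_mball dest!: spec[of _ "r / 2"])
    then have d: "norm (emb A a - emb A (\<mu> n x)) < r / 2"
      using a star_hom_closed[OF hom(2) x] by (simp add: cdist_def emb_minus flip: norm_emb)
    obtain N where N: "1 / real (Suc N) < r / 2" using r by (metis half_gt_zero nat_approx_posE)
    have "norm (emb A (\<mu> m (g m)) - emb A a) < r" if m: "m \<ge> max n N" for m
    proof -
      obtain l where l: "m = n + l" using m le_Suc_ex by auto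
      have "norm (emb A a - emb A (\<mu> n x)) \<in> D m"
        using star_hom_closed[OF hom_iterated x, of l] compatible_iterated[OF x, of l] unfolding D_def l by force
      then have "Inf (D m) < r / 2" using cInf_lower[OF _ bdd] d by (meson order_le_less_trans)
      moreover have "1 / real (Suc m) \<le> 1 / real (Suc N)" using m by (simp add: field_simps)
      ultimately show ?thesis using g_norm[of m] N by (simp add: norm_minus_commute)
    qed
    then show "\<exists>no. \<forall>n\<ge>no. norm (emb A (\<mu> n (g n)) - emb A a) < r" by blast
  qed
  then show thesis using that g by blast
qed

lemma stage_one_emb:
  "star (emb A (\<mu> n \<one>\<^bsub>stage n\<^esub>)) = emb A (\<mu> n \<one>\<^bsub>stage n\<^esub>)"
  "emb A (\<mu> n \<one>\<^bsub>stage n\<^esub>) * emb A (\<mu> n \<one>\<^bsub>stage n\<^esub>) = emb A (\<mu> n \<one>\<^bsub>stage n\<^esub>)"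
proof -
  interpret building_block "t n" "X n" "k n" "P n" by (rule block)
  have p: "\<one>\<^bsub>B\<^esub> \<in> carrier B" "adj B \<one>\<^bsub>B\<^esub> = \<one>\<^bsub>B\<^esub>" "\<one>\<^bsub>B\<^esub> \<otimes>\<^bsub>B\<^esub> \<one>\<^bsub>B\<^esub> = \<one>\<^bsub>B\<^esub>"
    using one_projection by (auto simp: projections_def)
  show "star (emb A (\<mu> n \<one>\<^bsub>B\<^esub>)) = emb A (\<mu> n \<one>\<^bsub>B\<^esub>)" "emb A (\<mu> n \<one>\<^bsub>B\<^esub>) * emb A (\<mu> n \<one>\<^bsub>B\<^esub>) = emb A (\<mu> n \<one>\<^bsub>B\<^esub>)"
    using emb_hom(3)[OF hom(2) p(1)] emb_hom(2)[OF hom(2) p(1) p(1)] p by simp_all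
qed

text \<open>The maps into \<open>A\<close> need not be unital. If \<open>u\<close> in a stage
  approximates the unit of \<open>A\<close> and \<open>q\<close> is the image of the unit of that
  stage, then \<open>q u = u\<close> and hence \<open>q - 1 = (u - 1) - q (u - 1)\<close>.\<close>

lemma stage_one_limit: "(\<lambda>n. emb A (\<mu> n \<one>\<^bsub>stage n\<^esub>)) \<longlonglongrightarrow> emb A \<one>"
proof -
  obtain u where u: "\<And>n. u n \<in> carrier (stage n)" and lim: "(\<lambda>n. emb A (\<mu> n (u n))) \<longlonglongrightarrow> emb A \<one>"
    using approximable[OF one_closed] by blast
  have 1: "norm (emb A (\<mu> n \<one>\<^bsub>stage n\<^esub>) - emb A \<one>) \<le> 2 * norm (emb A (\<mu> n (u n)) - emb A \<one>)" for n
  proof -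
    interpret building_block "t n" "X n" "k n" "P n" by (rule block)
    let ?q = "emb A (\<mu> n \<one>\<^bsub>B\<^esub>)"
    have "\<one>\<^bsub>B\<^esub> \<otimes>\<^bsub>B\<^esub> u n = u n" using u[of n] unfolding one_corner[symmetric] by (simp add: corner_def)
    then have "?q * emb A (\<mu> n (u n)) = emb A (\<mu> n (u n))" using emb_hom(2)[OF hom(2) block_closed(2) u[of n]] by simp
    moreover have "?q * emb A \<one> = ?q" by (simp add: emb_unit star_hom_closed[OF hom(2)] block_closed)
    ultimately have "?q - emb A \<one> = (emb A (\<mu> n (u n)) - emb A \<one>) - ?q * (emb A (\<mu> n (u n)) - emb A \<one>)"
      by (simp add: right_diff_distrib)
    then have "norm (?q - emb A \<one>) \<le> norm (emb A (\<mu> n (u n)) - emb A \<one>) + norm (?q * (emb A (\<mu> n (u n)) - emb A \<one>))"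
      by (metis norm_triangle_ineq4)
    also have "norm (?q * (emb A (\<mu> n (u n)) - emb A \<one>)) \<le> 1 * norm (emb A (\<mu> n (u n)) - emb A \<one>)"
      by (intro order_trans[OF norm_mult_ineq] mult_right_mono projection_norm_le_1 stage_one_emb) simp
    finally show ?thesis by simp
  qed
  have 2: "(\<lambda>n. 2 * norm (emb A (\<mu> n (u n)) - emb A \<one>)) \<longlonglongrightarrow> 0"
    using tendsto_mult_right_zero[OF tendsto_norm_zero[OF LIM_zero[OF lim]]] .
  have "(\<lambda>n. emb A (\<mu> n \<one>\<^bsub>stage n\<^esub>) - emb A \<one>) \<longlonglongrightarrow> 0"
    by (rule Lim_null_comparison[OF always_eventually[OF allI[OF 1]] 2])
  then show ?thesis by (rule LIM_zero_cancel)
qed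

end

lemma tendsto_sum_list:
  fixes f :: "'a \<Rightarrow> nat \<Rightarrow> 'b :: real_normed_vector"
  shows "(\<And>z. z \<in> set zs \<Longrightarrow> (\<lambda>n. f z n) \<longlonglongrightarrow> g z) \<Longrightarrow> (\<lambda>n. \<Sum>z\<leftarrow>zs. f z n) \<longlonglongrightarrow> (\<Sum>z\<leftarrow>zs. g z)"
  by (induction zs) (auto intro!: tendsto_add)

lemma csc_of_real_mult: "csc (of_real r) * x = r *\<^sub>R (x :: 'a :: unital_cstar)" "csc (- 1) * x = - (x :: 'a :: unital_cstar)"
  by (simp_all add: csc_def)

context AH_limit begin

lemma full_of_negative:
  assumes h: "h \<in> carrier A" and r: "r < 0" and C: "C \<ge> 0" and zs: "set zs \<subseteq> carrier A"
    and pos: "pos (r *\<^sub>R emb A \<one> + C *\<^sub>R (star (emb A h) * emb A h) + commutators zs)"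
  obtains vs where "set vs \<subseteq> carrier A"
    "norm (emb A \<one> - (\<Sum>v\<leftarrow>vs. emb A v * (star (emb A h) * emb A h) * star (emb A v))) \<le> 1 / 2"
proof -
  define e where "e = emb A \<one>"
  have e: "star e = e" "e * e = e" "\<And>x. e * x = x * e"
    by (simp_all add: e_def emb_component adj_one flip: emb_adj emb_mult)
  have e_unit: "e * emb A x = emb A x" "emb A x * e = emb A x" if "x \<in> carrier A" for x using that by (simp_all add: e_def emb_unit)
  define Y where "Y = star (emb A h) * emb A h"
  \<comment> \<open>\<open>D = C + 1\<close> provides the strict positivity that
    \<open>finite_stage\<close> asks for; the additional \<open>Y\<close> keeps the element
    positive.\<close>
  define \<delta> D where "\<delta> = - r" and "D = C + 1"
  have \<delta>: "\<delta> > 0" and D: "D > 0" using r C by (simp_all add: \<delta>_def D_def)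
  define x where "x = (- \<delta>) *\<^sub>R e + D *\<^sub>R Y + commutators zs"
  have "pos ((r *\<^sub>R emb A \<one> + C *\<^sub>R (star (emb A h) * emb A h) + commutators zs) + Y)"
    unfolding Y_def by (rule pos_add[OF pos pos_star_mult])
  then have "pos x" by (simp add: x_def \<delta>_def D_def Y_def e_def algebra_simps)
  then obtain u where u: "star u = u" "u * u = x" using pos_sqrt by metis
  have ex: "e * x = x"
  proof -
    have "e * Y = Y" unfolding Y_def using h by (simp flip: mult.assoc emb_adj add: e_unit adj_closed)
    moreover have "e * commutators zs = commutators zs" using zs
      by (induction zs) (simp_all add: commutators_def distrib_left right_diff_distrib e_unit adj_closed flip: mult.assoc emb_adj)
    ultimately show ?thesis by (simp add: x_def distrib_left right_diff_distrib e(2))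
  qed
  \<comment> \<open>The root \<open>u\<close> is taken in the universal algebra. Its component in
    \<open>A\<close> still has square \<open>x\<close>, as \<open>e * x = x\<close>.\<close>
  define s where "s = component A u"
  have s: "s \<in> carrier A" unfolding s_def by (rule component_closed[OF is_cstar])
  have "emb A s = u * e" by (simp add: s_def e_def emb_component)
  then have "star (emb A s) * emb A s = e * ((u * u) * e)" using u(1) e(1) by (simp only: star_mult mult.assoc)
  moreover have "x * e = x" using ex e(3)[of x] by simp
  ultimately have ss: "star (emb A s) * emb A s = x" using ex u(2) by simp
  obtain H where H: "\<And>n. H n \<in> carrier (stage n)" "(\<lambda>n. emb A (\<mu> n (H n))) \<longlonglongrightarrow> emb A h"
    using approximable[OF h] by blast
  obtain S where S: "\<And>n. S n \<in> carrier (stage n)" "(\<lambda>n. emb A (\<mu> n (S n))) \<longlonglongrightarrow> emb A s"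
    using approximable[OF s] by blast
  have "\<exists>g. (\<forall>n. g n \<in> carrier (stage n)) \<and> (\<lambda>n. emb A (\<mu> n (g n))) \<longlonglongrightarrow> emb A z" if "z \<in> carrier A" for z
    by (rule approximable[OF that]) blast
  then have "\<forall>z\<in>carrier A. \<exists>g. (\<forall>n. g n \<in> carrier (stage n)) \<and> (\<lambda>n. emb A (\<mu> n (g n))) \<longlonglongrightarrow> emb A z" by blast
  from bchoice[OF this] obtain Z where Z_all: "\<forall>z\<in>carrier A. (\<forall>n. Z z n \<in> carrier (stage n)) \<and> (\<lambda>n. emb A (\<mu> n (Z z n))) \<longlonglongrightarrow> emb A z"
    by blast
  then have Z: "\<And>z n. z \<in> carrier A \<Longrightarrow> Z z n \<in> carrier (stage n)"
    "\<And>z. z \<in> carrier A \<Longrightarrow> (\<lambda>n. emb A (\<mu> n (Z z n))) \<longlonglongrightarrow> emb A z" by simp_all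
  \<comment> \<open>The counterpart in stage \<open>n\<close> of the difference of the two sides of
    \<open>x = star s * s\<close>, with approximants in place of all elements; its image in
    \<open>A\<close> tends to 0.\<close>
  define W where "W n = cscale (stage n) (of_real (- \<delta>)) \<one>\<^bsub>stage n\<^esub> \<oplus>\<^bsub>stage n\<^esub>
      cscale (stage n) (of_real D) (adj (stage n) (H n) \<otimes>\<^bsub>stage n\<^esub> H n) \<oplus>\<^bsub>stage n\<^esub>
      commutator_sum (stage n) (map (\<lambda>z. Z z n) zs) \<oplus>\<^bsub>stage n\<^esub>
      cscale (stage n) (-1) (adj (stage n) (S n) \<otimes>\<^bsub>stage n\<^esub> S n)" for n
  have Wc: "W n \<in> carrier (stage n)" and W_emb: "emb A (\<mu> n (W n)) = (- \<delta>) *\<^sub>R emb A (\<mu> n \<one>\<^bsub>stage n\<^esub>)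
      + D *\<^sub>R (star (emb A (\<mu> n (H n))) * emb A (\<mu> n (H n)))
      + (\<Sum>z\<leftarrow>zs. emb A (\<mu> n (Z z n)) * star (emb A (\<mu> n (Z z n))) - star (emb A (\<mu> n (Z z n))) * emb A (\<mu> n (Z z n)))
      - star (emb A (\<mu> n (S n))) * emb A (\<mu> n (S n))" for n
  proof -
    interpret building_block "t n" "X n" "k n" "P n" by (rule block)
    note emb = emb_hom[OF hom(2)[of n]]
    define c where "c z = z \<otimes>\<^bsub>B\<^esub> adj B z \<oplus>\<^bsub>B\<^esub> cscale B (-1) (adj B z \<otimes>\<^bsub>B\<^esub> z)" for z
    have zs': "set (map (\<lambda>z. Z z n) zs) \<subseteq> carrier B" using zs Z(1) by auto
    have c: "c z \<in> carrier B" if "z \<in> carrier B" for z using that by (simp add: c_def block_closed)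
    then have cs: "set (map c (map (\<lambda>z. Z z n) zs)) \<subseteq> carrier B" using zs' by auto
    have W: "W n = cscale B (of_real (- \<delta>)) \<one>\<^bsub>B\<^esub> \<oplus>\<^bsub>B\<^esub> cscale B (of_real D) (adj B (H n) \<otimes>\<^bsub>B\<^esub> H n) \<oplus>\<^bsub>B\<^esub>
        lsum B (map c (map (\<lambda>z. Z z n) zs)) \<oplus>\<^bsub>B\<^esub> cscale B (-1) (adj B (S n) \<otimes>\<^bsub>B\<^esub> S n)"
      by (simp only: W_def c_def[abs_def])
    show "W n \<in> carrier B" unfolding W by (intro block_closed lsum_closed cs H S)
    have "emb A (\<mu> n (c z)) = emb A (\<mu> n z) * star (emb A (\<mu> n z)) - star (emb A (\<mu> n z)) * emb A (\<mu> n z)" if "z \<in> carrier B" for z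
      using that by (simp add: c_def emb block_closed csc_of_real_mult)
    then have "(\<Sum>z\<leftarrow>zs. emb A (\<mu> n (c (Z z n)))) =
        (\<Sum>z\<leftarrow>zs. emb A (\<mu> n (Z z n)) * star (emb A (\<mu> n (Z z n))) - star (emb A (\<mu> n (Z z n))) * emb A (\<mu> n (Z z n)))"
      using zs Z(1) by (intro arg_cong[of _ _ sum_list] map_cong) auto
    moreover have "emb A (\<mu> n (lsum B (map c (map (\<lambda>z. Z z n) zs)))) = (\<Sum>z\<leftarrow>zs. emb A (\<mu> n (c (Z z n))))"
      using emb_hom_block[OF block hom(2) cs] by (simp add: comp_def)
    ultimately show "emb A (\<mu> n (W n)) = (- \<delta>) *\<^sub>R emb A (\<mu> n \<one>\<^bsub>B\<^esub>) + D *\<^sub>R (star (emb A (\<mu> n (H n))) * emb A (\<mu> n (H n)))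
      + (\<Sum>z\<leftarrow>zs. emb A (\<mu> n (Z z n)) * star (emb A (\<mu> n (Z z n))) - star (emb A (\<mu> n (Z z n))) * emb A (\<mu> n (Z z n)))
      - star (emb A (\<mu> n (S n))) * emb A (\<mu> n (S n))"
      unfolding W
      by (simp only: emb block_closed lsum_closed[OF cs] H(1) S(1) csc_of_real_mult add_uminus_conv_diff)
  qed
  have HH: "(\<lambda>n. star (emb A (\<mu> n (H n))) * emb A (\<mu> n (H n))) \<longlonglongrightarrow> Y"
    unfolding Y_def by (intro tendsto_intros H)
  have "(\<lambda>n. emb A (\<mu> n (W n))) \<longlonglongrightarrow> (- \<delta>) *\<^sub>R e + D *\<^sub>R Y + commutators zs - star (emb A s) * emb A s"
    unfolding W_emb commutators_def e_def using zs
    by (intro tendsto_diff tendsto_add tendsto_scaleR tendsto_const stage_one_limit HH tendsto_sum_list tendsto_mult tendsto_star S Z(2)) auto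
  then have "(\<lambda>n. emb A (\<mu> n (W n))) \<longlonglongrightarrow> 0" by (simp add: ss x_def)
  then have 1: "\<forall>\<^sub>F n in sequentially. norm (emb A (\<mu> n (W n))) < \<delta> / 3"
    using \<delta> by (intro order_tendstoD(2)[OF tendsto_norm_zero]) auto
  have 2: "\<forall>\<^sub>F n in sequentially. norm (emb A (\<mu> n \<one>\<^bsub>stage n\<^esub>) - e) < 1 / 4"
    unfolding e_def by (intro order_tendstoD(2)[OF tendsto_norm_zero[OF LIM_zero[OF stage_one_limit]]]) simp
  \<comment> \<open>This tolerance times the bound \<open>K = 3 * D / (2 * \<delta>)\<close> is 1/4;
    with the 1/4 allowed for the unit, the total error is 1/2.\<close>
  have 3: "\<forall>\<^sub>F n in sequentially. norm (star (emb A (\<mu> n (H n))) * emb A (\<mu> n (H n)) - Y) < \<delta> / (6 * D)"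
    using \<delta> D by (intro order_tendstoD(2)[OF tendsto_norm_zero[OF LIM_zero[OF HH]]]) simp
  obtain n where nW: "norm (emb A (\<mu> n (W n))) < \<delta> / 3" and n1: "norm (emb A (\<mu> n \<one>\<^bsub>stage n\<^esub>) - e) < 1 / 4"
    and nH: "norm (star (emb A (\<mu> n (H n))) * emb A (\<mu> n (H n)) - Y) < \<delta> / (6 * D)"
    using eventually_happens[OF eventually_conj[OF 1 eventually_conj[OF 2 3]]] by auto
  have "cnorm A (\<mu> n (W n)) < \<delta> / 3" using nW by (simp add: norm_emb star_hom_closed[OF hom(2) Wc])
  \<comment> \<open>The norm in \<open>A\<close> is the limit of the norms along the sequence, so
    the relation need not hold approximately in stage \<open>n\<close> itself, but does so in some
    later stage. There the image of the unit of stage \<open>n\<close> is a projection that may be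
    smaller than the unit, whence the corners in \<open>finite_stage\<close>.\<close>
  from order_tendstoD(2)[OF norm_limit[OF Wc] this]
  obtain m where m: "cnorm (stage (n + m)) (iterated_map \<phi> n m (W n)) < \<delta> / 3"
    using eventually_happens[of _ sequentially] by auto
  define \<Phi> where "\<Phi> = iterated_map \<phi> n m"
  interpret B: building_block "t n" "X n" "k n" "P n" by (rule block)
  interpret B': building_block "t (n + m)" "X (n + m)" "k (n + m)" "P (n + m)" by (rule block)
  have \<Phi>: "star_hom B.B B'.B \<Phi>" unfolding \<Phi>_def by (rule hom_iterated)
  have \<mu>\<Phi>: "\<mu> (n + m) (\<Phi> x) = \<mu> n x" if "x \<in> carrier B.B" for x unfolding \<Phi>_def by (rule compatible_iterated[OF that])
  have cor: "\<Phi> x \<in> corner B'.B (\<Phi> \<one>\<^bsub>B.B\<^esub>)" if "x \<in> carrier B.B" for x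
    using that by (intro star_hom_corner[OF \<Phi> B.block_closed(2)]) (simp add: B.one_corner)
  have zs': "set (map (\<lambda>z. Z z n) zs) \<subseteq> carrier B.B" using zs Z(1) by auto
  have \<Phi>W: "\<Phi> (W n) = cscale B'.B (of_real (- \<delta>)) (\<Phi> \<one>\<^bsub>B.B\<^esub>) \<oplus>\<^bsub>B'.B\<^esub>
      cscale B'.B (of_real D) (adj B'.B (\<Phi> (H n)) \<otimes>\<^bsub>B'.B\<^esub> \<Phi> (H n)) \<oplus>\<^bsub>B'.B\<^esub>
      commutator_sum B'.B (map \<Phi> (map (\<lambda>z. Z z n) zs)) \<oplus>\<^bsub>B'.B\<^esub>
      cscale B'.B (-1) (adj B'.B (\<Phi> (S n)) \<otimes>\<^bsub>B'.B\<^esub> \<Phi> (S n))"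
  proof -
    define c where "c z = z \<otimes>\<^bsub>B.B\<^esub> adj B.B z \<oplus>\<^bsub>B.B\<^esub> cscale B.B (-1) (adj B.B z \<otimes>\<^bsub>B.B\<^esub> z)" for z
    have c: "c z \<in> carrier B.B" if "z \<in> carrier B.B" for z using that by (simp add: c_def B.block_closed)
    then have cs: "set (map c (map (\<lambda>z. Z z n) zs)) \<subseteq> carrier B.B" using zs' by auto
    have "\<Phi> (c z) = \<Phi> z \<otimes>\<^bsub>B'.B\<^esub> adj B'.B (\<Phi> z) \<oplus>\<^bsub>B'.B\<^esub> cscale B'.B (-1) (adj B'.B (\<Phi> z) \<otimes>\<^bsub>B'.B\<^esub> \<Phi> z)"
      if "z \<in> carrier B.B" for z
      using that by (simp add: c_def star_hom_simps[OF \<Phi>] B.block_closed)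
    then have *: "map \<Phi> (map c (map (\<lambda>z. Z z n) zs)) =
        map (\<lambda>z. z \<otimes>\<^bsub>B'.B\<^esub> adj B'.B z \<oplus>\<^bsub>B'.B\<^esub> cscale B'.B (-1) (adj B'.B z \<otimes>\<^bsub>B'.B\<^esub> z)) (map \<Phi> (map (\<lambda>z. Z z n) zs))"
      using zs Z(1) by auto
    have W: "W n = cscale B.B (of_real (- \<delta>)) \<one>\<^bsub>B.B\<^esub> \<oplus>\<^bsub>B.B\<^esub> cscale B.B (of_real D) (adj B.B (H n) \<otimes>\<^bsub>B.B\<^esub> H n) \<oplus>\<^bsub>B.B\<^esub>
        lsum B.B (map c (map (\<lambda>z. Z z n) zs)) \<oplus>\<^bsub>B.B\<^esub> cscale B.B (-1) (adj B.B (S n) \<otimes>\<^bsub>B.B\<^esub> S n)"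
      by (simp only: W_def c_def[abs_def])
    show ?thesis unfolding W *[symmetric]
      by (simp only: star_hom_simps[OF \<Phi>] B.block_closed B.lsum_closed[OF cs] H(1) S(1) B.hom_lsum[OF block \<Phi> cs])
  qed
  have m': "cnorm B'.B (\<Phi> (W n)) \<le> \<delta> / 3" using m by (simp add: \<Phi>_def less_imp_le)
  define K where "K = 3 * D / (2 * \<delta>)"
  have "\<exists>vs \<eta>. set vs \<subseteq> carrier B'.B \<and> \<eta> \<in> carrier B'.B \<and>
    lsum B'.B (map (\<lambda>v. v \<otimes>\<^bsub>B'.B\<^esub> (adj B'.B (\<Phi> (H n)) \<otimes>\<^bsub>B'.B\<^esub> \<Phi> (H n)) \<otimes>\<^bsub>B'.B\<^esub> adj B'.B v) vs) = \<Phi> \<one>\<^bsub>B.B\<^esub> \<and>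
    lsum B'.B (map (\<lambda>v. v \<otimes>\<^bsub>B'.B\<^esub> adj B'.B v) vs) \<oplus>\<^bsub>B'.B\<^esub> adj B'.B \<eta> \<otimes>\<^bsub>B'.B\<^esub> \<eta> = cscale B'.B (of_real K) (\<Phi> \<one>\<^bsub>B.B\<^esub>)"
    unfolding K_def
  proof (rule B'.finite_stage[OF _ _ _ _ \<delta> D])
    show "\<Phi> \<one>\<^bsub>B.B\<^esub> \<in> projections B'.B" by (rule star_hom_projection[OF \<Phi> B.one_projection])
    show "\<Phi> (H n) \<in> corner B'.B (\<Phi> \<one>\<^bsub>B.B\<^esub>)" "\<Phi> (S n) \<in> corner B'.B (\<Phi> \<one>\<^bsub>B.B\<^esub>)" by (intro cor H S)+
    show "set (map \<Phi> (map (\<lambda>z. Z z n) zs)) \<subseteq> corner B'.B (\<Phi> \<one>\<^bsub>B.B\<^esub>)" using zs' cor by auto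
  qed (rule m'[unfolded \<Phi>W])
  then obtain vs \<eta> where vs: "set vs \<subseteq> carrier B'.B" and \<eta>: "\<eta> \<in> carrier B'.B"
    and v1: "lsum B'.B (map (\<lambda>v. v \<otimes>\<^bsub>B'.B\<^esub> (adj B'.B (\<Phi> (H n)) \<otimes>\<^bsub>B'.B\<^esub> \<Phi> (H n)) \<otimes>\<^bsub>B'.B\<^esub> adj B'.B v) vs) = \<Phi> \<one>\<^bsub>B.B\<^esub>"
    and v2: "lsum B'.B (map (\<lambda>v. v \<otimes>\<^bsub>B'.B\<^esub> adj B'.B v) vs) \<oplus>\<^bsub>B'.B\<^esub> adj B'.B \<eta> \<otimes>\<^bsub>B'.B\<^esub> \<eta> = cscale B'.B (of_real K) (\<Phi> \<one>\<^bsub>B.B\<^esub>)"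
    by blast
  define F where "F v = emb A (\<mu> (n + m) v)" for v
  note F = emb_hom[OF hom(2)[of "n + m"], folded F_def]
  note F_lsum = emb_hom_block[OF block hom(2)[of "n + m"], folded F_def]
  have \<Phi>c: "\<Phi> (H n) \<in> carrier B'.B" "\<Phi> \<one>\<^bsub>B.B\<^esub> \<in> carrier B'.B" by (simp_all add: star_hom_closed[OF \<Phi>] H B.block_closed)
  define q where "q = emb A (\<mu> n \<one>\<^bsub>B.B\<^esub>)"
  have q: "F (\<Phi> \<one>\<^bsub>B.B\<^esub>) = q" by (simp add: F_def q_def \<mu>\<Phi> B.block_closed)
  define Y' where "Y' = star (emb A (\<mu> n (H n))) * emb A (\<mu> n (H n))"
  have Y': "star (F (\<Phi> (H n))) * F (\<Phi> (H n)) = Y'" by (simp add: F_def Y'_def \<mu>\<Phi> H)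
  have sum1: "(\<Sum>v\<leftarrow>vs. F v * Y' * star (F v)) = q"
  proof -
    let ?G = "\<lambda>v. v \<otimes>\<^bsub>B'.B\<^esub> (adj B'.B (\<Phi> (H n)) \<otimes>\<^bsub>B'.B\<^esub> \<Phi> (H n)) \<otimes>\<^bsub>B'.B\<^esub> adj B'.B v"
    have "set (map ?G vs) \<subseteq> carrier B'.B" using vs \<Phi>c by (auto intro!: B'.block_closed)
    from F_lsum[OF this] have "F (\<Phi> \<one>\<^bsub>B.B\<^esub>) = (\<Sum>v\<leftarrow>vs. F (?G v))" unfolding v1 by (simp add: comp_def)
    also have "\<dots> = (\<Sum>v\<leftarrow>vs. F v * Y' * star (F v))"
      using vs by (intro arg_cong[of _ _ sum_list] map_cong refl) (simp add: F B'.block_closed \<Phi>c Y' subset_iff)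
    finally show ?thesis using q by simp
  qed
  have sum2: "(\<Sum>v\<leftarrow>vs. F v * star (F v)) + star (F \<eta>) * F \<eta> = K *\<^sub>R q"
  proof -
    let ?G = "\<lambda>v. v \<otimes>\<^bsub>B'.B\<^esub> adj B'.B v"
    have G: "set (map ?G vs) \<subseteq> carrier B'.B" using vs by (auto intro!: B'.block_closed)
    have "K *\<^sub>R q = F (lsum B'.B (map ?G vs) \<oplus>\<^bsub>B'.B\<^esub> adj B'.B \<eta> \<otimes>\<^bsub>B'.B\<^esub> \<eta>)"
      unfolding v2 by (simp add: F \<Phi>c q csc_of_real_mult)
    also have "\<dots> = (\<Sum>v\<leftarrow>vs. F (?G v)) + star (F \<eta>) * F \<eta>"
      using F_lsum[OF G] by (simp add: F B'.lsum_closed[OF G] B'.block_closed \<eta> comp_def)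
    also have "(\<Sum>v\<leftarrow>vs. F (?G v)) = (\<Sum>v\<leftarrow>vs. F v * star (F v))"
      using vs by (intro arg_cong[of _ _ sum_list] map_cong refl) (simp add: F B'.block_closed subset_iff)
    finally show ?thesis by simp
  qed
  have K0: "K \<ge> 0" using D \<delta> by (simp add: K_def)
  have qq: "star q = q" "q * q = q" using stage_one_emb[of n] by (simp_all add: q_def)
  \<comment> \<open>By \<open>sum2\<close> this difference is
    \<open>K *\<^sub>R (1 - q) + star (F \<eta>) * F \<eta>\<close>.\<close>
  have "pos (of_real K - (\<Sum>v\<leftarrow>vs. F v * star (F v)))"
  proof -
    have "star (1 - q) * (1 - q) = 1 - q" using qq by (simp add: star_simps left_diff_distrib right_diff_distrib)
    then have "pos (1 - q)" using pos_star_mult[of "1 - q"] by simp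
    from pos_add[OF pos_scaleR[OF this K0] pos_star_mult[of "F \<eta>"]] sum2[symmetric]
    show ?thesis by (simp add: scaleR_diff_right of_real_def)
  qed
  from norm_conj_sum_le[OF _ this K0, of "Y' - Y"]
  have "norm (\<Sum>v\<leftarrow>vs. F v * (Y' - Y) * star (F v)) \<le> norm (Y' - Y) * K"
    by (simp add: Y_def Y'_def star_simps)
  also have "\<dots> \<le> \<delta> / (6 * D) * K" using nH K0 unfolding Y'_def by (intro mult_right_mono) auto
  also have "\<dots> = 1 / 4" using \<delta> D by (simp add: K_def)
  finally have 4: "norm (\<Sum>v\<leftarrow>vs. F v * (Y' - Y) * star (F v)) \<le> 1 / 4" .
  have "(\<Sum>v\<leftarrow>vs. F v * Y * star (F v)) + (\<Sum>v\<leftarrow>vs. F v * (Y' - Y) * star (F v)) = (\<Sum>v\<leftarrow>vs. F v * Y' * star (F v))"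
    by (simp add: algebra_simps flip: sum_list_addf)
  then have eq: "e - (\<Sum>v\<leftarrow>vs. F v * Y * star (F v)) = (e - q) + (\<Sum>v\<leftarrow>vs. F v * (Y' - Y) * star (F v))"
    unfolding sum1 by (simp add: algebra_simps)
  have "norm (e - (\<Sum>v\<leftarrow>vs. F v * Y * star (F v))) \<le> norm (e - q) + 1 / 4"
    unfolding eq using norm_triangle_ineq[of "e - q" "\<Sum>v\<leftarrow>vs. F v * (Y' - Y) * star (F v)"] 4 by linarith
  also have "norm (e - q) + 1 / 4 \<le> 1 / 2" using n1 by (simp add: q_def norm_minus_commute)
  finally have "norm (emb A \<one> - (\<Sum>v\<leftarrow>map (\<mu> (n + m)) vs. emb A v * (star (emb A h) * emb A h) * star (emb A v))) \<le> 1 / 2"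
    by (simp add: F_def e_def Y_def comp_def)
  moreover have "set (map (\<mu> (n + m)) vs) \<subseteq> carrier A" using vs star_hom_closed[OF hom(2)] by auto
  ultimately show thesis using that by blast
qed

theorem full_or_trace_null:
  assumes y: "y \<in> positives A"
  obtains (full) vs where "set vs \<subseteq> carrier A" "norm (emb A \<one> - (\<Sum>v\<leftarrow>vs. emb A v * emb A y * star (emb A v))) \<le> 1 / 2"
  | (null) \<tau> where "\<tau> \<in> tracial_states A" "\<tau> y = 0"
proof (cases "\<exists>r C zs. r < 0 \<and> C \<ge> 0 \<and> set zs \<subseteq> carrier A \<and> pos (r *\<^sub>R emb A \<one> + C *\<^sub>R emb A y + commutators zs)")
  case True
  obtain h where h: "h \<in> carrier A" "y = adj A h \<otimes> h" using y by (auto simp: positives_def)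
  have y_emb: "emb A y = star (emb A h) * emb A h" using h by (simp add: emb_mult emb_adj adj_closed)
  from True obtain r C zs where "r < 0" "C \<ge> 0" "set zs \<subseteq> carrier A" "pos (r *\<^sub>R emb A \<one> + C *\<^sub>R emb A y + commutators zs)" by blast
  from full_of_negative[OF h(1) this[unfolded y_emb]] show thesis using full unfolding y_emb by blast
next
  case False
  then have *: "0 \<le> r" if "C \<ge> 0" "set zs \<subseteq> carrier A" "pos (r *\<^sub>R emb A \<one> + C *\<^sub>R emb A y + commutators zs)" for r C zs
    using that by (meson not_le)
  show thesis by (rule tracial_state_of_cone[OF y *]) (use null in auto)
qed

end

section \<open>Comparison in AH algebras\<close>

lemma AH_algebra_limit:
  assumes "AH_algebra TYPE('x) A"
  obtains t X k P \<phi> \<mu> where "AH_limit A t (X :: nat \<Rightarrow> nat \<Rightarrow> 'x topology) k P \<phi> \<mu>"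
proof -
  obtain t and X :: "nat \<Rightarrow> nat \<Rightarrow> 'x topology" and k P \<phi> \<mu> where A: "cstar_algebra A"
    and B: "\<forall>n. 0 < t n \<and> (\<forall>i<t n. finite_CW_complex (X n i) \<and> connected_space (X n i) \<and> topspace (X n i) \<noteq> {} \<and>
              0 < k n i \<and> P n i \<in> projections (mat_alg (cont_alg (X n i)) (k n i)))"
    and lim: "is_inductive_limit (\<lambda>n. AH_building_block (t n) (X n) (k n) (P n)) \<phi> A \<mu>"
    using assms unfolding AH_algebra_def by blast
  have "building_block (t n) (X n) (k n) (P n)" for n
    using B finite_CW_complex_compact by unfold_locales blast+
  then have "AH_limit A t X k P \<phi> \<mu>"
    using A lim by (intro AH_limit.intro AH_limit_axioms.intro)
  then show thesis by (rule that)
qed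

theorem theorem3p7:
  fixes A :: "'a cstar"
  assumes "cstar_algebra A" and "\<one>\<^bsub>A\<^esub> \<noteq> \<zero>\<^bsub>A\<^esub>"
    and "AH_algebra TYPE('x) A"
    and "ideal_property A"
    and "finite (extremal_tracial_states A)"
    and "almost_unperforated A"
  shows "weak_strict_comparison A"
proof -
  obtain t and X :: "nat \<Rightarrow> nat \<Rightarrow> 'x topology" and k P \<phi> \<mu> where "AH_limit A t X k P \<phi> \<mu>"
    using AH_algebra_limit[OF assms(3)] by blast
  then interpret AH_limit A t X k P \<phi> \<mu> .
  have "quasitraces A \<noteq> {}"
  proof -
    have "\<zero>\<^bsub>A\<^esub> \<in> positives A" by (simp add: positives_iff)
    then show ?thesis
    proof (cases rule: full_or_trace_null)
      \<comment> \<open>If 0 were full, the unit would have norm at most 1/2; by the C*-identity its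
        norm is 0 or 1, and it is not 0 in a nonzero algebra.\<close>
      case (full vs)
      have "cnorm A \<one>\<^bsub>A\<^esub> = (cnorm A \<one>\<^bsub>A\<^esub>)\<^sup>2" using cstar_identity[of "\<one>\<^bsub>A\<^esub>"] by (simp add: adj_one)
      then have "cnorm A \<one>\<^bsub>A\<^esub> = 0 \<or> cnorm A \<one>\<^bsub>A\<^esub> = 1" by (auto simp: power2_eq_square)
      moreover have "cnorm A \<one>\<^bsub>A\<^esub> \<le> 1 / 2" using full(2) by (simp add: norm_emb)
      ultimately show ?thesis using assms(2) by (auto simp: cnorm_eq_zero)
    next
      case (null \<tau>)
      then show ?thesis using tracial_quasitrace by blast
    qed
  qed
  moreover have *: "cuntz_le A a b"
    if a: "a \<in> Minf_pos A" and b: "b \<in> Minf_pos A"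
      and less: "\<And>d. d \<in> dim_of_quasitrace A ` quasitraces A \<Longrightarrow> d a < d b"
      "\<And>d. d \<in> dimension_functions A \<Longrightarrow> d \<notin> dim_of_quasitrace A ` quasitraces A \<Longrightarrow> d b = 1 \<Longrightarrow> d a < d b" for a b
  proof -
    obtain n where n: "n \<ge> 1" and bn: "b \<in> positives (mat_alg A n)" using b by (auto simp: Minf_pos_def)
    have bc: "b i i \<in> carrier A" for i using bn by (auto simp: mat_positives_iff mat_carrier)
    have diag: "pos (emb A (b i i))" for i
      using bn unfolding mat_positives_iff by (auto intro!: pos_sum pos_star_mult)
    define y where "y = (\<Oplus>\<^bsub>A\<^esub>i\<in>{..<n}. b i i)"
    have y_emb: "emb A y = (\<Sum>i<n. emb A (b i i))" unfolding y_def using bc by (intro emb_finsum) auto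
    have "y \<in> carrier A" unfolding y_def using bc by (intro finsum_closed) auto
    then have "y \<in> positives A" using diag by (simp add: positives_iff y_emb pos_sum)
    then show ?thesis
    proof (cases rule: full_or_trace_null)
      case (full vs)
      have unit: "\<exists>N. cuntz_class_le A (cls c) (cls b [^]\<^bsub>cuntz_monoid\<^esub> (N::nat))" if "c \<in> Minf_pos A" for c
        using full(2) that
        by (intro full_order_unit[OF b bn n full(1)]) (simp_all add: y_emb sum_distrib_left sum_distrib_right)
      show ?thesis
      proof (rule ccontr)
        assume "\<not> cuntz_le A a b"
        then obtain d where "d \<in> dimension_functions A" "d b = 1" "1 \<le> d a"
          using separating_dimension_function[OF assms(6) a b unit] by blast
        \<comment> \<open>Whether or not \<open>d\<close> comes from a quasitrace, one of the two
          parts of \<open>less\<close> gives \<open>d a < d b\<close>, against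
          \<open>d b = 1 \<le> d a\<close>.\<close>
        then show False using less[of d] by (metis leD)
      qed
    next
      case (null \<tau>)
      \<comment> \<open>The values of \<open>\<tau>\<close> at the diagonal entries are nonnegative
        with sum \<open>\<tau> y = 0\<close>, so each of them vanishes, as
        \<open>dim_of_trace_null\<close> requires.\<close>
      have nonneg: "\<tau> (b i i) \<in> \<real>\<^sub>\<ge>\<^sub>0" for i
        using null(1) bc diag by (simp add: tracial_states_def positives_iff)
      have "(\<Sum>i<n. \<tau> (b i i)) = 0" using trace_finsum[OF null(1), of "{..<n}" "\<lambda>i. b i i"] bc null(2) by (simp add: y_def)
      then have "(\<Sum>i<n. Re (\<tau> (b i i))) = 0" by (metis Re_sum zero_complex.simps(1))
      then have "Re (\<tau> (b i i)) = 0" if "i < n" for i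
        using nonneg that by (subst (asm) sum_nonneg_eq_0_iff) (auto simp: complex_nonneg_Reals_iff)
      then have "\<tau> (b i i) = 0" if "i < n" for i
        using nonneg[of i] that by (auto simp: complex_nonneg_Reals_iff complex_eq_iff)
      then have "dim_of_quasitrace A \<tau> b = 0" by (rule dim_of_trace_null[OF null(1) bn n])
      then show ?thesis using less(1)[of "dim_of_quasitrace A \<tau>"] tracial_quasitrace[OF null(1)] by auto
    qed
  qed
  ultimately show ?thesis unfolding weak_strict_comparison_def Let_def
    by (intro conjI ballI impI *) blast+
qed

end
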